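(* Let $G$ and $G'$ be bipartite graphs. Then $C^\ast(G)\cong C^\ast(G')$ (as $C^\ast$-algebras) if and only if $\mathrm{Spec}_{\le 2}(C^\ast(G))\cong \mathrm{Spec}_{\le 2}(C^\ast(G'))$ (as topological spaces, i.e. they are homeomorphic).
   Context: A bipartite graph $G=(U,V,E)$ consists of two finite disjoint vertex sets $U,V$ and an edge set $E\subset\{\{u,v\}: u\in U, v\in V\}$. The bipartite graph $C^\ast$-algebra $C^\ast(G)$ is the universal $C^\ast$-algebra generated by projections $(p_x)_{x\in U\cup V}$ subject to the relations $\sum_{u\in U}p_u=1=\sum_{v\in V}p_v$ and $p_up_v=0$ for all $u\in U$, $v\in V$ with $\{u,v\}\notin E$. For a $C^\ast$-algebra $A$, $\mathrm{Spec}(A)$ is the set of unitary equivalence classes of irreducible representations of $A$, with the coarsest topology making the map $\mathrm{Spec}(A)\to\mathrm{Prim}(A)$, $\pi\mapsto\ker\pi$, continuous, where the primitive ideal space $\mathrm{Prim}(A)$ has the hull-kernel topology. $\mathrm{Spec}_{\le 2}(A)\subset\mathrm{Spec}(A)$ is the subspace (with the subspace topology) of classes of one- or two-dimensional irreducible representations, a representation being $n$-dimensional if it is a map $A\to M_n\cong B(\mathbb{C}^n)$. *)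

theory Defs
  imports "HOL-Analysis.Analysis" "HOL-Algebra.Ring" "HOL-Library.Poly_Mapping"
begin

section \<open>C*-algebras and their homomorphisms\<close>

record 'a star_algebra = "'a ring" +
  scale :: "complex \<Rightarrow> 'a \<Rightarrow> 'a"
  star :: "'a \<Rightarrow> 'a"
  nrm :: "'a \<Rightarrow> real"

text \<open>Unital C*-algebras.  The trivial algebra, in which one equals zero, is included.\<close>

locale cstar_algebra = ring A for A :: "('a, 'm) star_algebra_scheme" (structure) +
  assumes scale_closed: "a \<in> carrier A \<Longrightarrow> scale A c a \<in> carrier A"
    and scale_add_right:
      "\<lbrakk>a \<in> carrier A; b \<in> carrier A\<rbrakk> \<Longrightarrow> scale A c (a \<oplus> b) = scale A c a \<oplus> scale A c b"
    and scale_add_left: "a \<in> carrier A \<Longrightarrow> scale A (c + d) a = scale A c a \<oplus> scale A d a"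
    and scale_scale: "a \<in> carrier A \<Longrightarrow> scale A c (scale A d a) = scale A (c * d) a"
    and scale_one: "a \<in> carrier A \<Longrightarrow> scale A 1 a = a"
    and scale_mult_left:
      "\<lbrakk>a \<in> carrier A; b \<in> carrier A\<rbrakk> \<Longrightarrow> scale A c a \<otimes> b = scale A c (a \<otimes> b)"
    and scale_mult_right:
      "\<lbrakk>a \<in> carrier A; b \<in> carrier A\<rbrakk> \<Longrightarrow> a \<otimes> scale A c b = scale A c (a \<otimes> b)"
    and star_closed: "a \<in> carrier A \<Longrightarrow> star A a \<in> carrier A"
    and star_star: "a \<in> carrier A \<Longrightarrow> star A (star A a) = a"
    and star_add:
      "\<lbrakk>a \<in> carrier A; b \<in> carrier A\<rbrakk> \<Longrightarrow> star A (a \<oplus> b) = star A a \<oplus> star A b"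
    and star_scale: "a \<in> carrier A \<Longrightarrow> star A (scale A c a) = scale A (cnj c) (star A a)"
    and star_mult:
      "\<lbrakk>a \<in> carrier A; b \<in> carrier A\<rbrakk> \<Longrightarrow> star A (a \<otimes> b) = star A b \<otimes> star A a"
    and nrm_nonneg: "a \<in> carrier A \<Longrightarrow> 0 \<le> nrm A a"
    and nrm_eq_zero: "a \<in> carrier A \<Longrightarrow> nrm A a = 0 \<longleftrightarrow> a = \<zero>"
    and nrm_triangle:
      "\<lbrakk>a \<in> carrier A; b \<in> carrier A\<rbrakk> \<Longrightarrow> nrm A (a \<oplus> b) \<le> nrm A a + nrm A b"
    and nrm_scale: "a \<in> carrier A \<Longrightarrow> nrm A (scale A c a) = cmod c * nrm A a"
    and nrm_mult: "\<lbrakk>a \<in> carrier A; b \<in> carrier A\<rbrakk> \<Longrightarrow> nrm A (a \<otimes> b) \<le> nrm A a * nrm A b"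
    and cstar_identity: "a \<in> carrier A \<Longrightarrow> nrm A (star A a \<otimes> a) = (nrm A a)\<^sup>2"
    and complete:
      "\<lbrakk>\<And>n. s n \<in> carrier A; \<And>e. 0 < e \<Longrightarrow> \<exists>N. \<forall>m\<ge>N. \<forall>n\<ge>N. nrm A (s m \<ominus> s n) < e\<rbrakk>
        \<Longrightarrow> \<exists>a\<in>carrier A. (\<lambda>n. nrm A (s n \<ominus> a)) \<longlonglongrightarrow> 0"

definition star_hom ::
    "('a, 'm) star_algebra_scheme \<Rightarrow> ('b, 'n) star_algebra_scheme \<Rightarrow> ('a \<Rightarrow> 'b) set" where
  "star_hom A B = {f \<in> carrier A \<rightarrow> carrier B.
     (\<forall>a\<in>carrier A. \<forall>b\<in>carrier A. f (a \<oplus>\<^bsub>A\<^esub> b) = f a \<oplus>\<^bsub>B\<^esub> f b) \<and>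
     (\<forall>a\<in>carrier A. \<forall>b\<in>carrier A. f (a \<otimes>\<^bsub>A\<^esub> b) = f a \<otimes>\<^bsub>B\<^esub> f b) \<and>
     (\<forall>c. \<forall>a\<in>carrier A. f (scale A c a) = scale B c (f a)) \<and>
     (\<forall>a\<in>carrier A. f (star A a) = star B (f a))}"

text \<open>A bijective star-homomorphism between C*-algebras is automatically isometric and unital.\<close>

definition cstar_isomorphic ::
    "('a, 'm) star_algebra_scheme \<Rightarrow> ('b, 'n) star_algebra_scheme \<Rightarrow> bool" where
  "cstar_isomorphic A B \<longleftrightarrow> (\<exists>f\<in>star_hom A B. bij_betw f (carrier A) (carrier B))"


section \<open>Noncommutative star-polynomials\<close>

text \<open>
  The unital free star-algebra on a set of generators is the monoid algebra over the complex
  numbers of the free monoid on the letters \<open>(x, False)\<close>, standing for \<open>x\<close>, and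
  \<open>(x, True)\<close>, standing for the adjoint of \<open>x\<close>.  Its ring structure is the
  convolution ring structure of \<open>\<Rightarrow>\<^sub>0\<close>, for which the free monoid has to be
  written additively.
\<close>

datatype 'x free_mon = Word (letters: "'x list")

instantiation free_mon :: (type) monoid_add
begin

definition zero_free_mon :: "'a free_mon" where "0 = Word []"

definition plus_free_mon :: "'a free_mon \<Rightarrow> 'a free_mon \<Rightarrow> 'a free_mon" where
  "v + w = Word (letters v @ letters w)"

instance
  by standard (auto simp: zero_free_mon_def plus_free_mon_def)

end

type_synonym 'x star_poly = "('x \<times> bool) free_mon \<Rightarrow>\<^sub>0 complex"

definition word_star :: "('x \<times> bool) free_mon \<Rightarrow> ('x \<times> bool) free_mon" where
  "word_star w = Word (rev (map (\<lambda>(x, b). (x, \<not> b)) (letters w)))"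

definition poly_star :: "'x star_poly \<Rightarrow> 'x star_poly" where
  "poly_star p = Poly_Mapping.map_key word_star (Poly_Mapping.map cnj p)"

definition poly_scale :: "complex \<Rightarrow> 'x star_poly \<Rightarrow> 'x star_poly" where
  "poly_scale c p = Poly_Mapping.single 0 c * p"

definition poly_gen :: "'x \<Rightarrow> 'x star_poly" where
  "poly_gen x = Poly_Mapping.single (Word [(x, False)]) 1"

definition star_polys :: "'x set \<Rightarrow> 'x star_poly set" where
  "star_polys X = {p. \<forall>w \<in> Poly_Mapping.keys p. fst ` set (letters w) \<subseteq> X}"


section \<open>Universal C*-algebras\<close>

text \<open>
  The universal unital C*-algebra with generators \<open>X\<close> and relations \<open>r = 0\<close>,
  for \<open>r \<in> R\<close>, is the separation and completion of the free star-algebra with respect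
  to the largest C*-seminorm that vanishes on \<open>R\<close>.  It exists if the C*-seminorms
  vanishing on \<open>R\<close> are pointwise bounded.
\<close>

definition cstar_seminorms :: "'x set \<Rightarrow> 'x star_poly set \<Rightarrow> ('x star_poly \<Rightarrow> real) set" where
  "cstar_seminorms X R = {q.
     (\<forall>a\<in>star_polys X. 0 \<le> q a) \<and>
     (\<forall>a\<in>star_polys X. \<forall>b\<in>star_polys X. q (a + b) \<le> q a + q b) \<and>
     (\<forall>c. \<forall>a\<in>star_polys X. q (poly_scale c a) = cmod c * q a) \<and>
     (\<forall>a\<in>star_polys X. \<forall>b\<in>star_polys X. q (a * b) \<le> q a * q b) \<and>
     (\<forall>a\<in>star_polys X. q (poly_star a * a) = (q a)\<^sup>2) \<and>
     (\<forall>r\<in>R. q r = 0)}"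

definition univ_nrm :: "'x set \<Rightarrow> 'x star_poly set \<Rightarrow> 'x star_poly \<Rightarrow> real" where
  "univ_nrm X R a = (SUP q \<in> cstar_seminorms X R. q a)"

definition cauchy_polys :: "'x set \<Rightarrow> 'x star_poly set \<Rightarrow> (nat \<Rightarrow> 'x star_poly) set" where
  "cauchy_polys X R = {s. (\<forall>n. s n \<in> star_polys X) \<and>
     (\<forall>e>0. \<exists>N. \<forall>m\<ge>N. \<forall>n\<ge>N. univ_nrm X R (s m - s n) < e)}"

definition null_rel ::
    "'x set \<Rightarrow> 'x star_poly set \<Rightarrow> ((nat \<Rightarrow> 'x star_poly) \<times> (nat \<Rightarrow> 'x star_poly)) set" where
  "null_rel X R = {(s, t) \<in> cauchy_polys X R \<times> cauchy_polys X R.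
     (\<lambda>n. univ_nrm X R (s n - t n)) \<longlonglongrightarrow> 0}"

definition seq_class ::
    "'x set \<Rightarrow> 'x star_poly set \<Rightarrow> (nat \<Rightarrow> 'x star_poly) \<Rightarrow> (nat \<Rightarrow> 'x star_poly) set" where
  "seq_class X R s = null_rel X R `` {s}"

definition universal_cstar ::
    "'x set \<Rightarrow> 'x star_poly set \<Rightarrow> (nat \<Rightarrow> 'x star_poly) set star_algebra" where
  "universal_cstar X R = \<lparr>
     carrier = cauchy_polys X R // null_rel X R,
     mult = (\<lambda>P Q. \<Union>s\<in>P. \<Union>t\<in>Q. seq_class X R (\<lambda>n. s n * t n)),
     one = seq_class X R (\<lambda>n. 1),
     zero = seq_class X R (\<lambda>n. 0),
     add = (\<lambda>P Q. \<Union>s\<in>P. \<Union>t\<in>Q. seq_class X R (\<lambda>n. s n + t n)),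
     scale = (\<lambda>c P. \<Union>s\<in>P. seq_class X R (\<lambda>n. poly_scale c (s n))),
     star = (\<lambda>P. \<Union>s\<in>P. seq_class X R (\<lambda>n. poly_star (s n))),
     nrm = (\<lambda>P. the_elem (\<Union>s\<in>P. {lim (\<lambda>n. univ_nrm X R (s n))}))\<rparr>"

definition univ_gen :: "'x set \<Rightarrow> 'x star_poly set \<Rightarrow> 'x \<Rightarrow> (nat \<Rightarrow> 'x star_poly) set" where
  "univ_gen X R x = seq_class X R (\<lambda>n. poly_gen x)"


section \<open>Bipartite graph C*-algebras\<close>

record 'v bip_graph =
  left :: "'v set"
  right :: "'v set"
  edges :: "'v set set"

definition bipartite_graph :: "'v bip_graph \<Rightarrow> bool" where
  "bipartite_graph G \<longleftrightarrow> finite (left G) \<and> finite (right G) \<and> left G \<inter> right G = {} \<and>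
     edges G \<subseteq> {{u, v} | u v. u \<in> left G \<and> v \<in> right G}"

definition bip_relations :: "'v bip_graph \<Rightarrow> 'v star_poly set" where
  "bip_relations G =
     {poly_gen x - poly_star (poly_gen x) | x. x \<in> left G \<union> right G} \<union>
     {poly_gen x * poly_gen x - poly_gen x | x. x \<in> left G \<union> right G} \<union>
     {(\<Sum>u\<in>left G. poly_gen u) - 1, (\<Sum>v\<in>right G. poly_gen v) - 1} \<union>
     {poly_gen u * poly_gen v | u v. u \<in> left G \<and> v \<in> right G \<and> {u, v} \<notin> edges G}"

definition bip_cstar :: "'v bip_graph \<Rightarrow> (nat \<Rightarrow> 'v star_poly) set star_algebra" where
  "bip_cstar G = universal_cstar (left G \<union> right G) (bip_relations G)"


section \<open>Representations on Hilbert spaces\<close>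

text \<open>
  Up to unitary equivalence, the Hilbert spaces are the spaces of square summable families
  indexed by a set \<open>J\<close>.  The vectors are extended by zero outside \<open>J\<close>.
\<close>

definition l2 :: "'i set \<Rightarrow> ('i \<Rightarrow> complex) set" where
  "l2 J = {\<xi>. (\<forall>i. i \<notin> J \<longrightarrow> \<xi> i = 0) \<and> (\<lambda>i. (cmod (\<xi> i))\<^sup>2) summable_on UNIV}"

definition l2_inner :: "('i \<Rightarrow> complex) \<Rightarrow> ('i \<Rightarrow> complex) \<Rightarrow> complex" where
  "l2_inner \<xi> \<eta> = (\<Sum>\<^sub>\<infinity>i. cnj (\<xi> i) * \<eta> i)"

definition l2_norm :: "('i \<Rightarrow> complex) \<Rightarrow> real" where
  "l2_norm \<xi> = sqrt (\<Sum>\<^sub>\<infinity>i. (cmod (\<xi> i))\<^sup>2)"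

definition l2_linear :: "'i set \<Rightarrow> 'j set \<Rightarrow> (('i \<Rightarrow> complex) \<Rightarrow> ('j \<Rightarrow> complex)) \<Rightarrow> bool" where
  "l2_linear J K T \<longleftrightarrow> T \<in> l2 J \<rightarrow> l2 K \<and>
     (\<forall>\<xi>\<in>l2 J. \<forall>\<eta>\<in>l2 J. T (\<lambda>i. \<xi> i + \<eta> i) = (\<lambda>j. T \<xi> j + T \<eta> j)) \<and>
     (\<forall>c. \<forall>\<xi>\<in>l2 J. T (\<lambda>i. c * \<xi> i) = (\<lambda>j. c * T \<xi> j))"

definition l2_bounded :: "'i set \<Rightarrow> 'j set \<Rightarrow> (('i \<Rightarrow> complex) \<Rightarrow> ('j \<Rightarrow> complex)) \<Rightarrow> bool" where
  "l2_bounded J K T \<longleftrightarrow> l2_linear J K T \<and> (\<exists>C. \<forall>\<xi>\<in>l2 J. l2_norm (T \<xi>) \<le> C * l2_norm \<xi>)"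

definition l2_unitary :: "'i set \<Rightarrow> 'j set \<Rightarrow> (('i \<Rightarrow> complex) \<Rightarrow> ('j \<Rightarrow> complex)) \<Rightarrow> bool" where
  "l2_unitary J K T \<longleftrightarrow> l2_linear J K T \<and> bij_betw T (l2 J) (l2 K) \<and>
     (\<forall>\<xi>\<in>l2 J. \<forall>\<eta>\<in>l2 J. l2_inner (T \<xi>) (T \<eta>) = l2_inner \<xi> \<eta>)"

definition closed_l2_subspace :: "'i set \<Rightarrow> ('i \<Rightarrow> complex) set \<Rightarrow> bool" where
  "closed_l2_subspace J M \<longleftrightarrow> M \<subseteq> l2 J \<and> (\<lambda>i. 0) \<in> M \<and>
     (\<forall>\<xi>\<in>M. \<forall>\<eta>\<in>M. (\<lambda>i. \<xi> i + \<eta> i) \<in> M) \<and>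
     (\<forall>c. \<forall>\<xi>\<in>M. (\<lambda>i. c * \<xi> i) \<in> M) \<and>
     (\<forall>s \<xi>. (\<forall>n. s n \<in> M) \<and> \<xi> \<in> l2 J \<and> (\<lambda>n. l2_norm (\<lambda>i. s n i - \<xi> i)) \<longlonglongrightarrow> 0 \<longrightarrow> \<xi> \<in> M)"

text \<open>
  Operators are only considered on the subset \<open>l2 J\<close> of their HOL domain; the values
  elsewhere are irrelevant.
\<close>

definition hilbert_rep ::
    "('a, 'm) star_algebra_scheme \<Rightarrow> 'i set \<Rightarrow> ('a \<Rightarrow> ('i \<Rightarrow> complex) \<Rightarrow> 'i \<Rightarrow> complex) \<Rightarrow> bool" where
  "hilbert_rep A J \<pi> \<longleftrightarrow>
     (\<forall>a\<in>carrier A. l2_bounded J J (\<pi> a)) \<and>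
     (\<forall>a\<in>carrier A. \<forall>b\<in>carrier A. \<forall>\<xi>\<in>l2 J. \<pi> (a \<oplus>\<^bsub>A\<^esub> b) \<xi> = (\<lambda>i. \<pi> a \<xi> i + \<pi> b \<xi> i)) \<and>
     (\<forall>a\<in>carrier A. \<forall>b\<in>carrier A. \<forall>\<xi>\<in>l2 J. \<pi> (a \<otimes>\<^bsub>A\<^esub> b) \<xi> = \<pi> a (\<pi> b \<xi>)) \<and>
     (\<forall>c. \<forall>a\<in>carrier A. \<forall>\<xi>\<in>l2 J. \<pi> (scale A c a) \<xi> = (\<lambda>i. c * \<pi> a \<xi> i)) \<and>
     (\<forall>a\<in>carrier A. \<forall>\<xi>\<in>l2 J. \<forall>\<eta>\<in>l2 J. l2_inner (\<pi> (star A a) \<xi>) \<eta> = l2_inner \<xi> (\<pi> a \<eta>))"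

definition irreducible_rep ::
    "('a, 'm) star_algebra_scheme \<Rightarrow> 'i set \<Rightarrow> ('a \<Rightarrow> ('i \<Rightarrow> complex) \<Rightarrow> 'i \<Rightarrow> complex) \<Rightarrow> bool" where
  "irreducible_rep A J \<pi> \<longleftrightarrow> hilbert_rep A J \<pi> \<and>
     (\<exists>a\<in>carrier A. \<exists>\<xi>\<in>l2 J. \<pi> a \<xi> \<noteq> (\<lambda>i. 0)) \<and>
     (\<forall>M. closed_l2_subspace J M \<and> (\<forall>a\<in>carrier A. \<forall>\<xi>\<in>M. \<pi> a \<xi> \<in> M) \<longrightarrow>
        M = {\<lambda>i. 0} \<or> M = l2 J)"

definition rep_kernel ::
    "('a, 'm) star_algebra_scheme \<Rightarrow> 'i set \<Rightarrow> ('a \<Rightarrow> ('i \<Rightarrow> complex) \<Rightarrow> 'i \<Rightarrow> complex) \<Rightarrow> 'a set" where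
  "rep_kernel A J \<pi> = {a \<in> carrier A. \<forall>\<xi>\<in>l2 J. \<pi> a \<xi> = (\<lambda>i. 0)}"


section \<open>Spectrum and primitive ideal space\<close>

text \<open>
  An irreducible representation of \<open>A\<close> is cyclic, so the dimension of its Hilbert space
  does not exceed the cardinality of \<open>A\<close>.  Every irreducible representation is therefore
  unitarily equivalent to one on \<open>l2 J\<close> for a set \<open>J\<close> of elements of the type
  underlying \<open>A\<close>.
\<close>

type_synonym 'a rep = "'a set \<times> ('a \<Rightarrow> ('a \<Rightarrow> complex) \<Rightarrow> 'a \<Rightarrow> complex)"

definition irreps :: "('a, 'm) star_algebra_scheme \<Rightarrow> 'a rep set" where
  "irreps A = {(J, \<pi>). irreducible_rep A J \<pi>}"

definition unitarily_equivalent :: "('a, 'm) star_algebra_scheme \<Rightarrow> ('a rep \<times> 'a rep) set" where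
  "unitarily_equivalent A = {((J, \<pi>), (K, \<rho>)). (J, \<pi>) \<in> irreps A \<and> (K, \<rho>) \<in> irreps A \<and>
     (\<exists>T. l2_unitary J K T \<and> (\<forall>a\<in>carrier A. \<forall>\<xi>\<in>l2 J. T (\<pi> a \<xi>) = \<rho> a (T \<xi>)))}"

definition Spec :: "('a, 'm) star_algebra_scheme \<Rightarrow> 'a rep set set" where
  "Spec A = irreps A // unitarily_equivalent A"

definition Prim :: "('a, 'm) star_algebra_scheme \<Rightarrow> 'a set set" where
  "Prim A = {rep_kernel A J \<pi> | J \<pi>. (J, \<pi>) \<in> irreps A}"

definition prim_hull :: "('a, 'm) star_algebra_scheme \<Rightarrow> 'a set \<Rightarrow> 'a set set" where
  "prim_hull A I = {P \<in> Prim A. I \<subseteq> P}"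

definition Prim_topology :: "('a, 'm) star_algebra_scheme \<Rightarrow> 'a set topology" where
  "Prim_topology A = topology (\<lambda>W. \<exists>I \<subseteq> carrier A. W = Prim A - prim_hull A I)"

definition spec_kernel :: "('a, 'm) star_algebra_scheme \<Rightarrow> 'a rep set \<Rightarrow> 'a set" where
  "spec_kernel A c = the_elem ((\<lambda>(J, \<pi>). rep_kernel A J \<pi>) ` c)"

definition Spec_topology :: "('a, 'm) star_algebra_scheme \<Rightarrow> 'a rep set topology" where
  "Spec_topology A = pullback_topology (Spec A) (spec_kernel A) (Prim_topology A)"

definition Spec_le2 :: "('a, 'm) star_algebra_scheme \<Rightarrow> 'a rep set set" where
  "Spec_le2 A = {c \<in> Spec A. \<exists>(J, \<pi>) \<in> c. card J = 1 \<or> card J = 2}"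

definition Spec_le2_topology :: "('a, 'm) star_algebra_scheme \<Rightarrow> 'a rep set topology" where
  "Spec_le2_topology A = subtopology (Spec_topology A) (Spec_le2 A)"


section \<open>Well-definedness of the spectrum and its topology\<close>

lemma l2_zero: "(\<lambda>i. 0) \<in> l2 J"
  by (simp add: l2_def)

lemma l2_scale:
  assumes "\<xi> \<in> l2 J" shows "(\<lambda>i. c * \<xi> i) \<in> l2 J"
proof -
  have "(\<lambda>i. (cmod c)\<^sup>2 * (cmod (\<xi> i))\<^sup>2) summable_on UNIV"
    using assms by (intro summable_on_cmult_right) (simp add: l2_def)
  then show ?thesis
    using assms by (simp add: l2_def norm_mult power_mult_distrib)
qed

lemma l2_add:
  assumes "\<xi> \<in> l2 J" "\<eta> \<in> l2 J" shows "(\<lambda>i. \<xi> i + \<eta> i) \<in> l2 J"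
proof -
  have s: "(\<lambda>i. 2 * (cmod (\<xi> i))\<^sup>2 + 2 * (cmod (\<eta> i))\<^sup>2) summable_on UNIV"
    using assms by (intro summable_on_add summable_on_cmult_right) (simp_all add: l2_def)
  have "(cmod (\<xi> i + \<eta> i))\<^sup>2 \<le> 2 * (cmod (\<xi> i))\<^sup>2 + 2 * (cmod (\<eta> i))\<^sup>2" for i
  proof -
    have "(cmod (\<xi> i + \<eta> i))\<^sup>2 \<le> (cmod (\<xi> i) + cmod (\<eta> i))\<^sup>2"
      by (intro power_mono norm_triangle_ineq) simp
    also have "\<dots> \<le> 2 * (cmod (\<xi> i))\<^sup>2 + 2 * (cmod (\<eta> i))\<^sup>2"
      using sum_squares_bound[of "cmod (\<xi> i)" "cmod (\<eta> i)"] by (simp add: power2_sum)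
    finally show ?thesis .
  qed
  then have "(\<lambda>i. (cmod (\<xi> i + \<eta> i))\<^sup>2) summable_on UNIV"
    using s by (intro summable_on_comparison_test[OF s]) auto
  then show ?thesis
    using assms by (simp add: l2_def)
qed

lemma l2_diff:
  assumes "\<xi> \<in> l2 J" "\<eta> \<in> l2 J" shows "(\<lambda>i. \<xi> i - \<eta> i) \<in> l2 J"
  using l2_add[OF assms(1) l2_scale[OF assms(2), of "-1"]] by simp

lemma l2_norm_nonneg: "0 \<le> l2_norm \<xi>"
  by (simp add: l2_norm_def infsum_nonneg)

lemma l2_norm_eq_zero:
  assumes "\<xi> \<in> l2 J" "l2_norm \<xi> = 0" shows "\<xi> = (\<lambda>i. 0)"
proof
  fix i
  have s: "(\<lambda>i. (cmod (\<xi> i))\<^sup>2) summable_on UNIV"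
    using assms by (simp add: l2_def)
  have "(\<Sum>\<^sub>\<infinity>i. (cmod (\<xi> i))\<^sup>2) = 0"
    using assms by (simp add: l2_norm_def)
  moreover have "(\<Sum>\<^sub>\<infinity>j\<in>{i}. (cmod (\<xi> j))\<^sup>2) \<le> (\<Sum>\<^sub>\<infinity>i. (cmod (\<xi> i))\<^sup>2)"
    using s by (intro infsum_mono_neutral) auto
  ultimately show "\<xi> i = 0"
    by simp
qed

lemma l2_inner_self:
  assumes "\<xi> \<in> l2 J"
  shows "l2_inner \<xi> \<xi> = complex_of_real ((l2_norm \<xi>)\<^sup>2)"
proof -
  have "l2_inner \<xi> \<xi> = (\<Sum>\<^sub>\<infinity>i. complex_of_real ((cmod (\<xi> i))\<^sup>2))"
    unfolding l2_inner_def
    by (intro infsum_cong) (metis complex_norm_square mult.commute)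
  also have "\<dots> = complex_of_real (\<Sum>\<^sub>\<infinity>i. (cmod (\<xi> i))\<^sup>2)"
    using assms by (intro infsumI has_sum_of_real has_sum_infsum) (simp add: l2_def)
  finally show ?thesis
    by (simp add: l2_norm_def infsum_nonneg)
qed

lemma l2_linear_zero:
  assumes "l2_linear J K T" shows "T (\<lambda>i. 0) = (\<lambda>j. 0)"
proof -
  have "T (\<lambda>i. 0 * (0::complex)) = (\<lambda>j. 0 * T (\<lambda>i. 0) j)"
    using assms l2_zero[of J] unfolding l2_linear_def by fast
  then show ?thesis by simp
qed

lemma l2_linear_diff:
  assumes "l2_linear J K T" "\<xi> \<in> l2 J" "\<eta> \<in> l2 J"
  shows "T (\<lambda>i. \<xi> i - \<eta> i) = (\<lambda>j. T \<xi> j - T \<eta> j)"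
proof -
  have "T (\<lambda>i. \<xi> i + (-1) * \<eta> i) = (\<lambda>j. T \<xi> j + T (\<lambda>i. (-1) * \<eta> i) j)"
    using assms(1,2) l2_scale[OF assms(3), of "-1"] unfolding l2_linear_def by fast
  moreover have "T (\<lambda>i. (-1) * \<eta> i) = (\<lambda>j. (-1) * T \<eta> j)"
    using assms unfolding l2_linear_def by fast
  ultimately show ?thesis by simp
qed

lemma unitarily_equivalent_equiv: "equiv (irreps A) (unitarily_equivalent A)"
proof (rule equivI)
  show "unitarily_equivalent A \<subseteq> irreps A \<times> irreps A"
    by (auto simp: unitarily_equivalent_def)
  show "refl_on (irreps A) (unitarily_equivalent A)"
  proof (rule refl_onI)
    fix x :: "'a rep" assume "x \<in> irreps A"
    moreover obtain J \<pi> where "x = (J, \<pi>)" by fastforce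
    moreover have "l2_unitary J J (\<lambda>\<xi>. \<xi>)"
      by (auto simp: l2_unitary_def l2_linear_def bij_betw_def)
    ultimately show "(x, x) \<in> unitarily_equivalent A"
      by (auto simp: unitarily_equivalent_def)
  qed
  show "sym (unitarily_equivalent A)"
  proof (rule symI)
    fix x y :: "'a rep" assume xy: "(x, y) \<in> unitarily_equivalent A"
    obtain J \<pi> K \<rho> where eq: "x = (J, \<pi>)" "y = (K, \<rho>)" by fastforce
    with xy obtain T where ir: "(J, \<pi>) \<in> irreps A" "(K, \<rho>) \<in> irreps A" and U: "l2_unitary J K T"
      and T: "\<And>a \<xi>. a \<in> carrier A \<Longrightarrow> \<xi> \<in> l2 J \<Longrightarrow> T (\<pi> a \<xi>) = \<rho> a (T \<xi>)"
      by (auto simp: unitarily_equivalent_def)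
    define S where "S = inv_into (l2 J) T"
    have bij: "bij_betw T (l2 J) (l2 K)" and lin: "l2_linear J K T"
      using U by (auto simp: l2_unitary_def)
    have S_in: "S \<eta> \<in> l2 J" and TS: "T (S \<eta>) = \<eta>" if "\<eta> \<in> l2 K" for \<eta>
      using bij that by (auto simp: S_def bij_betw_def f_inv_into_f inv_into_into)
    have ST: "S (T \<xi>) = \<xi>" if "\<xi> \<in> l2 J" for \<xi>
      using bij that by (auto simp: S_def bij_betw_def)
    have "S (\<lambda>i. \<xi> i + \<eta> i) = (\<lambda>j. S \<xi> j + S \<eta> j)" if "\<xi> \<in> l2 K" "\<eta> \<in> l2 K" for \<xi> \<eta>
    proof -
      have "T (\<lambda>j. S \<xi> j + S \<eta> j) = (\<lambda>i. \<xi> i + \<eta> i)"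
        using lin that S_in TS by (auto simp: l2_linear_def)
      then show ?thesis
        using ST[OF l2_add[OF S_in[OF that(1)] S_in[OF that(2)]]] by simp
    qed
    moreover have "S (\<lambda>i. c * \<xi> i) = (\<lambda>j. c * S \<xi> j)" if "\<xi> \<in> l2 K" for c \<xi>
    proof -
      have "T (\<lambda>j. c * S \<xi> j) = (\<lambda>i. c * \<xi> i)"
        using lin that S_in TS by (auto simp: l2_linear_def)
      then show ?thesis
        using ST[OF l2_scale[OF S_in[OF that]], of c] by simp
    qed
    ultimately have "l2_linear K J S"
      using S_in by (auto simp: l2_linear_def)
    moreover have "bij_betw S (l2 K) (l2 J)"
      using bij by (simp add: S_def bij_betw_inv_into)
    moreover have "l2_inner (S \<xi>) (S \<eta>) = l2_inner \<xi> \<eta>" if "\<xi> \<in> l2 K" "\<eta> \<in> l2 K" for \<xi> \<eta>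
    proof -
      have "l2_inner (T (S \<xi>)) (T (S \<eta>)) = l2_inner (S \<xi>) (S \<eta>)"
        using U that S_in by (auto simp: l2_unitary_def)
      then show ?thesis using TS that by simp
    qed
    ultimately have "l2_unitary K J S"
      by (auto simp: l2_unitary_def)
    moreover have "S (\<rho> a \<xi>) = \<pi> a (S \<xi>)" if "a \<in> carrier A" "\<xi> \<in> l2 K" for a \<xi>
    proof -
      have "\<pi> a (S \<xi>) \<in> l2 J"
        using ir that S_in
        by (fastforce simp: irreps_def irreducible_rep_def hilbert_rep_def l2_bounded_def l2_linear_def)
      then show ?thesis
        using T[OF that(1) S_in[OF that(2)]] ST TS[OF that(2)] by metis
    qed
    ultimately show "(y, x) \<in> unitarily_equivalent A"
      using ir eq by (auto simp: unitarily_equivalent_def)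
  qed
  show "trans (unitarily_equivalent A)"
  proof (rule transI)
    fix x y z :: "'a rep"
    assume xy: "(x, y) \<in> unitarily_equivalent A" and yz: "(y, z) \<in> unitarily_equivalent A"
    obtain J \<pi> K \<rho> L \<sigma> where eq: "x = (J, \<pi>)" "y = (K, \<rho>)" "z = (L, \<sigma>)"
      by (metis surj_pair)
    from xy eq obtain T where ir: "(J, \<pi>) \<in> irreps A" and U: "l2_unitary J K T"
      and T: "\<And>a \<xi>. a \<in> carrier A \<Longrightarrow> \<xi> \<in> l2 J \<Longrightarrow> T (\<pi> a \<xi>) = \<rho> a (T \<xi>)"
      by (auto simp: unitarily_equivalent_def)
    from yz eq obtain S where ir': "(L, \<sigma>) \<in> irreps A" and U': "l2_unitary K L S"
      and S: "\<And>a \<xi>. a \<in> carrier A \<Longrightarrow> \<xi> \<in> l2 K \<Longrightarrow> S (\<rho> a \<xi>) = \<sigma> a (S \<xi>)"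
      by (auto simp: unitarily_equivalent_def)
    have T_in: "T \<xi> \<in> l2 K" if "\<xi> \<in> l2 J" for \<xi>
      using U that by (auto simp: l2_unitary_def l2_linear_def)
    have "l2_unitary J L (S \<circ> T)"
      unfolding l2_unitary_def
    proof (intro conjI)
      show "bij_betw (S \<circ> T) (l2 J) (l2 L)"
        using U U' bij_betw_trans unfolding l2_unitary_def by blast
      show "l2_linear J L (S \<circ> T)"
        using U U' T_in by (auto simp: l2_linear_def l2_unitary_def)
      show "\<forall>\<xi>\<in>l2 J. \<forall>\<eta>\<in>l2 J. l2_inner ((S \<circ> T) \<xi>) ((S \<circ> T) \<eta>) = l2_inner \<xi> \<eta>"
        using U U' T_in by (auto simp: l2_unitary_def)
    qed
    moreover have "\<forall>a\<in>carrier A. \<forall>\<xi>\<in>l2 J. (S \<circ> T) (\<pi> a \<xi>) = \<sigma> a ((S \<circ> T) \<xi>)"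
      using S T T_in by auto
    ultimately show "(x, z) \<in> unitarily_equivalent A"
      using ir ir' eq unfolding unitarily_equivalent_def by blast
  qed
qed

lemma rep_kernel_unitarily_equivalent:
  assumes "((J, \<pi>), (K, \<rho>)) \<in> unitarily_equivalent A"
  shows "rep_kernel A J \<pi> = rep_kernel A K \<rho>"
proof -
  have sub: "rep_kernel A J \<pi> \<subseteq> rep_kernel A K \<rho>"
    if eq: "((J, \<pi>), (K, \<rho>)) \<in> unitarily_equivalent A" for J \<pi> K \<rho>
  proof
    fix a assume a: "a \<in> rep_kernel A J \<pi>"
    obtain T where U: "l2_unitary J K T"
      and T: "\<And>a \<xi>. a \<in> carrier A \<Longrightarrow> \<xi> \<in> l2 J \<Longrightarrow> T (\<pi> a \<xi>) = \<rho> a (T \<xi>)"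
      using eq by (auto simp: unitarily_equivalent_def)
    have "\<rho> a \<eta> = (\<lambda>i. 0)" if \<eta>: "\<eta> \<in> l2 K" for \<eta>
    proof -
      obtain \<xi> where "\<xi> \<in> l2 J" "\<eta> = T \<xi>"
        using U \<eta> by (metis bij_betw_imp_surj_on imageE l2_unitary_def)
      then show ?thesis
        using T[of a \<xi>] a l2_linear_zero[of J K T] U by (auto simp: rep_kernel_def l2_unitary_def)
    qed
    then show "a \<in> rep_kernel A K \<rho>"
      using a by (auto simp: rep_kernel_def)
  qed
  have "((K, \<rho>), (J, \<pi>)) \<in> unitarily_equivalent A"
    using assms unitarily_equivalent_equiv[of A] by (meson equivE symD)
  then show ?thesis
    using sub assms by blast
qed

lemma spec_kernel_class:
  assumes "(J, \<pi>) \<in> irreps A"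
  shows "spec_kernel A (unitarily_equivalent A `` {(J, \<pi>)}) = rep_kernel A J \<pi>"
proof -
  have "(\<lambda>(J, \<pi>). rep_kernel A J \<pi>) ` (unitarily_equivalent A `` {(J, \<pi>)}) = {rep_kernel A J \<pi>}"
  proof
    show "(\<lambda>(J, \<pi>). rep_kernel A J \<pi>) ` (unitarily_equivalent A `` {(J, \<pi>)}) \<subseteq> {rep_kernel A J \<pi>}"
      using rep_kernel_unitarily_equivalent[of J \<pi> _ _ A, symmetric] by auto
    show "{rep_kernel A J \<pi>} \<subseteq> (\<lambda>(J, \<pi>). rep_kernel A J \<pi>) ` (unitarily_equivalent A `` {(J, \<pi>)})"
      using equiv_class_self[OF unitarily_equivalent_equiv assms] by force
  qed
  then show ?thesis
    by (simp add: spec_kernel_def)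
qed

lemma hilbert_repD:
  assumes "hilbert_rep A J \<pi>" "a \<in> carrier A"
  shows "l2_linear J J (\<pi> a)" "\<xi> \<in> l2 J \<Longrightarrow> \<pi> a \<xi> \<in> l2 J"
    "\<exists>C\<ge>0. \<forall>\<xi>\<in>l2 J. l2_norm (\<pi> a \<xi>) \<le> C * l2_norm \<xi>"
proof -
  show "l2_linear J J (\<pi> a)" "\<xi> \<in> l2 J \<Longrightarrow> \<pi> a \<xi> \<in> l2 J"
    using assms by (auto simp: hilbert_rep_def l2_bounded_def l2_linear_def)
  obtain C where C: "\<forall>\<xi>\<in>l2 J. l2_norm (\<pi> a \<xi>) \<le> C * l2_norm \<xi>"
    using assms by (auto simp: hilbert_rep_def l2_bounded_def)
  have "l2_norm (\<pi> a \<xi>) \<le> max C 0 * l2_norm \<xi>" if "\<xi> \<in> l2 J" for \<xi>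
    using C that l2_norm_nonneg[of \<xi>]
    by (meson max.cobounded1 mult_right_mono order_trans)
  then show "\<exists>C\<ge>0. \<forall>\<xi>\<in>l2 J. l2_norm (\<pi> a \<xi>) \<le> C * l2_norm \<xi>"
    by (meson max.cobounded2)
qed

text \<open>Primitive ideals are prime, so that finite unions of hulls are hulls.\<close>

lemma irreducible_rep_prime:
  fixes A :: "('a, 'm) star_algebra_scheme"
  assumes A: "cstar_algebra A" and irr: "irreducible_rep A J \<pi>"
    and a: "a \<in> carrier A" and b: "b \<in> carrier A"
    and ab: "\<And>c. c \<in> carrier A \<Longrightarrow> a \<otimes>\<^bsub>A\<^esub> (c \<otimes>\<^bsub>A\<^esub> b) \<in> rep_kernel A J \<pi>"
  shows "a \<in> rep_kernel A J \<pi> \<or> b \<in> rep_kernel A J \<pi>"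
proof (rule disjCI)
  interpret cstar_algebra A by (rule A)
  assume "b \<notin> rep_kernel A J \<pi>"
  then obtain \<xi>0 where \<xi>0: "\<xi>0 \<in> l2 J" "\<pi> b \<xi>0 \<noteq> (\<lambda>i. 0)"
    using b by (auto simp: rep_kernel_def)
  have rep: "hilbert_rep A J \<pi>"
    using irr by (simp add: irreducible_rep_def)
  note in_l2 = hilbert_repD(2)[OF rep]
  have mult: "\<pi> (c \<otimes>\<^bsub>A\<^esub> d) \<xi> = \<pi> c (\<pi> d \<xi>)"
    if "c \<in> carrier A" "d \<in> carrier A" "\<xi> \<in> l2 J" for c d \<xi>
    using rep that by (simp add: hilbert_rep_def)
  define M where "M = {\<xi> \<in> l2 J. \<forall>c\<in>carrier A. \<pi> a (\<pi> c \<xi>) = (\<lambda>i. 0)}"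
  have "closed_l2_subspace J M"
    unfolding closed_l2_subspace_def
  proof (intro conjI allI ballI impI)
    show "M \<subseteq> l2 J" by (auto simp: M_def)
    show "(\<lambda>i. 0) \<in> M"
      using a l2_linear_zero[OF hilbert_repD(1)[OF rep]] by (auto simp: M_def l2_zero)
    show "(\<lambda>i. \<xi> i + \<eta> i) \<in> M" if "\<xi> \<in> M" "\<eta> \<in> M" for \<xi> \<eta>
    proof -
      have "\<pi> a (\<pi> c (\<lambda>i. \<xi> i + \<eta> i)) = (\<lambda>i. 0)" if c: "c \<in> carrier A" for c
      proof -
        have mem: "\<xi> \<in> l2 J" "\<eta> \<in> l2 J" using \<open>\<xi> \<in> M\<close> \<open>\<eta> \<in> M\<close> by (auto simp: M_def)
        have "\<pi> c (\<lambda>i. \<xi> i + \<eta> i) = (\<lambda>i. \<pi> c \<xi> i + \<pi> c \<eta> i)"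
          using hilbert_repD(1)[OF rep c] mem by (auto simp: l2_linear_def)
        moreover have "\<pi> a (\<lambda>i. \<pi> c \<xi> i + \<pi> c \<eta> i) = (\<lambda>i. \<pi> a (\<pi> c \<xi>) i + \<pi> a (\<pi> c \<eta>) i)"
          using hilbert_repD(1)[OF rep a] mem in_l2[OF c] by (auto simp: l2_linear_def)
        ultimately show ?thesis
          using c \<open>\<xi> \<in> M\<close> \<open>\<eta> \<in> M\<close> by (auto simp: M_def)
      qed
      then show ?thesis using that by (auto simp: M_def l2_add)
    qed
    show "(\<lambda>i. z * \<xi> i) \<in> M" if "\<xi> \<in> M" for z \<xi>
    proof -
      have "\<pi> a (\<pi> c (\<lambda>i. z * \<xi> i)) = (\<lambda>i. 0)" if c: "c \<in> carrier A" for c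
      proof -
        have mem: "\<xi> \<in> l2 J" using \<open>\<xi> \<in> M\<close> by (auto simp: M_def)
        have "\<pi> c (\<lambda>i. z * \<xi> i) = (\<lambda>i. z * \<pi> c \<xi> i)"
          using hilbert_repD(1)[OF rep c] mem by (auto simp: l2_linear_def)
        moreover have "\<pi> a (\<lambda>i. z * \<pi> c \<xi> i) = (\<lambda>i. z * \<pi> a (\<pi> c \<xi>) i)"
          using hilbert_repD(1)[OF rep a] mem in_l2[OF c] by (auto simp: l2_linear_def)
        ultimately show ?thesis
          using c \<open>\<xi> \<in> M\<close> by (auto simp: M_def)
      qed
      then show ?thesis using that by (auto simp: M_def l2_scale)
    qed
    show "\<xi> \<in> M" if s: "(\<forall>n. s n \<in> M) \<and> \<xi> \<in> l2 J \<and> (\<lambda>n. l2_norm (\<lambda>i. s n i - \<xi> i)) \<longlonglongrightarrow> 0"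
      for s \<xi>
    proof -
      have "\<pi> a (\<pi> c \<xi>) = (\<lambda>i. 0)" if c: "c \<in> carrier A" for c
      proof -
        have ac: "a \<otimes>\<^bsub>A\<^esub> c \<in> carrier A" using a c by simp
        obtain C where C: "\<And>\<eta>. \<eta> \<in> l2 J \<Longrightarrow> l2_norm (\<pi> (a \<otimes>\<^bsub>A\<^esub> c) \<eta>) \<le> C * l2_norm \<eta>"
          using hilbert_repD(3)[OF rep ac] by blast
        have "l2_norm (\<pi> (a \<otimes>\<^bsub>A\<^esub> c) \<xi>) \<le> C * l2_norm (\<lambda>i. s n i - \<xi> i)" for n
        proof -
          have sn: "s n \<in> l2 J" "\<xi> \<in> l2 J" using s by (auto simp: M_def)
          have "\<pi> (a \<otimes>\<^bsub>A\<^esub> c) (s n) = (\<lambda>i. 0)"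
            using s c mult[OF a c] by (auto simp: M_def)
          then have "\<pi> (a \<otimes>\<^bsub>A\<^esub> c) (\<lambda>i. s n i - \<xi> i) = (\<lambda>i. - \<pi> (a \<otimes>\<^bsub>A\<^esub> c) \<xi> i)"
            using l2_linear_diff[OF hilbert_repD(1)[OF rep ac] sn] by simp
          then have "l2_norm (\<pi> (a \<otimes>\<^bsub>A\<^esub> c) \<xi>) = l2_norm (\<pi> (a \<otimes>\<^bsub>A\<^esub> c) (\<lambda>i. s n i - \<xi> i))"
            by (simp add: l2_norm_def)
          then show ?thesis using C[OF l2_diff[OF sn]] by simp
        qed
        moreover have "(\<lambda>n. C * l2_norm (\<lambda>i. s n i - \<xi> i)) \<longlonglongrightarrow> 0"
          using s tendsto_mult_right_zero by blast
        ultimately have "l2_norm (\<pi> (a \<otimes>\<^bsub>A\<^esub> c) \<xi>) \<le> 0"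
          by (intro LIMSEQ_le_const) auto
        then have "\<pi> (a \<otimes>\<^bsub>A\<^esub> c) \<xi> = (\<lambda>i. 0)"
          using l2_norm_eq_zero[OF in_l2[OF ac]] s l2_norm_nonneg[of "\<pi> (a \<otimes>\<^bsub>A\<^esub> c) \<xi>"] by force
        then show ?thesis using mult[OF a c] s by simp
      qed
      then show ?thesis using s by (auto simp: M_def)
    qed
  qed
  moreover have "\<pi> c \<xi> \<in> M" if "c \<in> carrier A" "\<xi> \<in> M" for c \<xi>
  proof -
    have "\<pi> a (\<pi> d (\<pi> c \<xi>)) = (\<lambda>i. 0)" if d: "d \<in> carrier A" for d
    proof -
      have "d \<otimes>\<^bsub>A\<^esub> c \<in> carrier A" using d \<open>c \<in> carrier A\<close> by simp
      then have "\<pi> a (\<pi> (d \<otimes>\<^bsub>A\<^esub> c) \<xi>) = (\<lambda>i. 0)" "\<xi> \<in> l2 J"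
        using \<open>\<xi> \<in> M\<close> unfolding M_def by blast+
      then show ?thesis using mult[OF d \<open>c \<in> carrier A\<close>] by simp
    qed
    then show ?thesis using that in_l2 by (auto simp: M_def)
  qed
  ultimately have "M = {\<lambda>i. 0} \<or> M = l2 J"
    using irr unfolding irreducible_rep_def by blast
  moreover have "\<pi> b \<xi>0 \<in> M"
  proof -
    have "\<pi> a (\<pi> c (\<pi> b \<xi>0)) = (\<lambda>i. 0)" if c: "c \<in> carrier A" for c
    proof -
      have "\<pi> (a \<otimes>\<^bsub>A\<^esub> (c \<otimes>\<^bsub>A\<^esub> b)) \<xi>0 = (\<lambda>i. 0)"
        using ab[OF c] \<xi>0 by (auto simp: rep_kernel_def)
      then show ?thesis
        using a b c \<xi>0 by (simp add: mult)
    qed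
    then show ?thesis using in_l2[OF b] \<xi>0 by (auto simp: M_def)
  qed
  ultimately have M: "M = l2 J" using \<xi>0 by auto
  have star_a: "star A a \<in> carrier A" using a by (rule star_closed)
  have "\<pi> (star A a) \<xi> = (\<lambda>i. 0)" if \<xi>: "\<xi> \<in> l2 J" for \<xi>
  proof -
    have "l2_inner (\<pi> (star A a) \<xi>) (\<pi> (star A a) \<xi>) = l2_inner \<xi> (\<pi> a (\<pi> (star A a) \<xi>))"
      using rep a \<xi> in_l2[OF star_a \<xi>] by (simp add: hilbert_rep_def)
    also have "\<pi> a (\<pi> (star A a) \<xi>) = (\<lambda>i. 0)"
      using M \<xi> star_a by (auto simp: M_def)
    finally have "l2_norm (\<pi> (star A a) \<xi>) = 0"
      using l2_inner_self[OF in_l2[OF star_a \<xi>]] by (simp add: l2_inner_def)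
    then show ?thesis
      using l2_norm_eq_zero[OF in_l2[OF star_a \<xi>]] by blast
  qed
  note star_zero = this
  have "\<pi> a \<xi> = (\<lambda>i. 0)" if \<xi>: "\<xi> \<in> l2 J" for \<xi>
  proof -
    have "l2_inner (\<pi> (star A a) (\<pi> a \<xi>)) \<xi> = l2_inner (\<pi> a \<xi>) (\<pi> a \<xi>)"
      using rep a \<xi> in_l2[OF a \<xi>] by (simp add: hilbert_rep_def)
    then have "l2_norm (\<pi> a \<xi>) = 0"
      using star_zero[OF in_l2[OF a \<xi>]] l2_inner_self[OF in_l2[OF a \<xi>]]
      by (simp add: l2_inner_def)
    then show ?thesis
      using l2_norm_eq_zero[OF in_l2[OF a \<xi>]] by blast
  qed
  then show "a \<in> rep_kernel A J \<pi>" using a by (auto simp: rep_kernel_def)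
qed

lemma rep_kernel_mult:
  assumes "cstar_algebra A" "hilbert_rep A J \<pi>" "b \<in> carrier A" "c \<in> carrier A"
  shows "a \<in> rep_kernel A J \<pi> \<Longrightarrow> a \<otimes>\<^bsub>A\<^esub> (c \<otimes>\<^bsub>A\<^esub> b) \<in> rep_kernel A J \<pi>"
    "b \<in> rep_kernel A J \<pi> \<Longrightarrow> a \<in> carrier A \<Longrightarrow> a \<otimes>\<^bsub>A\<^esub> (c \<otimes>\<^bsub>A\<^esub> b) \<in> rep_kernel A J \<pi>"
proof -
  interpret cstar_algebra A by (rule assms)
  have mult: "\<pi> (a \<otimes>\<^bsub>A\<^esub> (c \<otimes>\<^bsub>A\<^esub> b)) \<xi> = \<pi> a (\<pi> c (\<pi> b \<xi>))" if "a \<in> carrier A" "\<xi> \<in> l2 J" for a \<xi>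
    using assms(2-4) that by (simp add: hilbert_rep_def)
  show "a \<otimes>\<^bsub>A\<^esub> (c \<otimes>\<^bsub>A\<^esub> b) \<in> rep_kernel A J \<pi>" if "a \<in> rep_kernel A J \<pi>"
    using that assms(3,4) hilbert_repD(2)[OF assms(2)] by (auto simp: rep_kernel_def mult)
  show "a \<otimes>\<^bsub>A\<^esub> (c \<otimes>\<^bsub>A\<^esub> b) \<in> rep_kernel A J \<pi>" if "b \<in> rep_kernel A J \<pi>" "a \<in> carrier A"
    using that assms(3,4) l2_linear_zero[OF hilbert_repD(1)[OF assms(2)]]
    by (auto simp: rep_kernel_def mult)
qed

lemma openin_Prim_topology:
  assumes A: "cstar_algebra A"
  shows "openin (Prim_topology A) W \<longleftrightarrow> (\<exists>I \<subseteq> carrier A. W = Prim A - prim_hull A I)"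
proof -
  interpret cstar_algebra A by (rule A)
  have "istopology (\<lambda>W. \<exists>I \<subseteq> carrier A. W = Prim A - prim_hull A I)"
    unfolding istopology_def
  proof (intro conjI allI impI)
    fix S T assume "\<exists>I \<subseteq> carrier A. S = Prim A - prim_hull A I" "\<exists>I \<subseteq> carrier A. T = Prim A - prim_hull A I"
    then obtain I K where I: "I \<subseteq> carrier A" "S = Prim A - prim_hull A I"
      and K: "K \<subseteq> carrier A" "T = Prim A - prim_hull A K"
      by auto
    define L where "L = {a \<otimes>\<^bsub>A\<^esub> (c \<otimes>\<^bsub>A\<^esub> b) | a b c. a \<in> I \<and> b \<in> K \<and> c \<in> carrier A}"
    have "L \<subseteq> P \<longleftrightarrow> I \<subseteq> P \<or> K \<subseteq> P" if PP: "P \<in> Prim A" for P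
    proof -
      obtain J :: "'a set" and \<pi> where irr: "irreducible_rep A J \<pi>" and P: "P = rep_kernel A J \<pi>"
        using PP by (auto simp: Prim_def irreps_def)
      then have rep: "hilbert_rep A J \<pi>" by (simp add: irreducible_rep_def)
      have "I \<subseteq> P \<or> K \<subseteq> P" if LP: "L \<subseteq> P"
      proof (rule ccontr)
        assume "\<not> (I \<subseteq> P \<or> K \<subseteq> P)"
        then obtain a b where "a \<in> I" "b \<in> K" "a \<notin> P" "b \<notin> P" by auto
        moreover have "a \<otimes>\<^bsub>A\<^esub> (c \<otimes>\<^bsub>A\<^esub> b) \<in> P" if "c \<in> carrier A" for c
          using LP that \<open>a \<in> I\<close> \<open>b \<in> K\<close> by (auto simp: L_def)
        ultimately show False
          using irreducible_rep_prime[OF A irr, of a b] I K unfolding P by blast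
      qed
      moreover have "L \<subseteq> P" if "I \<subseteq> P \<or> K \<subseteq> P"
      proof
        fix x assume "x \<in> L"
        then obtain a b c where "x = a \<otimes>\<^bsub>A\<^esub> (c \<otimes>\<^bsub>A\<^esub> b)" "a \<in> I" "b \<in> K" "c \<in> carrier A"
          by (auto simp: L_def)
        moreover from this have "a \<in> carrier A" "b \<in> carrier A"
          using I K by auto
        ultimately show "x \<in> P"
          using that rep_kernel_mult[OF A rep, of b c a] unfolding P by auto
      qed
      ultimately show ?thesis by blast
    qed
    then have "S \<inter> T = Prim A - prim_hull A L"
      using I K by (auto simp: prim_hull_def)
    moreover have "L \<subseteq> carrier A"
      using I K by (auto simp: L_def)
    ultimately show "\<exists>I \<subseteq> carrier A. S \<inter> T = Prim A - prim_hull A I" by blast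
  next
    fix \<K> assume *: "\<forall>W\<in>\<K>. \<exists>I \<subseteq> carrier A. W = Prim A - prim_hull A I"
    then obtain I where I: "\<And>W. W \<in> \<K> \<Longrightarrow> I W \<subseteq> carrier A \<and> W = Prim A - prim_hull A (I W)"
      by metis
    have "\<Union>\<K> = Prim A - prim_hull A (\<Union>W\<in>\<K>. I W)"
      using I unfolding prim_hull_def by blast
    moreover have "(\<Union>W\<in>\<K>. I W) \<subseteq> carrier A" using I by blast
    ultimately show "\<exists>I \<subseteq> carrier A. \<Union>\<K> = Prim A - prim_hull A I" by blast
  qed
  then show ?thesis by (simp add: Prim_topology_def)
qed

lemma topspace_Prim_topology:
  assumes A: "cstar_algebra A" shows "topspace (Prim_topology A) = Prim A"
proof -
  interpret cstar_algebra A by (rule A)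
  have ex: "\<exists>a\<in>carrier A. a \<notin> P" if "P \<in> Prim A" for P
    using that by (fastforce simp: Prim_def irreps_def irreducible_rep_def rep_kernel_def)
  have "openin (Prim_topology A) (Prim A)"
    unfolding openin_Prim_topology[OF A] using ex
    by (intro exI[of _ "carrier A"]) (auto simp: prim_hull_def)
  moreover have "topspace (Prim_topology A) \<subseteq> Prim A"
    using openin_topspace[of "Prim_topology A"] unfolding openin_Prim_topology[OF A] by auto
  ultimately show ?thesis
    by (meson openin_subset subset_antisym)
qed

text \<open>The closure of a set of primitive ideals is the hull of its kernel.\<close>

lemma closure_of_Prim_topology:
  assumes A: "cstar_algebra A" and S: "S \<subseteq> Prim A"
  shows "Prim_topology A closure_of S = prim_hull A (carrier A \<inter> \<Inter>S)"
proof -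
  interpret cstar_algebra A by (rule A)
  show ?thesis
  proof (rule closure_of_unique)
    show "S \<subseteq> prim_hull A (carrier A \<inter> \<Inter>S)"
      using S by (auto simp: prim_hull_def)
    show "closedin (Prim_topology A) (prim_hull A (carrier A \<inter> \<Inter>S))"
      unfolding closedin_def topspace_Prim_topology[OF A] openin_Prim_topology[OF A]
      by (auto simp: prim_hull_def)
    fix T assume T: "S \<subseteq> T" "closedin (Prim_topology A) T"
    then obtain I where I: "I \<subseteq> carrier A" "Prim A - T = Prim A - prim_hull A I" "T \<subseteq> Prim A"
      unfolding closedin_def topspace_Prim_topology[OF A] openin_Prim_topology[OF A] by auto
    then have hull: "T = prim_hull A I" by (auto simp: prim_hull_def)
    then have "I \<subseteq> carrier A \<inter> \<Inter>S"
      using I T by (auto simp: prim_hull_def)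
    then have "I \<subseteq> P" if "carrier A \<inter> \<Inter>S \<subseteq> P" for P
      using that by (rule subset_trans)
    then show "prim_hull A (carrier A \<inter> \<Inter>S) \<subseteq> T"
      by (simp add: hull prim_hull_def Collect_mono_iff)
  qed
qed

lemma openin_Spec_topology:
  assumes "cstar_algebra A"
  shows "openin (Spec_topology A) W \<longleftrightarrow>
    (\<exists>I \<subseteq> carrier A. W = {c \<in> Spec A. \<not> I \<subseteq> spec_kernel A c})"
proof -
  have "spec_kernel A c \<in> Prim A" if c: "c \<in> Spec A" for c
  proof -
    obtain J \<pi> where "(J, \<pi>) \<in> irreps A" "c = unitarily_equivalent A `` {(J, \<pi>)}"
      using c unfolding Spec_def by (metis quotientE surj_pair)
    then show ?thesis
      using spec_kernel_class unfolding Prim_def by blast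
  qed
  then have "spec_kernel A -` (Prim A - prim_hull A I) \<inter> Spec A
      = {c \<in> Spec A. \<not> I \<subseteq> spec_kernel A c}" for I
    by (auto simp: prim_hull_def)
  then show ?thesis
    unfolding Spec_topology_def openin_pullback_topology openin_Prim_topology[OF assms]
    by metis
qed


section \<open>Existence of the universal C*-algebra\<close>

lemma free_mon_zero_letters [simp]: "letters 0 = []"
  by (simp add: zero_free_mon_def)

lemma free_mon_plus_letters [simp]: "letters (v + w) = letters v @ letters w"
  by (simp add: plus_free_mon_def)

lemma free_mon_eqI: "letters v = letters w \<Longrightarrow> v = w"
  by (cases v; cases w) simp

lemma word_star_zero [simp]: "word_star 0 = 0"
  by (rule free_mon_eqI) (simp add: word_star_def)

lemma word_star_plus [simp]: "word_star (v + w) = word_star w + word_star v"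
  by (rule free_mon_eqI) (simp add: word_star_def)

lemma word_star_star [simp]: "word_star (word_star w) = w"
  by (rule free_mon_eqI) (auto simp: word_star_def rev_map[symmetric] o_def intro!: map_idI)

lemma inj_word_star: "inj word_star"
  by (metis injI word_star_star)

lemma lookup_poly_star:
  "Poly_Mapping.lookup (poly_star p) w = cnj (Poly_Mapping.lookup p (word_star w))"
  by (simp add: poly_star_def map_key.rep_eq[OF inj_word_star] map.rep_eq when_def)

lemma poly_star_add: "poly_star (p + q) = poly_star p + poly_star q"
  by (rule poly_mapping_eqI) (simp add: lookup_poly_star lookup_add)

lemma poly_star_uminus: "poly_star (- p) = - poly_star p"
  by (rule poly_mapping_eqI) (simp add: lookup_poly_star)

lemma poly_star_diff: "poly_star (p - q) = poly_star p - poly_star q"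
  by (rule poly_mapping_eqI) (simp add: lookup_poly_star lookup_minus)

lemma poly_star_star: "poly_star (poly_star p) = p"
  by (rule poly_mapping_eqI) (simp add: lookup_poly_star)

lemma poly_star_single: "poly_star (Poly_Mapping.single w c) = Poly_Mapping.single (word_star w) (cnj c)"
  by (rule poly_mapping_eqI) (auto simp: lookup_poly_star lookup_single when_def)

lemma star_poly_induct [case_names zero single add]:
  fixes p :: "'x star_poly"
  assumes "P 0" "\<And>w c. P (Poly_Mapping.single w c)" "\<And>p q. P p \<Longrightarrow> P q \<Longrightarrow> P (p + q)"
  shows "P p"
proof (induction p rule: update_induct)
  case const
  then show ?case using assms(1) by simp
next
  case (update p w c)
  have "Poly_Mapping.update w c p = p + Poly_Mapping.single w c"
    using update by (intro poly_mapping_eqI)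
      (auto simp: lookup_update lookup_add lookup_single when_def in_keys_iff)
  then show ?case using assms update by simp
qed

lemma poly_star_mult: "poly_star (p * q) = poly_star q * poly_star p"
proof (induction p rule: star_poly_induct)
  case (single v c)
  show ?case
    by (induction q rule: star_poly_induct)
      (simp_all add: poly_star_single mult_single poly_star_add distrib_left distrib_right mult.commute
        poly_star_single[of 0 0, simplified])
qed (simp_all add: poly_star_add distrib_left distrib_right poly_star_single[of 0 0, simplified])

lemma poly_scale_mult_left: "poly_scale c p * q = poly_scale c (p * q)"
  by (simp add: poly_scale_def mult.assoc)

lemma poly_scale_mult_right: "p * poly_scale c q = poly_scale c (p * q)"
proof -
  have "p * Poly_Mapping.single 0 c = Poly_Mapping.single 0 c * p"
    by (induction p rule: star_poly_induct)
      (simp_all add: mult_single distrib_left distrib_right mult.commute)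
  then show ?thesis by (simp add: poly_scale_def mult.assoc[symmetric])
qed

lemma poly_scale_add_right: "poly_scale c (p + q) = poly_scale c p + poly_scale c q"
  by (simp add: poly_scale_def distrib_left)

lemma poly_scale_diff_right: "poly_scale c (p - q) = poly_scale c p - poly_scale c q"
  by (simp add: poly_scale_def right_diff_distrib)

lemma poly_scale_add_left: "poly_scale (c + d) p = poly_scale c p + poly_scale d p"
  by (simp add: poly_scale_def single_add distrib_right)

lemma poly_scale_scale: "poly_scale c (poly_scale d p) = poly_scale (c * d) p"
  by (simp add: poly_scale_def mult_single mult.assoc[symmetric])

lemma poly_scale_one: "poly_scale 1 p = p"
  by (simp add: poly_scale_def)

lemma poly_scale_minus_one: "poly_scale (- 1) p = - p"
  by (simp add: poly_scale_def single_uminus)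

lemma poly_scale_zero: "poly_scale 0 p = 0"
  by (simp add: poly_scale_def)

lemma poly_star_scale: "poly_star (poly_scale c p) = poly_scale (cnj c) (poly_star p)"
proof -
  have "poly_star (poly_scale c p) = poly_star p * Poly_Mapping.single 0 (cnj c)"
    by (simp add: poly_scale_def poly_star_mult poly_star_single)
  also have "\<dots> = poly_star p * poly_scale (cnj c) 1"
    by (simp add: poly_scale_def)
  finally show ?thesis by (simp add: poly_scale_mult_right)
qed

lemma star_polys_zero: "0 \<in> star_polys X"
  by (simp add: star_polys_def)

lemma star_polys_one: "1 \<in> star_polys X"
  by (simp add: star_polys_def)

lemma star_polys_single: "fst ` set (letters w) \<subseteq> X \<Longrightarrow> Poly_Mapping.single w c \<in> star_polys X"
  by (simp add: star_polys_def)

lemma star_polys_gen: "x \<in> X \<Longrightarrow> poly_gen x \<in> star_polys X"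
  by (simp add: star_polys_def poly_gen_def)

lemma star_polys_add: "p \<in> star_polys X \<Longrightarrow> q \<in> star_polys X \<Longrightarrow> p + q \<in> star_polys X"
  using Poly_Mapping.keys_add[of p q] unfolding star_polys_def by blast

lemma star_polys_diff: "p \<in> star_polys X \<Longrightarrow> q \<in> star_polys X \<Longrightarrow> p - q \<in> star_polys X"
  using keys_diff[of p q] unfolding star_polys_def by blast

lemma star_polys_uminus: "p \<in> star_polys X \<Longrightarrow> - p \<in> star_polys X"
  using star_polys_diff[OF star_polys_zero, of p] by simp

lemma star_polys_mult:
  assumes "p \<in> star_polys X" "q \<in> star_polys X" shows "p * q \<in> star_polys X"
proof -
  have "fst ` set (letters w) \<subseteq> X" if w: "w \<in> Poly_Mapping.keys (p * q)" for w
  proof -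
    obtain u v where "u \<in> Poly_Mapping.keys p" "v \<in> Poly_Mapping.keys q" "w = u + v"
      using keys_mult[of p q] w by blast
    then show ?thesis using assms by (auto simp: star_polys_def image_Un)
  qed
  then show ?thesis by (simp add: star_polys_def)
qed

lemma star_polys_scale: "p \<in> star_polys X \<Longrightarrow> poly_scale c p \<in> star_polys X"
  unfolding poly_scale_def by (intro star_polys_mult star_polys_single) auto

lemma star_polys_star: "p \<in> star_polys X \<Longrightarrow> poly_star p \<in> star_polys X"
proof -
  assume p: "p \<in> star_polys X"
  have "fst ` set (letters w) \<subseteq> X" if "w \<in> Poly_Mapping.keys (poly_star p)" for w
  proof -
    have "word_star w \<in> Poly_Mapping.keys p"
      using that by (simp add: in_keys_iff lookup_poly_star)
    then have "fst ` set (letters (word_star w)) \<subseteq> X"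
      using p by (simp add: star_polys_def)
    moreover have "fst ` set (letters (word_star w)) = fst ` set (letters w)"
      by (force simp: word_star_def image_image split_beta)
    ultimately show ?thesis by simp
  qed
  then show ?thesis by (simp add: star_polys_def)
qed

lemmas star_polys_closed = star_polys_zero star_polys_one star_polys_gen star_polys_add
  star_polys_diff star_polys_uminus star_polys_mult star_polys_scale star_polys_star

locale bounded_relations =
  fixes X :: "'x set" and R :: "'x star_poly set"
  assumes relations: "R \<subseteq> star_polys X"
    and bounded: "a \<in> star_polys X \<Longrightarrow> bdd_above ((\<lambda>q. q a) ` cstar_seminorms X R)"
begin

abbreviation "S \<equiv> star_polys X"
abbreviation "N \<equiv> univ_nrm X R"

lemma zero_seminorm: "(\<lambda>a. 0) \<in> cstar_seminorms X R"
  by (simp add: cstar_seminorms_def)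

lemma seminorm_le: "q \<in> cstar_seminorms X R \<Longrightarrow> a \<in> S \<Longrightarrow> q a \<le> N a"
  unfolding univ_nrm_def by (rule cSUP_upper[OF _ bounded])

lemma univ_nrm_le: "(\<And>q. q \<in> cstar_seminorms X R \<Longrightarrow> q a \<le> c) \<Longrightarrow> N a \<le> c"
  unfolding univ_nrm_def using zero_seminorm by (intro cSUP_least) auto

lemma N_nonneg: "a \<in> S \<Longrightarrow> 0 \<le> N a"
  using seminorm_le[OF zero_seminorm] by simp

lemma N_add: assumes "a \<in> S" "b \<in> S" shows "N (a + b) \<le> N a + N b"
proof (rule univ_nrm_le)
  fix q assume q: "q \<in> cstar_seminorms X R"
  then have "q (a + b) \<le> q a + q b" using assms by (simp add: cstar_seminorms_def)
  then show "q (a + b) \<le> N a + N b" using seminorm_le[OF q] assms by (meson add_mono order_trans)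
qed

lemma N_mult: assumes "a \<in> S" "b \<in> S" shows "N (a * b) \<le> N a * N b"
proof (rule univ_nrm_le)
  fix q assume q: "q \<in> cstar_seminorms X R"
  then have "q (a * b) \<le> q a * q b" "0 \<le> q a" "0 \<le> q b" using assms by (auto simp: cstar_seminorms_def)
  then show "q (a * b) \<le> N a * N b"
    using seminorm_le[OF q] assms N_nonneg by (meson mult_mono order_trans)
qed

lemma N_scale_le: assumes "a \<in> S" shows "N (poly_scale c a) \<le> cmod c * N a"
proof (rule univ_nrm_le)
  fix q assume q: "q \<in> cstar_seminorms X R"
  then have "q (poly_scale c a) = cmod c * q a" using assms by (simp add: cstar_seminorms_def)
  then show "q (poly_scale c a) \<le> cmod c * N a" using seminorm_le[OF q] assms by (simp add: mult_left_mono)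
qed

lemma N_zero: "N 0 = 0"
  using N_scale_le[of 0 0] N_nonneg[of 0] by (simp add: poly_scale_zero star_polys_zero)

lemma N_scale: assumes "a \<in> S" shows "N (poly_scale c a) = cmod c * N a"
proof (cases "c = 0")
  case False
  have "N a = N (poly_scale (inverse c) (poly_scale c a))"
    using False by (simp add: poly_scale_scale poly_scale_one)
  also have "\<dots> \<le> cmod (inverse c) * N (poly_scale c a)"
    using assms by (intro N_scale_le star_polys_scale)
  finally have "cmod c * N a \<le> N (poly_scale c a)"
    using False by (simp add: norm_inverse pos_divide_le_eq divide_inverse_commute[symmetric] le_divide_eq pos_le_divide_eq mult.commute)
  then show ?thesis using N_scale_le[OF assms, of c] by simp
qed (simp add: poly_scale_zero N_zero)

lemma N_star_mult_self: assumes "a \<in> S" shows "N (poly_star a * a) = (N a)\<^sup>2"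
proof (rule antisym)
  show "N (poly_star a * a) \<le> (N a)\<^sup>2"
  proof (rule univ_nrm_le)
    fix q assume q: "q \<in> cstar_seminorms X R"
    then have "q (poly_star a * a) = (q a)\<^sup>2" "0 \<le> q a" using assms by (auto simp: cstar_seminorms_def)
    then show "q (poly_star a * a) \<le> (N a)\<^sup>2" using seminorm_le[OF q assms] by (simp add: power_mono)
  qed
  have "N a \<le> sqrt (N (poly_star a * a))"
  proof (rule univ_nrm_le)
    fix q assume q: "q \<in> cstar_seminorms X R"
    then have "q (poly_star a * a) = (q a)\<^sup>2" "0 \<le> q a" using assms by (auto simp: cstar_seminorms_def)
    moreover have "q (poly_star a * a) \<le> N (poly_star a * a)"
      using seminorm_le[OF q] assms by (simp add: star_polys_closed)
    ultimately show "q a \<le> sqrt (N (poly_star a * a))" by (simp add: real_le_rsqrt)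
  qed
  then show "(N a)\<^sup>2 \<le> N (poly_star a * a)"
    using assms N_nonneg[of a] N_nonneg[of "poly_star a * a"]
    by (metis real_sqrt_le_iff real_sqrt_unique star_polys_mult star_polys_star)
qed

lemma N_relation: "r \<in> R \<Longrightarrow> N r = 0"
  using relations N_nonneg[of r] univ_nrm_le[of r 0] by (fastforce simp: cstar_seminorms_def)

lemma N_star: assumes "a \<in> S" shows "N (poly_star a) = N a"
proof -
  have le: "N a \<le> N (poly_star a)" if a: "a \<in> S" for a
  proof (cases "N a = 0")
    case False
    have "N a * N a \<le> N (poly_star a) * N a"
      using N_star_mult_self[OF a] N_mult[of "poly_star a" a] a
      by (simp add: star_polys_star power2_eq_square)
    then show ?thesis using False N_nonneg[OF a] by simp
  qed (use N_nonneg[of "poly_star a"] a star_polys_star in auto)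
  show ?thesis using le[OF assms] le[OF star_polys_star[OF assms]] by (simp add: poly_star_star)
qed

lemma N_uminus: "a \<in> S \<Longrightarrow> N (- a) = N a"
  using N_scale[of a "- 1"] by (simp add: poly_scale_minus_one)

lemma N_diff_commute: "a \<in> S \<Longrightarrow> b \<in> S \<Longrightarrow> N (a - b) = N (b - a)"
  using N_uminus[of "a - b"] by (simp add: star_polys_diff)

lemma N_diff_triangle: "a \<in> S \<Longrightarrow> b \<in> S \<Longrightarrow> c \<in> S \<Longrightarrow> N (a - c) \<le> N (a - b) + N (b - c)"
  using N_add[of "a - b" "b - c"] by (simp add: star_polys_diff)

lemma N_abs_diff: assumes "a \<in> S" "b \<in> S" shows "\<bar>N a - N b\<bar> \<le> N (a - b)"
  using N_add[of "a - b" b] N_add[of "b - a" a] assms N_diff_commute[of a b]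
  by (simp add: star_polys_diff abs_le_iff)

abbreviation "C \<equiv> cauchy_polys X R"
abbreviation "cls \<equiv> seq_class X R"
abbreviation "U \<equiv> universal_cstar X R"

lemma C_in: "s \<in> C \<Longrightarrow> s n \<in> S"
  by (simp add: cauchy_polys_def)

lemma C_D: "s \<in> C \<Longrightarrow> 0 < e \<Longrightarrow> \<exists>K. \<forall>m\<ge>K. \<forall>n\<ge>K. N (s m - s n) < e"
  by (simp add: cauchy_polys_def)

lemma C_const: "a \<in> S \<Longrightarrow> (\<lambda>n. a) \<in> C"
  by (auto simp: cauchy_polys_def N_zero)

lemma C_lipschitz:
  assumes s: "s \<in> C" and t: "\<And>n. t n \<in> S" and K: "0 \<le> K"
    and le: "\<And>m n. N (t m - t n) \<le> K * N (s m - s n)"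
  shows "t \<in> C"
  unfolding cauchy_polys_def
proof (safe intro!: t)
  fix e :: real assume "0 < e"
  then obtain M where M: "\<And>m n. m \<ge> M \<Longrightarrow> n \<ge> M \<Longrightarrow> N (s m - s n) < e / (K + 1)"
    using C_D[OF s, of "e / (K + 1)"] K by auto
  have "N (t m - t n) < e" if "m \<ge> M" "n \<ge> M" for m n
  proof -
    have "N (t m - t n) \<le> K * N (s m - s n)" by (rule le)
    also have "\<dots> \<le> (K + 1) * N (s m - s n)"
      using N_nonneg[OF star_polys_diff[OF C_in[OF s] C_in[OF s]]] by (simp add: mult_right_mono)
    also have "\<dots> < e" using M[OF that] K by (simp add: field_simps)
    finally show ?thesis .
  qed
  then show "\<exists>M. \<forall>m\<ge>M. \<forall>n\<ge>M. N (t m - t n) < e" by blast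
qed

lemma C_bounded: assumes s: "s \<in> C" shows "\<exists>K>0. \<forall>n. N (s n) \<le> K"
proof -
  obtain M where M: "\<And>m n. m \<ge> M \<Longrightarrow> n \<ge> M \<Longrightarrow> N (s m - s n) < 1"
    using C_D[OF s, of 1] by auto
  define K where "K = (\<Sum>k\<le>M. N (s k)) + 1"
  have nn: "0 \<le> N (s k)" for k using N_nonneg C_in[OF s] by blast
  have 1: "N (s n) \<le> (\<Sum>k\<le>M. N (s k))" if "n \<le> M" for n
    using that nn by (intro member_le_sum) auto
  have "N (s n) \<le> K" for n
  proof (cases "n \<le> M")
    case True then show ?thesis using 1 by (fastforce simp: K_def)
  next
    case False
    have "N (s n) \<le> N (s n - s M) + N (s M)"
      using N_abs_diff[OF C_in[OF s, of n] C_in[OF s, of M]] by linarith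
    then show ?thesis using M[of n M] 1[of M] False by (simp add: K_def)
  qed
  moreover have "0 < K" using nn by (simp add: K_def sum_nonneg add_nonneg_pos)
  ultimately show ?thesis by blast
qed

lemma C_add: assumes s: "s \<in> C" and t: "t \<in> C" shows "(\<lambda>n. s n + t n) \<in> C"
  unfolding cauchy_polys_def
proof (safe intro!: star_polys_add C_in[OF s] C_in[OF t])
  fix e :: real assume "0 < e"
  then obtain M M' where M: "\<And>m n. m \<ge> M \<Longrightarrow> n \<ge> M \<Longrightarrow> N (s m - s n) < e / 2"
    and M': "\<And>m n. m \<ge> M' \<Longrightarrow> n \<ge> M' \<Longrightarrow> N (t m - t n) < e / 2"
    using C_D[OF s, of "e / 2"] C_D[OF t, of "e / 2"] by (metis half_gt_zero)
  have "N (s m + t m - (s n + t n)) < e" if "m \<ge> max M M'" "n \<ge> max M M'" for m n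
  proof -
    have "N ((s m - s n) + (t m - t n)) \<le> N (s m - s n) + N (t m - t n)"
      by (intro N_add star_polys_diff C_in[OF s] C_in[OF t])
    then show ?thesis using M[of m n] M'[of m n] that by (simp add: algebra_simps)
  qed
  then show "\<exists>M. \<forall>m\<ge>M. \<forall>n\<ge>M. N (s m + t m - (s n + t n)) < e" by blast
qed

lemma N_mult_diff:
  assumes "a \<in> S" "b \<in> S" "c \<in> S" "d \<in> S"
  shows "N (a * b - c * d) \<le> N a * N (b - d) + N (a - c) * N d"
proof -
  have "N (a * b - c * d) = N (a * (b - d) + (a - c) * d)" by (simp add: algebra_simps)
  also have "\<dots> \<le> N (a * (b - d)) + N ((a - c) * d)"
    using assms by (intro N_add star_polys_closed)
  also have "\<dots> \<le> N a * N (b - d) + N (a - c) * N d"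
    using assms by (intro add_mono N_mult star_polys_closed)
  finally show ?thesis .
qed

lemma C_mult: assumes s: "s \<in> C" and t: "t \<in> C" shows "(\<lambda>n. s n * t n) \<in> C"
  unfolding cauchy_polys_def
proof (safe intro!: star_polys_mult C_in[OF s] C_in[OF t])
  fix e :: real assume "0 < e"
  obtain K L where K: "0 < K" "\<And>n. N (s n) \<le> K" and L: "0 < L" "\<And>n. N (t n) \<le> L"
    using C_bounded[OF s] C_bounded[OF t] by blast
  obtain M M' where M: "\<And>m n. m \<ge> M \<Longrightarrow> n \<ge> M \<Longrightarrow> N (s m - s n) < e / (2 * L)"
    and M': "\<And>m n. m \<ge> M' \<Longrightarrow> n \<ge> M' \<Longrightarrow> N (t m - t n) < e / (2 * K)"
    using C_D[OF s, of "e / (2 * L)"] C_D[OF t, of "e / (2 * K)"] \<open>0 < e\<close> K(1) L(1)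
    by (metis divide_pos_pos mult_pos_pos zero_less_numeral)
  have "N (s m * t m - s n * t n) < e" if "m \<ge> max M M'" "n \<ge> max M M'" for m n
  proof -
    note in_S = C_in[OF s] C_in[OF t]
    have "N (s m * t m - s n * t n) \<le> N (s m) * N (t m - t n) + N (s m - s n) * N (t n)"
      by (intro N_mult_diff in_S)
    also have "\<dots> \<le> K * N (t m - t n) + N (s m - s n) * L"
      by (intro add_mono mult_mono order_refl K L N_nonneg star_polys_diff in_S less_imp_le)
    also have "\<dots> < e"
    proof -
      have "K * N (t m - t n) < e / 2" using M'[of m n] that K by (simp add: field_simps)
      moreover have "N (s m - s n) * L < e / 2" using M[of m n] that L by (simp add: field_simps)
      ultimately show ?thesis by simp
    qed
    finally show ?thesis .
  qed
  then show "\<exists>M. \<forall>m\<ge>M. \<forall>n\<ge>M. N (s m * t m - s n * t n) < e" by blast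
qed

lemma C_scale: assumes s: "s \<in> C" shows "(\<lambda>n. poly_scale c (s n)) \<in> C"
  using s
proof (rule C_lipschitz)
  show "N (poly_scale c (s m) - poly_scale c (s n)) \<le> cmod c * N (s m - s n)" for m n
    using N_scale[OF star_polys_diff[OF C_in[OF s] C_in[OF s]]] by (simp add: poly_scale_diff_right[symmetric])
qed (simp_all add: star_polys_scale C_in[OF s])

lemma C_uminus: assumes s: "s \<in> C" shows "(\<lambda>n. - s n) \<in> C"
  using C_scale[OF s, of "- 1"] by (simp add: poly_scale_minus_one)

lemma C_diff: assumes "s \<in> C" "t \<in> C" shows "(\<lambda>n. s n - t n) \<in> C"
  using C_add[OF assms(1) C_uminus[OF assms(2)]] by simp

lemma C_star: assumes s: "s \<in> C" shows "(\<lambda>n. poly_star (s n)) \<in> C"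
  using s
proof (rule C_lipschitz)
  show "N (poly_star (s m) - poly_star (s n)) \<le> 1 * N (s m - s n)" for m n
    using N_star[OF star_polys_diff[OF C_in[OF s] C_in[OF s]]] by (simp add: poly_star_diff[symmetric])
qed (simp_all add: star_polys_star C_in[OF s])

lemma null_rel_iff:
  "(s, t) \<in> null_rel X R \<longleftrightarrow> s \<in> C \<and> t \<in> C \<and> (\<lambda>n. N (s n - t n)) \<longlonglongrightarrow> 0"
  by (simp add: null_rel_def)

lemma null_relI:
  assumes "s \<in> C" "t \<in> C" "\<And>n. N (s n - t n) \<le> f n" "f \<longlonglongrightarrow> 0"
  shows "(s, t) \<in> null_rel X R"
  unfolding null_rel_iff
proof (intro conjI assms(1,2))
  show "(\<lambda>n. N (s n - t n)) \<longlonglongrightarrow> 0"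
    using assms N_nonneg[OF star_polys_diff[OF C_in[OF assms(1)] C_in[OF assms(2)]]]
    by (intro tendsto_sandwich[OF _ _ tendsto_const assms(4)]) auto
qed

lemma equiv_null_rel: "equiv C (null_rel X R)"
proof (rule equivI)
  show "null_rel X R \<subseteq> C \<times> C" by (auto simp: null_rel_def)
  show "refl_on C (null_rel X R)" by (rule refl_onI) (simp add: null_rel_iff N_zero)
  show "sym (null_rel X R)"
    by (rule symI) (auto simp: null_rel_iff N_diff_commute[OF C_in C_in])
  show "trans (null_rel X R)"
  proof (rule transI)
    fix s t u assume st: "(s, t) \<in> null_rel X R" and tu: "(t, u) \<in> null_rel X R"
    then have "s \<in> C" "t \<in> C" "u \<in> C" by (auto simp: null_rel_iff)
    moreover have "(\<lambda>n. N (s n - t n) + N (t n - u n)) \<longlonglongrightarrow> 0"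
      using st tu tendsto_add[of _ 0 _ _ 0] by (auto simp: null_rel_iff)
    ultimately show "(s, u) \<in> null_rel X R"
      by (intro null_relI[where f = "\<lambda>n. N (s n - t n) + N (t n - u n)"] N_diff_triangle C_in)
  qed
qed

lemma carrier_U: "carrier U = C // null_rel X R"
  by (simp add: universal_cstar_def)

lemma cls_in: "s \<in> C \<Longrightarrow> cls s \<in> carrier U"
  by (simp add: carrier_U seq_class_def quotientI)

lemma cls_cases: assumes "P \<in> carrier U" obtains s where "s \<in> C" "P = cls s"
  using assms by (auto simp: carrier_U seq_class_def elim: quotientE)

lemma cls_eq_iff: "s \<in> C \<Longrightarrow> t \<in> C \<Longrightarrow> cls s = cls t \<longleftrightarrow> (\<lambda>n. N (s n - t n)) \<longlonglongrightarrow> 0"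
  using eq_equiv_class_iff[OF equiv_null_rel, of s t] by (simp add: seq_class_def null_rel_iff)

lemma cls_eqI: "(s, t) \<in> null_rel X R \<Longrightarrow> cls s = cls t"
  by (simp add: null_rel_iff cls_eq_iff)

lemma cls_add: assumes s: "s \<in> C" and t: "t \<in> C"
  shows "cls s \<oplus>\<^bsub>U\<^esub> cls t = cls (\<lambda>n. s n + t n)"
proof -
  have "congruent2 (null_rel X R) (null_rel X R) (\<lambda>s t. cls (\<lambda>n. s n + t n))"
  proof (rule congruent2I')
    fix s s' t t' assume a: "(s, s') \<in> null_rel X R" "(t, t') \<in> null_rel X R"
    then have in_C: "s \<in> C" "s' \<in> C" "t \<in> C" "t' \<in> C" by (auto simp: null_rel_iff)
    show "cls (\<lambda>n. s n + t n) = cls (\<lambda>n. s' n + t' n)"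
    proof (rule cls_eqI, rule null_relI)
      show "N (s n + t n - (s' n + t' n)) \<le> N (s n - s' n) + N (t n - t' n)" for n
        using N_add[of "s n - s' n" "t n - t' n"] in_C by (simp add: star_polys_diff C_in algebra_simps)
      show "(\<lambda>n. N (s n - s' n) + N (t n - t' n)) \<longlonglongrightarrow> 0"
        using a tendsto_add[of _ 0 _ _ 0] by (auto simp: null_rel_iff)
    qed (intro C_add in_C)+
  qed
  from UN_equiv_class2[OF equiv_null_rel equiv_null_rel this s t] show ?thesis
    by (simp add: universal_cstar_def seq_class_def)
qed

lemma cls_mult: assumes s: "s \<in> C" and t: "t \<in> C"
  shows "cls s \<otimes>\<^bsub>U\<^esub> cls t = cls (\<lambda>n. s n * t n)"
proof -
  have "congruent2 (null_rel X R) (null_rel X R) (\<lambda>s t. cls (\<lambda>n. s n * t n))"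
  proof (rule congruent2I')
    fix s s' t t' assume a: "(s, s') \<in> null_rel X R" "(t, t') \<in> null_rel X R"
    then have in_C: "s \<in> C" "s' \<in> C" "t \<in> C" "t' \<in> C" by (auto simp: null_rel_iff)
    obtain K where K: "\<And>n. N (s n) \<le> K" using C_bounded[OF in_C(1)] by blast
    obtain L where L: "\<And>n. N (t' n) \<le> L" using C_bounded[OF in_C(4)] by blast
    show "cls (\<lambda>n. s n * t n) = cls (\<lambda>n. s' n * t' n)"
    proof (rule cls_eqI, rule null_relI)
      fix n
      have "N (s n * t n - s' n * t' n) \<le> N (s n) * N (t n - t' n) + N (s n - s' n) * N (t' n)"
        by (intro N_mult_diff C_in in_C)
      also have "\<dots> \<le> K * N (t n - t' n) + N (s n - s' n) * L"
        by (intro add_mono mult_left_mono mult_right_mono K L N_nonneg star_polys_diff C_in in_C)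
      finally show "N (s n * t n - s' n * t' n) \<le> K * N (t n - t' n) + N (s n - s' n) * L" .
    next
      have "(\<lambda>n. K * N (t n - t' n) + N (s n - s' n) * L) \<longlonglongrightarrow> K * 0 + 0 * L"
        using a by (intro tendsto_intros) (auto simp: null_rel_iff)
      then show "(\<lambda>n. K * N (t n - t' n) + N (s n - s' n) * L) \<longlonglongrightarrow> 0" by simp
    qed (intro C_mult in_C)+
  qed
  from UN_equiv_class2[OF equiv_null_rel equiv_null_rel this s t] show ?thesis
    by (simp add: universal_cstar_def seq_class_def)
qed

lemma cls_scale: assumes s: "s \<in> C" shows "scale U c (cls s) = cls (\<lambda>n. poly_scale c (s n))"
proof -
  have "(\<lambda>s. cls (\<lambda>n. poly_scale c (s n))) respects null_rel X R"
  proof (rule congruentI)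
    fix s t assume a: "(s, t) \<in> null_rel X R"
    then have in_C: "s \<in> C" "t \<in> C" by (auto simp: null_rel_iff)
    show "cls (\<lambda>n. poly_scale c (s n)) = cls (\<lambda>n. poly_scale c (t n))"
    proof (rule cls_eqI, rule null_relI)
      show "N (poly_scale c (s n) - poly_scale c (t n)) \<le> cmod c * N (s n - t n)" for n
        using in_C by (simp add: poly_scale_diff_right[symmetric] N_scale star_polys_diff C_in)
      show "(\<lambda>n. cmod c * N (s n - t n)) \<longlonglongrightarrow> 0"
        using a tendsto_mult_right_zero by (auto simp: null_rel_iff)
    qed (intro C_scale in_C)+
  qed
  from UN_equiv_class[OF equiv_null_rel this s] show ?thesis
    by (simp add: universal_cstar_def seq_class_def)
qed

lemma cls_star: assumes s: "s \<in> C" shows "star U (cls s) = cls (\<lambda>n. poly_star (s n))"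
proof -
  have "(\<lambda>s. cls (\<lambda>n. poly_star (s n))) respects null_rel X R"
  proof (rule congruentI)
    fix s t assume a: "(s, t) \<in> null_rel X R"
    then have in_C: "s \<in> C" "t \<in> C" by (auto simp: null_rel_iff)
    show "cls (\<lambda>n. poly_star (s n)) = cls (\<lambda>n. poly_star (t n))"
    proof (rule cls_eqI, rule null_relI)
      show "N (poly_star (s n) - poly_star (t n)) \<le> N (s n - t n)" for n
        using in_C by (simp add: poly_star_diff[symmetric] N_star star_polys_diff C_in)
      show "(\<lambda>n. N (s n - t n)) \<longlonglongrightarrow> 0" using a by (auto simp: null_rel_iff)
    qed (intro C_star in_C)+
  qed
  from UN_equiv_class[OF equiv_null_rel this s] show ?thesis
    by (simp add: universal_cstar_def seq_class_def)
qed

lemma N_convergent: assumes s: "s \<in> C" shows "convergent (\<lambda>n. N (s n))"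
proof (rule Cauchy_convergent, rule metric_CauchyI)
  fix e :: real assume "0 < e"
  then obtain M where "\<And>m n. m \<ge> M \<Longrightarrow> n \<ge> M \<Longrightarrow> N (s m - s n) < e"
    using C_D[OF s] by blast
  then show "\<exists>M. \<forall>m\<ge>M. \<forall>n\<ge>M. dist (N (s m)) (N (s n)) < e"
    using N_abs_diff[OF C_in[OF s] C_in[OF s]] by (metis dist_real_def order_le_less_trans)
qed

lemma cls_nrm_lim: assumes s: "s \<in> C" shows "nrm U (cls s) = lim (\<lambda>n. N (s n))"
proof -
  have "(\<lambda>s. {lim (\<lambda>n. N (s n))}) respects null_rel X R"
  proof (rule congruentI)
    fix s t assume a: "(s, t) \<in> null_rel X R"
    then have in_C: "s \<in> C" "t \<in> C" by (auto simp: null_rel_iff)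
    have "(\<lambda>n. N (s n) - N (t n)) \<longlonglongrightarrow> 0"
    proof (rule tendsto_rabs_zero_cancel, rule tendsto_sandwich[OF _ _ tendsto_const])
      show "(\<lambda>n. N (s n - t n)) \<longlonglongrightarrow> 0" using a by (simp add: null_rel_iff)
      show "\<forall>\<^sub>F n in sequentially. \<bar>N (s n) - N (t n)\<bar> \<le> N (s n - t n)"
        by (intro always_eventually allI N_abs_diff C_in in_C)
    qed simp
    moreover have "(\<lambda>n. N (s n) - N (t n)) \<longlonglongrightarrow> lim (\<lambda>n. N (s n)) - lim (\<lambda>n. N (t n))"
      using N_convergent in_C by (intro tendsto_diff) (simp_all add: convergent_LIMSEQ_iff)
    ultimately show "{lim (\<lambda>n. N (s n))} = {lim (\<lambda>n. N (t n))}"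
      using LIMSEQ_unique by fastforce
  qed
  from UN_equiv_class[OF equiv_null_rel this s] show ?thesis
    by (simp add: universal_cstar_def seq_class_def)
qed

lemma cls_nrm: "s \<in> C \<Longrightarrow> (\<lambda>n. N (s n)) \<longlonglongrightarrow> nrm U (cls s)"
  using N_convergent[of s] by (simp add: cls_nrm_lim convergent_LIMSEQ_iff)

lemma U_one: "one U = cls (\<lambda>n. 1)" and U_zero: "zero U = cls (\<lambda>n. 0)"
  by (simp_all add: universal_cstar_def)

lemmas C_closed = C_const[OF star_polys_zero] C_const[OF star_polys_one] C_add C_mult C_scale
  C_star C_uminus C_diff

lemma U_ring: "ring U"
proof (rule ringI)
  show "abelian_group U"
  proof (rule abelian_groupI)
    fix P assume "P \<in> carrier U"
    then obtain s where s: "s \<in> C" "P = cls s" by (rule cls_cases)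
    then show "\<exists>Q\<in>carrier U. Q \<oplus>\<^bsub>U\<^esub> P = \<zero>\<^bsub>U\<^esub>"
      by (intro bexI[of _ "cls (\<lambda>n. - s n)"]) (simp_all add: cls_add C_closed cls_in U_zero)
  qed (auto elim!: cls_cases simp: cls_add C_closed cls_in U_zero add_ac)
  show "monoid U"
    by (rule monoidI) (auto elim!: cls_cases simp: cls_mult C_closed cls_in U_one mult.assoc)
qed (auto elim!: cls_cases simp: cls_mult cls_add C_closed distrib_left distrib_right)

lemma cls_minus: assumes s: "s \<in> C" and t: "t \<in> C"
  shows "cls s \<ominus>\<^bsub>U\<^esub> cls t = cls (\<lambda>n. s n - t n)"
proof -
  interpret ring U by (rule U_ring)
  have "cls (\<lambda>n. - t n) \<oplus>\<^bsub>U\<^esub> cls t = \<zero>\<^bsub>U\<^esub>"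
    using t by (simp add: cls_add C_closed U_zero)
  then have "\<ominus>\<^bsub>U\<^esub> cls t = cls (\<lambda>n. - t n)"
    using t by (intro minus_equality cls_in) (simp_all add: C_closed)
  then show ?thesis using s t by (simp add: a_minus_def cls_add C_closed)
qed

lemma U_complete:
  assumes P: "\<And>n. P n \<in> carrier U"
    and cauchy: "\<And>e. 0 < e \<Longrightarrow> \<exists>K. \<forall>m\<ge>K. \<forall>n\<ge>K. nrm U (P m \<ominus>\<^bsub>U\<^esub> P n) < e"
  shows "\<exists>Q\<in>carrier U. (\<lambda>n. nrm U (P n \<ominus>\<^bsub>U\<^esub> Q)) \<longlonglongrightarrow> 0"
proof -
  have "\<exists>s. s \<in> C \<and> P n = cls s" for n
    by (rule cls_cases[OF P[of n]]) blast
  then obtain s where s: "\<And>n. s n \<in> C" and P_eq: "\<And>n. P n = cls (s n)" by metis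
  define \<epsilon> :: "nat \<Rightarrow> real" where "\<epsilon> n = 1 / real (Suc n)" for n
  have \<epsilon>: "0 < \<epsilon> n" for n by (simp add: \<epsilon>_def)
  have \<epsilon>_lim: "\<epsilon> \<longlonglongrightarrow> 0" unfolding \<epsilon>_def using LIMSEQ_inverse_real_of_nat by (simp add: inverse_eq_divide)
  have "\<exists>k. \<forall>i\<ge>k. \<forall>j\<ge>k. N (s n i - s n j) < \<epsilon> n" for n using C_D[OF s \<epsilon>] by blast
  then obtain k where k: "\<And>n i j. i \<ge> k n \<Longrightarrow> j \<ge> k n \<Longrightarrow> N (s n i - s n j) < \<epsilon> n" by metis
  define t where "t n = s n (k n)" for n
  have in_S: "s n i \<in> S" "t n \<in> S" for n i using C_in[OF s] by (auto simp: t_def)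
  have nrm_lim: "(\<lambda>i. N (s m i - s n i)) \<longlonglongrightarrow> nrm U (P m \<ominus>\<^bsub>U\<^esub> P n)" for m n
    using cls_nrm[OF C_diff[OF s s]] by (simp add: P_eq cls_minus s)
  have t_C: "t \<in> C"
    unfolding cauchy_polys_def
  proof (safe intro!: in_S)
    fix e :: real assume e: "0 < e"
    obtain K where K: "\<And>m n. m \<ge> K \<Longrightarrow> n \<ge> K \<Longrightarrow> nrm U (P m \<ominus>\<^bsub>U\<^esub> P n) < e / 3"
      using cauchy[of "e / 3"] e by auto
    obtain L where L: "\<And>n. n \<ge> L \<Longrightarrow> \<epsilon> n < e / 3"
      using order_tendstoD(2)[OF \<epsilon>_lim, of "e / 3"] e by (auto simp: eventually_sequentially)
    have "N (t m - t n) < e" if mn: "m \<ge> max K L" "n \<ge> max K L" for m n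
    proof -
      have "\<forall>\<^sub>F i in sequentially. N (s m i - s n i) < e / 3"
        using order_tendstoD(2)[OF nrm_lim K] mn by simp
      then obtain i0 where i0: "\<And>i. i \<ge> i0 \<Longrightarrow> N (s m i - s n i) < e / 3"
        by (auto simp: eventually_sequentially)
      define i where "i = max i0 (max (k m) (k n))"
      have "N (t m - s m i) < \<epsilon> m" "N (s n i - t n) < \<epsilon> n" "N (s m i - s n i) < e / 3"
        using k i0 by (simp_all add: t_def i_def)
      moreover have "N (t m - t n) \<le> N (t m - s m i) + N (s m i - t n)"
        by (intro N_diff_triangle in_S)
      moreover have "N (s m i - t n) \<le> N (s m i - s n i) + N (s n i - t n)"
        by (intro N_diff_triangle in_S)
      ultimately show ?thesis using L[of m] L[of n] mn by simp
    qed
    then show "\<exists>K. \<forall>m\<ge>K. \<forall>n\<ge>K. N (t m - t n) < e" by blast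
  qed
  have "(\<lambda>n. nrm U (P n \<ominus>\<^bsub>U\<^esub> cls t)) \<longlonglongrightarrow> 0"
  proof (rule LIMSEQ_I)
    fix e :: real assume e: "0 < e"
    obtain K where K: "\<And>m n. m \<ge> K \<Longrightarrow> n \<ge> K \<Longrightarrow> N (t m - t n) < e / 3"
      using C_D[OF t_C, of "e / 3"] e by auto
    obtain L where L: "\<And>n. n \<ge> L \<Longrightarrow> \<epsilon> n < e / 3"
      using order_tendstoD(2)[OF \<epsilon>_lim, of "e / 3"] e by (auto simp: eventually_sequentially)
    have "norm (nrm U (P n \<ominus>\<^bsub>U\<^esub> cls t) - 0) < e" if n: "n \<ge> max K L" for n
    proof -
      have lim: "(\<lambda>i. N (s n i - t i)) \<longlonglongrightarrow> nrm U (P n \<ominus>\<^bsub>U\<^esub> cls t)"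
        using cls_nrm[OF C_diff[OF s t_C]] by (simp add: P_eq cls_minus s t_C)
      have "N (s n i - t i) \<le> 2 * e / 3" if i: "i \<ge> max (k n) K" for i
      proof -
        have "N (s n i - t i) \<le> N (s n i - t n) + N (t n - t i)" by (intro N_diff_triangle in_S)
        moreover have "N (s n i - t n) < \<epsilon> n" using k i by (simp add: t_def)
        moreover have "N (t n - t i) < e / 3" using K i n by simp
        ultimately show ?thesis using L[of n] n by simp
      qed
      then have "nrm U (P n \<ominus>\<^bsub>U\<^esub> cls t) \<le> 2 * e / 3"
        using lim by (intro LIMSEQ_le_const2) (blast intro: exI[of _ "max (k n) K"])+
      moreover have "0 \<le> nrm U (P n \<ominus>\<^bsub>U\<^esub> cls t)"
        using lim by (rule LIMSEQ_le_const) (auto intro!: N_nonneg star_polys_diff in_S)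
      ultimately show ?thesis using e by simp
    qed
    then show "\<exists>K. \<forall>n\<ge>K. norm (nrm U (P n \<ominus>\<^bsub>U\<^esub> cls t) - 0) < e" by blast
  qed
  then show ?thesis using cls_in[OF t_C] by blast
qed

theorem cstar_algebra_U: "cstar_algebra U"
proof (intro cstar_algebra.intro U_ring cstar_algebra_axioms.intro)
  fix P assume "P \<in> carrier U"
  then obtain s where s: "s \<in> C" "P = cls s" by (rule cls_cases)
  note s_nrm = cls_nrm[OF s(1)]
  show "0 \<le> nrm U P"
    unfolding s by (rule LIMSEQ_le_const[OF s_nrm]) (auto intro!: N_nonneg C_in s)
  show "nrm U P = 0 \<longleftrightarrow> P = \<zero>\<^bsub>U\<^esub>"
  proof -
    have "P = \<zero>\<^bsub>U\<^esub> \<longleftrightarrow> (\<lambda>n. N (s n)) \<longlonglongrightarrow> 0"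
      using cls_eq_iff[OF s(1) C_const[OF star_polys_zero]] by (simp add: s U_zero)
    then show ?thesis using s_nrm LIMSEQ_unique s by metis
  qed
  show "nrm U (scale U c P) = cmod c * nrm U P" for c
  proof -
    have "(\<lambda>n. N (poly_scale c (s n))) \<longlonglongrightarrow> cmod c * nrm U P"
      using tendsto_mult_left[OF s_nrm] by (simp add: N_scale C_in s)
    then show ?thesis
      using cls_nrm[OF C_scale[OF s(1)]] LIMSEQ_unique s by (metis cls_scale)
  qed
  show "nrm U (star U P \<otimes>\<^bsub>U\<^esub> P) = (nrm U P)\<^sup>2"
  proof -
    have "(\<lambda>n. N (poly_star (s n) * s n)) \<longlonglongrightarrow> (nrm U P)\<^sup>2"
      using tendsto_power[OF s_nrm] by (simp add: N_star_mult_self C_in s)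
    moreover have "(\<lambda>n. N (poly_star (s n) * s n)) \<longlonglongrightarrow> nrm U (star U P \<otimes>\<^bsub>U\<^esub> P)"
      using cls_nrm[OF C_mult[OF C_star[OF s(1)] s(1)]] by (simp add: s cls_star cls_mult C_closed)
    ultimately show ?thesis using LIMSEQ_unique by blast
  qed
  fix Q assume "Q \<in> carrier U"
  then obtain t where t: "t \<in> C" "Q = cls t" by (rule cls_cases)
  note t_nrm = cls_nrm[OF t(1)]
  have "nrm U (cls (\<lambda>n. s n + t n)) \<le> nrm U (cls s) + nrm U (cls t)"
    using cls_nrm[OF C_add[OF s(1) t(1)]] tendsto_add[OF s_nrm t_nrm]
    by (rule LIMSEQ_le) (auto intro!: N_add C_in s t)
  then show "nrm U (P \<oplus>\<^bsub>U\<^esub> Q) \<le> nrm U P + nrm U Q"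
    by (simp add: s t cls_add)
  have "nrm U (cls (\<lambda>n. s n * t n)) \<le> nrm U (cls s) * nrm U (cls t)"
    using cls_nrm[OF C_mult[OF s(1) t(1)]] tendsto_mult[OF s_nrm t_nrm]
    by (rule LIMSEQ_le) (auto intro!: N_mult C_in s t)
  then show "nrm U (P \<otimes>\<^bsub>U\<^esub> Q) \<le> nrm U P * nrm U Q"
    by (simp add: s t cls_mult)
next
  fix P :: "nat \<Rightarrow> (nat \<Rightarrow> 'x star_poly) set"
  assume "\<And>n. P n \<in> carrier U"
    "\<And>e. 0 < e \<Longrightarrow> \<exists>K. \<forall>m\<ge>K. \<forall>n\<ge>K. nrm U (P m \<ominus>\<^bsub>U\<^esub> P n) < e"
  then show "\<exists>Q\<in>carrier U. (\<lambda>n. nrm U (P n \<ominus>\<^bsub>U\<^esub> Q)) \<longlonglongrightarrow> 0"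
    by (rule U_complete)
qed (auto elim!: cls_cases simp: cls_scale cls_add cls_mult cls_star C_closed cls_in
  poly_scale_add_right poly_scale_add_left poly_scale_scale poly_scale_one poly_scale_mult_left
  poly_scale_mult_right poly_star_star poly_star_add poly_star_scale poly_star_mult)

end


lemma bip_relations_star_polys:
  "bip_relations G \<subseteq> star_polys (left G \<union> right G)"
proof -
  have "(\<Sum>x\<in>A. poly_gen x) \<in> star_polys X" if "A \<subseteq> X" for A X :: "'a set"
    using that by (induction A rule: infinite_finite_induct) (auto intro: star_polys_closed)
  then show ?thesis
    by (auto simp: bip_relations_def intro!: star_polys_closed)
qed

lemma bip_seminorm_gen:
  assumes q: "q \<in> cstar_seminorms (left G \<union> right G) (bip_relations G)" and x: "x \<in> left G \<union> right G"
  shows "q (poly_gen x) \<le> 1" "q (poly_star (poly_gen x)) \<le> 1"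
proof -
  let ?S = "star_polys (left G \<union> right G)" and ?p = "poly_gen x"
  have p: "?p \<in> ?S" "poly_star ?p \<in> ?S"
    using x by (auto intro: star_polys_closed)
  have add: "q (a + b) \<le> q a + q b" and mult: "q (a * b) \<le> q a * q b" and nn: "0 \<le> q a"
    if "a \<in> ?S" "b \<in> ?S" for a b
    using q that by (auto simp: cstar_seminorms_def)
  have minus: "q (- a) = q a" if "a \<in> ?S" for a
  proof -
    have "q (poly_scale (- 1) a) = cmod (- 1) * q a"
      using q that unfolding cstar_seminorms_def by blast
    then show ?thesis by (simp add: poly_scale_minus_one)
  qed
  have cong: "q a = q b" if a: "a \<in> ?S" "b \<in> ?S" and 0: "q (a - b) = 0" for a b
  proof (rule antisym)
    show "q a \<le> q b" using add[of "a - b" b] a 0 by (simp add: star_polys_diff)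
    show "q b \<le> q a"
      using add[of "- (a - b)" a] minus[of "a - b"] a 0 by (simp add: star_polys_diff star_polys_uminus)
  qed
  have rel: "q r = 0" if "r \<in> bip_relations G" for r
    using q that by (simp add: cstar_seminorms_def)
  have r1: "q (?p - poly_star ?p) = 0" and r2: "q (?p * ?p - ?p) = 0"
    using x by (auto intro!: rel simp: bip_relations_def)
  have "q (poly_star ?p * ?p - ?p * ?p) \<le> q (poly_star ?p - ?p) * q ?p"
    using mult[of "poly_star ?p - ?p" ?p] p by (simp add: star_polys_diff left_diff_distrib)
  also have "\<dots> = 0"
    using minus[of "?p - poly_star ?p"] r1 p by (simp add: star_polys_diff)
  finally have "q (poly_star ?p * ?p - ?p * ?p) = 0"
    using nn[of "poly_star ?p * ?p - ?p * ?p" 0] p by (simp add: star_polys_closed)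
  then have "q (poly_star ?p * ?p) = q (?p * ?p)"
    using p by (intro cong) (auto intro: star_polys_closed)
  also have "\<dots> = q ?p"
    using p r2 by (intro cong) (auto intro: star_polys_closed)
  also have "q (poly_star ?p * ?p) = (q ?p)\<^sup>2"
    using q p by (simp add: cstar_seminorms_def)
  finally show le: "q ?p \<le> 1" by (auto simp: power2_eq_square)
  have "q ?p = q (poly_star ?p)"
    using p r1 by (rule cong)
  then show "q (poly_star ?p) \<le> 1" using le by simp
qed

lemma poly_star_gen: "poly_star (poly_gen x) = Poly_Mapping.single (Word [(x, True)]) 1"
  by (simp add: poly_gen_def poly_star_single word_star_def)

lemma single_eq_poly_scale: "Poly_Mapping.single w c = poly_scale c (Poly_Mapping.single w 1)"
  by (simp add: poly_scale_def mult_single)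

lemma bip_seminorm_word:
  assumes q: "q \<in> cstar_seminorms (left G \<union> right G) (bip_relations G)"
    and ls: "fst ` set ls \<subseteq> left G \<union> right G"
  shows "q (Poly_Mapping.single (Word ls) 1) \<le> 1"
  using ls
proof (induction ls)
  case Nil
  have "poly_star 1 * 1 = (1 :: 'a star_poly)"
    using poly_star_single[of 0 1] by simp
  then have "q 1 = (q 1)\<^sup>2"
    using q star_polys_one unfolding cstar_seminorms_def by fastforce
  then have "q 1 \<le> 1" by (auto simp: power2_eq_square)
  moreover have "(Poly_Mapping.single (Word []) 1 :: 'a star_poly) = 1"
    by (metis single_one zero_free_mon_def)
  ultimately show ?case by simp
next
  case (Cons l ls)
  obtain x b where l: "l = (x, b)" by fastforce
  then have x: "x \<in> left G \<union> right G" using Cons by auto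
  have eq: "Poly_Mapping.single (Word (l # ls)) (1::complex)
      = Poly_Mapping.single (Word [l]) 1 * Poly_Mapping.single (Word ls) 1"
    by (simp add: mult_single plus_free_mon_def)
  have "q (Poly_Mapping.single (Word [l]) 1) \<le> 1"
    using bip_seminorm_gen[OF q x] by (cases b) (simp_all add: l poly_star_gen[symmetric] poly_gen_def[symmetric])
  moreover have "q (Poly_Mapping.single (Word ls) 1) \<le> 1" using Cons by simp
  moreover have in_S: "Poly_Mapping.single (Word [l]) 1 \<in> star_polys (left G \<union> right G)"
    "Poly_Mapping.single (Word ls) 1 \<in> star_polys (left G \<union> right G)"
    using Cons.prems by (simp_all add: star_polys_single)
  moreover have "q (a * b) \<le> q a * q b" "0 \<le> q a"
    if "a \<in> star_polys (left G \<union> right G)" "b \<in> star_polys (left G \<union> right G)" for a b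
    using q that by (auto simp: cstar_seminorms_def)
  ultimately show ?case
    unfolding eq by (meson mult_le_one order_trans)
qed

lemma bip_bounded_relations: "bounded_relations (left G \<union> right G) (bip_relations G)"
proof
  let ?X = "left G \<union> right G" and ?Q = "cstar_seminorms (left G \<union> right G) (bip_relations G)"
  show "bip_relations G \<subseteq> star_polys ?X" by (rule bip_relations_star_polys)
  fix a assume a: "a \<in> star_polys ?X"
  have "q a \<le> (\<Sum>w\<in>Poly_Mapping.keys a. cmod (Poly_Mapping.lookup a w))" if q: "q \<in> ?Q" for q
  proof -
    let ?f = "\<lambda>w. Poly_Mapping.single w (Poly_Mapping.lookup a w)"
    have *: "(\<Sum>w\<in>A. ?f w) \<in> star_polys ?X \<and> q (\<Sum>w\<in>A. ?f w) \<le> (\<Sum>w\<in>A. cmod (Poly_Mapping.lookup a w))"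
      if "finite A" "A \<subseteq> Poly_Mapping.keys a" for A
      using that
    proof (induction A rule: finite_induct)
      case empty
      have "q (poly_scale 0 0) = 0"
        using q star_polys_zero unfolding cstar_seminorms_def by fastforce
      then show ?case by (simp add: poly_scale_zero star_polys_zero)
    next
      case (insert w A)
      have w: "fst ` set (letters w) \<subseteq> ?X"
        using insert a by (auto simp: star_polys_def)
      have "q (?f w) = cmod (Poly_Mapping.lookup a w) * q (Poly_Mapping.single w 1)"
        using q star_polys_single[OF w] unfolding single_eq_poly_scale[of w "Poly_Mapping.lookup a w"]
        by (simp add: cstar_seminorms_def)
      also have "\<dots> \<le> cmod (Poly_Mapping.lookup a w)"
        using bip_seminorm_word[OF q w] by (simp add: mult_left_le)
      finally have "q (?f w) \<le> cmod (Poly_Mapping.lookup a w)" .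
      moreover have "q (?f w + (\<Sum>w\<in>A. ?f w)) \<le> q (?f w) + q (\<Sum>w\<in>A. ?f w)"
        using q star_polys_single[OF w] insert by (simp add: cstar_seminorms_def)
      ultimately show ?case
        using insert star_polys_single[OF w] by (auto intro!: star_polys_add)
    qed
    have "(\<Sum>w\<in>Poly_Mapping.keys a. ?f w) = a"
      by (rule poly_mapping_eqI) (auto simp: lookup_sum lookup_single when_def in_keys_iff)
    then show ?thesis using *[of "Poly_Mapping.keys a"] by simp
  qed
  then show "bdd_above ((\<lambda>q. q a) ` ?Q)" by (rule bdd_aboveI2)
qed

theorem cstar_algebra_bip_cstar: "cstar_algebra (bip_cstar G)"
  unfolding bip_cstar_def by (rule bounded_relations.cstar_algebra_U[OF bip_bounded_relations])


section \<open>The universal property\<close>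

context cstar_algebra
begin

lemma scale_zero: assumes "a \<in> carrier A" shows "scale A 0 a = \<zero>"
  using nrm_scale[OF assms, of 0] nrm_eq_zero[OF scale_closed[OF assms]] by simp

lemma nrm_zero: "nrm A \<zero> = 0"
  using nrm_eq_zero[of \<zero>] by simp

lemma scale_zero_right: "scale A c \<zero> = \<zero>"
  using nrm_scale[of \<zero> c] nrm_eq_zero[OF scale_closed[of \<zero> c]] by (simp add: nrm_zero)

lemma star_zero: "star A \<zero> = \<zero>"
  using star_scale[of \<zero> 0] by (simp add: scale_zero star_closed)

lemma star_one: "star A \<one> = \<one>"
  using star_mult[of "star A \<one>" \<one>] by (simp add: star_closed star_star)

lemma scale_minus_one: assumes "a \<in> carrier A" shows "scale A (- 1) a = \<ominus> a"
proof -
  have "scale A (- 1) a \<oplus> a = \<zero>"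
    using scale_add_left[OF assms, of "- 1" 1] assms by (simp add: scale_one scale_zero)
  then show ?thesis using assms by (simp add: minus_equality scale_closed)
qed

lemma nrm_uminus: "a \<in> carrier A \<Longrightarrow> nrm A (\<ominus> a) = nrm A a"
  using nrm_scale[of a "- 1"] by (simp add: scale_minus_one)

lemma star_uminus: "a \<in> carrier A \<Longrightarrow> star A (\<ominus> a) = \<ominus> star A a"
  using star_scale[of a "- 1"] by (simp add: scale_minus_one star_closed)

lemma scale_uminus: "a \<in> carrier A \<Longrightarrow> scale A c (\<ominus> a) = \<ominus> scale A c a"
  using scale_scale[of a c "- 1"] scale_scale[of a "- 1" c]
  by (simp add: scale_minus_one scale_closed)

lemma star_minus: "a \<in> carrier A \<Longrightarrow> b \<in> carrier A \<Longrightarrow> star A (a \<ominus> b) = star A a \<ominus> star A b"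
  by (simp add: a_minus_def star_add star_uminus)

lemma scale_minus: "a \<in> carrier A \<Longrightarrow> b \<in> carrier A \<Longrightarrow> scale A c (a \<ominus> b) = scale A c a \<ominus> scale A c b"
  by (simp add: a_minus_def scale_add_right scale_uminus)

lemma nrm_star: assumes "a \<in> carrier A" shows "nrm A (star A a) = nrm A a"
proof -
  have le: "nrm A a \<le> nrm A (star A a)" if a: "a \<in> carrier A" for a
  proof (cases "nrm A a = 0")
    case False
    have "nrm A a * nrm A a \<le> nrm A (star A a) * nrm A a"
      using cstar_identity[OF a] nrm_mult[of "star A a" a] a by (simp add: star_closed power2_eq_square)
    then show ?thesis using False nrm_nonneg[OF a] by simp
  qed (use nrm_nonneg[of "star A a"] a star_closed in auto)
  show ?thesis using le[OF assms] le[OF star_closed[OF assms]] by (simp add: star_star assms)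
qed

lemma nrm_minus_commute:
  assumes "a \<in> carrier A" "b \<in> carrier A" shows "nrm A (a \<ominus> b) = nrm A (b \<ominus> a)"
proof -
  have "\<ominus> (a \<ominus> b) = b \<ominus> a" using assms by (simp add: a_minus_def minus_add a_comm)
  then show ?thesis using nrm_uminus[of "a \<ominus> b"] assms by simp
qed

lemma minus_split:
  assumes "a \<in> carrier A" "b \<in> carrier A" "c \<in> carrier A" shows "a \<ominus> c = (a \<ominus> b) \<oplus> (b \<ominus> c)"
  using assms by (simp add: a_minus_def a_assoc r_neg1)

lemma nrm_minus_triangle:
  assumes "a \<in> carrier A" "b \<in> carrier A" "c \<in> carrier A"
  shows "nrm A (a \<ominus> c) \<le> nrm A (a \<ominus> b) + nrm A (b \<ominus> c)"
  using nrm_triangle[of "a \<ominus> b" "b \<ominus> c"] minus_split[OF assms] assms by simp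

lemma nrm_minus_add:
  assumes "a \<in> carrier A" "b \<in> carrier A" "c \<in> carrier A" "d \<in> carrier A"
  shows "nrm A ((a \<oplus> b) \<ominus> (c \<oplus> d)) \<le> nrm A (a \<ominus> c) + nrm A (b \<ominus> d)"
proof -
  have "(a \<oplus> b) \<ominus> (c \<oplus> d) = (a \<ominus> c) \<oplus> (b \<ominus> d)"
    using assms by (simp add: a_minus_def minus_add a_ac)
  then show ?thesis using nrm_triangle[of "a \<ominus> c" "b \<ominus> d"] assms by simp
qed

lemma nrm_minus_mult:
  assumes "a \<in> carrier A" "b \<in> carrier A" "c \<in> carrier A" "d \<in> carrier A"
  shows "nrm A ((a \<otimes> b) \<ominus> (c \<otimes> d)) \<le> nrm A a * nrm A (b \<ominus> d) + nrm A (a \<ominus> c) * nrm A d"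
proof -
  have "a \<otimes> (b \<ominus> d) = (a \<otimes> b) \<ominus> (a \<otimes> d)" "(a \<ominus> c) \<otimes> d = (a \<otimes> d) \<ominus> (c \<otimes> d)"
    using assms by (simp_all add: a_minus_def r_distr l_distr r_minus l_minus)
  then have "(a \<otimes> b) \<ominus> (c \<otimes> d) = a \<otimes> (b \<ominus> d) \<oplus> (a \<ominus> c) \<otimes> d"
    using minus_split[of "a \<otimes> b" "a \<otimes> d" "c \<otimes> d"] assms by simp
  then have "nrm A ((a \<otimes> b) \<ominus> (c \<otimes> d)) \<le> nrm A (a \<otimes> (b \<ominus> d)) + nrm A ((a \<ominus> c) \<otimes> d)"
    using nrm_triangle assms by simp
  also have "\<dots> \<le> nrm A a * nrm A (b \<ominus> d) + nrm A (a \<ominus> c) * nrm A d"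
    using assms by (intro add_mono nrm_mult) auto
  finally show ?thesis .
qed

lemma minus_zero_iff: "a \<in> carrier A \<Longrightarrow> b \<in> carrier A \<Longrightarrow> a \<ominus> b = \<zero> \<longleftrightarrow> a = b"
  by (metis a_minus_def add.inv_closed minus_equality minus_minus r_neg)

end


locale evaluation = cstar_algebra B for B :: "('b, 'n) star_algebra_scheme" (structure) +
  fixes e :: "'x \<Rightarrow> 'b"
  assumes e_closed: "e x \<in> carrier B"
begin

definition letter_eval :: "'x \<times> bool \<Rightarrow> 'b" where
  "letter_eval l = (if snd l then star B (e (fst l)) else e (fst l))"

definition word_eval :: "('x \<times> bool) free_mon \<Rightarrow> 'b" where
  "word_eval w = foldr (\<lambda>l b. letter_eval l \<otimes> b) (letters w) \<one>"

definition poly_eval :: "'x star_poly \<Rightarrow> 'b" where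
  "poly_eval p = (\<Oplus>w\<in>Poly_Mapping.keys p. scale B (Poly_Mapping.lookup p w) (word_eval w))"

lemma letter_eval_closed: "letter_eval l \<in> carrier B"
  by (simp add: letter_eval_def e_closed star_closed)

lemma foldr_letter_eval_closed: "foldr (\<lambda>l b. letter_eval l \<otimes> b) ls \<one> \<in> carrier B"
  by (induction ls) (simp_all add: letter_eval_closed)

lemma word_eval_closed: "word_eval w \<in> carrier B"
  by (simp add: word_eval_def foldr_letter_eval_closed)

lemma foldr_letter_eval_append:
  "foldr (\<lambda>l b. letter_eval l \<otimes> b) (ls @ ks) \<one>
    = foldr (\<lambda>l b. letter_eval l \<otimes> b) ls \<one> \<otimes> foldr (\<lambda>l b. letter_eval l \<otimes> b) ks \<one>"
proof (induction ls)
  case Nil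
  then show ?case using foldr_letter_eval_closed[of ks] by simp
next
  case (Cons l ls)
  then show ?case
    by (simp add: m_assoc letter_eval_closed foldr_letter_eval_closed del: foldr_append)
qed

lemma word_eval_plus: "word_eval (v + w) = word_eval v \<otimes> word_eval w"
  unfolding word_eval_def free_mon_plus_letters by (rule foldr_letter_eval_append)

lemma word_eval_zero: "word_eval 0 = \<one>"
  by (simp add: word_eval_def)

lemma word_eval_letter: "word_eval (Word [l]) = letter_eval l"
  by (simp add: word_eval_def letter_eval_closed)

lemma word_eval_star: "word_eval (word_star w) = star B (word_eval w)"
proof -
  have "word_eval (word_star (Word ls)) = star B (word_eval (Word ls))" for ls
  proof (induction ls)
    case Nil
    then show ?case by (simp add: word_eval_def word_star_def star_one)
  next
    case (Cons l ls)
    have eq: "Word (l # ls) = Word [l] + Word ls"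
      by (rule free_mon_eqI) simp
    have "word_eval (word_star (Word [l])) = star B (word_eval (Word [l]))"
      by (cases l) (simp add: word_star_def word_eval_letter letter_eval_def star_star e_closed)
    then show ?case
      unfolding eq word_star_plus word_eval_plus
      using Cons by (simp add: star_mult word_eval_closed)
  qed
  then show ?thesis by (metis free_mon.exhaust)
qed

lemma poly_eval_superset:
  assumes "finite K" "Poly_Mapping.keys p \<subseteq> K"
  shows "poly_eval p = (\<Oplus>w\<in>K. scale B (Poly_Mapping.lookup p w) (word_eval w))"
  unfolding poly_eval_def
  using assms by (intro add.finprod_mono_neutral_cong_left)
    (auto simp: in_keys_iff scale_zero word_eval_closed scale_closed)

lemma poly_eval_closed: "poly_eval p \<in> carrier B"
  unfolding poly_eval_def by (rule finsum_closed) (auto simp: scale_closed word_eval_closed)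

lemma poly_eval_add: "poly_eval (p + q) = poly_eval p \<oplus> poly_eval q"
proof -
  let ?K = "Poly_Mapping.keys p \<union> Poly_Mapping.keys q"
  have "poly_eval (p + q) = (\<Oplus>w\<in>?K. scale B (Poly_Mapping.lookup (p + q) w) (word_eval w))"
    using Poly_Mapping.keys_add[of p q] by (intro poly_eval_superset) auto
  also have "\<dots> = (\<Oplus>w\<in>?K. scale B (Poly_Mapping.lookup p w) (word_eval w)
      \<oplus> scale B (Poly_Mapping.lookup q w) (word_eval w))"
    by (simp add: lookup_add scale_add_left word_eval_closed)
  also have "\<dots> = (\<Oplus>w\<in>?K. scale B (Poly_Mapping.lookup p w) (word_eval w))
      \<oplus> (\<Oplus>w\<in>?K. scale B (Poly_Mapping.lookup q w) (word_eval w))"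
    by (rule finsum_addf) (auto simp: scale_closed word_eval_closed)
  also have "\<dots> = poly_eval p \<oplus> poly_eval q"
    using poly_eval_superset[of ?K p] poly_eval_superset[of ?K q] by simp
  finally show ?thesis .
qed

lemma poly_eval_single: "poly_eval (Poly_Mapping.single w c) = scale B c (word_eval w)"
  using poly_eval_superset[of "{w}" "Poly_Mapping.single w c"]
  by (simp add: scale_closed word_eval_closed)

lemma poly_eval_zero: "poly_eval 0 = \<zero>"
  using poly_eval_single[of 0 0] by (simp add: scale_zero word_eval_closed)

lemma poly_eval_mult: "poly_eval (p * q) = poly_eval p \<otimes> poly_eval q"
proof (induction p rule: star_poly_induct)
  case (single v c)
  show ?case
    by (induction q rule: star_poly_induct)
      (simp_all add: poly_eval_zero mult_single poly_eval_single word_eval_plus poly_eval_add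
        distrib_left r_distr poly_eval_closed scale_closed word_eval_closed scale_mult_left
        scale_mult_right scale_scale mult.commute)
qed (simp_all add: poly_eval_zero poly_eval_add distrib_right l_distr poly_eval_closed)

lemma poly_eval_scale: "poly_eval (poly_scale c p) = scale B c (poly_eval p)"
  by (simp add: poly_scale_def poly_eval_mult poly_eval_single word_eval_zero scale_mult_left
      poly_eval_closed)

lemma poly_eval_star: "poly_eval (poly_star p) = star B (poly_eval p)"
  by (induction p rule: star_poly_induct)
    (simp_all add: poly_star_single[of 0 0, simplified] poly_eval_zero star_zero poly_star_single
      poly_eval_single star_scale word_eval_closed word_eval_star poly_star_add poly_eval_add star_add
      poly_eval_closed)

lemma poly_eval_one: "poly_eval 1 = \<one>"
  using poly_eval_single[of 0 1] by (simp add: word_eval_zero scale_one)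

lemma poly_eval_diff: "poly_eval (p - q) = poly_eval p \<ominus> poly_eval q"
proof -
  have "poly_eval (- q) = \<ominus> poly_eval q"
    using poly_eval_scale[of "- 1" q] by (simp add: scale_minus_one poly_eval_closed poly_scale_minus_one)
  then show ?thesis using poly_eval_add[of p "- q"] by (simp add: a_minus_def)
qed

lemma poly_eval_gen: "poly_eval (poly_gen x) = e x"
  by (simp add: poly_gen_def poly_eval_single word_eval_letter letter_eval_def e_closed scale_one)

lemma poly_eval_sum: "poly_eval (\<Sum>x\<in>K. poly_gen x) = (\<Oplus>x\<in>K. e x)"
  by (induction K rule: infinite_finite_induct)
    (simp_all add: poly_eval_zero poly_eval_add poly_eval_gen e_closed)

end


locale universal_map = bounded_relations X R + evaluation B e
  for X :: "'x set" and R and B :: "('b, 'n) star_algebra_scheme" (structure) and e :: "'x \<Rightarrow> 'b" +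
  assumes eval_relations: "r \<in> R \<Longrightarrow> poly_eval r = \<zero>"
begin

lemma poly_eval_nrm_le: assumes "a \<in> star_polys X" shows "nrm B (poly_eval a) \<le> univ_nrm X R a"
proof (rule seminorm_le[OF _ assms])
  show "(\<lambda>a. nrm B (poly_eval a)) \<in> cstar_seminorms X R"
    unfolding cstar_seminorms_def
    by (auto simp: poly_eval_closed nrm_nonneg poly_eval_add nrm_triangle poly_eval_scale nrm_scale
        poly_eval_mult nrm_mult poly_eval_star cstar_identity eval_relations nrm_zero)
qed

definition eval_lim :: "(nat \<Rightarrow> 'x star_poly) \<Rightarrow> 'b \<Rightarrow> bool" where
  "eval_lim s b \<longleftrightarrow> b \<in> carrier B \<and> (\<lambda>n. nrm B (poly_eval (s n) \<ominus> b)) \<longlonglongrightarrow> 0"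

lemma eval_limI:
  assumes "b \<in> carrier B" "\<And>n. nrm B (poly_eval (s n) \<ominus> b) \<le> f n" "f \<longlonglongrightarrow> 0"
  shows "eval_lim s b"
  unfolding eval_lim_def
  using assms by (intro conjI tendsto_sandwich[OF _ _ tendsto_const assms(3)])
    (auto intro!: always_eventually nrm_nonneg poly_eval_closed)

lemma eval_lim_ex: assumes s: "s \<in> cauchy_polys X R" shows "\<exists>b. eval_lim s b"
proof -
  have "\<exists>b\<in>carrier B. (\<lambda>n. nrm B (poly_eval (s n) \<ominus> b)) \<longlonglongrightarrow> 0"
  proof (rule complete)
    fix \<epsilon> :: real assume "0 < \<epsilon>"
    then obtain K where K: "\<And>m n. m \<ge> K \<Longrightarrow> n \<ge> K \<Longrightarrow> univ_nrm X R (s m - s n) < \<epsilon>"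
      using C_D[OF s] by blast
    have "nrm B (poly_eval (s m) \<ominus> poly_eval (s n)) \<le> univ_nrm X R (s m - s n)" for m n
      using poly_eval_nrm_le[OF star_polys_diff[OF C_in[OF s] C_in[OF s]]] by (simp add: poly_eval_diff)
    then show "\<exists>K. \<forall>m\<ge>K. \<forall>n\<ge>K. nrm B (poly_eval (s m) \<ominus> poly_eval (s n)) < \<epsilon>"
      using K by (meson order_le_less_trans)
  qed (rule poly_eval_closed)
  then show ?thesis by (auto simp: eval_lim_def)
qed

lemma eval_lim_null:
  assumes st: "(s, t) \<in> null_rel X R" and b: "eval_lim s b" shows "eval_lim t b"
proof (rule eval_limI)
  have in_C: "s \<in> cauchy_polys X R" "t \<in> cauchy_polys X R" using st by (auto simp: null_rel_iff)
  show b_in: "b \<in> carrier B" using b by (simp add: eval_lim_def)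
  fix n
  have "nrm B (poly_eval (t n) \<ominus> b)
      \<le> nrm B (poly_eval (t n) \<ominus> poly_eval (s n)) + nrm B (poly_eval (s n) \<ominus> b)"
    by (intro nrm_minus_triangle poly_eval_closed b_in)
  moreover have "nrm B (poly_eval (t n) \<ominus> poly_eval (s n)) \<le> univ_nrm X R (s n - t n)"
    using poly_eval_nrm_le[OF star_polys_diff[OF C_in[OF in_C(1)] C_in[OF in_C(2)]]]
    by (simp add: poly_eval_diff nrm_minus_commute poly_eval_closed)
  ultimately show "nrm B (poly_eval (t n) \<ominus> b) \<le> univ_nrm X R (s n - t n) + nrm B (poly_eval (s n) \<ominus> b)"
    by linarith
next
  show "(\<lambda>n. univ_nrm X R (s n - t n) + nrm B (poly_eval (s n) \<ominus> b)) \<longlonglongrightarrow> 0"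
    using st b tendsto_add[of _ 0 _ _ 0] by (auto simp: null_rel_iff eval_lim_def)
qed

lemma eval_lim_unique: assumes "eval_lim s b" "eval_lim s c" shows "b = c"
proof -
  have in_B: "b \<in> carrier B" "c \<in> carrier B" using assms by (auto simp: eval_lim_def)
  have "(\<lambda>n. nrm B (poly_eval (s n) \<ominus> b) + nrm B (poly_eval (s n) \<ominus> c)) \<longlonglongrightarrow> 0"
    using assms tendsto_add[of _ 0 _ _ 0] by (auto simp: eval_lim_def)
  moreover have "nrm B (b \<ominus> c) \<le> nrm B (poly_eval (s n) \<ominus> b) + nrm B (poly_eval (s n) \<ominus> c)" for n
    using nrm_minus_triangle[OF in_B(1) poly_eval_closed in_B(2), of "s n"]
      nrm_minus_commute[OF in_B(1) poly_eval_closed, of "s n"] by simp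
  ultimately have "nrm B (b \<ominus> c) \<le> 0"
    by (intro LIMSEQ_le_const) auto
  then have "b \<ominus> c = \<zero>"
    using nrm_eq_zero[of "b \<ominus> c"] nrm_nonneg[of "b \<ominus> c"] in_B by simp
  then show ?thesis using in_B by (simp add: minus_zero_iff)
qed

lemma eval_lim_const: "eval_lim (\<lambda>n. a) (poly_eval a)"
  by (rule eval_limI[where f = "\<lambda>n. 0"]) (simp_all add: poly_eval_closed minus_zero_iff nrm_zero
      minus_zero_iff[THEN iffD2])

lemma eval_lim_add: assumes "eval_lim s b" "eval_lim t c" shows "eval_lim (\<lambda>n. s n + t n) (b \<oplus> c)"
proof (rule eval_limI)
  have in_B: "b \<in> carrier B" "c \<in> carrier B" using assms by (auto simp: eval_lim_def)
  then show "b \<oplus> c \<in> carrier B" by simp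
  show "nrm B (poly_eval (s n + t n) \<ominus> (b \<oplus> c))
      \<le> nrm B (poly_eval (s n) \<ominus> b) + nrm B (poly_eval (t n) \<ominus> c)" for n
    unfolding poly_eval_add by (intro nrm_minus_add poly_eval_closed in_B)
  show "(\<lambda>n. nrm B (poly_eval (s n) \<ominus> b) + nrm B (poly_eval (t n) \<ominus> c)) \<longlonglongrightarrow> 0"
    using assms tendsto_add[of _ 0 _ _ 0] by (auto simp: eval_lim_def)
qed

lemma eval_lim_mult:
  assumes s: "s \<in> cauchy_polys X R" and "eval_lim s b" "eval_lim t c"
  shows "eval_lim (\<lambda>n. s n * t n) (b \<otimes> c)"
proof -
  have in_B: "b \<in> carrier B" "c \<in> carrier B" using assms by (auto simp: eval_lim_def)
  obtain K where K: "\<And>n. univ_nrm X R (s n) \<le> K" using C_bounded[OF s] by blast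
  have sK: "nrm B (poly_eval (s n)) \<le> K" for n
    using poly_eval_nrm_le[OF C_in[OF s, of n]] K[of n] by linarith
  let ?f = "\<lambda>n. K * nrm B (poly_eval (t n) \<ominus> c) + nrm B (poly_eval (s n) \<ominus> b) * nrm B c"
  show ?thesis
  proof (rule eval_limI)
    show "b \<otimes> c \<in> carrier B" using in_B by simp
    fix n
    have "nrm B (poly_eval (s n * t n) \<ominus> (b \<otimes> c))
        \<le> nrm B (poly_eval (s n)) * nrm B (poly_eval (t n) \<ominus> c) + nrm B (poly_eval (s n) \<ominus> b) * nrm B c"
      unfolding poly_eval_mult by (intro nrm_minus_mult poly_eval_closed in_B)
    also have "\<dots> \<le> ?f n"
      using sK in_B by (intro add_right_mono mult_right_mono nrm_nonneg) (auto simp: poly_eval_closed)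
    finally show "nrm B (poly_eval (s n * t n) \<ominus> (b \<otimes> c)) \<le> ?f n" .
  next
    have "?f \<longlonglongrightarrow> K * 0 + 0 * nrm B c"
      using assms by (intro tendsto_intros) (auto simp: eval_lim_def)
    then show "?f \<longlonglongrightarrow> 0" by simp
  qed
qed

lemma eval_lim_scale: assumes "eval_lim s b" shows "eval_lim (\<lambda>n. poly_scale c (s n)) (scale B c b)"
proof (rule eval_limI)
  have in_B: "b \<in> carrier B" using assms by (auto simp: eval_lim_def)
  then show "scale B c b \<in> carrier B" by (rule scale_closed)
  show "nrm B (poly_eval (poly_scale c (s n)) \<ominus> scale B c b) \<le> cmod c * nrm B (poly_eval (s n) \<ominus> b)" for n
    using in_B by (simp add: poly_eval_scale scale_minus[symmetric] poly_eval_closed nrm_scale)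
  show "(\<lambda>n. cmod c * nrm B (poly_eval (s n) \<ominus> b)) \<longlonglongrightarrow> 0"
    using assms tendsto_mult_right_zero by (auto simp: eval_lim_def)
qed

lemma eval_lim_star: assumes "eval_lim s b" shows "eval_lim (\<lambda>n. poly_star (s n)) (star B b)"
proof (rule eval_limI)
  have in_B: "b \<in> carrier B" using assms by (auto simp: eval_lim_def)
  then show "star B b \<in> carrier B" by (rule star_closed)
  show "nrm B (poly_eval (poly_star (s n)) \<ominus> star B b) \<le> nrm B (poly_eval (s n) \<ominus> b)" for n
    using in_B by (simp add: poly_eval_star star_minus[symmetric] poly_eval_closed nrm_star)
  show "(\<lambda>n. nrm B (poly_eval (s n) \<ominus> b)) \<longlonglongrightarrow> 0"
    using assms by (auto simp: eval_lim_def)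
qed

definition univ_map :: "(nat \<Rightarrow> 'x star_poly) set \<Rightarrow> 'b" where
  "univ_map P = (THE b. \<exists>s\<in>cauchy_polys X R. P = seq_class X R s \<and> eval_lim s b)"

lemma univ_map_eq:
  assumes s: "s \<in> cauchy_polys X R" and b: "eval_lim s b"
  shows "univ_map (seq_class X R s) = b"
  unfolding univ_map_def
proof (rule the_equality)
  show "\<exists>t\<in>cauchy_polys X R. seq_class X R s = seq_class X R t \<and> eval_lim t b" using s b by blast
  fix c assume "\<exists>t\<in>cauchy_polys X R. seq_class X R s = seq_class X R t \<and> eval_lim t c"
  then obtain t where t: "t \<in> cauchy_polys X R" "seq_class X R s = seq_class X R t" "eval_lim t c"
    by blast
  then have "(s, t) \<in> null_rel X R"
    using s by (simp add: null_rel_iff cls_eq_iff)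
  then show "c = b" using eval_lim_null b t(3) eval_lim_unique by blast
qed

lemma univ_map_star_hom: "univ_map \<in> star_hom (universal_cstar X R) B"
proof -
  note C_ops = C_closed
  have ex: "\<exists>s b. s \<in> cauchy_polys X R \<and> P = seq_class X R s \<and> eval_lim s b \<and> b \<in> carrier B \<and> univ_map P = b"
    if P: "P \<in> carrier (universal_cstar X R)" for P
  proof -
    obtain s where s: "s \<in> cauchy_polys X R" "P = seq_class X R s" using cls_cases[OF P] by blast
    obtain b where "eval_lim s b" using eval_lim_ex[OF s(1)] by blast
    then show ?thesis using s univ_map_eq by (auto simp: eval_lim_def)
  qed
  show ?thesis
    unfolding star_hom_def
  proof (intro CollectI conjI ballI allI)
    show "univ_map \<in> carrier (universal_cstar X R) \<rightarrow> carrier B"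
      using ex by (metis Pi_I)
    fix P assume "P \<in> carrier (universal_cstar X R)"
    then obtain s b where s: "s \<in> cauchy_polys X R" "P = seq_class X R s" "eval_lim s b" "univ_map P = b"
      using ex by metis
    show "univ_map (scale (universal_cstar X R) c P) = scale B c (univ_map P)" for c
      using univ_map_eq[OF C_scale[OF s(1)] eval_lim_scale[OF s(3)]] s by (simp add: cls_scale)
    show "univ_map (star (universal_cstar X R) P) = star B (univ_map P)"
      using univ_map_eq[OF C_star[OF s(1)] eval_lim_star[OF s(3)]] s by (simp add: cls_star)
    fix Q assume "Q \<in> carrier (universal_cstar X R)"
    then obtain t c where t: "t \<in> cauchy_polys X R" "Q = seq_class X R t" "eval_lim t c" "univ_map Q = c"
      using ex by metis
    show "univ_map (P \<oplus>\<^bsub>universal_cstar X R\<^esub> Q) = univ_map P \<oplus> univ_map Q"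
      using univ_map_eq[OF C_add[OF s(1) t(1)] eval_lim_add[OF s(3) t(3)]] s t by (simp add: cls_add)
    show "univ_map (P \<otimes>\<^bsub>universal_cstar X R\<^esub> Q) = univ_map P \<otimes> univ_map Q"
      using univ_map_eq[OF C_mult[OF s(1) t(1)] eval_lim_mult[OF s(1) s(3) t(3)]] s t
      by (simp add: cls_mult)
  qed
qed

lemma univ_map_gen: "x \<in> X \<Longrightarrow> univ_map (univ_gen X R x) = e x"
  using univ_map_eq[OF C_const[OF star_polys_gen] eval_lim_const] by (simp add: univ_gen_def poly_eval_gen)

end


context bounded_relations
begin

lemma cls_const_relation: "r \<in> R \<Longrightarrow> cls (\<lambda>n. r) = \<zero>\<^bsub>U\<^esub>"
  using relations by (subst U_zero, subst cls_eq_iff) (auto simp: C_const star_polys_zero N_relation)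

lemma cls_const_eq: "a - b \<in> R \<Longrightarrow> a \<in> S \<Longrightarrow> b \<in> S \<Longrightarrow> cls (\<lambda>n. a) = cls (\<lambda>n. b)"
  by (simp add: cls_eq_iff C_const N_relation)

lemma polys_dense:
  assumes "P \<in> carrier U" "0 < \<epsilon>" shows "\<exists>a\<in>S. nrm U (P \<ominus>\<^bsub>U\<^esub> cls (\<lambda>n. a)) < \<epsilon>"
proof -
  obtain s where s: "s \<in> C" "P = cls s" by (rule cls_cases[OF assms(1)])
  obtain K where K: "\<And>m n. m \<ge> K \<Longrightarrow> n \<ge> K \<Longrightarrow> N (s m - s n) < \<epsilon> / 2"
    using C_D[OF s(1), of "\<epsilon> / 2"] assms(2) by auto
  have "nrm U (cls (\<lambda>n. s n - s K)) \<le> \<epsilon> / 2"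
    using cls_nrm[OF C_diff[OF s(1) C_const[OF C_in[OF s(1), of K]]]]
  proof (rule LIMSEQ_le_const2)
    show "\<exists>L. \<forall>n\<ge>L. N (s n - s K) \<le> \<epsilon> / 2"
      using K by (intro exI[of _ K]) (auto intro: less_imp_le)
  qed
  then have "nrm U (P \<ominus>\<^bsub>U\<^esub> cls (\<lambda>n. s K)) \<le> \<epsilon> / 2"
    by (simp add: s cls_minus C_const C_in)
  then show ?thesis using C_in[OF s(1)] assms(2) by (intro bexI[of _ "s K"]) auto
qed

end

definition bip_projections ::
    "'v bip_graph \<Rightarrow> ('b, 'n) star_algebra_scheme \<Rightarrow> ('v \<Rightarrow> 'b) \<Rightarrow> bool" where
  "bip_projections G B e \<longleftrightarrow>
     (\<forall>x\<in>left G \<union> right G. e x \<in> carrier B \<and> star B (e x) = e x \<and> e x \<otimes>\<^bsub>B\<^esub> e x = e x) \<and>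
     (\<Oplus>\<^bsub>B\<^esub>u\<in>left G. e u) = \<one>\<^bsub>B\<^esub> \<and> (\<Oplus>\<^bsub>B\<^esub>v\<in>right G. e v) = \<one>\<^bsub>B\<^esub> \<and>
     (\<forall>u\<in>left G. \<forall>v\<in>right G. {u, v} \<notin> edges G \<longrightarrow> e u \<otimes>\<^bsub>B\<^esub> e v = \<zero>\<^bsub>B\<^esub>)"

definition bip_gen :: "'v bip_graph \<Rightarrow> 'v \<Rightarrow> (nat \<Rightarrow> 'v star_poly) set" where
  "bip_gen G = univ_gen (left G \<union> right G) (bip_relations G)"

text \<open>
  The universal property: the generators satisfy the relations, and they can be mapped to any
  other family of projections that satisfies them.  The star-polynomials in the generators are
  dense by \<open>bounded_relations.polys_dense\<close>.
\<close>

theorem bip_gen_projections: "bip_projections G (bip_cstar G) (bip_gen G)"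
proof -
  let ?X = "left G \<union> right G" and ?R = "bip_relations G"
  interpret bounded_relations ?X ?R by (rule bip_bounded_relations)
  interpret ring "bip_cstar G" using U_ring by (simp add: bip_cstar_def)
  have gen_in: "bip_gen G x \<in> carrier (bip_cstar G)" if "x \<in> ?X" for x
    using that by (simp only: bip_gen_def univ_gen_def bip_cstar_def) (intro cls_in C_const star_polys_gen)
  have sum: "(\<Oplus>\<^bsub>bip_cstar G\<^esub>x\<in>K. bip_gen G x) = cls (\<lambda>n. \<Sum>x\<in>K. poly_gen x)
      \<and> (\<Sum>x\<in>K. poly_gen x) \<in> star_polys ?X" if "K \<subseteq> ?X" for K
    using that
  proof (induction K rule: infinite_finite_induct)
    case (insert x K)
    then have K: "(\<Oplus>\<^bsub>bip_cstar G\<^esub>x\<in>K. bip_gen G x) = cls (\<lambda>n. \<Sum>x\<in>K. poly_gen x)"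
      "(\<Sum>x\<in>K. poly_gen x) \<in> star_polys ?X" "x \<in> ?X"
      by auto
    have "(\<Oplus>\<^bsub>bip_cstar G\<^esub>x\<in>insert x K. bip_gen G x)
        = bip_gen G x \<oplus>\<^bsub>bip_cstar G\<^esub> cls (\<lambda>n. \<Sum>x\<in>K. poly_gen x)"
      using insert gen_in by (subst finsum_insert) (auto simp: K(1))
    also have "\<dots> = cls (\<lambda>n. poly_gen x + (\<Sum>x\<in>K. poly_gen x))"
      unfolding bip_cstar_def bip_gen_def univ_gen_def
      by (intro cls_add C_const star_polys_gen K)
    finally show ?case
      using insert(1,2) K by (simp add: star_polys_add star_polys_gen)
  qed (simp_all add: bip_cstar_def U_zero star_polys_zero finsum_infinite[unfolded bip_cstar_def]
      finsum_empty[unfolded bip_cstar_def])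
  have one: "\<one>\<^bsub>bip_cstar G\<^esub> = cls (\<lambda>n. 1)" by (simp add: bip_cstar_def U_one)
  have sum_one: "(\<Oplus>\<^bsub>bip_cstar G\<^esub>x\<in>K. bip_gen G x) = \<one>\<^bsub>bip_cstar G\<^esub>"
    if "K \<subseteq> ?X" "(\<Sum>x\<in>K. poly_gen x) - 1 \<in> ?R" for K
    using sum[OF that(1)] cls_const_eq[OF that(2)] by (simp add: one star_polys_one)
  show ?thesis
    unfolding bip_projections_def
  proof (intro conjI ballI impI gen_in)
    show "(\<Oplus>\<^bsub>bip_cstar G\<^esub>u\<in>left G. bip_gen G u) = \<one>\<^bsub>bip_cstar G\<^esub>"
      "(\<Oplus>\<^bsub>bip_cstar G\<^esub>v\<in>right G. bip_gen G v) = \<one>\<^bsub>bip_cstar G\<^esub>"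
      by (rule sum_one; simp add: bip_relations_def)+
  next
    fix x assume x: "x \<in> ?X"
    note p = star_polys_gen[OF x] star_polys_star[OF star_polys_gen[OF x]]
    have "poly_gen x - poly_star (poly_gen x) \<in> ?R" using x by (auto simp: bip_relations_def)
    from cls_const_eq[OF this p] show "star (bip_cstar G) (bip_gen G x) = bip_gen G x"
      using p by (simp add: bip_cstar_def bip_gen_def univ_gen_def cls_star C_const poly_star_star)
    have "poly_gen x * poly_gen x - poly_gen x \<in> ?R" using x by (auto simp: bip_relations_def)
    from cls_const_eq[OF this star_polys_mult[OF p(1) p(1)] p(1)]
    show "bip_gen G x \<otimes>\<^bsub>bip_cstar G\<^esub> bip_gen G x = bip_gen G x"
      using p by (simp add: bip_cstar_def bip_gen_def univ_gen_def cls_mult C_const)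
  next
    fix u v assume uv: "u \<in> left G" "v \<in> right G" "{u, v} \<notin> edges G"
    then have "poly_gen u * poly_gen v \<in> ?R" by (auto simp: bip_relations_def)
    from cls_const_relation[OF this] show "bip_gen G u \<otimes>\<^bsub>bip_cstar G\<^esub> bip_gen G v = \<zero>\<^bsub>bip_cstar G\<^esub>"
      using uv by (simp add: bip_cstar_def bip_gen_def univ_gen_def cls_mult C_const star_polys_gen)
  qed
qed

theorem bip_cstar_universal:
  assumes B: "cstar_algebra B" and e: "bip_projections G B e"
  shows "\<exists>f\<in>star_hom (bip_cstar G) B. \<forall>x\<in>left G \<union> right G. f (bip_gen G x) = e x"
proof -
  let ?X = "left G \<union> right G"
  interpret B: cstar_algebra B by (rule B)
  interpret bounded_relations ?X "bip_relations G" by (rule bip_bounded_relations)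
  define e' where "e' x = (if x \<in> ?X then e x else \<zero>\<^bsub>B\<^esub>)" for x
  interpret evaluation B e'
    using e by unfold_locales (auto simp: e'_def bip_projections_def)
  have e'_eq: "e' x = e x" if "x \<in> ?X" for x using that by (auto simp: e'_def)
  have sums: "(\<Oplus>\<^bsub>B\<^esub>u\<in>left G. e' u) = \<one>\<^bsub>B\<^esub>" "(\<Oplus>\<^bsub>B\<^esub>v\<in>right G. e' v) = \<one>\<^bsub>B\<^esub>"
  proof -
    have "(\<Oplus>\<^bsub>B\<^esub>u\<in>left G. e' u) = (\<Oplus>\<^bsub>B\<^esub>u\<in>left G. e u)" "(\<Oplus>\<^bsub>B\<^esub>v\<in>right G. e' v) = (\<Oplus>\<^bsub>B\<^esub>v\<in>right G. e v)"
      using e by (intro B.add.finprod_cong'; auto simp: e'_def bip_projections_def)+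
    then show "(\<Oplus>\<^bsub>B\<^esub>u\<in>left G. e' u) = \<one>\<^bsub>B\<^esub>" "(\<Oplus>\<^bsub>B\<^esub>v\<in>right G. e' v) = \<one>\<^bsub>B\<^esub>"
      using e by (simp_all add: bip_projections_def)
  qed
  interpret universal_map ?X "bip_relations G" B e'
  proof unfold_locales
    fix r assume "r \<in> bip_relations G"
    then consider
        x where "x \<in> ?X" "r = poly_gen x - poly_star (poly_gen x)"
      | x where "x \<in> ?X" "r = poly_gen x * poly_gen x - poly_gen x"
      | "r = (\<Sum>u\<in>left G. poly_gen u) - 1" | "r = (\<Sum>v\<in>right G. poly_gen v) - 1"
      | u v where "u \<in> left G" "v \<in> right G" "{u, v} \<notin> edges G" "r = poly_gen u * poly_gen v"
      unfolding bip_relations_def by blast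
    then show "poly_eval r = \<zero>\<^bsub>B\<^esub>"
    proof cases
      case 1
      then show ?thesis using e e'_eq[of x] e_closed[of x]
        by (auto simp: poly_eval_diff poly_eval_star poly_eval_gen bip_projections_def B.minus_zero_iff)
    next
      case 2
      then show ?thesis using e e'_eq[of x] e_closed[of x]
        by (auto simp: poly_eval_diff poly_eval_mult poly_eval_gen bip_projections_def B.minus_zero_iff)
    next
      case 3
      then show ?thesis by (simp add: poly_eval_diff poly_eval_sum poly_eval_one sums B.minus_zero_iff)
    next
      case 4
      then show ?thesis by (simp add: poly_eval_diff poly_eval_sum poly_eval_one sums B.minus_zero_iff)
    next
      case 5
      then show ?thesis using e by (auto simp: poly_eval_mult poly_eval_gen e'_def bip_projections_def)
    qed
  qed
  show ?thesis
    using univ_map_star_hom univ_map_gen e'_eq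
    by (intro bexI[of _ univ_map]) (auto simp: bip_gen_def bip_cstar_def)
qed

end

theory Submission
  imports Defs
begin

text \<open>
  The irreducible representations of \<open>C*(G)\<close> of dimension at most two are known: every edge gives a
  character, every 4-cycle gives a family of two-dimensional representations indexed by the angle
  \<open>t \<in> (0, pi/2)\<close> between two lines, and there are no others.  As \<open>t\<close> tends to an end of the interval,
  such a family converges to both characters of a pair of opposite edges of its cycle.  Hence the
  characters are exactly the points of the spectrum that are isolated or cannot be separated by open
  sets from some other point; two edges are opposite in a 4-cycle if and only if their characters
  cannot be separated; and two edges lie on a common 4-cycle if and only if both characters are in
  the closure of one connected set of other points.  So the spectrum determines a bijection of the
  edges, up to these two relations.

  Such a bijection need not come from a graph isomorphism, since it can interchange the two sides of the
  graph on some of the cherries (paths of length two inside a 4-cycle).  But the products of generators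
  along cherries of the two types annihilate each other, so the generators of the other algebra can be
  assembled modulo the two ideals separately and glued, which yields an isomorphism of the algebras.

  To separate points, a self-adjoint contraction acting as \<open>cos (2^k * \<theta>)\<close> is split into its positive and
  negative parts; the required square roots come from Visser's iteration.  Doubling the angle is the
  tent map, so any two different angles are eventually on different sides of \<open>pi / 2\<close>.
\<close>

section \<open>Square roots in C*-algebras\<close>

text \<open>In the algebraic half every relation is checked modulo two ideals of polynomials, not of
  the algebra, so no closure of an ideal and no quotient algebra enters. A product of members of the
  two ideals evaluates to zero; as one of them is star-closed, a common member \<open>a\<close> has
  \<open>star a * a\<close> evaluating to zero, and the C*-identity then kills \<open>a\<close>. The
  topological half is shaped by the open sets: basic ones consist of the points at which some
  element does not vanish. On a family of angles a polynomial in the generators vanishes identically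
  or at finitely many angles only, so polynomials cannot separate two angles; elements vanishing on
  whole intervals are required, hence the positive and negative parts. The norm bound under which
  the square root exists comes from writing each cosine as half the sum of a unitary and its
  adjoint. The same square root supplies all order arguments: orthogonality of projections with sum
  one, and contractivity of representations. The topology of the spectrum is pulled back from the
  kernels, and small representations are determined by their kernels; so points are treated as
  kernels.\<close>

context cstar_algebra
begin

text \<open>Norm convergence is a predicate because the algebra is a carrier set and not a type with
  a topology; membership of all terms is built in so that limits combine without side
  conditions.\<close>

definition limit_of :: "(nat \<Rightarrow> 'a) \<Rightarrow> 'a \<Rightarrow> bool" where
  "limit_of s a \<longleftrightarrow> (\<forall>n. s n \<in> carrier A) \<and> a \<in> carrier A \<and> (\<lambda>n. nrm A (s n \<ominus> a)) \<longlonglongrightarrow> 0"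

lemma limit_ofI:
  assumes "\<And>n. s n \<in> carrier A" "a \<in> carrier A" "\<And>n. nrm A (s n \<ominus> a) \<le> f n" "f \<longlonglongrightarrow> 0"
  shows "limit_of s a"
  unfolding limit_of_def
  using assms by (auto intro!: tendsto_sandwich[OF _ _ tendsto_const assms(4)] always_eventually nrm_nonneg)

lemma limit_of_const: "a \<in> carrier A \<Longrightarrow> limit_of (\<lambda>n. a) a"
  by (simp add: limit_of_def minus_zero_iff[THEN iffD2] nrm_zero)

lemma limit_of_add:
  assumes "limit_of s a" "limit_of t b" shows "limit_of (\<lambda>n. s n \<oplus> t n) (a \<oplus> b)"
proof (rule limit_ofI)
  show "(\<lambda>n. nrm A (s n \<ominus> a) + nrm A (t n \<ominus> b)) \<longlonglongrightarrow> 0"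
    using assms tendsto_add[of _ 0 _ _ 0] by (auto simp: limit_of_def)
qed (use assms nrm_minus_add in \<open>auto simp: limit_of_def\<close>)

lemma nrm_le_minus: "a \<in> carrier A \<Longrightarrow> b \<in> carrier A \<Longrightarrow> nrm A a \<le> nrm A (a \<ominus> b) + nrm A b"
  using nrm_triangle[of "a \<ominus> b" b] by (simp add: a_minus_def a_assoc l_neg)

lemma limit_of_nrm:
  assumes "limit_of s a" shows "(\<lambda>n. nrm A (s n)) \<longlonglongrightarrow> nrm A a"
proof -
  have in_A: "s n \<in> carrier A" "a \<in> carrier A" for n using assms by (auto simp: limit_of_def)
  have "\<bar>nrm A (s n) - nrm A a\<bar> \<le> nrm A (s n \<ominus> a)" for n
    using nrm_le_minus[OF in_A(1)[of n] in_A(2)] nrm_le_minus[OF in_A(2) in_A(1)[of n]]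
      nrm_minus_commute[OF in_A(1)[of n] in_A(2)] by linarith
  moreover have "(\<lambda>n. nrm A (s n \<ominus> a)) \<longlonglongrightarrow> 0" using assms by (simp add: limit_of_def)
  ultimately have "(\<lambda>n. nrm A (s n) - nrm A a) \<longlonglongrightarrow> 0"
    by (intro Lim_null_comparison[of "\<lambda>n. nrm A (s n) - nrm A a"]) auto
  then show ?thesis by (simp add: LIM_zero_iff)
qed

lemma limit_of_mult:
  assumes "limit_of s a" "limit_of t b" shows "limit_of (\<lambda>n. s n \<otimes> t n) (a \<otimes> b)"
proof (rule limit_ofI)
  have in_A: "s n \<in> carrier A" "a \<in> carrier A" "t n \<in> carrier A" "b \<in> carrier A" for n
    using assms by (auto simp: limit_of_def)
  show "s n \<otimes> t n \<in> carrier A" "a \<otimes> b \<in> carrier A" for n using in_A by auto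
  show "nrm A (s n \<otimes> t n \<ominus> (a \<otimes> b)) \<le> nrm A (s n) * nrm A (t n \<ominus> b) + nrm A (s n \<ominus> a) * nrm A b" for n
  proof -
    have "s n \<otimes> t n \<ominus> (a \<otimes> b) = s n \<otimes> (t n \<ominus> b) \<oplus> (s n \<ominus> a) \<otimes> b"
      using in_A by algebra
    also have "nrm A \<dots> \<le> nrm A (s n \<otimes> (t n \<ominus> b)) + nrm A ((s n \<ominus> a) \<otimes> b)"
      using in_A by (intro nrm_triangle) auto
    also have "\<dots> \<le> nrm A (s n) * nrm A (t n \<ominus> b) + nrm A (s n \<ominus> a) * nrm A b"
      using in_A by (intro add_mono nrm_mult) auto
    finally show ?thesis .
  qed
  have "(\<lambda>n. nrm A (t n \<ominus> b)) \<longlonglongrightarrow> 0" "(\<lambda>n. nrm A (s n \<ominus> a)) \<longlonglongrightarrow> 0"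
    using assms by (auto simp: limit_of_def)
  then have "(\<lambda>n. nrm A (s n) * nrm A (t n \<ominus> b) + nrm A (s n \<ominus> a) * nrm A b)
      \<longlonglongrightarrow> nrm A a * 0 + 0 * nrm A b"
    using limit_of_nrm[OF assms(1)] by (intro tendsto_intros)
  then show "(\<lambda>n. nrm A (s n) * nrm A (t n \<ominus> b) + nrm A (s n \<ominus> a) * nrm A b) \<longlonglongrightarrow> 0" by simp
qed

lemma limit_of_scale:
  assumes "limit_of s a" shows "limit_of (\<lambda>n. scale A c (s n)) (scale A c a)"
proof (rule limit_ofI)
  show "(\<lambda>n. cmod c * nrm A (s n \<ominus> a)) \<longlonglongrightarrow> 0"
    using assms tendsto_mult_right_zero by (auto simp: limit_of_def)
qed (use assms in \<open>auto simp: limit_of_def scale_closed scale_minus[symmetric] nrm_scale\<close>)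

lemma limit_of_star:
  assumes "limit_of s a" shows "limit_of (\<lambda>n. star A (s n)) (star A a)"
proof (rule limit_ofI)
  show "(\<lambda>n. nrm A (s n \<ominus> a)) \<longlonglongrightarrow> 0" using assms by (auto simp: limit_of_def)
qed (use assms in \<open>auto simp: limit_of_def star_closed star_minus[symmetric] nrm_star\<close>)

lemma limit_of_unique:
  assumes "limit_of s a" "limit_of s b" shows "a = b"
proof -
  have in_A: "s n \<in> carrier A" "a \<in> carrier A" "b \<in> carrier A" for n
    using assms by (auto simp: limit_of_def)
  have "(\<lambda>n. nrm A (s n \<ominus> a) + nrm A (s n \<ominus> b)) \<longlonglongrightarrow> 0"
    using assms tendsto_add[of _ 0 _ _ 0] by (auto simp: limit_of_def)
  moreover have "nrm A (a \<ominus> b) \<le> nrm A (s n \<ominus> a) + nrm A (s n \<ominus> b)" for n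
    using nrm_minus_triangle[OF in_A(2) in_A(1) in_A(3), of n]
      nrm_minus_commute[OF in_A(2) in_A(1), of n] by simp
  ultimately have "nrm A (a \<ominus> b) \<le> 0" by (intro LIMSEQ_le_const) auto
  then show ?thesis
    using nrm_eq_zero[of "a \<ominus> b"] nrm_nonneg[of "a \<ominus> b"] in_A by (simp add: minus_zero_iff)
qed

lemma limit_of_Suc: "limit_of s a \<Longrightarrow> limit_of (\<lambda>n. s (Suc n)) a"
  unfolding limit_of_def by (auto intro: LIMSEQ_Suc)

lemma half_double: "d \<in> carrier A \<Longrightarrow> scale A (1/2) (d \<oplus> d) = d"
  using scale_add_left[of d "1/2" "1/2"] by (simp add: scale_add_right scale_one)

lemma double_half: "d \<in> carrier A \<Longrightarrow> scale A (1/2) d \<oplus> scale A (1/2) d = d"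
  using scale_add_left[of d "1/2" "1/2"] by (simp add: scale_one)

end

text \<open>Visser's iteration for \<open>1 - sqrt (1 - b)\<close>, and its value for \<open>b = 1\<close>.\<close>

primrec visser :: "('a, 'm) star_algebra_scheme \<Rightarrow> 'a \<Rightarrow> nat \<Rightarrow> 'a" where
  "visser A b 0 = \<zero>\<^bsub>A\<^esub>"
| "visser A b (Suc n) = scale A (1/2) (b \<oplus>\<^bsub>A\<^esub> visser A b n \<otimes>\<^bsub>A\<^esub> visser A b n)"

primrec visser1 :: "nat \<Rightarrow> real" where
  "visser1 0 = 0"
| "visser1 (Suc n) = (1 + (visser1 n)\<^sup>2) / 2"

lemma visser1_bounds: "0 \<le> visser1 n \<and> visser1 n \<le> 1"
proof (induction n)
  case (Suc n)
  then have "(visser1 n)\<^sup>2 \<le> 1" by (simp add: power_le_one)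
  then show ?case by auto
qed simp

lemma visser1_mono: "visser1 n \<le> visser1 (Suc n)"
proof -
  have "0 \<le> (1 - visser1 n)\<^sup>2" by simp
  then show ?thesis by (simp add: power2_eq_square algebra_simps)
qed

lemma visser1_convergent: "convergent visser1"
proof -
  have "incseq visser1" using visser1_mono by (rule incseq_SucI)
  moreover have "Bseq visser1"
    using visser1_bounds by (intro BseqI'[of _ 1]) (auto simp: abs_le_iff intro: order_trans[of _ 0])
  ultimately show ?thesis using Bseq_monoseq_convergent incseq_imp_monoseq by blast
qed

context cstar_algebra
begin

lemma visser_closed: "b \<in> carrier A \<Longrightarrow> visser A b n \<in> carrier A"
  by (induction n) (auto simp: scale_closed)

lemma visser_commute:
  assumes b: "b \<in> carrier A" and z: "z \<in> carrier A" "z \<otimes> b = b \<otimes> z"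
  shows "z \<otimes> visser A b n = visser A b n \<otimes> z"
proof (induction n)
  case (Suc n)
  let ?d = "visser A b n"
  have d: "?d \<in> carrier A" using b by (rule visser_closed)
  have "z \<otimes> (?d \<otimes> ?d) = ?d \<otimes> ?d \<otimes> z"
    using Suc d z by (metis m_assoc)
  then show ?case
    using b z d by (simp add: scale_mult_left scale_mult_right r_distr l_distr)
qed (use z in simp)

text \<open>The iterates are polynomials in \<open>b\<close> with nonnegative coefficients, so their
  norms are dominated by the values for \<open>b = 1\<close>.\<close>

lemma visser_nrm:
  assumes b: "b \<in> carrier A" "nrm A b \<le> 1" shows "nrm A (visser A b n) \<le> visser1 n"
proof (induction n)
  case (Suc n)
  let ?d = "visser A b n"
  have d: "?d \<in> carrier A" using b(1) by (rule visser_closed)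
  have "nrm A (?d \<otimes> ?d) \<le> nrm A ?d * nrm A ?d" using d by (intro nrm_mult)
  also have "\<dots> \<le> visser1 n * visser1 n" using Suc d visser1_bounds[of n]
    by (intro mult_mono nrm_nonneg) auto
  finally have "nrm A (b \<oplus> ?d \<otimes> ?d) \<le> 1 + visser1 n * visser1 n"
    using nrm_triangle[of b "?d \<otimes> ?d"] b d by auto
  then show ?case using b d by (simp add: nrm_scale power2_eq_square)
qed (simp add: nrm_zero)

lemma square_diff_factor:
  assumes "x \<in> carrier A" "y \<in> carrier A" "x \<otimes> y = y \<otimes> x"
  shows "x \<otimes> x \<ominus> y \<otimes> y = (x \<oplus> y) \<otimes> (x \<ominus> y)"
  using assms by (simp add: ring_simprules r_neg1 r_neg2)

text \<open>The same domination for the increments: consecutive iterates commute, so the difference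
  of their squares factors, and the scalar recursion factors in the same way.\<close>

lemma visser_step:
  assumes b: "b \<in> carrier A" "nrm A b \<le> 1"
  shows "nrm A (visser A b (Suc n) \<ominus> visser A b n) \<le> visser1 (Suc n) - visser1 n"
proof (induction n)
  case 0
  have "visser A b 1 \<ominus> visser A b 0 = scale A (1/2) b"
    using b scale_closed[OF b(1), of "1/2"] by (simp add: a_minus_def)
  then show ?case using b by (simp add: nrm_scale)
next
  case (Suc n)
  let ?x = "visser A b (Suc n)" and ?y = "visser A b n"
  have xy: "?x \<in> carrier A" "?y \<in> carrier A" using visser_closed[OF b(1)] by blast+
  have "?y \<otimes> b = b \<otimes> ?y" using visser_commute[OF b(1) b(1), of n] by (simp only:)
  then have comm: "?x \<otimes> ?y = ?y \<otimes> ?x"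
    using visser_commute[OF b(1) xy(2), of "Suc n"] by (simp only:)
  have "visser A b (Suc (Suc n)) \<ominus> visser A b (Suc n) = scale A (1/2) (b \<oplus> ?x \<otimes> ?x \<ominus> (b \<oplus> ?y \<otimes> ?y))"
    using b xy by (simp only: visser.simps(2)) (simp add: scale_minus)
  also have "b \<oplus> ?x \<otimes> ?x \<ominus> (b \<oplus> ?y \<otimes> ?y) = ?x \<otimes> ?x \<ominus> ?y \<otimes> ?y"
    using b(1) xy by (simp del: visser.simps add: ring_simprules r_neg1 r_neg2)
  also have "\<dots> = (?x \<oplus> ?y) \<otimes> (?x \<ominus> ?y)" by (rule square_diff_factor[OF xy comm])
  finally have "nrm A (visser A b (Suc (Suc n)) \<ominus> visser A b (Suc n))
      = nrm A ((?x \<oplus> ?y) \<otimes> (?x \<ominus> ?y)) / 2"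
    using xy by (simp only: nrm_scale m_closed a_closed minus_closed) simp
  also have "nrm A ((?x \<oplus> ?y) \<otimes> (?x \<ominus> ?y)) \<le> nrm A (?x \<oplus> ?y) * nrm A (?x \<ominus> ?y)"
    using xy by (intro nrm_mult) auto
  also have "\<dots> \<le> (visser1 (Suc n) + visser1 n) * (visser1 (Suc n) - visser1 n)"
  proof (intro mult_mono)
    show "nrm A (?x \<oplus> ?y) \<le> visser1 (Suc n) + visser1 n"
      using nrm_triangle[OF xy] visser_nrm[OF b, of n] visser_nrm[OF b, of "Suc n"] by linarith
    show "nrm A (?x \<ominus> ?y) \<le> visser1 (Suc n) - visser1 n" by (rule Suc)
    show "0 \<le> visser1 (Suc n) + visser1 n" using visser1_bounds by (simp del: visser1.simps)
    show "0 \<le> nrm A (?x \<ominus> ?y)" using xy by (intro nrm_nonneg) auto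
  qed
  also have "\<dots> = 2 * (visser1 (Suc (Suc n)) - visser1 (Suc n))"
    by (simp add: power2_eq_square field_simps)
  finally show ?case by (simp del: visser.simps visser1.simps add: divide_right_mono)
qed

lemma visser_diff:
  assumes b: "b \<in> carrier A" "nrm A b \<le> 1"
  shows "nrm A (visser A b (n + k) \<ominus> visser A b n) \<le> visser1 (n + k) - visser1 n"
proof (induction k)
  case 0
  then show ?case using visser_closed[OF b(1)] by (simp add: minus_zero_iff[THEN iffD2] nrm_zero)
next
  case (Suc k)
  have "nrm A (visser A b (n + Suc k) \<ominus> visser A b n)
      \<le> nrm A (visser A b (Suc (n + k)) \<ominus> visser A b (n + k)) + nrm A (visser A b (n + k) \<ominus> visser A b n)"
    using nrm_minus_triangle visser_closed[OF b(1)] by (metis add_Suc_right)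
  then show ?case using visser_step[OF b, of "n + k"] Suc by (simp del: visser.simps visser1.simps)
qed

text \<open>The increments are bounded by those of a convergent scalar sequence, so the iterates are
  Cauchy. The fixed-point equation says that \<open>\<one> \<ominus> d\<close> is a square root of
  \<open>\<one> \<ominus> b\<close>. The last two clauses allow \<open>d\<close> to be used together
  with other commuting elements and inside the corner of a projection \<open>p\<close>, where
  \<open>p\<close> takes the place of the unit.\<close>

theorem visser_limit:
  assumes b: "b \<in> carrier A" "nrm A b \<le> 1" "star A b = b"
  obtains d where "d \<in> carrier A" "star A d = d" "nrm A d \<le> 1" "b \<oplus> d \<otimes> d = d \<oplus> d"
    "\<And>z. z \<in> carrier A \<Longrightarrow> z \<otimes> b = b \<otimes> z \<Longrightarrow> z \<otimes> d = d \<otimes> z"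
    "\<And>p. p \<in> carrier A \<Longrightarrow> p \<otimes> b = b \<Longrightarrow> p \<otimes> d = d"
proof -
  note V = visser_closed[OF b(1)]
  have "\<exists>d\<in>carrier A. (\<lambda>n. nrm A (visser A b n \<ominus> d)) \<longlonglongrightarrow> 0"
  proof (rule complete)
    fix e :: real assume e: "0 < e"
    obtain N where N: "\<And>m n. m \<ge> N \<Longrightarrow> n \<ge> N \<Longrightarrow> dist (visser1 m) (visser1 n) < e"
      using visser1_convergent e unfolding Cauchy_convergent_iff[symmetric] Cauchy_def by blast
    have le: "nrm A (visser A b m \<ominus> visser A b n) < e" if "m \<ge> n" "n \<ge> N" for m n
      using visser_diff[OF b(1,2), of n "m - n"] N[of m n] that by (simp add: dist_real_def)
    have "nrm A (visser A b m \<ominus> visser A b n) < e" if "m \<ge> N" "n \<ge> N" for m n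
      using le[of m n] le[of n m] that nrm_minus_commute[OF V V, of m n] by (cases "m \<ge> n") auto
    then show "\<exists>N. \<forall>m\<ge>N. \<forall>n\<ge>N. nrm A (visser A b m \<ominus> visser A b n) < e" by blast
  qed (rule V)
  then obtain d where lim: "limit_of (visser A b) d" and d: "d \<in> carrier A" using V by (auto simp: limit_of_def)
  show thesis
  proof
    show "d \<in> carrier A" by (rule d)
    have "star A (visser A b n) = visser A b n" for n
      by (induction n) (use b V in \<open>auto simp: star_zero star_scale star_add star_mult\<close>)
    then show "star A d = d" using limit_of_star[OF lim] lim limit_of_unique by simp
    show "nrm A d \<le> 1"
      using visser_nrm[OF b(1,2)] visser1_bounds by (intro LIMSEQ_le_const2[OF limit_of_nrm[OF lim]]) (meson order_trans)
    have "limit_of (\<lambda>n. scale A (1/2) (b \<oplus> visser A b n \<otimes> visser A b n)) (scale A (1/2) (b \<oplus> d \<otimes> d))"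
      by (intro limit_of_scale limit_of_add limit_of_const limit_of_mult lim b)
    then have "scale A (1/2) (b \<oplus> d \<otimes> d) = d"
      using limit_of_unique limit_of_Suc[OF lim] by (simp add: limit_of_def)
    then show "b \<oplus> d \<otimes> d = d \<oplus> d" using b d double_half[of "b \<oplus> d \<otimes> d"] by simp
    show "z \<otimes> d = d \<otimes> z" if "z \<in> carrier A" "z \<otimes> b = b \<otimes> z" for z
      using limit_of_mult[OF limit_of_const[OF that(1)] lim] limit_of_mult[OF lim limit_of_const[OF that(1)]]
        visser_commute[OF b(1) that] limit_of_unique by simp
    fix p assume p: "p \<in> carrier A" "p \<otimes> b = b"
    have "p \<otimes> visser A b n = visser A b n" for n
      by (induction n) (use b p V in \<open>simp_all add: scale_mult_right r_distr flip: m_assoc\<close>)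
    then show "p \<otimes> d = d" using limit_of_mult[OF limit_of_const[OF p(1)] lim] lim limit_of_unique by simp
  qed
qed

end

section \<open>Positivity expressed through norm bounds and square roots\<close>

context cstar_algebra
begin

lemma nrm_eq_zero_of_star_mult: "a \<in> carrier A \<Longrightarrow> star A a \<otimes> a = \<zero> \<Longrightarrow> a = \<zero>"
  using cstar_identity[of a] nrm_eq_zero[of a] nrm_zero by simp

text \<open>In the corner of \<open>p\<close> each norm bound yields a square root: with
  \<open>d\<close> from Visser's iteration for \<open>p \<ominus> k\<close>, the square of
  \<open>p \<ominus> d\<close> is \<open>k\<close>, and likewise \<open>\<ominus> k\<close> is the
  square of \<open>w\<close>. So \<open>k\<close> is positive and negative at once. As
  \<open>y\<close> and \<open>w\<close> commute, \<open>z = y + i w\<close> satisfies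
  \<open>star A z \<otimes> z = \<zero>\<close>, and both parts vanish.\<close>

lemma both_signs_contractive_zero:
  assumes p: "p \<in> carrier A" "star A p = p" "p \<otimes> p = p"
    and k: "k \<in> carrier A" "star A k = k" "p \<otimes> k = k"
    and le: "nrm A (p \<ominus> k) \<le> 1" "nrm A (p \<oplus> k) \<le> 1"
  shows "k = \<zero>"
proof -
  have kp: "k \<otimes> p = k" using star_mult[OF p(1) k(1)] p k by simp
  let ?b = "p \<ominus> k" and ?c = "p \<oplus> k"
  obtain d where d: "d \<in> carrier A" "star A d = d" "?b \<oplus> d \<otimes> d = d \<oplus> d"
    and d_comm: "\<And>z. z \<in> carrier A \<Longrightarrow> z \<otimes> ?b = ?b \<otimes> z \<Longrightarrow> z \<otimes> d = d \<otimes> z"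
    and pd: "p \<otimes> d = d"
    using visser_limit[of ?b] p k le
    by (metis (no_types, lifting) m_assoc minus_closed star_minus a_minus_def r_distr r_minus a_inv_closed)
  obtain f where f: "f \<in> carrier A" "star A f = f" "?c \<oplus> f \<otimes> f = f \<oplus> f"
    and f_comm: "\<And>z. z \<in> carrier A \<Longrightarrow> z \<otimes> ?c = ?c \<otimes> z \<Longrightarrow> z \<otimes> f = f \<otimes> z"
    and pf: "p \<otimes> f = f"
    using visser_limit[of ?c] p k le by (metis (no_types, lifting) a_closed star_add r_distr)
  have dp: "d \<otimes> p = d" and fp: "f \<otimes> p = f"
    using star_mult[OF p(1) d(1)] star_mult[OF p(1) f(1)] p d f pd pf by simp_all
  \<comment> \<open>Each limit commutes with whatever commutes with its starting point, so
    commutation passes from \<open>?b\<close> and \<open>?c\<close> to \<open>d\<close> and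
    \<open>f\<close> in two steps.\<close>
  have "?c \<otimes> ?b = ?b \<otimes> ?c" using p k kp by algebra
  then have "?c \<otimes> d = d \<otimes> ?c" using d_comm p k by simp
  then have df: "d \<otimes> f = f \<otimes> d" using f_comm d by simp
  define y where "y = p \<ominus> d"
  define w where "w = p \<ominus> f"
  define z where "z = y \<oplus> scale A \<i> w"
  have yw: "y \<in> carrier A" "w \<in> carrier A" "star A y = y" "star A w = w" "z \<in> carrier A"
    using p d f by (auto simp: y_def w_def z_def star_minus scale_closed)
  have comm: "w \<otimes> y = y \<otimes> w"
    unfolding y_def w_def using p(1,3) d(1) f(1) pd dp pf fp df by algebra
  have yy: "y \<otimes> y = p \<oplus> (d \<otimes> d \<ominus> (d \<oplus> d))"
    unfolding y_def using p(1,3) d(1) pd dp by algebra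
  have "d \<otimes> d \<ominus> (d \<oplus> d) = \<ominus> ?b"
    unfolding d(3)[symmetric] using p(1) k(1) d(1) by algebra
  then have yy: "y \<otimes> y = k"
    unfolding yy using p(1) k(1) by algebra
  have ww: "w \<otimes> w = p \<oplus> (f \<otimes> f \<ominus> (f \<oplus> f))"
    unfolding w_def using p(1,3) f(1) pf fp by algebra
  have "f \<otimes> f \<ominus> (f \<oplus> f) = \<ominus> ?c"
    unfolding f(3)[symmetric] using p(1) k(1) f(1) by algebra
  then have ww: "w \<otimes> w = \<ominus> k"
    unfolding ww using p(1) k(1) by algebra
  have star_z: "star A z = y \<oplus> scale A (- \<i>) w"
    using yw by (simp add: z_def star_add star_scale scale_closed)
  define v where "v = scale A \<i> w"
  have v: "v \<in> carrier A" "scale A (- \<i>) w = \<ominus> v"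
    using yw scale_scale[of w "- 1" \<i>] scale_minus_one[of v] by (auto simp: v_def scale_closed)
  have "v \<otimes> v = scale A (- 1) (w \<otimes> w)"
    using yw by (simp add: v_def scale_mult_left scale_mult_right scale_scale scale_closed)
  then have v2: "v \<otimes> v = k" "v \<otimes> y = y \<otimes> v"
    using yw k(1) ww comm by (auto simp: v_def scale_closed scale_minus_one scale_mult_left scale_mult_right)
  have "star A z \<otimes> z = (y \<oplus> \<ominus> v) \<otimes> (y \<oplus> v)"
    unfolding star_z v(2) by (simp only: z_def v_def)
  also have "\<dots> = \<zero>" using v(1) v2 yw(1) yy k(1) by algebra
  finally have "star A z \<otimes> z = \<zero>" .
  then have "z = \<zero>" using yw nrm_eq_zero_of_star_mult by blast
  then have "y \<oplus> scale A \<i> w = \<zero>" "y \<oplus> scale A (- \<i>) w = \<zero>"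
    using star_z star_zero by (auto simp: z_def)
  then have "(y \<oplus> scale A \<i> w) \<oplus> (y \<oplus> scale A (- \<i>) w) = \<zero>" by simp
  moreover have "(y \<oplus> scale A \<i> w) \<oplus> (y \<oplus> scale A (- \<i>) w) = (y \<oplus> y) \<oplus> (scale A \<i> w \<oplus> scale A (- \<i>) w)"
    using yw by (simp add: a_ac scale_closed)
  moreover have "scale A \<i> w \<oplus> scale A (- \<i>) w = \<zero>"
    using yw scale_add_left[of w "\<i>" "- \<i>"] by (simp add: scale_zero)
  ultimately have "y \<oplus> y = \<zero>" using yw by simp
  then have "y = \<zero>" using half_double[OF yw(1)] scale_zero_right by metis
  then show "k = \<zero>" using yy by simp
qed

lemma projection_nrm_le: assumes "p \<in> carrier A" "star A p = p" "p \<otimes> p = p" shows "nrm A p \<le> 1"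
proof -
  have "(nrm A p)\<^sup>2 = nrm A p" using cstar_identity[OF assms(1)] assms by simp
  then have "nrm A p * (nrm A p - 1) = 0" by (simp add: power2_eq_square algebra_simps)
  then show ?thesis by auto
qed

text \<open>Compression by \<open>p = e j\<close> turns the sum into \<open>p\<close>, and
  \<open>h j = p\<close>, so the remaining compressions add up to zero. All of them are positive,
  hence each vanishes; positivity enters only through the norm bounds of
  \<open>both_signs_contractive_zero\<close>. Finally \<open>h i\<close> is
  \<open>star A x \<otimes> x\<close> for \<open>x = e i \<otimes> p\<close>.\<close>

lemma projections_orthogonal:
  assumes fin: "finite I" and e: "\<And>i. i \<in> I \<Longrightarrow> e i \<in> carrier A \<and> star A (e i) = e i \<and> e i \<otimes> e i = e i"
    and sum: "(\<Oplus>i\<in>I. e i) = \<one>" and ij: "i \<in> I" "j \<in> I" "i \<noteq> j"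
  shows "e i \<otimes> e j = \<zero>"
proof -
  define p where "p = e j"
  define h where "h i = p \<otimes> (e i \<otimes> p)" for i
  have p: "p \<in> carrier A" "star A p = p" "p \<otimes> p = p" using e ij by (auto simp: p_def)
  have h: "h l \<in> carrier A" "star A (h l) = h l" "p \<otimes> h l = h l" if "l \<in> I" for l
    using e[OF that] p by (auto simp: h_def star_mult m_assoc) (simp add: m_assoc[symmetric])
  have np: "nrm A p \<le> 1" using projection_nrm_le p by blast
  have nh: "nrm A (p \<ominus> h l) \<le> 1" if "l \<in> I" for l
  proof -
    note el = e[OF that]
    have "(\<one> \<ominus> e l) \<otimes> (\<one> \<ominus> e l) = \<one> \<ominus> e l"
      using el r_one[of "e l"] by algebra
    then have "nrm A (\<one> \<ominus> e l) \<le> 1"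
      using el by (intro projection_nrm_le) (auto simp: star_minus star_one)
    then have "nrm A (p \<otimes> ((\<one> \<ominus> e l) \<otimes> p)) \<le> 1 * (1 * 1)"
      using np p el nrm_mult[of p "(\<one> \<ominus> e l) \<otimes> p"] nrm_mult[of "\<one> \<ominus> e l" p]
      by (intro order_trans[OF nrm_mult] mult_mono order_trans[OF nrm_mult[of "\<one> \<ominus> e l" p]])
        (auto intro!: nrm_nonneg)
    also have "p \<otimes> ((\<one> \<ominus> e l) \<otimes> p) = p \<ominus> h l"
      using el p by (simp add: h_def a_minus_def l_distr r_distr l_minus r_minus)
    finally show ?thesis by simp
  qed
  \<comment> \<open>Norm form of the positivity of a sum: each summand costs one multiple of
    \<open>p\<close>.\<close>
  have partial: "nrm A (scale A (of_nat (card S)) p \<ominus> (\<Oplus>l\<in>S. h l)) \<le> card S"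
    if "finite S" "S \<subseteq> I" for S
    using that
  proof (induction S)
    case empty
    then show ?case using p by (simp add: scale_zero minus_zero_iff[THEN iffD2] nrm_zero)
  next
    case (insert l S)
    have S: "(\<Oplus>l\<in>S. h l) \<in> carrier A" "l \<in> I" using insert.prems h by (auto intro!: finsum_closed)
    have "scale A (of_nat (card (insert l S))) p \<ominus> (\<Oplus>l\<in>insert l S. h l)
        = (p \<ominus> h l) \<oplus> (scale A (of_nat (card S)) p \<ominus> (\<Oplus>l\<in>S. h l))"
      using insert S h p
      by (subst finsum_insert) (auto simp: scale_add_left scale_one a_minus_def minus_add a_ac scale_closed)
    also have "nrm A \<dots> \<le> 1 + card S"
      using nrm_triangle[of "p \<ominus> h l" "scale A (of_nat (card S)) p \<ominus> (\<Oplus>l\<in>S. h l)"] insert S h p nh[OF S(2)]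
      by (auto simp: scale_closed)
    finally show ?case using insert by simp
  qed
  define S where "S = I - {i, j}"
  \<comment> \<open>One more than the number of the other summands: then \<open>n\<close> is at
    least 1 even if there are none, and a single scaling by \<open>1 / n\<close> serves both norm
    bounds.\<close>
  define n where "n = real (card S) + 1"
  have S: "finite S" "S \<subseteq> I" "(\<Oplus>l\<in>S. h l) \<in> carrier A" using fin h by (auto simp: S_def intro!: finsum_closed)
  have I_eq: "I = insert i (insert j S)" using ij by (auto simp: S_def)
  have "p \<otimes> ((\<Oplus>l\<in>I. e l) \<otimes> p) = p" using sum p by simp
  moreover have "p \<otimes> ((\<Oplus>l\<in>I. e l) \<otimes> p) = (\<Oplus>l\<in>I. h l)"
    unfolding h_def using fin p e by (subst finsum_ldistr) (auto simp: finsum_rdistr)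
  moreover have "(\<Oplus>l\<in>I. h l) = h i \<oplus> (h j \<oplus> (\<Oplus>l\<in>S. h l))"
    unfolding I_eq using ij fin h S by (subst finsum_insert; (subst finsum_insert)?) (auto simp: S_def)
  moreover have "h j = p" using p by (simp add: h_def p_def)
  ultimately have "h i \<oplus> (p \<oplus> (\<Oplus>l\<in>S. h l)) = p" by simp
  then have "p \<oplus> (h i \<oplus> (\<Oplus>l\<in>S. h l)) = p" using p h[OF ij(1)] S(3) by (metis a_lcomm)
  then have "h i \<oplus> (\<Oplus>l\<in>S. h l) = \<zero>" using p h[OF ij(1)] S(3) by (simp only: add.l_cancel_one a_closed)
  then have hi: "h i = \<ominus> (\<Oplus>l\<in>S. h l)" using h[OF ij(1)] S(3) by (simp add: minus_equality)
  have n: "n \<ge> 1" by (simp add: n_def)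
  define k where "k = scale A (1 / n) (h i)"
  have k: "k \<in> carrier A" "star A k = k" "p \<otimes> k = k"
    using h[OF ij(1)] p by (auto simp: k_def scale_closed star_scale scale_mult_right)
  \<comment> \<open>A convex combination with \<open>p\<close>: the bound \<open>m\<close> on
    \<open>a\<close>, after division by \<open>n\<close>, is filled up to 1 by a multiple of
    \<open>p\<close>.\<close>
  have bound: "nrm A (scale A (1 / n) a \<oplus> scale A (1 - m / n) p) \<le> 1"
    if "a \<in> carrier A" "nrm A a \<le> m" "0 \<le> m" "m \<le> n" for a m
  proof -
    have eq: "cmod (1 - complex_of_real m / complex_of_real n) = 1 - m / n"
      using that n by (metis abs_of_nonneg divide_le_eq_1_pos le_iff_diff_le_0 less_le_trans minus_diff_eq norm_of_real
          of_real_1 of_real_diff of_real_divide zero_less_one diff_ge_0_iff_ge)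
    have "nrm A (scale A (1 / n) a \<oplus> scale A (1 - m / n) p) \<le> nrm A (scale A (1 / n) a) + nrm A (scale A (1 - m / n) p)"
      using that p by (intro nrm_triangle) (auto simp: scale_closed)
    also have "\<dots> = nrm A a / n + (1 - m / n) * nrm A p"
      using that p n eq by (simp add: nrm_scale norm_divide)
    also have "\<dots> \<le> m / n + (1 - m / n) * 1"
      using that n np by (intro add_mono mult_left_mono divide_right_mono) auto
    finally show ?thesis by simp
  qed
  have shuffle: "(x \<ominus> z) \<oplus> y = (x \<oplus> y) \<ominus> z" "(x \<oplus> z) \<oplus> y = (x \<oplus> y) \<oplus> z"
    if "x \<in> carrier A" "z \<in> carrier A" "y \<in> carrier A" for x y z
    using that by algebra+
  have "scale A (1 / n) (p \<ominus> h i) \<oplus> scale A (1 - 1 / n) p = p \<ominus> k"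
    using shuffle(1)[of "scale A (1 / n) p" "k" "scale A (1 - 1 / n) p"] p h[OF ij(1)]
      scale_add_left[OF p(1), of "1 / n" "1 - 1 / n"]
    by (simp add: k_def scale_minus scale_closed scale_one)
  then have 1: "nrm A (p \<ominus> k) \<le> 1"
    using bound[of "p \<ominus> h i" 1] nh[OF ij(1)] p h[OF ij(1)] n by simp
  have m: "complex_of_nat (card S) = of_real (n - 1)" by (simp add: n_def)
  have "nrm A (scale A (n - 1) p \<oplus> h i) \<le> n - 1"
    using partial[OF S(1,2)] unfolding m hi by (simp add: a_minus_def n_def)
  moreover have "scale A (1 / n) (scale A (n - 1) p \<oplus> h i) \<oplus> scale A (1 - (n - 1) / n) p = p \<oplus> k"
  proof -
    have "1 / n * (n - 1) + (1 - (n - 1) / n) = 1" using n by (simp add: field_simps)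
    then have "complex_of_real (1 / n) * complex_of_real (n - 1) + complex_of_real (1 - (n - 1) / n) = 1"
      by (simp only: of_real_mult[symmetric] of_real_add[symmetric] of_real_1)
    then have "scale A (complex_of_real (1 / n) * complex_of_real (n - 1)) p \<oplus> scale A (1 - (n - 1) / n) p = p"
      using scale_add_left[OF p(1), of "complex_of_real (1 / n) * complex_of_real (n - 1)" "1 - (n - 1) / n"]
      by (simp only: scale_one[OF p(1)])
    then show ?thesis
      using shuffle(2)[of "scale A (complex_of_real (1 / n) * complex_of_real (n - 1)) p" "k" "scale A (1 - (n - 1) / n) p"] p h[OF ij(1)]
      by (simp add: k_def scale_add_right scale_scale scale_closed del: of_real_diff)
  qed
  ultimately have 2: "nrm A (p \<oplus> k) \<le> 1"
    using bound[of "scale A (n - 1) p \<oplus> h i" "n - 1"] p h[OF ij(1)] n by (simp add: scale_closed)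
  have "k = \<zero>" by (rule both_signs_contractive_zero[OF p k 1 2])
  then have "scale A n k = \<zero>" by (simp add: scale_zero_right)
  then have "h i = \<zero>" using n h[OF ij(1)] by (simp add: k_def scale_scale scale_one)
  moreover have "star A (e i \<otimes> p) \<otimes> (e i \<otimes> p) = h i"
    using e[OF ij(1)] p by (simp add: h_def star_mult m_assoc) (metis m_assoc)
  ultimately show "e i \<otimes> e j = \<zero>"
    using nrm_eq_zero_of_star_mult[of "e i \<otimes> p"] e[OF ij(1)] p by (simp add: p_def)
qed

text \<open>By Visser's iteration, \<open>(nrm A a)\<^sup>2 \<one> - a\<^sup>* a\<close> is a positive multiple of a square.\<close>

lemma positive_functional_le:
  fixes g :: "'a \<Rightarrow> real"
  assumes a: "a \<in> carrier A"
    and add: "\<And>x y. x \<in> carrier A \<Longrightarrow> y \<in> carrier A \<Longrightarrow> g (x \<oplus> y) = g x + g y"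
    and scale: "\<And>r x. x \<in> carrier A \<Longrightarrow> g (scale A (complex_of_real r) x) = r * g x"
    and pos: "\<And>x. x \<in> carrier A \<Longrightarrow> 0 \<le> g (star A x \<otimes> x)"
  shows "g (star A a \<otimes> a) \<le> (nrm A a)\<^sup>2 * g \<one>"
proof (cases "a = \<zero>")
  case True
  then show ?thesis using scale[of \<one> 0] by (simp add: star_zero nrm_zero scale_zero)
next
  case False
  define h where "h = star A a \<otimes> a"
  define b where "b = scale A (1 / (nrm A a)\<^sup>2) h"
  have h: "h \<in> carrier A" "star A h = h" using a by (auto simp: h_def star_closed star_mult star_star)
  have n: "nrm A a > 0" using False nrm_eq_zero[OF a] nrm_nonneg[OF a] by simp
  have b: "b \<in> carrier A" "star A b = b" using h by (auto simp: b_def scale_closed star_scale)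
  have nb: "nrm A b \<le> 1"
    using n h cstar_identity[OF a] by (simp add: b_def nrm_scale h_def[symmetric] norm_divide norm_power)
  obtain d where d: "d \<in> carrier A" "star A d = d" "b \<oplus> d \<otimes> d = d \<oplus> d"
    using visser_limit[OF b(1) nb b(2)] by metis
  have "b \<oplus> star A (\<one> \<ominus> d) \<otimes> (\<one> \<ominus> d) = (b \<oplus> d \<otimes> d) \<oplus> (\<one> \<ominus> (d \<oplus> d))"
    unfolding star_minus[OF one_closed d(1)] star_one d(2) using b(1) d(1) r_one[OF d(1)] by algebra
  also have "\<dots> = \<one>" unfolding d(3) using d(1) by algebra
  finally have "g b + g (star A (\<one> \<ominus> d) \<otimes> (\<one> \<ominus> d)) = g \<one>"
    using add[of b "star A (\<one> \<ominus> d) \<otimes> (\<one> \<ominus> d)"] b d by (simp add: star_closed)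
  moreover have "0 \<le> g (star A (\<one> \<ominus> d) \<otimes> (\<one> \<ominus> d))" using d by (intro pos) auto
  ultimately have "g b \<le> g \<one>" by linarith
  moreover have "h = scale A (complex_of_real ((nrm A a)\<^sup>2)) b" using n h by (simp add: b_def scale_scale scale_one)
  ultimately have "g h = (nrm A a)\<^sup>2 * g b" using scale[OF b(1), of "(nrm A a)\<^sup>2"] by metis
  then show ?thesis using \<open>g b \<le> g \<one>\<close> by (simp add: h_def[symmetric] mult_left_mono)
qed

end

section \<open>Homomorphisms of graph algebras\<close>

text \<open>Splits off one monomial at a time, and from a monomial one letter at a time, without
  leaving \<open>star_polys X\<close>; words disappear from later arguments.\<close>

lemma star_polys_induct [consumes 1, case_names zero one gen gen_star add mult scale]:
  fixes q :: "'x star_poly"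
  assumes q: "q \<in> star_polys X" and zero: "P 0" and one: "P 1"
    and gen: "\<And>x. x \<in> X \<Longrightarrow> P (poly_gen x)" "\<And>x. x \<in> X \<Longrightarrow> P (poly_star (poly_gen x))"
    and add: "\<And>p q. p \<in> star_polys X \<Longrightarrow> q \<in> star_polys X \<Longrightarrow> P p \<Longrightarrow> P q \<Longrightarrow> P (p + q)"
    and mult: "\<And>p q. p \<in> star_polys X \<Longrightarrow> q \<in> star_polys X \<Longrightarrow> P p \<Longrightarrow> P q \<Longrightarrow> P (p * q)"
    and scale: "\<And>c p. p \<in> star_polys X \<Longrightarrow> P p \<Longrightarrow> P (poly_scale c p)"
  shows "P q"
proof -
  have word: "P (Poly_Mapping.single (Word ls) 1)" if "fst ` set ls \<subseteq> X" for ls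
    using that
  proof (induction ls)
    case Nil
    then show ?case using one by (simp add: zero_free_mon_def[symmetric])
  next
    case (Cons l ls)
    have eq: "Poly_Mapping.single (Word (l # ls)) (1::complex)
        = Poly_Mapping.single (Word [l]) 1 * Poly_Mapping.single (Word ls) 1"
      by (simp add: mult_single plus_free_mon_def)
    have "P (Poly_Mapping.single (Word [l]) 1)"
      using gen[of "fst l"] Cons.prems by (cases l; cases "snd l") (auto simp: poly_star_gen, simp add: poly_gen_def)
    then show ?case
      unfolding eq using Cons by (intro mult star_polys_single) auto
  qed
  from q show ?thesis
  proof (induction q rule: update_induct)
    case const
    then show ?case using zero by simp
  next
    case (update p w c)
    have eq: "Poly_Mapping.update w c p = p + Poly_Mapping.single w c"
      using update by (intro poly_mapping_eqI)
        (auto simp: lookup_update lookup_add lookup_single when_def in_keys_iff)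
    have "Poly_Mapping.keys (Poly_Mapping.update w c p) = insert w (Poly_Mapping.keys p)"
      using update by (auto simp: in_keys_iff lookup_update split: if_splits)
    then have in_S: "p \<in> star_polys X" "fst ` set (letters w) \<subseteq> X"
      using update.prems by (auto simp: star_polys_def)
    obtain ls where w: "w = Word ls" by (cases w)
    have "P (poly_scale c (Poly_Mapping.single w 1))"
      using in_S word[of ls] by (intro scale star_polys_single) (auto simp: w)
    then show ?case
      unfolding eq using in_S update by (intro add star_polys_single) (auto simp: single_eq_poly_scale[of w c])
  qed
qed

context universal_map
begin

lemma univ_map_nrm_le:
  assumes "P \<in> carrier (universal_cstar X R)"
  shows "nrm B (univ_map P) \<le> nrm (universal_cstar X R) P"
proof -
  obtain s where s: "s \<in> cauchy_polys X R" "P = seq_class X R s" using cls_cases[OF assms] by blast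
  obtain b where b: "eval_lim s b" using eval_lim_ex[OF s(1)] by blast
  have "limit_of (\<lambda>n. poly_eval (s n)) b"
    using b by (simp add: eval_lim_def limit_of_def poly_eval_closed)
  then have "nrm B b \<le> nrm (universal_cstar X R) P"
    using cls_nrm[OF s(1)] poly_eval_nrm_le[OF C_in[OF s(1)]]
    by (intro LIMSEQ_le[OF limit_of_nrm[of _ b]]) (auto simp: s)
  then show ?thesis using univ_map_eq[OF s(1) b] by (simp add: s)
qed

lemma univ_map_one: "univ_map (one (universal_cstar X R)) = one B"
  using univ_map_eq[OF C_const[OF star_polys_one] eval_lim_const] by (simp add: U_one poly_eval_one)

end

text \<open>Continuity is not part of \<open>star_hom\<close>; contractivity is carried along as a
  separate property so that homomorphisms commute with the limits added by the completion.\<close>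

definition contractive_on :: "('a, 'm) star_algebra_scheme \<Rightarrow> ('b, 'n) star_algebra_scheme \<Rightarrow> ('a \<Rightarrow> 'b) \<Rightarrow> bool" where
  "contractive_on A B f \<longleftrightarrow> (\<forall>a\<in>carrier A. nrm B (f a) \<le> nrm A a)"

lemma star_homD:
  assumes "f \<in> star_hom A B"
  shows "a \<in> carrier A \<Longrightarrow> f a \<in> carrier B"
    "a \<in> carrier A \<Longrightarrow> b \<in> carrier A \<Longrightarrow> f (a \<oplus>\<^bsub>A\<^esub> b) = f a \<oplus>\<^bsub>B\<^esub> f b"
    "a \<in> carrier A \<Longrightarrow> b \<in> carrier A \<Longrightarrow> f (a \<otimes>\<^bsub>A\<^esub> b) = f a \<otimes>\<^bsub>B\<^esub> f b"
    "a \<in> carrier A \<Longrightarrow> f (scale A c a) = scale B c (f a)"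
    "a \<in> carrier A \<Longrightarrow> f (star A a) = star B (f a)"
  using assms unfolding star_hom_def by auto

lemma star_hom_zero_minus:
  assumes "cstar_algebra A" "cstar_algebra B" "f \<in> star_hom A B"
  shows "f \<zero>\<^bsub>A\<^esub> = \<zero>\<^bsub>B\<^esub>"
    "a \<in> carrier A \<Longrightarrow> b \<in> carrier A \<Longrightarrow> f (a \<ominus>\<^bsub>A\<^esub> b) = f a \<ominus>\<^bsub>B\<^esub> f b"
proof -
  interpret A: cstar_algebra A by (rule assms)
  interpret B: cstar_algebra B by (rule assms)
  note f = star_homD[OF assms(3)]
  show "f \<zero>\<^bsub>A\<^esub> = \<zero>\<^bsub>B\<^esub>"
    using f(4)[of "\<zero>\<^bsub>A\<^esub>" 0] f(1)[of "\<zero>\<^bsub>A\<^esub>"] by (simp add: A.scale_zero B.scale_zero)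
  show "f (a \<ominus>\<^bsub>A\<^esub> b) = f a \<ominus>\<^bsub>B\<^esub> f b" if "a \<in> carrier A" "b \<in> carrier A"
    using that f(2)[of a "\<ominus>\<^bsub>A\<^esub> b"] f(4)[of b "- 1"] f(1)[of b]
    by (simp add: a_minus_def A.scale_minus_one B.scale_minus_one)
qed

lemma star_hom_limit:
  assumes A: "cstar_algebra A" and B: "cstar_algebra B" and f: "f \<in> star_hom A B" "contractive_on A B f"
    and lim: "cstar_algebra.limit_of A s a"
  shows "cstar_algebra.limit_of B (\<lambda>n. f (s n)) (f a)"
proof -
  interpret A: cstar_algebra A by (rule A)
  interpret B: cstar_algebra B by (rule B)
  have s: "s n \<in> carrier A" "a \<in> carrier A" for n using lim by (auto simp: A.limit_of_def)
  show ?thesis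
  proof (rule B.limit_ofI)
    show "nrm B (f (s n) \<ominus>\<^bsub>B\<^esub> f a) \<le> nrm A (s n \<ominus>\<^bsub>A\<^esub> a)" for n
      using s f(2) star_hom_zero_minus(2)[OF A B f(1) s(1) s(2), of n, symmetric]
      by (simp add: contractive_on_def)
  qed (use s lim star_homD(1)[OF f(1)] in \<open>auto simp: A.limit_of_def\<close>)
qed

lemma star_hom_comp:
  assumes "f \<in> star_hom A B" "g \<in> star_hom B C" shows "(\<lambda>x. g (f x)) \<in> star_hom A C"
  using assms unfolding star_hom_def by (auto simp: Pi_iff)

locale bip_algebra =
  fixes G :: "'v bip_graph"
begin

abbreviation "X \<equiv> left G \<union> right G"
abbreviation "A \<equiv> bip_cstar G"
abbreviation "gen \<equiv> bip_gen G"

sublocale bounded_relations X "bip_relations G" by (rule bip_bounded_relations)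

sublocale A: cstar_algebra "bip_cstar G" by (rule cstar_algebra_bip_cstar)

lemma gen_closed: "x \<in> X \<Longrightarrow> gen x \<in> carrier A"
  and star_gen: "x \<in> X \<Longrightarrow> star A (gen x) = gen x"
  and gen_idem: "x \<in> X \<Longrightarrow> gen x \<otimes>\<^bsub>A\<^esub> gen x = gen x"
  and gen_sums: "(\<Oplus>\<^bsub>A\<^esub>u\<in>left G. gen u) = \<one>\<^bsub>A\<^esub>" "(\<Oplus>\<^bsub>A\<^esub>v\<in>right G. gen v) = \<one>\<^bsub>A\<^esub>"
  and gen_nonedge: "u \<in> left G \<Longrightarrow> v \<in> right G \<Longrightarrow> {u, v} \<notin> edges G \<Longrightarrow> gen u \<otimes>\<^bsub>A\<^esub> gen v = \<zero>\<^bsub>A\<^esub>"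
  using bip_gen_projections[of G] unfolding bip_projections_def by blast+

abbreviation "pcls q \<equiv> cls (\<lambda>n::nat. q)"

lemma pcls_in: "q \<in> S \<Longrightarrow> pcls q \<in> carrier A"
  by (simp add: bip_cstar_def cls_in C_const)

lemma pcls_ops:
  shows "p \<in> S \<Longrightarrow> q \<in> S \<Longrightarrow> pcls (p + q) = pcls p \<oplus>\<^bsub>A\<^esub> pcls q"
    "p \<in> S \<Longrightarrow> q \<in> S \<Longrightarrow> pcls (p * q) = pcls p \<otimes>\<^bsub>A\<^esub> pcls q"
    "p \<in> S \<Longrightarrow> pcls (poly_scale c p) = scale A c (pcls p)"
    "p \<in> S \<Longrightarrow> pcls (poly_star p) = star A (pcls p)"
  by (simp_all add: bip_cstar_def cls_add cls_mult cls_scale cls_star C_const)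

lemma pcls_gen: "pcls (poly_gen x) = gen x" "pcls 0 = \<zero>\<^bsub>A\<^esub>" "pcls 1 = \<one>\<^bsub>A\<^esub>"
  by (simp_all add: bip_gen_def univ_gen_def bip_cstar_def U_zero U_one)

text \<open>Polynomials in the generators are dense. The star is covered by self-adjointness of the
  generators, and zero is the multiple 0 of the unit.\<close>

lemma bip_cstar_induct [consumes 1, case_names one gen add mult scale limit]:
  assumes a: "a \<in> carrier A" and one: "P \<one>\<^bsub>A\<^esub>" and gen: "\<And>x. x \<in> X \<Longrightarrow> P (gen x)"
    and add: "\<And>a b. a \<in> carrier A \<Longrightarrow> b \<in> carrier A \<Longrightarrow> P a \<Longrightarrow> P b \<Longrightarrow> P (a \<oplus>\<^bsub>A\<^esub> b)"
    and mult: "\<And>a b. a \<in> carrier A \<Longrightarrow> b \<in> carrier A \<Longrightarrow> P a \<Longrightarrow> P b \<Longrightarrow> P (a \<otimes>\<^bsub>A\<^esub> b)"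
    and scale: "\<And>a c. a \<in> carrier A \<Longrightarrow> P a \<Longrightarrow> P (scale A c a)"
    and limit: "\<And>s a. A.limit_of s a \<Longrightarrow> (\<And>n. P (s n)) \<Longrightarrow> P a"
  shows "P a"
proof -
  have poly: "P (pcls q)" if "q \<in> S" for q
    using that
  proof (induction q rule: star_polys_induct)
    case zero
    then show ?case using scale[OF A.one_closed one, of 0] by (simp add: pcls_gen A.scale_zero)
  next
    case (gen_star x)
    then show ?case using gen[of x] by (simp add: pcls_ops pcls_gen star_polys_gen star_gen)
  qed (simp_all add: one gen pcls_gen pcls_ops pcls_in add mult scale)
  have "\<exists>q\<in>S. nrm A (a \<ominus>\<^bsub>A\<^esub> pcls q) < 1 / Suc n" for n
    using polys_dense[of a "1 / Suc n"] a by (simp add: bip_cstar_def)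
  then obtain q where q: "\<And>n. q n \<in> S" "\<And>n. nrm A (a \<ominus>\<^bsub>A\<^esub> pcls (q n)) < 1 / Suc n" by metis
  have "A.limit_of (\<lambda>n. pcls (q n)) a"
  proof (rule A.limit_ofI)
    show "nrm A (pcls (q n) \<ominus>\<^bsub>A\<^esub> a) \<le> 1 / Suc n" for n
      using q[of n] pcls_in[of "q n"] a A.nrm_minus_commute[of a "pcls (q n)"] by simp
    show "(\<lambda>n. 1 / real (Suc n)) \<longlonglongrightarrow> 0" using LIMSEQ_inverse_real_of_nat by (simp add: inverse_eq_divide)
  qed (use q pcls_in a in auto)
  then show ?thesis using limit poly q by blast
qed

lemma star_hom_eqI:
  assumes B: "cstar_algebra B" and f: "f \<in> star_hom A B" "contractive_on A B f" "f \<one>\<^bsub>A\<^esub> = \<one>\<^bsub>B\<^esub>"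
    and g: "g \<in> star_hom A B" "contractive_on A B g" "g \<one>\<^bsub>A\<^esub> = \<one>\<^bsub>B\<^esub>"
    and eq: "\<And>x. x \<in> X \<Longrightarrow> f (gen x) = g (gen x)" and a: "a \<in> carrier A"
  shows "f a = g a"
  using a
proof (induction a rule: bip_cstar_induct)
  case (limit s a)
  interpret B: cstar_algebra B by (rule B)
  show ?case
    using star_hom_limit[OF A.cstar_algebra_axioms B f(1,2) limit(1)]
      star_hom_limit[OF A.cstar_algebra_axioms B g(1,2) limit(1)] limit(2) B.limit_of_unique by simp
qed (use f(3) g(3) eq star_homD[OF f(1)] star_homD[OF g(1)] in simp_all)

text \<open>The mapping property as given states neither a norm bound nor the image of the unit. The
  homomorphism \<open>h\<close> that it provides only serves to see that evaluation of polynomials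
  kills the relations; the homomorphism returned is this evaluation extended by limits, which is
  contractive and unital.\<close>

theorem bip_universal:
  assumes B: "cstar_algebra B" and e: "bip_projections G B e"
  obtains f where "f \<in> star_hom A B" "contractive_on A B f" "f \<one>\<^bsub>A\<^esub> = \<one>\<^bsub>B\<^esub>"
    "\<And>x. x \<in> X \<Longrightarrow> f (gen x) = e x"
proof -
  interpret B: cstar_algebra B by (rule B)
  obtain h where h: "h \<in> star_hom A B" "\<And>x. x \<in> X \<Longrightarrow> h (gen x) = e x"
    using bip_cstar_universal[OF B e] by blast
  define e' where "e' x = (if x \<in> X then e x else \<zero>\<^bsub>B\<^esub>)" for x
  interpret evaluation B e'
    using e by unfold_locales (auto simp: e'_def bip_projections_def)
  have e'_eq: "e' x = e x" if "x \<in> X" for x using that by (simp add: e'_def)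
  have sum: "h (\<Oplus>\<^bsub>A\<^esub>u\<in>K. gen u) = (\<Oplus>\<^bsub>B\<^esub>u\<in>K. e u)" if "K \<subseteq> X" for K
    using that
  proof (induction K rule: infinite_finite_induct)
    case (insert x K)
    then have "(\<Oplus>\<^bsub>A\<^esub>u\<in>K. gen u) \<in> carrier A" "e \<in> K \<rightarrow> carrier B" "e x \<in> carrier B"
      using gen_closed e by (auto intro!: A.finsum_closed simp: bip_projections_def)
    then show ?case
      using insert gen_closed h star_homD(2)[OF h(1)]
      by (subst A.finsum_insert; (subst B.finsum_insert)?) auto
  qed (simp_all add: star_hom_zero_minus(1)[OF A.cstar_algebra_axioms B h(1)] A.finsum_infinite B.finsum_infinite)
  have h_one: "h \<one>\<^bsub>A\<^esub> = \<one>\<^bsub>B\<^esub>"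
    using sum[of "left G"] e gen_sums(1) by (simp add: bip_projections_def)
  have poly_eval_h: "poly_eval q = h (pcls q)" if "q \<in> S" for q
    using that
  proof (induction q rule: star_polys_induct)
    case zero
    then show ?case using star_hom_zero_minus(1)[OF A.cstar_algebra_axioms B h(1)]
      by (simp add: poly_eval_zero pcls_gen)
  next
    case (gen_star x)
    then show ?case using star_homD(5)[OF h(1)] h(2) gen_closed
      by (simp add: poly_eval_star poly_eval_gen pcls_ops star_polys_gen pcls_gen e'_eq)
  qed (simp_all add: h h_one poly_eval_gen pcls_gen e'_eq poly_eval_one poly_eval_add poly_eval_mult
      poly_eval_scale pcls_ops pcls_in star_homD[OF h(1)])
  interpret universal_map X "bip_relations G" B e'
  proof unfold_locales
    fix r assume r: "r \<in> bip_relations G"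
    then have "poly_eval r = h (pcls r)" using relations poly_eval_h by blast
    also have "pcls r = \<zero>\<^bsub>A\<^esub>" using cls_const_relation[OF r] by (simp add: bip_cstar_def)
    finally show "poly_eval r = \<zero>\<^bsub>B\<^esub>"
      using star_hom_zero_minus(1)[OF A.cstar_algebra_axioms B h(1)] by simp
  qed
  show thesis
  proof
    show "univ_map \<in> star_hom A B" using univ_map_star_hom by (simp add: bip_cstar_def)
    show "contractive_on A B univ_map" using univ_map_nrm_le by (simp add: bip_cstar_def contractive_on_def)
    show "univ_map \<one>\<^bsub>A\<^esub> = \<one>\<^bsub>B\<^esub>" using univ_map_one by (simp add: bip_cstar_def)
    show "univ_map (gen x) = e x" if "x \<in> X" for x
      using univ_map_gen[OF that] that by (simp add: bip_gen_def e'_eq)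
  qed
qed

end

section \<open>Ideals of noncommutative polynomials\<close>

definition two_sided_ideal :: "'a::ring_1 set \<Rightarrow> bool" where
  "two_sided_ideal J \<longleftrightarrow> 0 \<in> J \<and> (\<forall>a\<in>J. \<forall>b\<in>J. a + b \<in> J) \<and> (\<forall>a\<in>J. \<forall>x. x * a \<in> J \<and> a * x \<in> J)"

locale ring_ideal =
  fixes J :: "'a::ring_1 set"
  assumes ideal: "two_sided_ideal J"
begin

definition eqv :: "'a \<Rightarrow> 'a \<Rightarrow> bool" (infix \<open>\<sim>\<close> 50) where
  "a \<sim> b \<longleftrightarrow> a - b \<in> J"

lemma zero_in: "0 \<in> J" and add_in: "a \<in> J \<Longrightarrow> b \<in> J \<Longrightarrow> a + b \<in> J"
  and left_in: "a \<in> J \<Longrightarrow> x * a \<in> J" and right_in: "a \<in> J \<Longrightarrow> a * x \<in> J"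
  using ideal by (auto simp: two_sided_ideal_def)

lemma uminus_in: "a \<in> J \<Longrightarrow> - a \<in> J"
  using left_in[of a "- 1"] by simp

lemma diff_in: "a \<in> J \<Longrightarrow> b \<in> J \<Longrightarrow> a - b \<in> J"
  using add_in[of a "- b"] uminus_in by simp

lemma eqv_refl [simp]: "a \<sim> a" by (simp add: eqv_def zero_in)

lemma eqv_sym: "a \<sim> b \<Longrightarrow> b \<sim> a"
  using uminus_in[of "a - b"] by (simp add: eqv_def)

lemma eqv_trans [trans]: "a \<sim> b \<Longrightarrow> b \<sim> c \<Longrightarrow> a \<sim> c"
  using add_in[of "a - b" "b - c"] by (simp add: eqv_def)

lemma eqv_add: "a \<sim> b \<Longrightarrow> c \<sim> d \<Longrightarrow> a + c \<sim> b + d"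
  using add_in[of "a - b" "c - d"] by (simp add: eqv_def algebra_simps)

lemma eqv_diff: "a \<sim> b \<Longrightarrow> c \<sim> d \<Longrightarrow> a - c \<sim> b - d"
  using diff_in[of "a - b" "c - d"] by (simp add: eqv_def algebra_simps)

lemma eqv_mult: "a \<sim> b \<Longrightarrow> c \<sim> d \<Longrightarrow> a * c \<sim> b * d"
  using add_in[OF right_in[of "a - b" c] left_in[of "c - d" b]] by (simp add: eqv_def algebra_simps)

lemma eqv_sum: "(\<And>i. i \<in> I \<Longrightarrow> f i \<sim> g i) \<Longrightarrow> sum f I \<sim> sum g I"
  by (induction I rule: infinite_finite_induct) (auto intro: eqv_add)

lemma eqv_zero_iff: "a \<sim> 0 \<longleftrightarrow> a \<in> J" by (simp add: eqv_def)

lemma eqv_in: "a \<sim> b \<Longrightarrow> b \<in> J \<Longrightarrow> a \<in> J"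
  using eqv_trans eqv_zero_iff by blast

lemma sum_in: "(\<And>i. i \<in> I \<Longrightarrow> f i \<in> J) \<Longrightarrow> sum f I \<in> J"
  by (induction I rule: infinite_finite_induct) (auto intro: add_in zero_in)

lemma eqv_sum_single:
  assumes "finite I" "i \<in> I" "\<And>j. j \<in> I \<Longrightarrow> j \<noteq> i \<Longrightarrow> f j \<in> J"
  shows "sum f I \<sim> f i"
proof -
  have "sum f I = f i + sum f (I - {i})" using assms(1,2) by (simp add: sum.remove)
  moreover have "sum f (I - {i}) \<in> J" using assms(3) by (intro sum_in) auto
  ultimately show ?thesis by (simp add: eqv_def)
qed

lemma eqv_sum_restrict:
  assumes "finite I" "K \<subseteq> I" "\<And>j. j \<in> I - K \<Longrightarrow> f j \<in> J"
  shows "sum f I \<sim> sum f K"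
  using sum_in[of "I - K" f] assms(3) sum.subset_diff[OF assms(2,1), of f] by (simp add: eqv_def)

end

text \<open>The relations of a graph algebra, holding modulo \<open>J\<close>. An arbitrary ring and
  ideal are allowed so that one calculation serves the evaluation kernel and the two larger ideals
  alike. Edges are ordered pairs, and \<open>swap\<close> produces the mirrored statements.\<close>

locale graph_ideal = ring_ideal J for J :: "'a::ring_1 set" +
  fixes U V :: "'v set" and E :: "('v \<times> 'v) set" and p :: "'v \<Rightarrow> 'a"
  assumes finite_U: "finite U" and finite_V: "finite V"
    and E_sub: "E \<subseteq> U \<times> V"
    and idem_U: "u \<in> U \<Longrightarrow> p u * p u - p u \<in> J" and idem_V: "v \<in> V \<Longrightarrow> p v * p v - p v \<in> J"
    and orth_U: "u \<in> U \<Longrightarrow> u' \<in> U \<Longrightarrow> u \<noteq> u' \<Longrightarrow> p u * p u' \<in> J"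
    and orth_V: "v \<in> V \<Longrightarrow> v' \<in> V \<Longrightarrow> v \<noteq> v' \<Longrightarrow> p v * p v' \<in> J"
    and sum_U: "(\<Sum>u\<in>U. p u) - 1 \<in> J" and sum_V: "(\<Sum>v\<in>V. p v) - 1 \<in> J"
    and nonedge_UV: "u \<in> U \<Longrightarrow> v \<in> V \<Longrightarrow> (u, v) \<notin> E \<Longrightarrow> p u * p v \<in> J"
    and nonedge_VU: "u \<in> U \<Longrightarrow> v \<in> V \<Longrightarrow> (u, v) \<notin> E \<Longrightarrow> p v * p u \<in> J"
begin

lemma swap: "graph_ideal J V U (E\<inverse>) p"
  using finite_U finite_V E_sub idem_U idem_V orth_U orth_V sum_U sum_V nonedge_UV nonedge_VU
  by unfold_locales auto

text \<open>Candidate for the image of a vertex of the other graph, where \<open>D\<close> consists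
  of the edges that are mapped to edges at this vertex.\<close>

definition edge_sum :: "('v \<times> 'v) set \<Rightarrow> 'a" where
  "edge_sum D = (\<Sum>(u, v)\<in>D. p u * p v)"

text \<open>At a left vertex \<open>u\<close> the edges in \<open>D\<close> and the remaining ones
  do not interact: no product through \<open>u\<close> passes from one part to the other. This makes
  \<open>p u\<close> commute with the sum of the \<open>p v\<close> over the part in
  \<open>D\<close>.\<close>

definition left_saturated :: "('v \<times> 'v) set \<Rightarrow> bool" where
  "left_saturated D \<longleftrightarrow> D \<subseteq> E \<and> (\<forall>u v w. (u, v) \<in> D \<longrightarrow> (u, w) \<in> E - D \<longrightarrow> p v * p u * p w \<in> J \<and> p w * p u * p v \<in> J)"

definition right_saturated :: "('v \<times> 'v) set \<Rightarrow> bool" where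
  "right_saturated D \<longleftrightarrow> D \<subseteq> E \<and> (\<forall>u v w. (u, v) \<in> D \<longrightarrow> (w, v) \<in> E - D \<longrightarrow> p u * p v * p w \<in> J \<and> p w * p v * p u \<in> J)"

lemma finite_E: "finite E" using E_sub finite_U finite_V by (meson finite_SigmaI finite_subset)

lemma finite_image_E: "D \<subseteq> E \<Longrightarrow> finite (D `` {u})" "D \<subseteq> E \<Longrightarrow> D `` {u} \<subseteq> V"
  using E_sub finite_V by (auto intro: finite_subset[of _ V])

lemma edge_sum_left:
  assumes "D \<subseteq> E" shows "edge_sum D = (\<Sum>u\<in>U. p u * (\<Sum>v\<in>D `` {u}. p v))"
    "(\<Sum>(u, v)\<in>D. p v * p u) = (\<Sum>u\<in>U. (\<Sum>v\<in>D `` {u}. p v) * p u)"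
proof -
  have D: "D = Sigma U (\<lambda>u. D `` {u})" using assms E_sub by auto
  show "edge_sum D = (\<Sum>u\<in>U. p u * (\<Sum>v\<in>D `` {u}. p v))"
    unfolding edge_sum_def using finite_U finite_image_E(1)[OF assms]
    by (subst D, subst sum.Sigma[symmetric]) (auto simp: sum_distrib_left)
  show "(\<Sum>(u, v)\<in>D. p v * p u) = (\<Sum>u\<in>U. (\<Sum>v\<in>D `` {u}. p v) * p u)"
    using finite_U finite_image_E(1)[OF assms]
    by (subst D, subst sum.Sigma[symmetric]) (auto simp: sum_distrib_right)
qed

text \<open>Relative to the decomposition \<open>1 \<sim> ?R + ?T\<close>, saturation (and the
  relations, for non-edges) kills the off-diagonal blocks \<open>?T * p u * ?R\<close> and
  \<open>?R * p u * ?T\<close>; what is block diagonal commutes with \<open>?R\<close>.\<close>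

lemma left_saturated_commute:
  assumes D: "left_saturated D" and u: "u \<in> U"
  shows "(\<Sum>v\<in>D `` {u}. p v) * p u \<sim> p u * (\<Sum>v\<in>D `` {u}. p v)"
proof -
  let ?R = "\<Sum>v\<in>D `` {u}. p v" and ?T = "\<Sum>w\<in>V - D `` {u}. p w"
  have DE: "D \<subseteq> E" using D by (simp add: left_saturated_def)
  have "?R + ?T = (\<Sum>v\<in>V. p v)"
    using finite_image_E(2)[OF DE] finite_V by (metis add.commute sum.subset_diff)
  then have one: "1 \<sim> ?R + ?T" using sum_V eqv_sym by (simp add: eqv_def)
  have in_J: "p w * p u * p v \<in> J \<and> p v * p u * p w \<in> J" if "v \<in> D `` {u}" "w \<in> V - D `` {u}" for v w
  proof (cases "(u, w) \<in> E")
    case True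
    then show ?thesis using that D by (auto simp: left_saturated_def)
  next
    case False
    then show ?thesis
      using that u nonedge_UV[of u w] nonedge_VU[of u w] left_in[of "p u * p w" "p v"] right_in[of "p w * p u" "p v"]
      by (auto simp: mult.assoc)
  qed
  have 1: "?T * p u * ?R \<in> J" "?R * p u * ?T \<in> J"
    using in_J by (auto simp: sum_distrib_left sum_distrib_right intro!: sum_in)
  have "?R * p u * 1 \<sim> ?R * p u * (?R + ?T)" by (rule eqv_mult[OF eqv_refl one])
  also have "?R * p u * (?R + ?T) \<sim> ?R * p u * ?R" using 1 by (simp add: distrib_left eqv_def)
  also have "?R * p u * ?R \<sim> (?R + ?T) * (p u * ?R)"
    using uminus_in[OF 1(1)] by (simp add: algebra_simps eqv_def)
  also have "(?R + ?T) * (p u * ?R) \<sim> 1 * (p u * ?R)" by (rule eqv_mult[OF eqv_sym[OF one] eqv_refl])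
  finally show ?thesis by simp
qed

lemma edge_sum_commute:
  assumes "left_saturated D" shows "edge_sum D \<sim> (\<Sum>(u, v)\<in>D. p v * p u)"
proof -
  have "D \<subseteq> E" using assms by (simp add: left_saturated_def)
  then show ?thesis
    unfolding edge_sum_left[OF \<open>D \<subseteq> E\<close>] by (intro eqv_sum eqv_sym[OF left_saturated_commute[OF assms]])
qed

lemma sum_mult_sum:
  assumes "D \<subseteq> V" "D' \<subseteq> V" shows "(\<Sum>v\<in>D. p v) * (\<Sum>v\<in>D'. p v) \<sim> (\<Sum>v\<in>D \<inter> D'. p v)"
proof -
  have fin: "finite D" "finite D'" using assms finite_V finite_subset by blast+
  have "(\<Sum>v\<in>D. p v) * (\<Sum>v\<in>D'. p v) = (\<Sum>v\<in>D. \<Sum>w\<in>D'. p v * p w)"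
    by (simp add: sum_product)
  also have "\<dots> \<sim> (\<Sum>v\<in>D. if v \<in> D' then p v else 0)"
  proof (rule eqv_sum)
    fix v assume v: "v \<in> D"
    show "(\<Sum>w\<in>D'. p v * p w) \<sim> (if v \<in> D' then p v else 0)"
    proof (cases "v \<in> D'")
      case True
      have "(\<Sum>w\<in>D'. p v * p w) \<sim> p v * p v"
        using True fin v assms orth_V by (intro eqv_sum_single) auto
      also have "p v * p v \<sim> p v" using idem_V v assms by (auto simp: eqv_def)
      finally show ?thesis using True by simp
    next
      case False
      then show ?thesis using v assms orth_V by (auto simp: eqv_zero_iff intro!: sum_in)
    qed
  qed
  also have "(\<Sum>v\<in>D. if v \<in> D' then p v else 0) = (\<Sum>v\<in>D \<inter> D'. p v)"
    using fin by (simp add: sum.inter_restrict)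
  finally show ?thesis .
qed

text \<open>Commuting the partial sum at \<open>u\<close> to the front brings \<open>p u\<close> and
  \<open>p u'\<close> side by side, where orthogonality removes the mixed terms. The partial sums
  that remain multiply like indicator functions.\<close>

lemma edge_sum_left_left:
  assumes D: "left_saturated D" and D': "left_saturated D'"
  shows "edge_sum D * edge_sum D' \<sim> edge_sum (D \<inter> D')"
proof -
  let ?R = "\<lambda>D u. \<Sum>v\<in>D `` {u}. p v"
  have DE: "D \<subseteq> E" "D' \<subseteq> E" "D \<inter> D' \<subseteq> E" using D D' by (auto simp: left_saturated_def)
  have img: "(D \<inter> D') `` {u} = D `` {u} \<inter> D' `` {u}" for u by auto
  have "edge_sum D * edge_sum D' = (\<Sum>u\<in>U. \<Sum>u'\<in>U. (p u * ?R D u) * (p u' * ?R D' u'))"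
    unfolding edge_sum_left[OF DE(1)] edge_sum_left[OF DE(2)] by (rule sum_product)
  also have "\<dots> \<sim> (\<Sum>u\<in>U. \<Sum>u'\<in>U. ?R D u * (p u * p u') * ?R D' u')"
  proof (intro eqv_sum)
    fix u u' assume "u \<in> U" "u' \<in> U"
    then have "(p u * ?R D u) * (p u' * ?R D' u') \<sim> (?R D u * p u) * (p u' * ?R D' u')"
      by (intro eqv_mult eqv_refl eqv_sym[OF left_saturated_commute[OF D]])
    then show "(p u * ?R D u) * (p u' * ?R D' u') \<sim> ?R D u * (p u * p u') * ?R D' u'"
      by (simp add: mult.assoc)
  qed
  also have "\<dots> \<sim> (\<Sum>u\<in>U. ?R D u * (p u * p u) * ?R D' u)"
    using finite_U orth_U left_in right_in by (intro eqv_sum eqv_sum_single) auto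
  also have "\<dots> \<sim> (\<Sum>u\<in>U. p u * ?R (D \<inter> D') u)"
  proof (intro eqv_sum)
    fix u assume u: "u \<in> U"
    have "?R D u * (p u * p u) * ?R D' u \<sim> ?R D u * p u * ?R D' u"
      using idem_U[OF u] by (intro eqv_mult eqv_refl) (simp add: eqv_def)
    also have "?R D u * p u * ?R D' u \<sim> p u * ?R D u * ?R D' u"
      using u by (intro eqv_mult eqv_refl left_saturated_commute[OF D])
    also have "p u * ?R D u * ?R D' u \<sim> p u * ?R (D \<inter> D') u"
      unfolding img mult.assoc using finite_image_E(2) DE by (intro eqv_mult eqv_refl sum_mult_sum) auto
    finally show "?R D u * (p u * p u) * ?R D' u \<sim> p u * ?R (D \<inter> D') u" .
  qed
  also have "(\<Sum>u\<in>U. p u * ?R (D \<inter> D') u) = edge_sum (D \<inter> D')"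
    using edge_sum_left(1)[OF DE(3)] by simp
  finally show ?thesis .
qed

lemma right_saturated_swap: "right_saturated D \<longleftrightarrow> graph_ideal.left_saturated J (E\<inverse>) p (D\<inverse>)"
proof -
  interpret s: graph_ideal J V U "E\<inverse>" p by (rule swap)
  show ?thesis unfolding right_saturated_def s.left_saturated_def by auto
qed

lemma edge_sum_swap: "graph_ideal.edge_sum p (D\<inverse>) = (\<Sum>(u, v)\<in>D. p v * p u)"
proof -
  interpret s: graph_ideal J V U "E\<inverse>" p by (rule swap)
  have "s.edge_sum (D\<inverse>) = (\<Sum>(u, v)\<in>prod.swap ` D. p u * p v)"
    unfolding s.edge_sum_def by (intro sum.cong) auto
  also have "\<dots> = (\<Sum>(u, v)\<in>D. p v * p u)"
    by (subst sum.reindex) (auto intro!: sum.cong)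
  finally show ?thesis .
qed

lemma edge_sum_commute_right:
  assumes "right_saturated D" shows "edge_sum D \<sim> (\<Sum>(u, v)\<in>D. p v * p u)"
proof -
  interpret s: graph_ideal J V U "E\<inverse>" p by (rule swap)
  have "s.edge_sum (D\<inverse>) \<sim> (\<Sum>(u, v)\<in>D\<inverse>. p v * p u)"
    using assms right_saturated_swap by (intro s.edge_sum_commute) simp
  moreover have "(\<Sum>(u, v)\<in>D\<inverse>. p v * p u) = edge_sum D"
    using s.edge_sum_swap[of "D\<inverse>"] by simp
  ultimately show ?thesis using eqv_sym by (simp add: edge_sum_swap)
qed

text \<open>The second factor is rewritten with the right vertex in front. Then a partial sum over
  right vertices meets \<open>p v\<close> and, after one commutation, a partial sum over left
  vertices meets \<open>p u\<close>; each contact acts as an indicator function, of \<open>D\<close>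
  and then of \<open>D'\<close>.\<close>

lemma edge_sum_left_right:
  assumes D: "left_saturated D" and D': "right_saturated D'"
  shows "edge_sum D * edge_sum D' \<sim> edge_sum (D \<inter> D')"
proof -
  interpret s: graph_ideal J V U "E\<inverse>" p by (rule swap)
  have D's: "s.left_saturated (D'\<inverse>)" using D' right_saturated_swap by simp
  have DE: "D \<subseteq> E" "D' \<subseteq> E" using D D' by (auto simp: left_saturated_def right_saturated_def)
  then have DUV: "D \<subseteq> U \<times> V" using E_sub by auto
  have finD: "finite D" using DE(1) finite_E finite_subset by blast
  let ?R = "\<lambda>u. \<Sum>v\<in>D `` {u}. p v" and ?T = "\<lambda>v. \<Sum>u\<in>D'\<inverse> `` {v}. p u"
  have "edge_sum D' \<sim> (\<Sum>(u, v)\<in>D'. p v * p u)" by (rule edge_sum_commute_right[OF D'])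
  also have "(\<Sum>(u, v)\<in>D'. p v * p u) = (\<Sum>v\<in>V. p v * ?T v)"
    using edge_sum_swap[of D'] s.edge_sum_left(1)[of "D'\<inverse>"] DE(2) by simp
  finally have "edge_sum D * edge_sum D' \<sim> (\<Sum>u\<in>U. p u * ?R u) * (\<Sum>v\<in>V. p v * ?T v)"
    unfolding edge_sum_left[OF DE(1)] by (intro eqv_mult eqv_refl)
  also have "(\<Sum>u\<in>U. p u * ?R u) * (\<Sum>v\<in>V. p v * ?T v) = (\<Sum>u\<in>U. \<Sum>v\<in>V. p u * (?R u * p v) * ?T v)"
    by (simp add: sum_product mult.assoc)
  also have "\<dots> \<sim> (\<Sum>u\<in>U. \<Sum>v\<in>V. if (u, v) \<in> D then p u * p v * ?T v else 0)"
  proof (intro eqv_sum)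
    fix u v assume uv: "u \<in> U" "v \<in> V"
    have "?R u * p v \<sim> (if (u, v) \<in> D then p v else 0)"
      using sum_mult_sum[OF finite_image_E(2)[OF DE(1)], of "{v}" u] uv
      by (cases "(u, v) \<in> D") (auto simp: Int_insert_right)
    then have "p u * (?R u * p v) * ?T v \<sim> p u * (if (u, v) \<in> D then p v else 0) * ?T v"
      by (intro eqv_mult eqv_refl)
    then show "p u * (?R u * p v) * ?T v \<sim> (if (u, v) \<in> D then p u * p v * ?T v else 0)"
      by (auto split: if_splits)
  qed
  also have "(\<Sum>u\<in>U. \<Sum>v\<in>V. if (u, v) \<in> D then p u * p v * ?T v else 0)
      = (\<Sum>(u, v)\<in>U \<times> V. if (u, v) \<in> D then p u * p v * ?T v else 0)"
    using finite_U finite_V by (simp add: sum.cartesian_product)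
  also have "\<dots> = (\<Sum>(u, v)\<in>D. p u * p v * ?T v)"
    using DUV finite_U finite_V by (intro sum.mono_neutral_cong_right) auto
  also have "\<dots> \<sim> (\<Sum>(u, v)\<in>D. if (u, v) \<in> D' then p u * p v else 0)"
  proof (intro eqv_sum)
    fix e assume e: "e \<in> D"
    obtain u v where uv: "e = (u, v)" "u \<in> U" "v \<in> V" using DUV e by auto
    have "p u * p v * ?T v \<sim> p u * (?T v * p v)"
      using eqv_mult[OF eqv_refl eqv_sym[OF s.left_saturated_commute[OF D's uv(3)]], of "p u"]
      by (simp add: mult.assoc)
    also have "p u * (?T v * p v) = (p u * ?T v) * p v" by (simp add: mult.assoc)
    also have "(p u * ?T v) * p v \<sim> (if (u, v) \<in> D' then p u else 0) * p v"
    proof -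
      have "p u * ?T v \<sim> (\<Sum>x\<in>{u} \<inter> D'\<inverse> `` {v}. p x)"
        using s.sum_mult_sum[of "{u}" "D'\<inverse> `` {v}"] uv DE(2) E_sub by auto
      then have "p u * ?T v \<sim> (if (u, v) \<in> D' then p u else 0)" by (cases "(u, v) \<in> D'") auto
      then show ?thesis by (intro eqv_mult eqv_refl)
    qed
    finally show "(case e of (u, v) \<Rightarrow> p u * p v * ?T v) \<sim> (case e of (u, v) \<Rightarrow> if (u, v) \<in> D' then p u * p v else 0)"
      by (auto simp: uv(1) split: if_splits)
  qed
  also have "(\<Sum>(u, v)\<in>D. if (u, v) \<in> D' then p u * p v else 0) = edge_sum (D \<inter> D')"
    unfolding edge_sum_def using finD by (subst sum.inter_restrict) (auto intro!: sum.cong)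
  finally show ?thesis .
qed

text \<open>Mirror image of \<open>edge_sum_left_right\<close>; exchanging the sides reverses every
  product, hence the order \<open>p v * p u\<close> in the result.\<close>

lemma edge_sum_right_left:
  assumes D: "right_saturated D" and D': "left_saturated D'"
  shows "edge_sum D * edge_sum D' \<sim> (\<Sum>(u, v)\<in>D \<inter> D'. p v * p u)"
proof -
  interpret s: graph_ideal J V U "E\<inverse>" p by (rule swap)
  have "s.edge_sum (D\<inverse>) * s.edge_sum (D'\<inverse>) \<sim> s.edge_sum (D\<inverse> \<inter> D'\<inverse>)"
    using D D' right_saturated_swap s.right_saturated_swap[of "D'\<inverse>"] by (intro s.edge_sum_left_right) auto
  moreover have "D\<inverse> \<inter> D'\<inverse> = (D \<inter> D')\<inverse>" by auto
  ultimately have "(\<Sum>(u, v)\<in>D. p v * p u) * (\<Sum>(u, v)\<in>D'. p v * p u) \<sim> (\<Sum>(u, v)\<in>D \<inter> D'. p v * p u)"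
    by (simp only: edge_sum_swap)
  then show ?thesis
    using eqv_mult[OF edge_sum_commute_right[OF D] edge_sum_commute[OF D']] eqv_trans by blast
qed

lemma edge_sum_right_right:
  assumes D: "right_saturated D" and D': "right_saturated D'"
  shows "edge_sum D * edge_sum D' \<sim> (\<Sum>(u, v)\<in>D \<inter> D'. p v * p u)"
proof -
  interpret s: graph_ideal J V U "E\<inverse>" p by (rule swap)
  have "s.edge_sum (D\<inverse>) * s.edge_sum (D'\<inverse>) \<sim> s.edge_sum (D\<inverse> \<inter> D'\<inverse>)"
    using D D' right_saturated_swap by (intro s.edge_sum_left_left) auto
  moreover have "D\<inverse> \<inter> D'\<inverse> = (D \<inter> D')\<inverse>" by auto
  ultimately have "(\<Sum>(u, v)\<in>D. p v * p u) * (\<Sum>(u, v)\<in>D'. p v * p u) \<sim> (\<Sum>(u, v)\<in>D \<inter> D'. p v * p u)"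
    by (simp only: edge_sum_swap)
  then show ?thesis
    using eqv_mult[OF edge_sum_commute_right[OF D] edge_sum_commute_right[OF D']] eqv_trans by blast
qed

end

section \<open>Generated ideals, and words with cherries of both types\<close>

inductive_set gen_ideal :: "'a::ring_1 set \<Rightarrow> 'a set" for S where
  zero: "0 \<in> gen_ideal S"
| gen: "a \<in> S \<Longrightarrow> a \<in> gen_ideal S"
| add: "a \<in> gen_ideal S \<Longrightarrow> b \<in> gen_ideal S \<Longrightarrow> a + b \<in> gen_ideal S"
| left: "a \<in> gen_ideal S \<Longrightarrow> x * a \<in> gen_ideal S"
| right: "a \<in> gen_ideal S \<Longrightarrow> a * x \<in> gen_ideal S"

lemma two_sided_ideal_gen_ideal: "two_sided_ideal (gen_ideal S)"
  by (auto simp: two_sided_ideal_def intro: gen_ideal.intros)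

text \<open>The arbitrary element \<open>x\<close> between two generators absorbs the multipliers by
  which members of the two ideals are built.\<close>

lemma (in ring_ideal) gen_ideal_mult:
  assumes ST: "\<And>s t x. s \<in> S \<Longrightarrow> t \<in> T \<Longrightarrow> s * x * t \<in> J"
    and a: "a \<in> gen_ideal S" and b: "b \<in> gen_ideal T"
  shows "a * b \<in> J"
proof -
  have 1: "s * x * b \<in> J" if "s \<in> S" for s x
    using b
  proof (induction b arbitrary: x)
    case (left b y)
    show ?case using left(2)[of "x * y"] by (simp add: mult.assoc)
  next
    case (right b y)
    show ?case using right_in[OF right(2)[of x], of y] by (simp add: mult.assoc)
  qed (use that ST in \<open>auto simp: distrib_left zero_in add_in\<close>)
  have "a * x * b \<in> J" for x
    using a
  proof (induction a arbitrary: x)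
    case (left a y)
    show ?case using left_in[OF left(2)[of x], of y] by (simp add: mult.assoc)
  next
    case (right a y)
    show ?case using right(2)[of "y * x"] by (simp add: mult.assoc)
  qed (use 1 in \<open>auto simp: distrib_right zero_in add_in\<close>)
  from this[of 1] show ?thesis by simp
qed

text \<open>Meant for \<open>poly_star\<close>: reversal exchanges left and right multiples, so
  invariance of an ideal can be read off its generators.\<close>

lemma gen_ideal_antimult:
  assumes add: "\<And>a b. f (a + b) = f a + f b" and mult: "\<And>a b. f (a * b) = f b * f a"
    and gen: "\<And>s. s \<in> S \<Longrightarrow> f s \<in> gen_ideal S" and a: "a \<in> gen_ideal S"
  shows "f a \<in> gen_ideal S"
  using a
proof induction
  case zero
  have "f 0 = 0" using add[of 0 0] by simp
  then show ?case by (simp add: gen_ideal.zero)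
qed (auto simp: add mult intro: gen gen_ideal.intros)

text \<open>
  A cherry \<open>v - u - w\<close> is a path whose product may be nonzero; the cherries come in two types.
  The types are constant on 4-cycles, and on three pairwise cherries with a common centre.
\<close>

locale cherries = graph_ideal J U V E p for J :: "'a::ring_1 set" and U V :: "'v set" and E p +
  fixes C :: "bool \<Rightarrow> 'v \<Rightarrow> 'v \<Rightarrow> 'v \<Rightarrow> bool"
  assumes disjoint: "U \<inter> V = {}"
    and C_sym: "C b v u w \<Longrightarrow> C b w u v"
    and C_adj: "C b v u w \<Longrightarrow> (v, u) \<in> E \<union> E\<inverse> \<and> (u, w) \<in> E \<union> E\<inverse> \<and> v \<noteq> w"
    and C_excl: "C b v u w \<Longrightarrow> \<not> C (\<not> b) v u w"
    and C_cycle: "\<lbrakk>(v, u) \<in> E \<union> E\<inverse>; (u, w) \<in> E \<union> E\<inverse>; (w, u') \<in> E \<union> E\<inverse>; (u', v) \<in> E \<union> E\<inverse>; v \<noteq> w; u \<noteq> u'\<rbrakk>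
      \<Longrightarrow> \<exists>b. C b v u w \<and> C b u w u'"
    and C_vanish: "\<lbrakk>(v, u) \<in> E \<union> E\<inverse>; (u, w) \<in> E \<union> E\<inverse>; v \<noteq> w; \<And>b. \<not> C b v u w\<rbrakk> \<Longrightarrow> p v * p u * p w \<in> J"
    and C_triangle: "\<lbrakk>C b x u y; C b' y u z; C b'' x u z\<rbrakk> \<Longrightarrow> b = b'"
begin

abbreviation "adj x y \<equiv> (x, y) \<in> E \<union> E\<inverse>"

lemma not_adj_zero:
  assumes "x \<in> U \<union> V" "y \<in> U \<union> V" "x \<noteq> y" "\<not> adj x y" shows "p x * p y \<in> J"
  using assms orth_U orth_V nonedge_UV nonedge_VU by auto

text \<open>\<open>p v * p w\<close> vanishes, as \<open>v\<close> and \<open>w\<close> are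
  different vertices on one side. Inserting the sum of all generators of the other side, which is 1,
  lets the middle vertex \<open>u\<close> be traded for the other common neighbours.\<close>

lemma common_neighbour_sum:
  assumes "adj v u" "adj u w" "v \<noteq> w"
  defines "N \<equiv> {u'. adj v u' \<and> adj u' w} - {u}"
  shows "p v * p u * p w \<sim> - (\<Sum>u'\<in>N. p v * p u' * p w)"
proof -
  have *: "p v * p u * p w \<sim> - (\<Sum>u'\<in>N. p v * p u' * p w)"
    if W: "finite W" "(\<Sum>x\<in>W. p x) - 1 \<in> J" "u \<in> W" "N \<subseteq> W" "W \<subseteq> U \<union> V" "v \<notin> W" "w \<notin> W"
      and vw: "p v * p w \<in> J" "v \<in> U \<union> V" "w \<in> U \<union> V" for W
  proof -
    let ?S = "\<Sum>u'\<in>W - {u}. p v * p u' * p w"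
    have "p v * (\<Sum>x\<in>W. p x) * p w \<sim> p v * 1 * p w"
      using W(2) by (intro eqv_mult eqv_refl) (simp add: eqv_def)
    then have "p v * (\<Sum>x\<in>W. p x) * p w \<in> J" using vw(1) eqv_in by simp
    then have "(\<Sum>x\<in>W. p v * p x * p w) \<in> J" by (simp add: sum_distrib_left sum_distrib_right)
    then have "p v * p u * p w + ?S \<in> J" using W(1,3) by (simp add: sum.remove)
    then have 1: "p v * p u * p w \<sim> - ?S" by (simp add: eqv_def)
    have "?S \<sim> (\<Sum>u'\<in>N. p v * p u' * p w)"
    proof (rule eqv_sum_restrict)
      show "finite (W - {u})" "N \<subseteq> W - {u}" using W by (auto simp: N_def)
      fix u' assume u': "u' \<in> W - {u} - N"
      then have "\<not> adj v u' \<or> \<not> adj u' w" by (auto simp: N_def)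
      then have "p v * p u' \<in> J \<or> p u' * p w \<in> J"
        using not_adj_zero[of v u'] not_adj_zero[of u' w] W vw u' by blast
      then show "p v * p u' * p w \<in> J"
        using left_in[of "p u' * p w" "p v"] right_in[of "p v * p u'" "p w"] by (auto simp: mult.assoc)
    qed
    then have "- ?S \<sim> - (\<Sum>u'\<in>N. p v * p u' * p w)" using eqv_diff[OF eqv_refl[of 0]] by fastforce
    then show ?thesis using 1 eqv_trans by blast
  qed
  consider "v \<in> V" "w \<in> V" "u \<in> U" | "v \<in> U" "w \<in> U" "u \<in> V"
    using assms(1,2) E_sub disjoint by auto
  then show ?thesis
  proof cases
    case 1
    then show ?thesis using finite_U sum_U orth_V assms(3) E_sub disjoint by (intro *[of U]) (auto simp: N_def)
  next
    case 2
    then show ?thesis using finite_V sum_V orth_U assms(3) E_sub disjoint by (intro *[of V]) (auto simp: N_def)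
  qed
qed

text \<open>\<open>v u w u'\<close> is a 4-cycle, around which the type is constant and
  exclusive.\<close>

lemma cherry_common_neighbour:
  assumes "C b v u w" "u' \<in> {u'. adj v u' \<and> adj u' w} - {u}"
  shows "C b u' w u" "C b v u' w"
proof -
  have a: "adj v u" "adj u w" "v \<noteq> w" using C_adj[OF assms(1)] by auto
  obtain c where c: "C c v u w" "C c u w u'" using C_cycle[of v u w u'] a assms(2) by auto
  then have "c = b" using C_excl[OF assms(1)] by (cases c; cases b) auto
  with c show "C b u' w u" using C_sym by blast
  obtain d where d: "C d u w u'" "C d w u' v" using C_cycle[of u w u' v] a assms(2) by auto
  then have "d = b" using C_excl c \<open>c = b\<close> by (cases d; cases b) force+
  then show "C b v u' w" using d C_sym by blast
qed

text \<open>If \<open>u' w x\<close> were a cherry, three pairwise cherries centred at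
  \<open>w\<close> would have two types, against \<open>C_triangle\<close>; a path that is no cherry
  has vanishing product.\<close>

lemma mixed_triple_zero:
  assumes "C b u' w u" "C (\<not> b) u w x" shows "p u' * p w * p x \<in> J"
proof (rule C_vanish)
  show "u' \<noteq> x" using assms C_excl C_sym by blast
  show "\<not> C c u' w x" for c
    using C_triangle[OF assms] C_sym by blast
qed (use C_adj[OF assms(1)] C_adj[OF assms(2)] in auto)

text \<open>Rerouting the first cherry through another common neighbour \<open>u'\<close> of
  \<open>v\<close> and \<open>w\<close> produces the triple \<open>u' w x\<close> of
  \<open>mixed_triple_zero\<close>.\<close>

lemma mixed_path_zero:
  assumes "C b v u w" "C (\<not> b) u w x" shows "p v * p u * p w * p x \<in> J"
proof -
  let ?N = "{u'. adj v u' \<and> adj u' w} - {u}"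
  have "p v * p u * p w * p x \<sim> - (\<Sum>u'\<in>?N. p v * p u' * p w) * p x"
    using C_adj[OF assms(1)] by (intro eqv_mult eqv_refl common_neighbour_sum) auto
  moreover have "(\<Sum>u'\<in>?N. p v * p u' * p w) * p x \<in> J"
    unfolding sum_distrib_right
  proof (rule sum_in)
    fix u' assume "u' \<in> ?N"
    then have "p u' * p w * p x \<in> J"
      using mixed_triple_zero[OF _ assms(2)] cherry_common_neighbour(1)[OF assms(1)] by blast
    then show "p v * p u' * p w * p x \<in> J" using left_in[of _ "p v"] by (simp add: mult.assoc)
  qed
  ultimately show ?thesis using eqv_in uminus_in by fastforce
qed

definition word :: "'v list \<Rightarrow> 'a" where
  "word l = prod_list (map p l)"

lemma word_Cons: "word (x # l) = p x * word l" and word_append: "word (k @ l) = word k * word l"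
  by (simp_all add: word_def)

fun has_cherry :: "bool \<Rightarrow> 'v list \<Rightarrow> bool" where
  "has_cherry b (x # y # z # l) \<longleftrightarrow> C b x y z \<or> has_cherry b (y # z # l)"
| "has_cherry b l \<longleftrightarrow> False"

lemma has_cherry_append: "C b x y z \<Longrightarrow> has_cherry b (k @ x # y # z # l)"
proof (induction k)
  case (Cons a k)
  then have *: "has_cherry b (k @ x # y # z # l)" by simp
  obtain c d m where "k @ x # y # z # l = c # d # m" by (cases k; cases "tl k") auto
  with * show ?case by (cases m) auto
qed simp

text \<open>Induction on the tail. The letter after \<open>w\<close> repeats \<open>w\<close>,
  breaks the path, turns back to \<open>u\<close>, or continues the path; each time the word gets
  shorter or contains a vanishing factor.\<close>

lemma mixed_word_zero:
  assumes "C b v u w" "has_cherry (\<not> b) (u # w # l)" "set l \<subseteq> U \<union> V"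
  shows "word (v # u # w # l) \<in> J"
  using assms
proof (induction l arbitrary: v u w)
  case (Cons x l)
  have adj: "adj v u" "adj u w" "v \<noteq> w" using C_adj[OF Cons(2)] by auto
  have X: "v \<in> U \<union> V" "u \<in> U \<union> V" "w \<in> U \<union> V" "x \<in> U \<union> V" using adj E_sub Cons.prems(3) by auto
  have right4: "p w * p x \<in> J \<Longrightarrow> ?case"
    using left_in[of "p w * p x * word l" "p v * p u"] right_in[of "p w * p x" "word l"] by (simp add: word_Cons mult.assoc)
  have right3: "p u * p w * p x \<in> J \<Longrightarrow> ?case"
    using left_in[of "p u * p w * p x * word l" "p v"] right_in[of "p u * p w * p x" "word l"] by (simp add: word_Cons mult.assoc)
  consider "x = w" | "x \<noteq> w" "\<not> adj w x" | "adj w x" "x = u" | "adj w x" "x \<noteq> u" by auto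
  then show ?case
  proof cases
    case 1
    have "\<not> C c u w w" for c using C_adj[of c u w w] adj E_sub disjoint by auto
    moreover have "\<not> C c w w y" for c y using C_adj[of c w w y] adj E_sub disjoint by auto
    ultimately have "has_cherry (\<not> b) (u # w # l)"
      using Cons.prems(2) unfolding 1 by (cases l) auto
    then have "word (v # u # w # l) \<in> J" using Cons by simp
    moreover have "p w * p w \<sim> p w" using idem_U idem_V X(3) by (auto simp: eqv_def)
    then have "p v * p u * (p w * p w) * word l \<sim> p v * p u * p w * word l" by (intro eqv_mult eqv_refl)
    ultimately show ?thesis using eqv_in by (simp add: word_Cons 1 mult.assoc)
  next
    case 2
    then show ?thesis using not_adj_zero X right4 by auto
  next
    \<comment> \<open>Here the leading cherry cannot be shifted along the word, since
      \<open>u w u\<close> is no cherry. Rerouting through \<open>u'\<close> replaces it by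
      \<open>u' w u\<close>, which has the same type and a shorter tail.\<close>
    case 3
    let ?N = "{u'. adj v u' \<and> adj u' w} - {u}"
    have "\<not> C c u w u" for c using C_adj by blast
    then have hc: "has_cherry (\<not> b) (w # u # l)" using Cons.prems(2) 3 by simp
    have "p v * p u * p w * word (x # l) \<sim> - (\<Sum>u'\<in>?N. p v * p u' * p w) * word (x # l)"
      using adj by (intro eqv_mult eqv_refl common_neighbour_sum)
    moreover have "(\<Sum>u'\<in>?N. p v * p u' * p w) * word (x # l) \<in> J"
      unfolding sum_distrib_right
    proof (rule sum_in)
      fix u' assume "u' \<in> ?N"
      then have "word (u' # w # u # l) \<in> J"
        using Cons.IH[OF cherry_common_neighbour(1)[OF Cons.prems(1)] hc] Cons.prems(3) by auto
      then show "p v * p u' * p w * word (x # l) \<in> J"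
        using left_in[of _ "p v"] 3 by (simp add: word_Cons mult.assoc)
    qed
    ultimately have "p v * p u * p w * word (x # l) \<in> J" using eqv_in uminus_in by fastforce
    then show ?thesis by (simp add: word_Cons mult.assoc)
  next
    case 4
    show ?thesis
    proof (cases "C b u w x")
      case True
      then have "has_cherry (\<not> b) (w # x # l)" using Cons.prems(2) C_excl[OF True] by simp
      then have "word (u # w # x # l) \<in> J" using Cons.IH[OF True] Cons.prems(3) by auto
      then show ?thesis using left_in[of _ "p v"] by (simp add: word_Cons)
    next
      case False
      show ?thesis
      proof (cases "C (\<not> b) u w x")
        case True
        then show ?thesis using right_in[OF mixed_path_zero[OF Cons.prems(1) True], of "word l"]
          by (simp add: word_Cons mult.assoc)
      next
        case f: False
        then have "\<not> C c u w x" for c using False by (cases "c = b") auto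
        then show ?thesis using C_vanish[of u w x] adj 4 right3 by auto
      qed
    qed
  qed
qed simp

definition cherry_products :: "bool \<Rightarrow> 'a set" where
  "cherry_products b = {p v * p u * p w | v u w. C b v u w}"

lemma mixed_product_zero:
  assumes "C b v u w" "C (\<not> b) v' u' w'" "set l \<subseteq> U \<union> V"
  shows "(p v * p u * p w) * word l * (p v' * p u' * p w') \<in> J"
proof -
  have "has_cherry (\<not> b) (u # w # l @ [v', u', w'])"
    using has_cherry_append[OF assms(2), of "u # w # l" "[]"] by simp
  moreover have "set (l @ [v', u', w']) \<subseteq> U \<union> V"
    using assms(3) C_adj[OF assms(2)] E_sub by auto
  ultimately have "word (v # u # w # l @ [v', u', w']) \<in> J"
    using mixed_word_zero[OF assms(1)] by blast
  then show ?thesis by (simp add: word_def mult.assoc)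
qed

end

section \<open>Edge isomorphisms induce algebra isomorphisms\<close>

definition four_cycle :: "'v bip_graph \<Rightarrow> 'v \<Rightarrow> 'v \<Rightarrow> 'v \<Rightarrow> 'v \<Rightarrow> bool" where
  "four_cycle G u u' v v' \<longleftrightarrow> u \<in> left G \<and> u' \<in> left G \<and> u \<noteq> u' \<and> v \<in> right G \<and> v' \<in> right G \<and> v \<noteq> v' \<and>
     {u, v} \<in> edges G \<and> {u, v'} \<in> edges G \<and> {u', v} \<in> edges G \<and> {u', v'} \<in> edges G"

definition opposite :: "'v bip_graph \<Rightarrow> 'v set \<Rightarrow> 'v set \<Rightarrow> bool" where
  "opposite G e f \<longleftrightarrow> (\<exists>u u' v v'. four_cycle G u u' v v' \<and> e = {u, v} \<and> f = {u', v'})"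

text \<open>The case \<open>e = f\<close> is allowed: \<open>cocyclic G e e\<close> says that
  \<open>e\<close> lies on a 4-cycle at all.\<close>

definition cocyclic :: "'v bip_graph \<Rightarrow> 'v set \<Rightarrow> 'v set \<Rightarrow> bool" where
  "cocyclic G e f \<longleftrightarrow> (\<exists>u u' v v'. four_cycle G u u' v v' \<and>
     e \<in> {{u, v}, {u, v'}, {u', v}, {u', v'}} \<and> f \<in> {{u, v}, {u, v'}, {u', v}, {u', v'}})"

definition edge_iso :: "'v bip_graph \<Rightarrow> 'w bip_graph \<Rightarrow> ('v set \<Rightarrow> 'w set) \<Rightarrow> bool" where
  "edge_iso G G' \<phi> \<longleftrightarrow> bij_betw \<phi> (edges G) (edges G') \<and>
     (\<forall>e\<in>edges G. \<forall>f\<in>edges G. opposite G e f \<longleftrightarrow> opposite G' (\<phi> e) (\<phi> f)) \<and>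
     (\<forall>e\<in>edges G. \<forall>f\<in>edges G. cocyclic G e f \<longleftrightarrow> cocyclic G' (\<phi> e) (\<phi> f))"

lemma edge_iso_inv:
  assumes "edge_iso G G' \<phi>" shows "edge_iso G' G (inv_into (edges G) \<phi>)"
proof -
  let ?\<psi> = "inv_into (edges G) \<phi>"
  have bij: "bij_betw \<phi> (edges G) (edges G')" using assms by (simp add: edge_iso_def)
  then have "bij_betw ?\<psi> (edges G') (edges G)" by (rule bij_betw_inv_into)
  moreover from this have "?\<psi> e \<in> edges G" "\<phi> (?\<psi> e) = e" if "e \<in> edges G'" for e
    using that bij bij_betw_apply bij_betw_inv_into_right by fastforce+
  ultimately show ?thesis using assms unfolding edge_iso_def by metis
qed

context
  fixes G :: "'v bip_graph"
  assumes G: "bipartite_graph G"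
begin

lemma edgeE:
  assumes "e \<in> edges G"
  obtains u v where "u \<in> left G" "v \<in> right G" "e = {u, v}"
  using assms G unfolding bipartite_graph_def by blast

lemma edge_left_unique: "e \<in> edges G \<Longrightarrow> x \<in> e \<Longrightarrow> y \<in> e \<Longrightarrow> (x \<in> left G \<longleftrightarrow> y \<in> left G) \<Longrightarrow> x = y"
  using G unfolding bipartite_graph_def by blast

lemma opposite_disjoint: "opposite G e f \<Longrightarrow> e \<inter> f = {}"
  using G unfolding opposite_def four_cycle_def bipartite_graph_def by auto

lemma adjacent_in_cycle:
  assumes "cocyclic G e f" "e \<noteq> f" "\<not> opposite G e f"
  obtains x where "e \<inter> f = {x}"
proof -
  obtain u u' v v' where c: "four_cycle G u u' v v'"
    "e \<in> {{u, v}, {u, v'}, {u', v}, {u', v'}}" "f \<in> {{u, v}, {u, v'}, {u', v}, {u', v'}}"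
    using assms(1) by (auto simp: cocyclic_def)
  have s: "four_cycle G u' u v v'" "four_cycle G u u' v' v" "four_cycle G u' u v' v"
    using c(1) by (auto simp: four_cycle_def)
  have ne: "u \<noteq> v" "u \<noteq> v'" "u' \<noteq> v" "u' \<noteq> v'" "u \<noteq> u'" "v \<noteq> v'"
    using c(1) G by (auto simp: four_cycle_def bipartite_graph_def)
  have opp: "opposite G {u, v} {u', v'}" "opposite G {u', v'} {u, v}" "opposite G {u, v'} {u', v}" "opposite G {u', v} {u, v'}"
    using c(1) s by (auto simp: opposite_def)
  show thesis
    using c(2,3) assms(2,3) opp ne that by (elim insertE emptyE) (auto simp: Int_insert_left)
qed

end

section \<open>Cherries of a graph and their types under an edge bijection\<close>

locale flip =
  fixes G :: "'v bip_graph" and G' :: "'w bip_graph" and \<phi> :: "'v set \<Rightarrow> 'w set"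
  assumes G: "bipartite_graph G" and G': "bipartite_graph G'" and iso: "edge_iso G G' \<phi>"
begin

sublocale bip_algebra G .

text \<open>Evaluation asks for a value at every element of the vertex type; zero is the default
  outside the graph.\<close>

definition gen0 :: "'v \<Rightarrow> (nat \<Rightarrow> 'v star_poly) set" where
  "gen0 x = (if x \<in> X then gen x else \<zero>\<^bsub>A\<^esub>)"

sublocale ev: evaluation "bip_cstar G" gen0
  by unfold_locales (auto simp: gen0_def gen_closed)

text \<open>The kernel of evaluation in the C*-algebra. All ideals below contain it, so calculations
  modulo them stay purely algebraic.\<close>

definition K :: "'v star_poly set" where
  "K = {q. ev.poly_eval q = \<zero>\<^bsub>A\<^esub>}"

definition EP :: "('v \<times> 'v) set" where
  "EP = {(u, v). u \<in> left G \<and> v \<in> right G \<and> {u, v} \<in> edges G}"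

lemma K_iff: "a - b \<in> K \<longleftrightarrow> ev.poly_eval a = ev.poly_eval b"
  by (simp add: K_def ev.poly_eval_diff A.minus_zero_iff ev.poly_eval_closed)

lemma fin: "finite (left G)" "finite (right G)" "left G \<inter> right G = {}"
  using G by (auto simp: bipartite_graph_def)

lemma orth:
  assumes "x \<noteq> y" "x \<in> left G \<and> y \<in> left G \<or> x \<in> right G \<and> y \<in> right G"
  shows "gen x \<otimes>\<^bsub>A\<^esub> gen y = \<zero>\<^bsub>A\<^esub>"
  using assms(2)
proof
  assume "x \<in> left G \<and> y \<in> left G"
  then show ?thesis
    using assms(1) A.projections_orthogonal[OF fin(1) _ gen_sums(1)] gen_closed star_gen gen_idem by blast
next
  assume "x \<in> right G \<and> y \<in> right G"
  then show ?thesis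
    using assms(1) A.projections_orthogonal[OF fin(2) _ gen_sums(2)] gen_closed star_gen gen_idem by blast
qed

lemma eval_gen: "x \<in> X \<Longrightarrow> ev.poly_eval (poly_gen x) = gen x"
  by (simp add: ev.poly_eval_gen gen0_def)

lemma eval_sum: "finite I \<Longrightarrow> ev.poly_eval (sum f I) = (\<Oplus>\<^bsub>A\<^esub>i\<in>I. ev.poly_eval (f i))"
  by (induction I rule: finite_induct) (simp_all add: ev.poly_eval_zero ev.poly_eval_add ev.poly_eval_closed Pi_def)

lemma gen_nonedge': "u \<in> left G \<Longrightarrow> v \<in> right G \<Longrightarrow> {u, v} \<notin> edges G \<Longrightarrow> gen v \<otimes>\<^bsub>A\<^esub> gen u = \<zero>\<^bsub>A\<^esub>"
  using gen_nonedge[of u v] A.star_mult[of "gen u" "gen v"] A.star_zero by (simp add: gen_closed star_gen)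

lemma eval_gens:
  "(\<Oplus>\<^bsub>A\<^esub>u\<in>left G. ev.poly_eval (poly_gen u)) = \<one>\<^bsub>A\<^esub>"
  "(\<Oplus>\<^bsub>A\<^esub>v\<in>right G. ev.poly_eval (poly_gen v)) = \<one>\<^bsub>A\<^esub>"
proof -
  have "(\<Oplus>\<^bsub>A\<^esub>u\<in>left G. ev.poly_eval (poly_gen u)) = (\<Oplus>\<^bsub>A\<^esub>u\<in>left G. gen u)"
    "(\<Oplus>\<^bsub>A\<^esub>v\<in>right G. ev.poly_eval (poly_gen v)) = (\<Oplus>\<^bsub>A\<^esub>v\<in>right G. gen v)"
    using gen_closed by (intro A.add.finprod_cong'; auto simp: eval_gen)+
  then show "(\<Oplus>\<^bsub>A\<^esub>u\<in>left G. ev.poly_eval (poly_gen u)) = \<one>\<^bsub>A\<^esub>"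
    "(\<Oplus>\<^bsub>A\<^esub>v\<in>right G. ev.poly_eval (poly_gen v)) = \<one>\<^bsub>A\<^esub>" by (simp_all add: gen_sums)
qed

lemma ideal_K: "two_sided_ideal K"
  by (auto simp: two_sided_ideal_def K_def ev.poly_eval_add ev.poly_eval_mult ev.poly_eval_zero ev.poly_eval_closed)

lemma graph_ideal_superset:
  assumes "two_sided_ideal J" "K \<subseteq> J"
  shows "graph_ideal J (left G) (right G) EP poly_gen"
proof unfold_locales
  have *: "a \<in> J" if "ev.poly_eval a = \<zero>\<^bsub>A\<^esub>" for a using that assms(2) by (auto simp: K_def)
  have **: "a - b \<in> J" if "ev.poly_eval a = ev.poly_eval b" for a b using that assms(2) K_iff by blast
  show "EP \<subseteq> left G \<times> right G" by (auto simp: EP_def)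
  show "poly_gen u * poly_gen u - poly_gen u \<in> J" if "u \<in> left G" for u
    using that by (intro **) (simp add: ev.poly_eval_mult eval_gen gen_idem)
  show "poly_gen u * poly_gen u - poly_gen u \<in> J" if "u \<in> right G" for u
    using that by (intro **) (simp add: ev.poly_eval_mult eval_gen gen_idem)
  show "poly_gen x * poly_gen y \<in> J" if "x \<in> left G" "y \<in> left G" "x \<noteq> y" for x y
    using that orth[of x y] by (intro *) (simp add: ev.poly_eval_mult eval_gen)
  show "poly_gen x * poly_gen y \<in> J" if "x \<in> right G" "y \<in> right G" "x \<noteq> y" for x y
    using that orth[of x y] by (intro *) (simp add: ev.poly_eval_mult eval_gen)
  show "sum poly_gen (left G) - 1 \<in> J" "sum poly_gen (right G) - 1 \<in> J"
    using fin by (auto intro!: ** simp: eval_sum eval_gens ev.poly_eval_one)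
  show "poly_gen u * poly_gen v \<in> J" "poly_gen v * poly_gen u \<in> J"
    if "u \<in> left G" "v \<in> right G" "(u, v) \<notin> EP" for u v
    using that gen_nonedge[of u v] gen_nonedge'[of u v]
    by (auto intro!: * simp: ev.poly_eval_mult eval_gen EP_def)
qed (use assms fin in auto)

definition cherry :: "'v \<Rightarrow> 'v \<Rightarrow> 'v \<Rightarrow> bool" where
  "cherry v u w \<longleftrightarrow> v \<noteq> w \<and> {v, u} \<in> edges G \<and> {u, w} \<in> edges G \<and> cocyclic G {v, u} {u, w}"

text \<open>Whether the images of the two edges meet on the same side as the edges themselves;
  otherwise \<phi> interchanges the sides at this cherry.\<close>

definition keeps :: "'v \<Rightarrow> 'v \<Rightarrow> 'v \<Rightarrow> bool" where
  "keeps v u w \<longleftrightarrow> (\<exists>x\<in>\<phi> {v, u} \<inter> \<phi> {u, w}. x \<in> left G' \<longleftrightarrow> u \<in> left G)"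

lemma phi_edge: "e \<in> edges G \<Longrightarrow> \<phi> e \<in> edges G'"
  using iso bij_betw_apply unfolding edge_iso_def by fastforce

lemma phi_inj: "e \<in> edges G \<Longrightarrow> f \<in> edges G \<Longrightarrow> \<phi> e = \<phi> f \<Longrightarrow> e = f"
  using iso unfolding edge_iso_def bij_betw_def inj_on_def by blast

lemma cherry_image:
  assumes "cherry v u w" obtains x where "\<phi> {v, u} \<inter> \<phi> {u, w} = {x}"
proof -
  have c: "v \<noteq> w" "{v, u} \<in> edges G" "{u, w} \<in> edges G" "cocyclic G {v, u} {u, w}"
    using assms by (auto simp: cherry_def)
  have "\<not> opposite G {v, u} {u, w}" using opposite_disjoint[OF G] by blast
  moreover have "{v, u} \<noteq> {u, w}" using c(1) by (auto simp: doubleton_eq_iff)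
  ultimately have "cocyclic G' (\<phi> {v, u}) (\<phi> {u, w})" "\<phi> {v, u} \<noteq> \<phi> {u, w}" "\<not> opposite G' (\<phi> {v, u}) (\<phi> {u, w})"
    using c iso phi_inj unfolding edge_iso_def by blast+
  then show thesis using that adjacent_in_cycle[OF G'] by blast
qed

lemma keeps_iff: "\<phi> {v, u} \<inter> \<phi> {u, w} = {x} \<Longrightarrow> keeps v u w \<longleftrightarrow> (x \<in> left G' \<longleftrightarrow> u \<in> left G)"
  by (simp add: keeps_def)

definition Ch :: "bool \<Rightarrow> 'v \<Rightarrow> 'v \<Rightarrow> 'v \<Rightarrow> bool" where
  "Ch b v u w \<longleftrightarrow> cherry v u w \<and> (keeps v u w \<longleftrightarrow> b)"

lemma adj_sides: "{x, y} \<in> edges G \<Longrightarrow> (x \<in> left G \<and> y \<in> right G) \<or> (x \<in> right G \<and> y \<in> left G)"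
  by (elim edgeE[OF G]) (auto simp: doubleton_eq_iff)

lemma EP_adj: "(x, y) \<in> EP \<union> EP\<inverse> \<longleftrightarrow> {x, y} \<in> edges G"
  using adj_sides[of x y] by (auto simp: EP_def insert_commute)

lemma cycle_cocyclic:
  assumes "{v, u} \<in> edges G" "{u, w} \<in> edges G" "{w, u'} \<in> edges G" "{u', v} \<in> edges G" "v \<noteq> w" "u \<noteq> u'"
  shows "cherry v u w" "opposite G {v, u} {w, u'}"
proof -
  consider "u \<in> left G" "v \<in> right G" "w \<in> right G" "u' \<in> left G" | "u \<in> right G" "v \<in> left G" "w \<in> left G" "u' \<in> right G"
    using adj_sides[OF assms(1)] adj_sides[OF assms(2)] adj_sides[OF assms(3)] fin(3) by blast
  then have "four_cycle G u u' v w \<or> four_cycle G v w u u'"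
    by cases (use assms in \<open>auto simp: four_cycle_def insert_commute\<close>)
  then show "cherry v u w" "opposite G {v, u} {w, u'}"
    unfolding cherry_def cocyclic_def opposite_def using assms by (auto simp: insert_commute)
qed

lemma cherry_sym: "cherry v u w \<Longrightarrow> cherry w u v"
  unfolding cherry_def cocyclic_def by (auto simp: insert_commute)

lemma keeps_sym: "keeps v u w \<longleftrightarrow> keeps w u v"
  by (auto simp: keeps_def insert_commute)

lemma cherries_superset:
  assumes "two_sided_ideal J" "K \<subseteq> J"
  shows "cherries J (left G) (right G) EP poly_gen Ch"
proof -
  interpret graph_ideal J "left G" "right G" EP poly_gen by (rule graph_ideal_superset[OF assms])
  show ?thesis
  proof unfold_locales
    show "left G \<inter> right G = {}" by (rule fin)
    show "Ch b v u w \<Longrightarrow> Ch b w u v" for b v u w using cherry_sym keeps_sym by (auto simp: Ch_def)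
    show "Ch b v u w \<Longrightarrow> (v, u) \<in> EP \<union> EP\<inverse> \<and> (u, w) \<in> EP \<union> EP\<inverse> \<and> v \<noteq> w" for b v u w
      unfolding EP_adj by (auto simp: Ch_def cherry_def)
    show "Ch b v u w \<Longrightarrow> \<not> Ch (\<not> b) v u w" for b v u w by (auto simp: Ch_def)
    \<comment> \<open>Opposite edges of the cycle stay opposite, so \<open>\<phi> {v, u}\<close> and
      \<open>\<phi> {w, u'}\<close> are disjoint and meet \<open>\<phi> {u, w}\<close> in its two
      ends. These lie on different sides, as do \<open>u\<close> and \<open>w\<close>, so both
      cherries have the same type.\<close>
    show "\<exists>b. Ch b v u w \<and> Ch b u w u'"
      if "(v, u) \<in> EP \<union> EP\<inverse>" "(u, w) \<in> EP \<union> EP\<inverse>" "(w, u') \<in> EP \<union> EP\<inverse>" "(u', v) \<in> EP \<union> EP\<inverse>" "v \<noteq> w" "u \<noteq> u'"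
      for v u w u'
    proof -
      note e = that(1-4)[unfolded EP_adj]
      have ch: "cherry v u w" "cherry u w u'" and op: "opposite G {v, u} {w, u'}"
        using cycle_cocyclic[OF e that(5,6)] cycle_cocyclic[OF e(2-4) e(1)] that(5,6) by auto
      obtain x y where xy: "\<phi> {v, u} \<inter> \<phi> {u, w} = {x}" "\<phi> {u, w} \<inter> \<phi> {w, u'} = {y}"
        using cherry_image[OF ch(1)] cherry_image[OF ch(2)] by metis
      have "opposite G' (\<phi> {v, u}) (\<phi> {w, u'})" using op e iso unfolding edge_iso_def by blast
      then have "\<phi> {v, u} \<inter> \<phi> {w, u'} = {}" by (rule opposite_disjoint[OF G'])
      then have "x \<noteq> y" using xy by blast
      moreover have "x \<in> \<phi> {u, w}" "y \<in> \<phi> {u, w}" using xy by blast+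
      ultimately have "x \<in> left G' \<longleftrightarrow> y \<notin> left G'"
        using edge_left_unique[OF G' phi_edge[OF e(2)]] by blast
      moreover have "u \<in> left G \<longleftrightarrow> w \<notin> left G" using adj_sides[OF e(2)] fin(3) by blast
      ultimately have "keeps v u w \<longleftrightarrow> keeps u w u'" using keeps_iff xy by simp
      then show ?thesis using ch by (auto simp: Ch_def)
    qed
    \<comment> \<open>Without a 4-cycle through the path, \<open>u\<close> is the only common
      neighbour of \<open>v\<close> and \<open>w\<close>. Inserting the sum of the generators on the
      side of \<open>u\<close> between \<open>poly_gen v\<close> and \<open>poly_gen w\<close>,
      whose product vanishes, leaves just this term.\<close>
    show "poly_gen v * poly_gen u * poly_gen w \<in> J"
      if adj: "(v, u) \<in> EP \<union> EP\<inverse>" "(u, w) \<in> EP \<union> EP\<inverse>" and vw: "v \<noteq> w" and no: "\<And>b. \<not> Ch b v u w" for v u w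
    proof -
      note e = adj[unfolded EP_adj]
      have no: "\<not> cherry v u w" using no[of "keeps v u w"] by (simp add: Ch_def)
      have only: "u' = u" if "{v, u'} \<in> edges G" "{u', w} \<in> edges G" for u'
        using cycle_cocyclic(1)[OF e, of u'] that vw no by (auto simp: insert_commute)
      have *: "poly_gen v * poly_gen u * poly_gen w \<in> J"
        if W: "finite W" "sum poly_gen W - 1 \<in> J" "u \<in> W" "poly_gen v * poly_gen w \<in> J"
          "\<And>u'. u' \<in> W \<Longrightarrow> {v, u'} \<notin> edges G \<Longrightarrow> poly_gen v * poly_gen u' \<in> J"
          "\<And>u'. u' \<in> W \<Longrightarrow> {u', w} \<notin> edges G \<Longrightarrow> poly_gen u' * poly_gen w \<in> J" for W
      proof -
        have "(\<Sum>x\<in>W. poly_gen v * poly_gen x * poly_gen w) \<sim> poly_gen v * poly_gen u * poly_gen w"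
        proof (rule eqv_sum_single[OF W(1,3)])
          fix u' assume u': "u' \<in> W" "u' \<noteq> u"
          then have "poly_gen v * poly_gen u' \<in> J \<or> poly_gen u' * poly_gen w \<in> J" using only W(5,6) by blast
          then show "poly_gen v * poly_gen u' * poly_gen w \<in> J"
            using right_in[of "poly_gen v * poly_gen u'" "poly_gen w"] left_in[of "poly_gen u' * poly_gen w" "poly_gen v"]
            by (auto simp: mult.assoc)
        qed
        moreover have "poly_gen v * sum poly_gen W * poly_gen w \<sim> poly_gen v * 1 * poly_gen w"
          using W(2) by (intro eqv_mult eqv_refl) (simp add: eqv_def)
        then have "(\<Sum>x\<in>W. poly_gen v * poly_gen x * poly_gen w) \<in> J"
          using W(4) eqv_in by (simp add: sum_distrib_left sum_distrib_right)
        ultimately show ?thesis using eqv_in eqv_sym by blast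
      qed
      consider "u \<in> left G" "v \<in> right G" "w \<in> right G" | "u \<in> right G" "v \<in> left G" "w \<in> left G"
        using adj_sides[OF e(1)] adj_sides[OF e(2)] fin(3) by blast
      then show ?thesis
      proof cases
        case 1
        then show ?thesis
          using fin sum_U vw orth_V nonedge_UV nonedge_VU by (intro *[of "left G"]) (auto simp: EP_def insert_commute)
      next
        case 2
        then show ?thesis
          using fin sum_V vw orth_U nonedge_UV nonedge_VU by (intro *[of "right G"]) (auto simp: EP_def insert_commute)
      qed
    qed
    \<comment> \<open>The images of the three edges at \<open>u\<close> meet pairwise. A bipartite
      graph has no triangle, so they meet in one vertex, whose side decides the types.\<close>
    show "b = b'" if c: "Ch b x u y" "Ch b' y u z" "Ch b'' x u z" for b b' b'' x u y z
    proof -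
      have ch: "cherry x u y" "cherry y u z" "cherry x u z" using c by (auto simp: Ch_def)
      have e: "{x, u} \<in> edges G" "{u, y} \<in> edges G" "{u, z} \<in> edges G" using ch by (auto simp: cherry_def)
      have s: "{y, u} = {u, y}" by auto
      obtain a c d where acd: "\<phi> {x, u} \<inter> \<phi> {u, y} = {a}" "\<phi> {u, y} \<inter> \<phi> {u, z} = {c}" "\<phi> {x, u} \<inter> \<phi> {u, z} = {d}"
        using cherry_image[OF ch(1)] cherry_image[OF ch(2)] cherry_image[OF ch(3)] unfolding s by metis
      note un = edge_left_unique[OF G' phi_edge[OF e(1)]] edge_left_unique[OF G' phi_edge[OF e(2)]]
        edge_left_unique[OF G' phi_edge[OF e(3)]]
      have "a = c"
      proof (rule ccontr)
        assume ac: "a \<noteq> c"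
        have m: "a \<in> \<phi> {x, u}" "a \<in> \<phi> {u, y}" "c \<in> \<phi> {u, y}" "c \<in> \<phi> {u, z}" "d \<in> \<phi> {x, u}" "d \<in> \<phi> {u, z}"
          using acd by (metis Int_iff singletonI)+
        have "d = a \<or> d = c"
          using un(2)[OF m(2,3)] un(1)[OF m(5,1)] un(3)[OF m(6,4)] ac by metis
        then have "c \<in> \<phi> {x, u} \<or> a \<in> \<phi> {u, z}" using m by auto
        then have "c \<in> {a} \<or> a \<in> {c}" unfolding acd[symmetric] using m by blast
        then show False using ac by auto
      qed
      then show ?thesis using acd c keeps_iff[of x u y a] keeps_iff[of y u z c] by (simp add: Ch_def s)
    qed
  qed
qed

text \<open>Modulo \<open>J b\<close> only cherries of type \<open>b\<close> survive: modulo
  \<open>J True\<close> the bijection of edges behaves as if it preserved the sides, modulo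
  \<open>J False\<close> as if it interchanged them.\<close>

definition J :: "bool \<Rightarrow> 'v star_poly set" where
  "J b = gen_ideal (K \<union> cherries.cherry_products poly_gen Ch (\<not> b))"

lemma ideal_J: "two_sided_ideal (J b)" and K_sub_J: "K \<subseteq> J b"
  unfolding J_def by (auto intro: two_sided_ideal_gen_ideal gen_ideal.gen)

text \<open>Starred letters evaluate to the same self-adjoint generators, and a letter outside the
  graph makes the word zero; what remains is a product of plain generators.\<close>

lemma eval_word:
  "ev.poly_eval (Poly_Mapping.single (Word ls) 1) = \<zero>\<^bsub>A\<^esub> \<or>
    (\<exists>l. set l \<subseteq> X \<and> ev.poly_eval (Poly_Mapping.single (Word ls) 1) = ev.poly_eval (prod_list (map poly_gen l)))"
proof (induction ls)
  case Nil
  have "ev.poly_eval (Poly_Mapping.single (Word []) 1) = ev.poly_eval (prod_list (map poly_gen []))"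
    by (simp add: zero_free_mon_def[symmetric])
  then show ?case by (intro disjI2 exI[of _ "[]"]) simp
next
  case (Cons c ls)
  have "Poly_Mapping.single (Word (c # ls)) (1::complex)
      = Poly_Mapping.single (Word [c]) 1 * Poly_Mapping.single (Word ls) 1"
    by (simp add: mult_single plus_free_mon_def)
  moreover have "star A (gen0 (fst c)) = gen0 (fst c)" by (simp add: gen0_def star_gen A.star_zero)
  then have "ev.poly_eval (Poly_Mapping.single (Word [c]) 1) = gen0 (fst c)"
    by (simp add: ev.poly_eval_single ev.word_eval_letter ev.letter_eval_def A.scale_one ev.e_closed)
  ultimately have eq: "ev.poly_eval (Poly_Mapping.single (Word (c # ls)) 1)
      = gen0 (fst c) \<otimes>\<^bsub>A\<^esub> ev.poly_eval (Poly_Mapping.single (Word ls) 1)"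
    by (simp only: ev.poly_eval_mult)
  show ?case
  proof (cases "fst c \<in> X")
    case True
    then have *: "gen0 (fst c) = ev.poly_eval (poly_gen (fst c))" by (simp add: ev.poly_eval_gen)
    from Cons show ?thesis
    proof
      assume "ev.poly_eval (Poly_Mapping.single (Word ls) 1) = \<zero>\<^bsub>A\<^esub>"
      then show ?thesis using eq ev.e_closed by simp
    next
      assume "\<exists>l. set l \<subseteq> X \<and> ev.poly_eval (Poly_Mapping.single (Word ls) 1) = ev.poly_eval (prod_list (map poly_gen l))"
      then obtain l where "set l \<subseteq> X" "ev.poly_eval (Poly_Mapping.single (Word ls) 1) = ev.poly_eval (prod_list (map poly_gen l))"
        by blast
      then show ?thesis
        using eq True by (intro disjI2 exI[of _ "fst c # l"]) (simp add: ev.poly_eval_mult *)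
    qed
  next
    case False
    then have "gen0 (fst c) = \<zero>\<^bsub>A\<^esub>" by (simp add: gen0_def)
    then show ?thesis using eq ev.poly_eval_closed by simp
  qed
qed

lemma cherry_products_annihilate:
  assumes s: "s \<in> cherries.cherry_products poly_gen Ch b" and t: "t \<in> cherries.cherry_products poly_gen Ch (\<not> b)"
  shows "s * q * t \<in> K"
proof -
  interpret cherries K "left G" "right G" EP poly_gen Ch by (rule cherries_superset[OF ideal_K order_refl])
  show ?thesis
  proof (induction q rule: star_poly_induct)
    case (single w c)
    obtain ls where w: "w = Word ls" by (cases w)
    have "ev.poly_eval s \<otimes>\<^bsub>A\<^esub> ev.poly_eval (Poly_Mapping.single w 1) \<otimes>\<^bsub>A\<^esub> ev.poly_eval t = \<zero>\<^bsub>A\<^esub>"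
      using eval_word[of ls]
    proof
      assume "\<exists>l. set l \<subseteq> X \<and> ev.poly_eval (Poly_Mapping.single (Word ls) 1) = ev.poly_eval (prod_list (map poly_gen l))"
      then obtain l where l: "set l \<subseteq> X" "ev.poly_eval (Poly_Mapping.single w 1) = ev.poly_eval (word l)"
        unfolding w word_def by blast
      have "s * word l * t \<in> K" using s t l(1) mixed_product_zero unfolding cherry_products_def by blast
      then show ?thesis by (simp add: K_def l(2) ev.poly_eval_mult)
    qed (simp add: w ev.poly_eval_closed)
    then show ?case
      by (simp add: K_def single_eq_poly_scale[of w c] ev.poly_eval_mult ev.poly_eval_scale A.scale_mult_right
          A.scale_mult_left ev.poly_eval_closed A.scale_zero_right)
  qed (auto simp: distrib_left distrib_right zero_in add_in)
qed

text \<open>\<open>J True\<close> is closed under the star because reversing a cherry keeps its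
  type. So \<open>poly_star a * a\<close> lies in the product of the two ideals, which is contained
  in \<open>K\<close> as cherries of different types annihilate each other; the C*-identity removes
  the square.\<close>

lemma J_Int: assumes "a \<in> J True" "a \<in> J False" shows "a \<in> K"
proof -
  interpret cherries K "left G" "right G" EP poly_gen Ch by (rule cherries_superset[OF ideal_K order_refl])
  have star_in: "poly_star a \<in> J True"
  proof -
    have "poly_star s \<in> J True" if s: "s \<in> K \<union> cherry_products (\<not> True)" for s
      using s
    proof
      assume "s \<in> K"
      then have "poly_star s \<in> K" by (simp add: K_def ev.poly_eval_star A.star_zero)
      then show ?thesis using K_sub_J by blast
    next
      assume "s \<in> cherry_products (\<not> True)"
      then obtain v u w where c: "Ch (\<not> True) v u w" "s = poly_gen v * poly_gen u * poly_gen w"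
        by (auto simp: cherry_products_def)
      then have X: "v \<in> X" "u \<in> X" "w \<in> X" using C_adj[OF c(1)] E_sub by auto
      have "poly_star s - poly_gen w * poly_gen u * poly_gen v \<in> K"
        unfolding K_iff using X
        by (simp add: c(2) ev.poly_eval_star ev.poly_eval_mult eval_gen A.star_mult gen_closed star_gen A.m_assoc)
      moreover have "poly_gen w * poly_gen u * poly_gen v \<in> J True"
        using C_sym[OF c(1)] unfolding J_def cherry_products_def by (intro gen_ideal.gen) blast
      ultimately show ?thesis
        using K_sub_J ideal_J[of True] unfolding two_sided_ideal_def
        by (metis (no_types, lifting) diff_add_cancel subsetD)
    qed
    then show ?thesis
      using gen_ideal_antimult[where f = poly_star, OF poly_star_add poly_star_mult _ assms(1)[unfolded J_def]]
      unfolding J_def by blast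
  qed
  have "poly_star a * a \<in> K"
  proof (rule gen_ideal_mult[OF _ star_in[unfolded J_def] assms(2)[unfolded J_def]])
    fix s t x assume "s \<in> K \<union> cherry_products (\<not> True)" "t \<in> K \<union> cherry_products (\<not> False)"
    then show "s * x * t \<in> K"
      using cherry_products_annihilate[of s False t x] left_in right_in by auto
  qed
  then have "star A (ev.poly_eval a) \<otimes>\<^bsub>A\<^esub> ev.poly_eval a = \<zero>\<^bsub>A\<^esub>"
    by (simp add: K_def ev.poly_eval_mult ev.poly_eval_star)
  then show ?thesis using A.nrm_eq_zero_of_star_mult[OF ev.poly_eval_closed] by (simp add: K_def)
qed

end

context graph_ideal
begin

lemma star_sum_left:
  assumes u: "u \<in> U"
  shows "(\<Sum>(a, b)\<in>{(a, b) \<in> E. a = u}. p a * p b) \<sim> p u" "(\<Sum>(a, b)\<in>{(a, b) \<in> E. a = u}. p b * p a) \<sim> p u"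
proof -
  have set: "{(a, b) \<in> E. a = u} = Pair u ` (E `` {u})" by auto
  have one: "(\<Sum>v\<in>V. p v) \<sim> 1" using sum_V by (simp add: eqv_def)
  have "(\<Sum>b\<in>V. p u * p b) \<sim> (\<Sum>b\<in>E `` {u}. p u * p b)" "(\<Sum>b\<in>V. p b * p u) \<sim> (\<Sum>b\<in>E `` {u}. p b * p u)"
    using finite_V finite_image_E(2)[of E u] u
    by (intro eqv_sum_restrict; auto intro: nonedge_UV[OF u] nonedge_VU[OF u])+
  moreover have "(\<Sum>b\<in>V. p u * p b) \<sim> p u" "(\<Sum>b\<in>V. p b * p u) \<sim> p u"
    using eqv_mult[OF eqv_refl[of "p u"] one] eqv_mult[OF one eqv_refl[of "p u"]]
    by (simp_all add: sum_distrib_left sum_distrib_right)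
  ultimately have "(\<Sum>b\<in>E `` {u}. p u * p b) \<sim> p u" "(\<Sum>b\<in>E `` {u}. p b * p u) \<sim> p u"
    using eqv_sym eqv_trans by blast+
  then show "(\<Sum>(a, b)\<in>{(a, b) \<in> E. a = u}. p a * p b) \<sim> p u" "(\<Sum>(a, b)\<in>{(a, b) \<in> E. a = u}. p b * p a) \<sim> p u"
    unfolding set by (subst sum.reindex; simp add: inj_on_def)+
qed

lemma star_sum_right:
  assumes v: "v \<in> V"
  shows "(\<Sum>(a, b)\<in>{(a, b) \<in> E. b = v}. p a * p b) \<sim> p v" "(\<Sum>(a, b)\<in>{(a, b) \<in> E. b = v}. p b * p a) \<sim> p v"
proof -
  interpret s: graph_ideal J V U "E\<inverse>" p by (rule swap)
  have set: "{(a, b) \<in> E\<inverse>. a = v} = prod.swap ` {(a, b) \<in> E. b = v}" by auto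
  show "(\<Sum>(a, b)\<in>{(a, b) \<in> E. b = v}. p a * p b) \<sim> p v" "(\<Sum>(a, b)\<in>{(a, b) \<in> E. b = v}. p b * p a) \<sim> p v"
    using s.star_sum_left[OF v] unfolding set
    by (subst (asm) (1 2) sum.reindex; simp add: case_prod_unfold)+
qed

lemma edge_sum_all: "edge_sum E \<sim> 1"
proof -
  have "edge_sum E = (\<Sum>u\<in>U. \<Sum>(a, b)\<in>{(a, b) \<in> E. a = u}. p a * p b)"
    unfolding edge_sum_def using finite_E finite_U E_sub
    by (subst sum.UNION_disjoint[symmetric]) (auto intro!: sum.cong finite_subset[OF _ finite_E])
  also have "\<dots> \<sim> (\<Sum>u\<in>U. p u)" by (intro eqv_sum star_sum_left)
  also have "(\<Sum>u\<in>U. p u) \<sim> 1" using sum_U by (simp add: eqv_def)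
  finally show ?thesis .
qed

end

section \<open>The transported generators\<close>

context flip
begin

interpretation JT: graph_ideal "J True" "left G" "right G" EP poly_gen
  by (rule graph_ideal_superset[OF ideal_J K_sub_J])
interpretation JF: graph_ideal "J False" "left G" "right G" EP poly_gen
  by (rule graph_ideal_superset[OF ideal_J K_sub_J])
interpretation KK: graph_ideal K "left G" "right G" EP poly_gen
  by (rule graph_ideal_superset[OF ideal_K order_refl])
interpretation KC: cherries K "left G" "right G" EP poly_gen Ch
  by (rule cherries_superset[OF ideal_K order_refl])

definition D :: "'w \<Rightarrow> ('v \<times> 'v) set" where
  "D x = {(u, v) \<in> EP. x \<in> \<phi> {u, v}}"

abbreviation "lr_sum M \<equiv> \<Sum>(u, v)\<in>M. poly_gen u * poly_gen v"
abbreviation "rl_sum M \<equiv> \<Sum>(u, v)\<in>M. poly_gen v * poly_gen u"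

text \<open>If \<phi> comes from a side-preserving graph isomorphism taking a left vertex
  \<open>u\<close> to \<open>x\<close>, then \<open>D x\<close> is the set of edges at
  \<open>u\<close> and the sum is \<open>gen u\<close>. The formula still makes sense when \<phi>
  does not come from a map of vertices.\<close>

definition new_gen :: "'w \<Rightarrow> (nat \<Rightarrow> 'v star_poly) set" where
  "new_gen x = ev.poly_eval (lr_sum (D x))"

lemma EP_edge: "(u, v) \<in> EP \<Longrightarrow> {u, v} \<in> edges G"
  by (simp add: EP_def)

lemma phi_unique:
  "(u, v) \<in> EP \<Longrightarrow> x \<in> \<phi> {u, v} \<Longrightarrow> y \<in> \<phi> {u, v} \<Longrightarrow> (x \<in> left G' \<longleftrightarrow> y \<in> left G') \<Longrightarrow> x = y"
  using edge_left_unique[OF G' phi_edge[OF EP_edge]] by blast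

lemma G'_disjoint: "left G' \<inter> right G' = {}" using G' by (auto simp: bipartite_graph_def)

text \<open>
  Two edges with a common vertex, exactly one of them mapped to an edge at \<open>x\<close>: if they form a
  cherry, its type is determined by the sides of \<open>x\<close> and of the common vertex.
\<close>

lemma separated_product:
  assumes e: "{a, c} \<in> edges G" "{c, b} \<in> edges G" and x: "x \<in> \<phi> {a, c}" "x \<notin> \<phi> {c, b}"
  shows "poly_gen a * poly_gen c * poly_gen b \<in> J (x \<in> left G' \<longleftrightarrow> c \<in> left G)"
    "poly_gen b * poly_gen c * poly_gen a \<in> J (x \<in> left G' \<longleftrightarrow> c \<in> left G)"
proof -
  let ?b = "x \<in> left G' \<longleftrightarrow> c \<in> left G"
  have ab: "a \<noteq> b" using x by (auto simp: insert_commute)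
  have adj: "(a, c) \<in> EP \<union> EP\<inverse>" "(c, b) \<in> EP \<union> EP\<inverse>" "(b, c) \<in> EP \<union> EP\<inverse>" "(c, a) \<in> EP \<union> EP\<inverse>"
    using e unfolding EP_adj by (auto simp: insert_commute)
  have "poly_gen a * poly_gen c * poly_gen b \<in> J ?b \<and> poly_gen b * poly_gen c * poly_gen a \<in> J ?b"
  proof (cases "cherry a c b")
    case True
    obtain y where y: "\<phi> {a, c} \<inter> \<phi> {c, b} = {y}" using cherry_image[OF True] by blast
    have yin: "y \<in> \<phi> {a, c}" "y \<in> \<phi> {c, b}" using y by blast+
    have "y \<in> left G' \<longleftrightarrow> x \<notin> left G'"
      using edge_left_unique[OF G' phi_edge[OF e(1)], of x y] x yin by blast
    then have "Ch (\<not> ?b) a c b" using True keeps_iff[OF y] by (auto simp: Ch_def)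
    then have "poly_gen a * poly_gen c * poly_gen b \<in> KC.cherry_products (\<not> ?b)"
      "poly_gen b * poly_gen c * poly_gen a \<in> KC.cherry_products (\<not> ?b)"
      using KC.C_sym unfolding KC.cherry_products_def by blast+
    then show ?thesis unfolding J_def by (auto intro: gen_ideal.gen)
  next
    case False
    then have "\<not> Ch b' a c b" "\<not> Ch b' b c a" for b' using cherry_sym by (auto simp: Ch_def)
    then have "poly_gen a * poly_gen c * poly_gen b \<in> K" "poly_gen b * poly_gen c * poly_gen a \<in> K"
      using KC.C_vanish adj ab by blast+
    then show ?thesis using K_sub_J by blast
  qed
  then show "poly_gen a * poly_gen c * poly_gen b \<in> J ?b" "poly_gen b * poly_gen c * poly_gen a \<in> J ?b" by blast+
qed

text \<open>Modulo \<open>J True\<close> a left vertex \<open>x\<close> behaves like a left vertex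
  of \<open>G\<close>: at left vertices the edges sent to \<open>x\<close> are cut off from the
  others. Modulo \<open>J False\<close> it behaves like a right vertex. For \<open>x\<close> on the
  right the roles are exchanged.\<close>

lemma D_saturated:
  "x \<in> left G' \<Longrightarrow> JT.left_saturated (D x)" "x \<in> left G' \<Longrightarrow> JF.right_saturated (D x)"
  "x \<in> right G' \<Longrightarrow> JT.right_saturated (D x)" "x \<in> right G' \<Longrightarrow> JF.left_saturated (D x)"
proof -
  have sides: "u \<in> left G \<and> v \<notin> left G" if "(u, v) \<in> EP" for u v using that fin(3) by (auto simp: EP_def)
  have Dd: "(u, v) \<in> EP" "x \<in> \<phi> {u, v}" if "(u, v) \<in> D x" for u v using that by (auto simp: D_def)
  have nD: "(u, v) \<in> EP" "x \<notin> \<phi> {u, v}" if "(u, v) \<in> EP - D x" for u v using that by (auto simp: D_def)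
  have L: "poly_gen v * poly_gen u * poly_gen w \<in> J (x \<in> left G') \<and> poly_gen w * poly_gen u * poly_gen v \<in> J (x \<in> left G')"
    if "(u, v) \<in> D x" "(u, w) \<in> EP - D x" for u v w
  proof -
    have h: "{v, u} \<in> edges G" "{u, w} \<in> edges G" "x \<in> \<phi> {v, u}" "x \<notin> \<phi> {u, w}" "u \<in> left G"
      using EP_edge[OF Dd(1)[OF that(1)]] EP_edge[OF nD(1)[OF that(2)]] Dd(2)[OF that(1)] nD(2)[OF that(2)]
        sides[OF Dd(1)[OF that(1)]] by (simp_all add: insert_commute)
    show ?thesis using separated_product[OF h(1-4)] h(5) by (simp only: simp_thms)
  qed
  have R: "poly_gen u * poly_gen v * poly_gen w \<in> J (x \<notin> left G') \<and> poly_gen w * poly_gen v * poly_gen u \<in> J (x \<notin> left G')"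
    if "(u, v) \<in> D x" "(w, v) \<in> EP - D x" for u v w
  proof -
    have h: "{u, v} \<in> edges G" "{v, w} \<in> edges G" "x \<in> \<phi> {u, v}" "x \<notin> \<phi> {v, w}" "v \<notin> left G"
      using EP_edge[OF Dd(1)[OF that(1)]] EP_edge[OF nD(1)[OF that(2)]] Dd(2)[OF that(1)] nD(2)[OF that(2)]
        sides[OF Dd(1)[OF that(1)]] by (simp_all add: insert_commute)
    show ?thesis using separated_product[OF h(1-4)] h(5) by (simp only: simp_thms)
  qed
  have sub: "D x \<subseteq> EP" by (auto simp: D_def)
  have r: "x \<in> right G' \<Longrightarrow> x \<notin> left G'" using G'_disjoint by blast
  show "x \<in> left G' \<Longrightarrow> JT.left_saturated (D x)" "x \<in> left G' \<Longrightarrow> JF.right_saturated (D x)"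
    "x \<in> right G' \<Longrightarrow> JT.right_saturated (D x)" "x \<in> right G' \<Longrightarrow> JF.left_saturated (D x)"
    unfolding JT.left_saturated_def JF.left_saturated_def JT.right_saturated_def JF.right_saturated_def
    using L R sub r by auto
qed

text \<open>The gluing step: the two ideals have no common member outside \<open>K\<close>.\<close>

lemma eval_eqI: "JT.eqv a b \<Longrightarrow> JF.eqv a b \<Longrightarrow> ev.poly_eval a = ev.poly_eval b"
  unfolding JT.eqv_def JF.eqv_def using J_Int[of "a - b"] K_iff by blast

lemma D_products:
  shows "x \<in> left G' \<Longrightarrow> y \<in> left G' \<Longrightarrow> JT.eqv (lr_sum (D x) * lr_sum (D y)) (lr_sum (D x \<inter> D y)) \<and>
      JF.eqv (lr_sum (D x) * lr_sum (D y)) (rl_sum (D x \<inter> D y))"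
    "x \<in> left G' \<Longrightarrow> y \<in> right G' \<Longrightarrow> JT.eqv (lr_sum (D x) * lr_sum (D y)) (lr_sum (D x \<inter> D y)) \<and>
      JF.eqv (lr_sum (D x) * lr_sum (D y)) (rl_sum (D x \<inter> D y))"
    "x \<in> right G' \<Longrightarrow> y \<in> right G' \<Longrightarrow> JT.eqv (lr_sum (D x) * lr_sum (D y)) (rl_sum (D x \<inter> D y)) \<and>
      JF.eqv (lr_sum (D x) * lr_sum (D y)) (lr_sum (D x \<inter> D y))"
  using JT.edge_sum_left_left[OF D_saturated(1) D_saturated(1), of x y]
    JF.edge_sum_right_right[OF D_saturated(2) D_saturated(2), of x y]
    JT.edge_sum_left_right[OF D_saturated(1) D_saturated(3), of x y]
    JF.edge_sum_right_left[OF D_saturated(2) D_saturated(4), of x y]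
    JT.edge_sum_right_right[OF D_saturated(3) D_saturated(3), of x y]
    JF.edge_sum_left_left[OF D_saturated(4) D_saturated(4), of x y]
  unfolding JT.edge_sum_def JF.edge_sum_def by simp_all

lemma D_commute:
  assumes "x \<in> left G' \<union> right G'"
  shows "JT.eqv (lr_sum (D x)) (rl_sum (D x))" "JF.eqv (lr_sum (D x)) (rl_sum (D x))"
  using assms JT.edge_sum_commute[OF D_saturated(1), of x] JT.edge_sum_commute_right[OF D_saturated(3), of x]
    JF.edge_sum_commute_right[OF D_saturated(2), of x] JF.edge_sum_commute[OF D_saturated(4), of x]
  unfolding JT.edge_sum_def JF.edge_sum_def by (elim UnE; simp)+

lemma finite_D: "finite (D x)"
  by (rule finite_subset[OF _ KK.finite_E]) (auto simp: D_def)

lemma D_sub: "D x \<subseteq> EP"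
  by (auto simp: D_def)

lemma D_UNION:
  assumes "W = left G' \<or> W = right G'"
  shows "(\<Union>x\<in>W. D x) = EP" "\<And>x y. x \<in> W \<Longrightarrow> y \<in> W \<Longrightarrow> x \<noteq> y \<Longrightarrow> D x \<inter> D y = {}"
proof -
  have "\<exists>x\<in>W. x \<in> \<phi> {u, v}" if uv: "(u, v) \<in> EP" for u v
  proof (rule edgeE[OF G' phi_edge[OF EP_edge[OF uv]]])
    fix x z assume "x \<in> left G'" "z \<in> right G'" "\<phi> {u, v} = {x, z}"
    then show ?thesis using assms by auto
  qed
  then show "(\<Union>x\<in>W. D x) = EP" by (auto simp: D_def)
  show "D x \<inter> D y = {}" if xy: "x \<in> W" "y \<in> W" "x \<noteq> y" for x y
  proof (rule ccontr)
    assume "D x \<inter> D y \<noteq> {}"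
    then obtain u v where uv: "(u, v) \<in> EP" "x \<in> \<phi> {u, v}" "y \<in> \<phi> {u, v}" by (auto simp: D_def)
    have "x \<in> left G' \<longleftrightarrow> y \<in> left G'" using assms xy(1,2) G'_disjoint by auto
    then show False using phi_unique[OF uv] xy(3) by blast
  qed
qed

lemma new_gen_sum:
  assumes "W = left G' \<or> W = right G'" shows "(\<Oplus>\<^bsub>A\<^esub>x\<in>W. new_gen x) = \<one>\<^bsub>A\<^esub>"
proof -
  have W: "finite W" using assms G' by (auto simp: bipartite_graph_def)
  have "(\<Oplus>\<^bsub>A\<^esub>x\<in>W. new_gen x) = ev.poly_eval (\<Sum>x\<in>W. lr_sum (D x))"
    unfolding new_gen_def by (rule eval_sum[OF W, symmetric])
  also have "(\<Sum>x\<in>W. lr_sum (D x)) = lr_sum EP"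
    unfolding D_UNION(1)[OF assms, symmetric] using W finite_D D_UNION(2)[OF assms]
    by (subst sum.UNION_disjoint) auto
  also have "ev.poly_eval (lr_sum EP) = ev.poly_eval 1"
    using KK.edge_sum_all unfolding KK.edge_sum_def KK.eqv_def K_iff .
  finally show ?thesis by (simp add: ev.poly_eval_one)
qed

text \<open>The star of an edge sum is the reversed sum, and saturation identifies the two. Products
  follow the intersections of the sets \<open>D x\<close>: idempotence from \<open>D x\<close> with
  itself, and the relation for a non-edge because no edge is mapped to it.\<close>

lemma new_gen_projections: "bip_projections G' A new_gen"
  unfolding bip_projections_def
proof (intro conjI ballI impI)
  fix x assume x: "x \<in> left G' \<union> right G'"
  show "new_gen x \<in> carrier A" by (simp add: new_gen_def ev.poly_eval_closed)
  have "star A (ev.poly_eval (lr_sum M)) = ev.poly_eval (rl_sum M)" if "M \<subseteq> EP" "finite M" for M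
    using that(2,1)
  proof (induction M rule: finite_induct)
    case empty
    then show ?case by (simp add: ev.poly_eval_zero A.star_zero)
  next
    case (insert e M)
    obtain u v where e: "e = (u, v)" by (cases e)
    with insert.prems have "u \<in> X" "v \<in> X" by (auto simp: EP_def)
    then show ?case
      using insert by (simp add: e ev.poly_eval_add ev.poly_eval_mult A.star_add A.star_mult eval_gen gen_closed star_gen ev.poly_eval_closed)
  qed
  then have "star A (new_gen x) = ev.poly_eval (rl_sum (D x))"
    using finite_D[of x] D_sub[of x] by (simp only: new_gen_def)
  also have "\<dots> = new_gen x" unfolding new_gen_def using eval_eqI[OF D_commute[OF x]] by simp
  finally show "star A (new_gen x) = new_gen x" .
  have "ev.poly_eval (lr_sum (D x) * lr_sum (D x)) = ev.poly_eval (lr_sum (D x))"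
    using D_products(1)[of x x] D_products(3)[of x x] x
      JT.eqv_trans[OF _ JT.eqv_sym[OF D_commute(1)[OF x]]] JF.eqv_trans[OF _ JF.eqv_sym[OF D_commute(2)[OF x]]]
    unfolding Int_absorb by (intro eval_eqI) auto
  then show "new_gen x \<otimes>\<^bsub>A\<^esub> new_gen x = new_gen x" by (simp add: new_gen_def ev.poly_eval_mult)
next
  fix x z assume xz: "x \<in> left G'" "z \<in> right G'" "{x, z} \<notin> edges G'"
  have "D x \<inter> D z = {}"
  proof (rule ccontr)
    assume "D x \<inter> D z \<noteq> {}"
    then obtain u v where uv: "(u, v) \<in> EP" "x \<in> \<phi> {u, v}" "z \<in> \<phi> {u, v}" by (auto simp: D_def)
    then have "\<phi> {u, v} = {x, z}"
      using edgeE[OF G' phi_edge[OF EP_edge[OF uv(1)]]] xz G'_disjoint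
      by (metis (no_types, lifting) disjoint_iff insert_iff singletonD insert_commute)
    then show False using phi_edge[OF EP_edge[OF uv(1)]] xz by simp
  qed
  then have "ev.poly_eval (lr_sum (D x) * lr_sum (D z)) = ev.poly_eval 0"
    using D_products(2)[OF xz(1,2)] by (intro eval_eqI) auto
  then show "new_gen x \<otimes>\<^bsub>A\<^esub> new_gen z = \<zero>\<^bsub>A\<^esub>" by (simp add: new_gen_def ev.poly_eval_mult ev.poly_eval_zero)
qed (use new_gen_sum in auto)

text \<open>Each product collapses to the single edge that \<phi> maps to \<open>{x, z}\<close>, so
  the total is the sum over the edges at \<open>u\<close>. Modulo \<open>J False\<close> it comes
  out in reversed order, which gives \<open>gen u\<close> as well.\<close>

lemma new_gen_inverse:
  assumes u: "u \<in> X" and inv: "\<And>e. e \<in> edges G \<Longrightarrow> \<psi> (\<phi> e) = e"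
  defines "M \<equiv> {(x, z). x \<in> left G' \<and> z \<in> right G' \<and> {x, z} \<in> edges G' \<and> u \<in> \<psi> {x, z}}"
  shows "(\<Oplus>\<^bsub>A\<^esub>e\<in>M. new_gen (fst e) \<otimes>\<^bsub>A\<^esub> new_gen (snd e)) = gen u"
proof -
  have "M \<subseteq> left G' \<times> right G'" by (auto simp: M_def)
  then have M: "finite M" using G' finite_subset by (fastforce simp: bipartite_graph_def)
  define N where "N = {(a, b) \<in> EP. u \<in> {a, b}}"
  have phi_eq: "\<phi> {a, b} = {x, z}" if "(a, b) \<in> D x \<inter> D z" "x \<in> left G'" "z \<in> right G'" for a b x z
    using that edgeE[OF G' phi_edge[OF EP_edge[of a b]]] G'_disjoint unfolding D_def
    by (smt (verit) IntD1 IntD2 case_prod_conv disjoint_iff insert_iff mem_Collect_eq singletonD)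
  have MD: "fst m \<in> left G'" "snd m \<in> right G'" "u \<in> \<psi> {fst m, snd m}" if "m \<in> M" for m
    using that by (auto simp: M_def)
  have N: "(\<Union>m\<in>M. D (fst m) \<inter> D (snd m)) = N"
  proof (intro equalityI subsetI)
    fix e assume "e \<in> (\<Union>m\<in>M. D (fst m) \<inter> D (snd m))"
    then obtain m where m: "m \<in> M" "e \<in> D (fst m) \<inter> D (snd m)" by blast
    obtain a b where e: "e = (a, b)" by (cases e)
    have ab: "(a, b) \<in> EP" using m(2) D_sub unfolding e by blast
    have "\<psi> {fst m, snd m} = {a, b}"
      using phi_eq[of a b "fst m" "snd m"] m(2) MD[OF m(1)] inv[OF EP_edge[OF ab]] unfolding e by simp
    then show "e \<in> N" using MD(3)[OF m(1)] ab by (simp add: N_def e)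
  next
    fix e assume "e \<in> N"
    then obtain a b where e: "e = (a, b)" "(a, b) \<in> EP" "u \<in> {a, b}" unfolding N_def by blast
    obtain x z where xz: "x \<in> left G'" "z \<in> right G'" "\<phi> {a, b} = {x, z}"
      using edgeE[OF G' phi_edge[OF EP_edge[OF e(2)]]] by metis
    then have "\<psi> {x, z} = {a, b}" "{x, z} \<in> edges G'"
      using inv[OF EP_edge[OF e(2)]] phi_edge[OF EP_edge[OF e(2)]] by simp_all
    then have "(x, z) \<in> M" using xz(1,2) e(3) by (simp add: M_def)
    moreover have "e \<in> D x \<inter> D z" using xz(3) e(1,2) by (simp add: D_def)
    ultimately show "e \<in> (\<Union>m\<in>M. D (fst m) \<inter> D (snd m))" by force
  qed
  have disj: "(D (fst m) \<inter> D (snd m)) \<inter> (D (fst m') \<inter> D (snd m')) = {}" if "m \<in> M" "m' \<in> M" "m \<noteq> m'" for m m'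
    using D_UNION(2)[of "left G'" "fst m" "fst m'"] D_UNION(2)[of "right G'" "snd m" "snd m'"] MD[OF that(1)] MD[OF that(2)] that(3)
    by (cases "fst m = fst m'") (auto simp: prod_eq_iff)
  have sumN: "lr_sum N = (\<Sum>m\<in>M. lr_sum (D (fst m) \<inter> D (snd m)))" "rl_sum N = (\<Sum>m\<in>M. rl_sum (D (fst m) \<inter> D (snd m)))"
    unfolding N[symmetric] using M disj finite_D
    by (subst sum.UNION_disjoint; blast intro: finite_Int)+
  have "JT.eqv (\<Sum>m\<in>M. lr_sum (D (fst m)) * lr_sum (D (snd m))) (lr_sum N)"
    "JF.eqv (\<Sum>m\<in>M. lr_sum (D (fst m)) * lr_sum (D (snd m))) (rl_sum N)"
    unfolding sumN using D_products(2) MD by (intro JT.eqv_sum JF.eqv_sum; blast)+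
  moreover have "N = {(a, b) \<in> EP. a = u} \<and> u \<in> left G \<or> N = {(a, b) \<in> EP. b = u} \<and> u \<in> right G"
    using u fin(3) by (auto simp: N_def EP_def)
  then have "JT.eqv (lr_sum N) (poly_gen u)" "JF.eqv (rl_sum N) (poly_gen u)"
    using JT.star_sum_left(1) JT.star_sum_right(1) JF.star_sum_left(2) JF.star_sum_right(2) by auto
  ultimately have "ev.poly_eval (\<Sum>m\<in>M. lr_sum (D (fst m)) * lr_sum (D (snd m))) = ev.poly_eval (poly_gen u)"
    using JT.eqv_trans JF.eqv_trans by (intro eval_eqI) blast+
  moreover have "ev.poly_eval (\<Sum>m\<in>M. lr_sum (D (fst m)) * lr_sum (D (snd m)))
      = (\<Oplus>\<^bsub>A\<^esub>m\<in>M. new_gen (fst m) \<otimes>\<^bsub>A\<^esub> new_gen (snd m))"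
    using M by (simp add: eval_sum ev.poly_eval_mult new_gen_def)
  ultimately show ?thesis using u by (simp add: eval_gen)
qed

end

lemma star_hom_finsum:
  assumes "cstar_algebra A" "cstar_algebra B" "f \<in> star_hom A B" "finite I" "\<And>i. i \<in> I \<Longrightarrow> g i \<in> carrier A"
  shows "f (\<Oplus>\<^bsub>A\<^esub>i\<in>I. g i) = (\<Oplus>\<^bsub>B\<^esub>i\<in>I. f (g i))"
proof -
  interpret A: cstar_algebra A by (rule assms)
  interpret B: cstar_algebra B by (rule assms)
  show ?thesis
    using assms(4,5)
  proof (induction I rule: finite_induct)
    case empty
    then show ?case using star_hom_zero_minus(1)[OF assms(1-3)] by simp
  next
    case (insert i I)
    then have "f \<in> carrier A \<rightarrow> carrier B" using star_homD(1)[OF assms(3)] by blast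
    then show ?case using insert star_homD(2)[OF assms(3)] by (simp add: Pi_def)
  qed
qed

text \<open>The new generator on the side of \<open>G'\<close> is a sum of products of two
  generators along edges; its image under \<open>f\<close> is the sum computed in
  \<open>new_gen_inverse\<close>.\<close>

lemma (in flip) new_gen_roundtrip:
  assumes \<psi>: "edge_iso G' G \<psi>" "\<And>e. e \<in> edges G \<Longrightarrow> \<psi> (\<phi> e) = e"
    and f: "f \<in> star_hom (bip_cstar G') A" "\<And>x. x \<in> left G' \<union> right G' \<Longrightarrow> f (bip_gen G' x) = new_gen x"
    and u: "u \<in> X"
  shows "f (flip.new_gen G' \<psi> u) = gen u"
proof -
  interpret i: flip G' G \<psi> using G G' \<psi>(1) by unfold_locales
  define M where "M = {(x, z). x \<in> left G' \<and> z \<in> right G' \<and> {x, z} \<in> edges G' \<and> u \<in> \<psi> {x, z}}"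
  have M: "i.D u = M" by (auto simp: M_def i.D_def i.EP_def)
  have MX: "fst e \<in> left G' \<union> right G'" "snd e \<in> left G' \<union> right G'" if "e \<in> M" for e
    using that by (auto simp: M_def)
  have closed: "bip_gen G' (fst e) \<in> carrier (bip_cstar G')" "bip_gen G' (snd e) \<in> carrier (bip_cstar G')"
    if "e \<in> M" for e using i.gen_closed MX[OF that] by blast+
  have "i.new_gen u = (\<Oplus>\<^bsub>bip_cstar G'\<^esub>e\<in>M. i.ev.poly_eval (case e of (x, z) \<Rightarrow> poly_gen x * poly_gen z))"
    unfolding i.new_gen_def M by (rule i.eval_sum[OF i.finite_D[of u, unfolded M]])
  also have "\<dots> = (\<Oplus>\<^bsub>bip_cstar G'\<^esub>e\<in>M. bip_gen G' (fst e) \<otimes>\<^bsub>bip_cstar G'\<^esub> bip_gen G' (snd e))"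
    using closed MX i.eval_gen
    by (intro i.A.add.finprod_cong') (auto simp: i.ev.poly_eval_mult case_prod_unfold simp del: Un_iff)
  finally have "f (i.new_gen u) = (\<Oplus>\<^bsub>A\<^esub>e\<in>M. f (bip_gen G' (fst e) \<otimes>\<^bsub>bip_cstar G'\<^esub> bip_gen G' (snd e)))"
    using star_hom_finsum[OF i.A.cstar_algebra_axioms A.cstar_algebra_axioms f(1) i.finite_D[of u, unfolded M]] closed
    by simp
  also have "\<dots> = (\<Oplus>\<^bsub>A\<^esub>e\<in>M. new_gen (fst e) \<otimes>\<^bsub>A\<^esub> new_gen (snd e))"
    using closed MX f(2) star_homD(3)[OF f(1)]
    by (intro A.add.finprod_cong') (auto simp: new_gen_def ev.poly_eval_closed simp del: Un_iff)
  also have "\<dots> = gen u" unfolding M_def by (rule new_gen_inverse[OF u \<psi>(2)])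
  finally show ?thesis .
qed

theorem edge_iso_imp_isomorphic:
  fixes G :: "'v bip_graph" and G' :: "'w bip_graph"
  assumes G: "bipartite_graph G" and G': "bipartite_graph G'" and iso: "edge_iso G G' \<phi>"
  shows "cstar_isomorphic (bip_cstar G) (bip_cstar G')"
proof -
  define \<psi> where "\<psi> = inv_into (edges G) \<phi>"
  have \<psi>: "edge_iso G' G \<psi>" unfolding \<psi>_def by (rule edge_iso_inv[OF iso])
  have bij: "bij_betw \<phi> (edges G) (edges G')" using iso by (simp add: edge_iso_def)
  have \<psi>\<phi>: "\<psi> (\<phi> e) = e" if "e \<in> edges G" for e using that bij by (simp add: \<psi>_def bij_betw_inv_into_left)
  have \<phi>\<psi>: "\<phi> (\<psi> e) = e" if "e \<in> edges G'" for e using that bij by (simp add: \<psi>_def bij_betw_inv_into_right)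
  interpret f: flip G G' \<phi> using G G' iso by unfold_locales
  interpret i: flip G' G \<psi> using G G' \<psi> by unfold_locales
  obtain g where g: "g \<in> star_hom (bip_cstar G') (bip_cstar G)" "contractive_on (bip_cstar G') (bip_cstar G) g"
    "g \<one>\<^bsub>bip_cstar G'\<^esub> = \<one>\<^bsub>bip_cstar G\<^esub>" "\<And>x. x \<in> left G' \<union> right G' \<Longrightarrow> g (bip_gen G' x) = f.new_gen x"
    using i.bip_universal[OF f.A.cstar_algebra_axioms f.new_gen_projections] by metis
  obtain h where h: "h \<in> star_hom (bip_cstar G) (bip_cstar G')" "contractive_on (bip_cstar G) (bip_cstar G') h"
    "h \<one>\<^bsub>bip_cstar G\<^esub> = \<one>\<^bsub>bip_cstar G'\<^esub>" "\<And>x. x \<in> left G \<union> right G \<Longrightarrow> h (bip_gen G x) = i.new_gen x"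
    using f.bip_universal[OF i.A.cstar_algebra_axioms i.new_gen_projections] by metis
  have gh: "g (h a) = a" if a: "a \<in> carrier (bip_cstar G)" for a
  proof (rule f.star_hom_eqI[where g = "\<lambda>a. a", OF f.A.cstar_algebra_axioms star_hom_comp[OF h(1) g(1)] _ _ _ _ _ _ a])
    show "contractive_on (bip_cstar G) (bip_cstar G) (\<lambda>x. g (h x))"
      using g(2) h(2) star_homD(1)[OF h(1)] unfolding contractive_on_def by (meson order_trans)
    show "g (h (bip_gen G x)) = bip_gen G x" if "x \<in> left G \<union> right G" for x
      using f.new_gen_roundtrip[OF \<psi> \<psi>\<phi> g(1,4) that] h(4)[OF that] by simp
  qed (use g(3) h(3) in \<open>auto simp: star_hom_def contractive_on_def\<close>)
  have hg: "h (g a) = a" if a: "a \<in> carrier (bip_cstar G')" for a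
  proof (rule i.star_hom_eqI[where g = "\<lambda>a. a", OF i.A.cstar_algebra_axioms star_hom_comp[OF g(1) h(1)] _ _ _ _ _ _ a])
    show "contractive_on (bip_cstar G') (bip_cstar G') (\<lambda>x. h (g x))"
      using g(2) h(2) star_homD(1)[OF g(1)] unfolding contractive_on_def by (meson order_trans)
    show "h (g (bip_gen G' x)) = bip_gen G' x" if "x \<in> left G' \<union> right G'" for x
      using i.new_gen_roundtrip[OF iso \<phi>\<psi> h(1,4) that] g(4)[OF that] by simp
  qed (use g(3) h(3) in \<open>auto simp: star_hom_def contractive_on_def\<close>)
  have "bij_betw h (carrier (bip_cstar G)) (carrier (bip_cstar G'))"
    using gh hg star_homD(1)[OF h(1)] star_homD(1)[OF g(1)] by (intro bij_betw_byWitness[of _ g]) auto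
  then show ?thesis using h(1) by (auto simp: cstar_isomorphic_def)
qed

section \<open>Operators on the plane\<close>

type_synonym cvec = "complex \<times> complex"

definition cscale :: "complex \<Rightarrow> cvec \<Rightarrow> cvec" where
  "cscale c x = (c * fst x, c * snd x)"

definition cinner :: "cvec \<Rightarrow> cvec \<Rightarrow> complex" where
  "cinner x y = cnj (fst x) * fst y + cnj (snd x) * snd y"

lemma cscale_simps [simp]: "fst (cscale c x) = c * fst x" "snd (cscale c x) = c * snd x"
  "cscale 1 x = x" "cscale 0 x = 0" "cscale c 0 = 0"
  by (simp_all add: cscale_def prod_eq_iff)

lemma cscale_cscale: "cscale c (cscale d x) = cscale (c * d) x"
  and cscale_add: "cscale c (x + y) = cscale c x + cscale c y"
  and cscale_add_left: "cscale (c + d) x = cscale c x + cscale d x"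
  and cscale_of_real: "cscale (of_real r) x = r *\<^sub>R x"
  by (simp_all add: prod_eq_iff algebra_simps scaleR_conv_of_real)

lemma inner_cvec: "x \<bullet> y = Re (cinner x y)" for x y :: cvec
  by (cases x; cases y) (simp add: cinner_def inner_complex_def)

lemma cinner_self: "cinner x x = of_real ((norm x)\<^sup>2)"
proof -
  have "Im (cinner x x) = 0" by (simp add: cinner_def)
  moreover have "Re (cinner x x) = (norm x)\<^sup>2" by (simp add: inner_cvec[symmetric] power2_norm_eq_inner)
  ultimately show ?thesis by (simp add: complex_eq_iff)
qed

lemma cinner_simps:
  "cinner (x + y) z = cinner x z + cinner y z" "cinner z (x + y) = cinner z x + cinner z y"
  "cinner (x - y) z = cinner x z - cinner y z" "cinner z (x - y) = cinner z x - cinner z y"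
  "cinner (cscale c x) y = cnj c * cinner x y" "cinner x (cscale c y) = c * cinner x y"
  "cinner 0 x = 0" "cinner x 0 = 0"
  by (simp_all add: cinner_def algebra_simps)

lemma norm_cscale: "norm (cscale c x) = cmod c * norm x"
proof -
  have "(norm (cscale c x))\<^sup>2 = (cmod c * norm x)\<^sup>2"
    by (simp add: norm_prod_def norm_mult power_mult_distrib algebra_simps)
  then show ?thesis by (simp add: power2_eq_iff_nonneg)
qed

lemma bounded_linear_cscale: "bounded_linear (cscale c)"
  by (intro bounded_linear_intro[where K = "cmod c"])
    (simp_all add: cscale_add norm_cscale prod_eq_iff mult.commute)

definition cscale_op :: "complex \<Rightarrow> cvec \<Rightarrow>\<^sub>L cvec" where
  "cscale_op c = Blinfun (cscale c)"

lemma cscale_op_apply [simp]: "cscale_op c x = cscale c x"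
  by (simp add: cscale_op_def bounded_linear_Blinfun_apply bounded_linear_cscale)

text \<open>The adjoint for the real inner product, which is the real part of \<open>cinner\<close>.
  On complex-linear operators it is the adjoint for \<open>cinner\<close> too, see
  \<open>cinner_adj_op\<close>.\<close>

definition adj_op :: "(cvec \<Rightarrow>\<^sub>L cvec) \<Rightarrow> cvec \<Rightarrow>\<^sub>L cvec" where
  "adj_op f = Blinfun (adjoint (blinfun_apply f))"

lemma linear_blinfun: "linear (blinfun_apply f)"
  by (simp add: bounded_linear.linear blinfun.bounded_linear_right)

lemma adj_op_apply: "blinfun_apply (adj_op f) = adjoint (blinfun_apply f)"
  unfolding adj_op_def using adjoint_linear[OF linear_blinfun[of f]]
  by (simp add: bounded_linear_Blinfun_apply linear_conv_bounded_linear)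

lemma adj_op_inner: "x \<bullet> adj_op f y = f x \<bullet> y"
  unfolding adj_op_apply by (rule adjoint_works[OF linear_blinfun])

lemma adj_op_eqI:
  assumes "\<And>x y. blinfun_apply f x \<bullet> y = x \<bullet> blinfun_apply g y" shows "adj_op f = g"
  by (rule blinfun_eqI, rule vector_eq_ldot[THEN iffD1]) (simp add: adj_op_inner assms)

text \<open>The complex 2 by 2 matrices. The type of bounded operators is real-linear, so complex
  linearity is imposed as the carrier condition.\<close>

definition opV :: "(cvec \<Rightarrow>\<^sub>L cvec) star_algebra" where
  "opV = \<lparr>carrier = {f. \<forall>c x. blinfun_apply f (cscale c x) = cscale c (f x)},
     mult = (o\<^sub>L), one = id_blinfun, zero = 0, add = (+),
     scale = (\<lambda>c f. cscale_op c o\<^sub>L f), star = adj_op, nrm = norm\<rparr>"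

lemma opV_sel [simp]:
  "mult opV = (o\<^sub>L)" "one opV = id_blinfun" "zero opV = 0" "add opV = (+)"
  "scale opV c f = cscale_op c o\<^sub>L f" "star opV = adj_op" "nrm opV = norm"
  by (simp_all add: opV_def)

lemma in_opV: "f \<in> carrier opV \<longleftrightarrow> (\<forall>c x. blinfun_apply f (cscale c x) = cscale c (f x))"
  by (simp add: opV_def)

lemma opV_apply_cscale: "f \<in> carrier opV \<Longrightarrow> blinfun_apply f (cscale c x) = cscale c (f x)"
  unfolding in_opV by blast

lemma ring_opV: "ring opV"
proof (rule ringI)
  show "abelian_group opV"
  proof (rule abelian_groupI)
    show "\<exists>y\<in>carrier opV. y \<oplus>\<^bsub>opV\<^esub> x = \<zero>\<^bsub>opV\<^esub>" if "x \<in> carrier opV" for x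
      using that by (intro bexI[of _ "- x"])
        (auto simp: in_opV blinfun.minus_left prod_eq_iff)
  qed (auto simp: in_opV blinfun.add_left cscale_add)
  show "monoid opV"
    by (rule monoidI) (auto simp: in_opV simp del: split_paired_All intro!: blinfun_eqI)
qed (auto intro!: blinfun_eqI simp: blinfun.add_left blinfun.add_right)

lemma opV_minus: assumes "a \<in> carrier opV" "b \<in> carrier opV" shows "a \<ominus>\<^bsub>opV\<^esub> b = a - b"
proof -
  interpret ring opV by (rule ring_opV)
  have "- b \<in> carrier opV" using assms by (auto simp: in_opV blinfun.minus_left prod_eq_iff)
  then have "\<ominus>\<^bsub>opV\<^esub> b = - b" using assms minus_equality[of "- b" b] by simp
  then show ?thesis by (simp add: a_minus_def)
qed

lemma adj_op_closed: assumes f: "f \<in> carrier opV" shows "adj_op f \<in> carrier opV"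
proof -
  have inner_cscale: "x \<bullet> cscale c y = cscale (cnj c) x \<bullet> y" for x y :: cvec and c
    by (simp add: inner_cvec cinner_simps)
  have "x \<bullet> adj_op f (cscale c y) = x \<bullet> cscale c (adj_op f y)" for x y c
    unfolding adj_op_inner inner_cscale opV_apply_cscale[OF f, symmetric] by simp
  then show ?thesis unfolding in_opV by (meson vector_eq_ldot)
qed

lemma norm_adj_op_le: "norm (adj_op f) \<le> norm f"
proof (rule norm_blinfun_bound)
  fix y
  have "(norm (adj_op f y))\<^sup>2 = f (adj_op f y) \<bullet> y"
    by (simp add: power2_norm_eq_inner adj_op_inner[symmetric])
  also have "\<dots> \<le> norm (f (adj_op f y)) * norm y" by (rule norm_cauchy_schwarz)
  also have "\<dots> \<le> norm f * norm (adj_op f y) * norm y" by (intro mult_right_mono norm_blinfun) simp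
  finally have "norm (adj_op f y) * norm (adj_op f y) \<le> (norm f * norm y) * norm (adj_op f y)"
    by (simp add: power2_eq_square mult_ac)
  then show "norm (adj_op f y) \<le> norm f * norm y"
    by (cases "adj_op f y = 0") (simp_all add: mult_le_cancel_right)
qed simp

lemma adj_op_adj_op: "adj_op (adj_op f) = f"
  by (rule adj_op_eqI) (metis adj_op_inner inner_commute)

lemma norm_adj_op: "norm (adj_op f) = norm f"
  using norm_adj_op_le[of f] norm_adj_op_le[of "adj_op f"] by (simp add: adj_op_adj_op)

lemma norm_adj_op_compose: "norm (adj_op f o\<^sub>L f) = (norm f)\<^sup>2"
proof (rule antisym)
  show "norm (adj_op f o\<^sub>L f) \<le> (norm f)\<^sup>2"
    using norm_blinfun_compose[of "adj_op f" f] by (simp add: norm_adj_op power2_eq_square)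
  have "norm f \<le> sqrt (norm (adj_op f o\<^sub>L f))"
  proof (rule norm_blinfun_bound)
    fix x
    have "(norm (f x))\<^sup>2 = x \<bullet> (adj_op f o\<^sub>L f) x"
      by (simp add: power2_norm_eq_inner adj_op_inner)
    also have "\<dots> \<le> norm x * norm ((adj_op f o\<^sub>L f) x)" by (rule norm_cauchy_schwarz)
    also have "\<dots> \<le> norm x * (norm (adj_op f o\<^sub>L f) * norm x)" by (intro mult_left_mono norm_blinfun) simp
    finally have "sqrt ((norm (f x))\<^sup>2) \<le> sqrt (norm (adj_op f o\<^sub>L f) * (norm x)\<^sup>2)"
      by (intro real_sqrt_le_mono) (simp add: power2_eq_square mult_ac)
    then show "norm (f x) \<le> sqrt (norm (adj_op f o\<^sub>L f)) * norm x" by (simp add: real_sqrt_mult)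
  qed simp
  then have "(norm f)\<^sup>2 \<le> (sqrt (norm (adj_op f o\<^sub>L f)))\<^sup>2" by (intro power_mono) simp_all
  then show "(norm f)\<^sup>2 \<le> norm (adj_op f o\<^sub>L f)" by simp
qed

theorem cstar_algebra_opV: "cstar_algebra opV"
proof -
  interpret ring opV by (rule ring_opV)
  have sa: "x \<bullet> cscale c y = cscale (cnj c) x \<bullet> y" for x y :: cvec and c
    by (simp add: inner_cvec cinner_simps)
  show ?thesis
  proof unfold_locales
    fix a b :: "cvec \<Rightarrow>\<^sub>L cvec" and c d :: complex
    assume a: "a \<in> carrier opV"
    show "scale opV c a \<in> carrier opV" using a by (auto simp: in_opV cscale_cscale mult.commute)
    show "star opV a \<in> carrier opV" using adj_op_closed[OF a] by simp
    show "scale opV (c + d) a = scale opV c a \<oplus>\<^bsub>opV\<^esub> scale opV d a"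
      by (rule blinfun_eqI) (simp add: blinfun.add_left cscale_add_left)
    show "scale opV c (scale opV d a) = scale opV (c * d) a"
      by (rule blinfun_eqI) (simp add: cscale_cscale)
    show "scale opV 1 a = a" by (rule blinfun_eqI) simp
    show "star opV (star opV a) = a" by (simp add: adj_op_adj_op)
    have "adj_op (cscale_op c o\<^sub>L a) = cscale_op (cnj c) o\<^sub>L adj_op a"
    proof (rule adj_op_eqI)
      fix x y
      have "(cscale_op c o\<^sub>L a) x \<bullet> y = a x \<bullet> cscale (cnj c) y" by (simp add: sa)
      also have "\<dots> = x \<bullet> adj_op a (cscale (cnj c) y)" by (simp add: adj_op_inner)
      finally show "(cscale_op c o\<^sub>L a) x \<bullet> y = x \<bullet> (cscale_op (cnj c) o\<^sub>L adj_op a) y"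
        by (simp add: opV_apply_cscale[OF adj_op_closed[OF a]])
    qed
    then show "star opV (scale opV c a) = scale opV (cnj c) (star opV a)" by simp
    show "0 \<le> nrm opV a" by simp
    show "nrm opV a = 0 \<longleftrightarrow> a = \<zero>\<^bsub>opV\<^esub>" by simp
    show "nrm opV (star opV a \<otimes>\<^bsub>opV\<^esub> a) = (nrm opV a)\<^sup>2" by (simp add: norm_adj_op_compose)
    have le: "norm (cscale_op c o\<^sub>L a) \<le> cmod c * norm a" for c and a :: "cvec \<Rightarrow>\<^sub>L cvec"
      using norm_blinfun[of a] by (intro norm_blinfun_bound) (auto simp: norm_cscale mult.assoc intro!: mult_left_mono)
    show "nrm opV (scale opV c a) = cmod c * nrm opV a"
    proof (cases "c = 0")
      case True
      then have "cscale_op c o\<^sub>L a = 0" by (intro blinfun_eqI) simp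
      then show ?thesis using True by simp
    next
      case False
      have "a = cscale_op (inverse c) o\<^sub>L (cscale_op c o\<^sub>L a)"
        using False by (intro blinfun_eqI) (simp add: cscale_cscale)
      then have "norm a \<le> cmod (inverse c) * norm (cscale_op c o\<^sub>L a)"
        using le[of "inverse c" "cscale_op c o\<^sub>L a"] by simp
      then have "cmod c * norm a \<le> norm (cscale_op c o\<^sub>L a)"
        using False by (simp add: norm_divide field_simps)
      then show ?thesis using le[of c a] by simp
    qed
    assume b: "b \<in> carrier opV"
    show "scale opV c (a \<oplus>\<^bsub>opV\<^esub> b) = scale opV c a \<oplus>\<^bsub>opV\<^esub> scale opV c b"
      by (rule blinfun_eqI) (simp add: blinfun.add_left cscale_add)
    show "scale opV c a \<otimes>\<^bsub>opV\<^esub> b = scale opV c (a \<otimes>\<^bsub>opV\<^esub> b)" by (rule blinfun_eqI) simp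
    show "a \<otimes>\<^bsub>opV\<^esub> scale opV c b = scale opV c (a \<otimes>\<^bsub>opV\<^esub> b)"
      by (rule blinfun_eqI) (simp add: opV_apply_cscale[OF a])
    show "star opV (a \<oplus>\<^bsub>opV\<^esub> b) = star opV a \<oplus>\<^bsub>opV\<^esub> star opV b"
      by (simp, rule adj_op_eqI) (simp add: blinfun.add_left inner_add_left inner_add_right adj_op_inner)
    show "star opV (a \<otimes>\<^bsub>opV\<^esub> b) = star opV b \<otimes>\<^bsub>opV\<^esub> star opV a"
      by (simp, rule adj_op_eqI) (simp add: adj_op_inner)
    show "nrm opV (a \<oplus>\<^bsub>opV\<^esub> b) \<le> nrm opV a + nrm opV b" by (simp add: norm_triangle_ineq)
    show "nrm opV (a \<otimes>\<^bsub>opV\<^esub> b) \<le> nrm opV a * nrm opV b" by (simp add: norm_blinfun_compose)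
  next
    fix s :: "nat \<Rightarrow> cvec \<Rightarrow>\<^sub>L cvec"
    assume s: "\<And>n. s n \<in> carrier opV"
      and cauchy: "\<And>e. 0 < e \<Longrightarrow> \<exists>N. \<forall>m\<ge>N. \<forall>n\<ge>N. nrm opV (s m \<ominus>\<^bsub>opV\<^esub> s n) < e"
    have "Cauchy s" using cauchy s by (simp add: Cauchy_def dist_norm opV_minus)
    then obtain f where f: "s \<longlonglongrightarrow> f" using Cauchy_convergent_iff convergent_def by blast
    have ap: "(\<lambda>n. s n x) \<longlonglongrightarrow> f x" for x using f by (intro tendsto_intros)
    have "f (cscale c x) = cscale c (f x)" for c x
    proof (rule LIMSEQ_unique[OF ap])
      have "(\<lambda>n. cscale c (s n x)) \<longlonglongrightarrow> cscale c (f x)"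
        using ap bounded_linear.tendsto[OF bounded_linear_cscale] by blast
      then show "(\<lambda>n. s n (cscale c x)) \<longlonglongrightarrow> cscale c (f x)" using s by (simp add: opV_apply_cscale)
    qed
    then have fin: "f \<in> carrier opV" by (simp add: in_opV)
    have "(\<lambda>n. norm (s n - f)) \<longlonglongrightarrow> 0" using f by (simp add: LIM_zero_iff tendsto_norm_zero_iff)
    then show "\<exists>a\<in>carrier opV. (\<lambda>n. nrm opV (s n \<ominus>\<^bsub>opV\<^esub> a)) \<longlonglongrightarrow> 0"
      using fin s by (auto simp: opV_minus)
  qed
qed

interpretation opV: cstar_algebra opV by (rule cstar_algebra_opV)

lemma opV_finsum: "(\<And>i. i \<in> I \<Longrightarrow> f i \<in> carrier opV) \<Longrightarrow> (\<Oplus>\<^bsub>opV\<^esub>i\<in>I. f i) = sum f I"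
  by (induction I rule: infinite_finite_induct) (simp_all add: opV.finsum_infinite Pi_def)

text \<open>The projection onto the line through the real vector \<open>(a, b)\<close>, if that is a unit vector.\<close>

definition line_proj :: "real \<Rightarrow> real \<Rightarrow> cvec \<Rightarrow>\<^sub>L cvec" where
  "line_proj a b = Blinfun (\<lambda>x. cscale (of_real a * fst x + of_real b * snd x) (of_real a, of_real b))"

lemma line_proj_apply: "line_proj a b x = cscale (of_real a * fst x + of_real b * snd x) (of_real a, of_real b)"
proof -
  have "linear (\<lambda>x. cscale (of_real a * fst x + of_real b * snd x) (complex_of_real a, complex_of_real b))"
    by (intro linearI) (simp_all add: prod_eq_iff algebra_simps scaleR_conv_of_real)
  then show ?thesis
    unfolding line_proj_def by (simp add: bounded_linear_Blinfun_apply linear_conv_bounded_linear)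
qed

lemma line_proj_closed: "line_proj a b \<in> carrier opV"
  by (simp add: in_opV line_proj_apply cscale_cscale distrib_left mult_ac)

lemma line_proj_adj: "adj_op (line_proj a b) = line_proj a b"
  by (rule adj_op_eqI) (simp add: line_proj_apply inner_cvec cinner_def algebra_simps)

lemma line_proj_idem: assumes "a\<^sup>2 + b\<^sup>2 = 1" shows "line_proj a b o\<^sub>L line_proj a b = line_proj a b"
proof (rule blinfun_eqI)
  fix x
  have "complex_of_real a * a + complex_of_real b * b = 1"
    using assms by (metis of_real_1 of_real_add of_real_mult power2_eq_square)
  then have "a * (c * a) + b * (c * b) = c" for c :: complex
    by (metis mult.left_commute mult.right_neutral distrib_left)
  then show "(line_proj a b o\<^sub>L line_proj a b) x = line_proj a b x" by (simp add: line_proj_apply)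
qed

lemma line_proj_sum: assumes "a\<^sup>2 + b\<^sup>2 = 1" shows "line_proj a b + line_proj b (- a) = id_blinfun"
proof (rule blinfun_eqI)
  fix x
  have 1: "complex_of_real a * a + complex_of_real b * b = 1"
    using assms by (metis of_real_1 of_real_add of_real_mult power2_eq_square)
  have "(complex_of_real a * fst x + complex_of_real b * snd x) * a + (complex_of_real b * fst x + - complex_of_real a * snd x) * b
        = (complex_of_real a * a + complex_of_real b * b) * fst x"
    "(complex_of_real a * fst x + complex_of_real b * snd x) * b + (complex_of_real b * fst x + - complex_of_real a * snd x) * (- complex_of_real a) = (complex_of_real a * a + complex_of_real b * b) * snd x"
    by (simp_all add: algebra_simps)
  then show "(line_proj a b + line_proj b (- a)) x = id_blinfun x"
    by (simp add: line_proj_apply blinfun.add_left prod_eq_iff 1)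
qed

text \<open>A character is doubled to act by scalars on the plane, so that one- and two-dimensional
  representations share the target \<open>opV\<close>.\<close>

definition edge_model :: "'v \<Rightarrow> 'v \<Rightarrow> 'v \<Rightarrow> cvec \<Rightarrow>\<^sub>L cvec" where
  "edge_model u v x = (if x = u \<or> x = v then id_blinfun else 0)"

text \<open>The left pair are the projections onto the axes, the right pair those onto the line at
  angle \<open>t\<close> and its orthogonal complement. In both pairs the second one has the form
  \<open>line_proj b (- a)\<close> of \<open>line_proj_sum\<close>, hence
  \<open>line_proj 0 (- 1)\<close> for the second axis.\<close>

definition cycle_model :: "'v \<Rightarrow> 'v \<Rightarrow> 'v \<Rightarrow> 'v \<Rightarrow> real \<Rightarrow> 'v \<Rightarrow> cvec \<Rightarrow>\<^sub>L cvec" where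
  "cycle_model u u' v v' t x = (if x = u then line_proj 1 0 else if x = u' then line_proj 0 (- 1)
     else if x = v then line_proj (cos t) (sin t) else if x = v' then line_proj (sin t) (- cos t) else 0)"

lemma edge_model_projections:
  assumes G: "bipartite_graph G" and uv: "u \<in> left G" "v \<in> right G" "{u, v} \<in> edges G"
  shows "bip_projections G opV (edge_model u v)"
proof -
  have [simp]: "finite (left G)" "finite (right G)" using G by (auto simp: bipartite_graph_def)
  have d: "u \<notin> right G" "v \<notin> left G" using G uv by (auto simp: bipartite_graph_def)
  have cl: "edge_model u v x \<in> carrier opV" for x by (simp add: edge_model_def in_opV)
  have ids: "adj_op id_blinfun = id_blinfun" "adj_op 0 = 0" by (rule adj_op_eqI; simp)+
  have "(\<Sum>x\<in>left G. edge_model u v x) = (\<Sum>x\<in>left G. if x = u then id_blinfun else 0)"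
    "(\<Sum>x\<in>right G. edge_model u v x) = (\<Sum>x\<in>right G. if x = v then id_blinfun else 0)"
    using d by (intro sum.cong refl; auto simp: edge_model_def)+
  then have "(\<Sum>x\<in>left G. edge_model u v x) = id_blinfun" "(\<Sum>x\<in>right G. edge_model u v x) = id_blinfun"
    using uv by (simp_all add: sum.delta)
  moreover have "edge_model u v x o\<^sub>L edge_model u v x = edge_model u v x" for x
    by (rule blinfun_eqI) (simp add: edge_model_def)
  moreover have "edge_model u v x o\<^sub>L edge_model u v y = 0" if "x \<in> left G" "y \<in> right G" "{x, y} \<notin> edges G" for x y
    using that uv d by (intro blinfun_eqI) (auto simp: edge_model_def)
  ultimately show ?thesis
    unfolding bip_projections_def using cl by (auto simp: opV_finsum ids edge_model_def)
qed

lemma cycle_model_projections: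
  assumes G: "bipartite_graph G" and c: "four_cycle G u u' v v'"
  shows "bip_projections G opV (cycle_model u u' v v' t)"
proof -
  have [simp]: "finite (left G)" "finite (right G)" using G by (auto simp: bipartite_graph_def)
  have in_G: "u \<in> left G" "u' \<in> left G" "v \<in> right G" "v' \<in> right G" "u \<noteq> u'" "v \<noteq> v'"
    using c by (auto simp: four_cycle_def)
  then have d: "u \<notin> right G" "v \<notin> left G" "u' \<notin> right G" "v' \<notin> left G" using G by (auto simp: bipartite_graph_def)
  have ne: "v \<noteq> u" "v' \<noteq> u" "v \<noteq> u'" "v' \<noteq> u'" using in_G d by auto
  have zero: "adj_op 0 = 0" by (rule adj_op_eqI) simp
  have cl: "cycle_model u u' v v' t x \<in> carrier opV" for x
    by (auto simp: cycle_model_def line_proj_closed) (simp add: in_opV)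
  have "(\<Sum>x\<in>left G. cycle_model u u' v v' t x) = (\<Sum>x\<in>{u, u'}. cycle_model u u' v v' t x)"
    using in_G d by (intro sum.mono_neutral_right) (auto simp: cycle_model_def)
  also have "\<dots> = id_blinfun" using in_G line_proj_sum[of 1 0] by (simp add: cycle_model_def)
  finally have 1: "(\<Sum>x\<in>left G. cycle_model u u' v v' t x) = id_blinfun" .
  have "(\<Sum>x\<in>right G. cycle_model u u' v v' t x) = (\<Sum>x\<in>{v, v'}. cycle_model u u' v v' t x)"
    using in_G d by (intro sum.mono_neutral_right) (auto simp: cycle_model_def)
  also have "\<dots> = id_blinfun" using in_G ne line_proj_sum[of "cos t" "sin t"] by (simp add: cycle_model_def)
  finally have 2: "(\<Sum>x\<in>right G. cycle_model u u' v v' t x) = id_blinfun" .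
  have 3: "cycle_model u u' v v' t x o\<^sub>L cycle_model u u' v v' t x = cycle_model u u' v v' t x" for x
    by (auto simp: cycle_model_def line_proj_idem)
  have 4: "adj_op (cycle_model u u' v v' t x) = cycle_model u u' v v' t x" for x
    by (auto simp: cycle_model_def line_proj_adj zero)
  have 5: "cycle_model u u' v v' t x o\<^sub>L cycle_model u u' v v' t y = 0"
    if "x \<in> left G" "y \<in> right G" "{x, y} \<notin> edges G" for x y
  proof -
    have "x \<notin> {u, u'} \<or> y \<notin> {v, v'}" using that c by (auto simp: four_cycle_def)
    then have "cycle_model u u' v v' t x = 0 \<or> cycle_model u u' v v' t y = 0"
      using that in_G d by (auto simp: cycle_model_def)
    then show ?thesis by (auto intro!: blinfun_eqI)
  qed
  show ?thesis
    unfolding bip_projections_def using cl 1 2 3 4 5 by (simp add: opV_finsum)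
qed

lemma cinner_adj_op: assumes f: "f \<in> carrier opV" shows "cinner (adj_op f x) y = cinner x (f y)"
proof -
  have re: "Re (cinner (adj_op f x) y) = Re (cinner x (f y))" for x y
    using adj_op_inner[of y f x] by (metis inner_commute inner_cvec)
  have im: "Im (cinner x y) = Re (cinner (cscale \<i> x) y)" for x y by (simp add: cinner_simps)
  have "Im (cinner (adj_op f x) y) = Im (cinner x (f y))"
    unfolding im using re[of "cscale \<i> x" y] opV_apply_cscale[OF adj_op_closed[OF f]] by simp
  with re show ?thesis by (simp add: complex_eq_iff)
qed

lemma l2_finite: assumes "finite J" shows "\<xi> \<in> l2 J \<longleftrightarrow> (\<forall>k. k \<notin> J \<longrightarrow> \<xi> k = 0)"
proof -
  have "(\<lambda>k. (cmod (\<xi> k))\<^sup>2) summable_on UNIV" if "\<forall>k. k \<notin> J \<longrightarrow> \<xi> k = 0"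
  proof (rule finite_nonzero_values_imp_summable_on)
    show "finite {k \<in> UNIV. (cmod (\<xi> k))\<^sup>2 \<noteq> 0}"
      using that by (intro finite_subset[OF _ assms]) auto
  qed
  then show ?thesis by (auto simp: l2_def)
qed

lemma infsum_finite_support:
  fixes f :: "'i \<Rightarrow> 'b :: {comm_monoid_add, t2_space}"
  assumes "finite J" "\<And>k. k \<notin> J \<Longrightarrow> f k = 0" shows "(\<Sum>\<^sub>\<infinity>k. f k) = sum f J"
  using assms infsum_cong_neutral[of UNIV J f f] by simp

definition emb :: "'i \<Rightarrow> 'i \<Rightarrow> cvec \<Rightarrow> 'i \<Rightarrow> complex" where
  "emb i j x = (\<lambda>k. if k = i then fst x else if k = j then snd x else 0)"

definition coord :: "'i \<Rightarrow> 'i \<Rightarrow> ('i \<Rightarrow> complex) \<Rightarrow> cvec" where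
  "coord i j \<xi> = (\<xi> i, \<xi> j)"

lemma coord_linear: "coord i j (\<lambda>k. \<xi> k + \<eta> k) = coord i j \<xi> + coord i j \<eta>"
    "coord i j (\<lambda>k. c * \<xi> k) = cscale c (coord i j \<xi>)"
  and emb_linear: "emb i j (x + y) = (\<lambda>k. emb i j x k + emb i j y k)"
    "emb i j (cscale c x) = (\<lambda>k. c * emb i j x k)" "emb i j 0 = (\<lambda>k. 0)"
  by (auto simp: coord_def emb_def prod_eq_iff)

lemma coord_emb: "i \<noteq> j \<Longrightarrow> coord i j (emb i j x) = x"
  by (simp add: coord_def emb_def)

lemma emb_eq_zero: assumes "i \<noteq> j" shows "emb i j x = (\<lambda>k. 0) \<longleftrightarrow> x = 0"
proof
  assume "emb i j x = (\<lambda>k. 0)"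
  then have "coord i j (emb i j x) = 0" by (simp add: coord_def zero_prod_def)
  then show "x = 0" by (simp add: coord_emb[OF assms])
qed (simp add: emb_linear)

lemma emb_in: "emb i j x \<in> l2 {i, j}"
  by (auto simp: l2_finite emb_def)

lemma emb_coord: "\<xi> \<in> l2 {i, j} \<Longrightarrow> emb i j (coord i j \<xi>) = \<xi>"
  by (auto simp: l2_finite emb_def coord_def)

lemma l2_inner_coord:
  assumes "i \<noteq> j" "\<xi> \<in> l2 {i, j}" shows "l2_inner \<xi> \<eta> = cinner (coord i j \<xi>) (coord i j \<eta>)"
proof -
  have "\<And>k. k \<notin> {i, j} \<Longrightarrow> \<xi> k = 0" using assms(2) by (simp add: l2_finite)
  then show ?thesis
    unfolding l2_inner_def using assms(1)
    by (subst infsum_finite_support[of "{i, j}"]) (auto simp: cinner_def coord_def)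
qed

lemma l2_norm_coord:
  assumes "i \<noteq> j" "\<xi> \<in> l2 {i, j}" shows "l2_norm \<xi> = norm (coord i j \<xi>)"
proof -
  have "\<And>k. k \<notin> {i, j} \<Longrightarrow> \<xi> k = 0" using assms(2) by (simp add: l2_finite)
  then show ?thesis
    unfolding l2_norm_def using assms(1)
    by (subst infsum_finite_support[of "{i, j}"]) (auto simp: norm_prod_def coord_def)
qed

lemma l2_norm_component: assumes "\<xi> \<in> l2 {i, j}" "i \<noteq> j" shows "cmod (\<xi> i) \<le> l2_norm \<xi>" "cmod (\<xi> j) \<le> l2_norm \<xi>"
  using norm_fst_le[of "\<xi> i" "\<xi> j"] norm_snd_le[of "\<xi> j" "\<xi> i"]
  by (simp_all add: l2_norm_coord[OF assms(2,1)] coord_def)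

section \<open>Representations of dimension one and two as homomorphisms into
  \<open>opV\<close>\<close>

definition op_kernel :: "('a, 'm) star_algebra_scheme \<Rightarrow> ('a \<Rightarrow> cvec \<Rightarrow>\<^sub>L cvec) \<Rightarrow> 'a set" where
  "op_kernel A g = {a \<in> carrier A. g a = 0}"

definition op_scalar :: "('a, 'm) star_algebra_scheme \<Rightarrow> ('a \<Rightarrow> cvec \<Rightarrow>\<^sub>L cvec) \<Rightarrow> bool" where
  "op_scalar A g \<longleftrightarrow> g \<in> star_hom A opV \<and> g \<one>\<^bsub>A\<^esub> = id_blinfun \<and> (\<forall>a\<in>carrier A. \<exists>c. g a = cscale_op c)"

text \<open>Proper nonzero subspaces of the plane are lines, so irreducibility means that no line is
  invariant. That the unit acts as the identity is a consequence, see
  \<open>irred_one\<close>.\<close>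

definition op_irred :: "('a, 'm) star_algebra_scheme \<Rightarrow> ('a \<Rightarrow> cvec \<Rightarrow>\<^sub>L cvec) \<Rightarrow> bool" where
  "op_irred A g \<longleftrightarrow> g \<in> star_hom A opV \<and> (\<forall>x. x \<noteq> 0 \<longrightarrow> (\<exists>a\<in>carrier A. \<forall>c. g a x \<noteq> cscale c x))"

definition kern_le2 :: "('a, 'm) star_algebra_scheme \<Rightarrow> 'a set set" where
  "kern_le2 A = {rep_kernel A J \<pi> | (J :: 'a set) \<pi>. irreducible_rep A J \<pi> \<and> (card J = 1 \<or> card J = 2)}"

text \<open>Cramer's rule; the determinant \<open>?D\<close> vanishes only if \<open>y\<close> is a
  multiple of \<open>x\<close>.\<close>

lemma cvec_basis:
  assumes "\<And>c. y \<noteq> cscale c x" "x \<noteq> 0" shows "\<exists>c d. z = cscale c x + cscale d y"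
proof -
  let ?D = "fst x * snd y - snd x * fst y"
  have "?D \<noteq> 0"
  proof
    assume D: "?D = 0"
    have "y = cscale (if fst x = 0 then snd y / snd x else fst y / fst x) x"
      using D assms(2) by (auto simp: prod_eq_iff field_simps)
    then show False using assms(1) by blast
  qed
  then have "z = cscale ((fst z * snd y - snd z * fst y) / ?D) x + cscale ((fst x * snd z - snd x * fst z) / ?D) y"
    by (simp add: prod_eq_iff divide_simps) (simp add: algebra_simps)
  then show ?thesis by blast
qed

lemma blinfun_Blinfun_complex:
  assumes "\<And>x y. f (x + y) = f x + f y" "\<And>c x. f (cscale c x) = cscale c (f x)"
  shows "blinfun_apply (Blinfun f) = f" "Blinfun f \<in> carrier opV"
proof -
  have "linear f" using assms by (intro linearI) (simp_all add: cscale_of_real[symmetric])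
  then show eq: "blinfun_apply (Blinfun f) = f"
    by (simp add: bounded_linear_Blinfun_apply linear_conv_bounded_linear)
  show "Blinfun f \<in> carrier opV" unfolding in_opV eq using assms(2) by blast
qed

lemma l2_linear_add:
  "l2_linear J K T \<Longrightarrow> \<xi> \<in> l2 J \<Longrightarrow> \<eta> \<in> l2 J \<Longrightarrow> T (\<lambda>i. \<xi> i + \<eta> i) = (\<lambda>j. T \<xi> j + T \<eta> j)"
  and l2_linear_scale: "l2_linear J K T \<Longrightarrow> \<xi> \<in> l2 J \<Longrightarrow> T (\<lambda>i. c * \<xi> i) = (\<lambda>j. c * T \<xi> j)"
  unfolding l2_linear_def by blast+

lemma hilbert_rep_ops:
  assumes "hilbert_rep A J \<pi>" "a \<in> carrier A" "\<xi> \<in> l2 J"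
  shows "b \<in> carrier A \<Longrightarrow> \<pi> (a \<oplus>\<^bsub>A\<^esub> b) \<xi> = (\<lambda>i. \<pi> a \<xi> i + \<pi> b \<xi> i)"
    "b \<in> carrier A \<Longrightarrow> \<pi> (a \<otimes>\<^bsub>A\<^esub> b) \<xi> = \<pi> a (\<pi> b \<xi>)"
    "\<pi> (scale A c a) \<xi> = (\<lambda>i. c * \<pi> a \<xi> i)"
    "\<eta> \<in> l2 J \<Longrightarrow> l2_inner (\<pi> (star A a) \<xi>) \<eta> = l2_inner \<xi> (\<pi> a \<eta>)"
  using assms unfolding hilbert_rep_def by blast+

definition rep_op :: "'i \<Rightarrow> 'i \<Rightarrow> ('a \<Rightarrow> ('i \<Rightarrow> complex) \<Rightarrow> 'i \<Rightarrow> complex) \<Rightarrow> 'a \<Rightarrow> cvec \<Rightarrow>\<^sub>L cvec" where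
  "rep_op i j \<pi> a = Blinfun (\<lambda>x. coord i j (\<pi> a (emb i j x)))"

lemma rep_op:
  assumes rep: "hilbert_rep A {i, j} \<pi>" and ij: "i \<noteq> j" and A: "cstar_algebra A"
  shows "a \<in> carrier A \<Longrightarrow> emb i j (rep_op i j \<pi> a x) = \<pi> a (emb i j x)"
    "a \<in> carrier A \<Longrightarrow> \<xi> \<in> l2 {i, j} \<Longrightarrow> \<pi> a \<xi> = emb i j (rep_op i j \<pi> a (coord i j \<xi>))"
    "rep_op i j \<pi> \<in> star_hom A opV"
    "op_kernel A (rep_op i j \<pi>) = rep_kernel A {i, j} \<pi>"
proof -
  interpret A: cstar_algebra A by (rule A)
  have app: "blinfun_apply (rep_op i j \<pi> a) = (\<lambda>x. coord i j (\<pi> a (emb i j x)))" "rep_op i j \<pi> a \<in> carrier opV"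
    if a: "a \<in> carrier A" for a
  proof -
    have lin: "l2_linear {i, j} {i, j} (\<pi> a)" by (rule hilbert_repD(1)[OF rep a])
    have add: "coord i j (\<pi> a (emb i j (x + y))) = coord i j (\<pi> a (emb i j x)) + coord i j (\<pi> a (emb i j y))" for x y
      unfolding emb_linear l2_linear_add[OF lin emb_in emb_in] by (rule coord_linear)
    have sc: "coord i j (\<pi> a (emb i j (cscale c x))) = cscale c (coord i j (\<pi> a (emb i j x)))" for c x
      unfolding emb_linear l2_linear_scale[OF lin emb_in] by (rule coord_linear)
    show "blinfun_apply (rep_op i j \<pi> a) = (\<lambda>x. coord i j (\<pi> a (emb i j x)))" "rep_op i j \<pi> a \<in> carrier opV"
      unfolding rep_op_def using blinfun_Blinfun_complex[OF add sc] by simp_all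
  qed
  show 1: "emb i j (rep_op i j \<pi> a x) = \<pi> a (emb i j x)" if "a \<in> carrier A" for a x
    using app(1)[OF that] hilbert_repD(2)[OF rep that emb_in] by (simp add: emb_coord)
  show 2: "\<pi> a \<xi> = emb i j (rep_op i j \<pi> a (coord i j \<xi>))" if "a \<in> carrier A" "\<xi> \<in> l2 {i, j}" for a \<xi>
    using 1[OF that(1)] emb_coord[OF that(2)] by simp
  show "rep_op i j \<pi> \<in> star_hom A opV"
    unfolding star_hom_def
  proof (intro CollectI conjI ballI allI)
    show "rep_op i j \<pi> \<in> carrier A \<rightarrow> carrier opV" using app(2) by blast
    fix a assume a: "a \<in> carrier A"
    show "rep_op i j \<pi> (scale A c a) = scale opV c (rep_op i j \<pi> a)" for c
      using hilbert_rep_ops(3)[OF rep a emb_in] a by (intro blinfun_eqI) (simp add: app A.scale_closed coord_linear)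
    show "rep_op i j \<pi> (star A a) = star opV (rep_op i j \<pi> a)"
    proof -
      have "rep_op i j \<pi> (star A a) x \<bullet> y = x \<bullet> rep_op i j \<pi> a y" for x y
      proof -
        have "l2_inner (\<pi> (star A a) (emb i j x)) (emb i j y) = l2_inner (emb i j x) (\<pi> a (emb i j y))"
          by (rule hilbert_rep_ops(4)[OF rep a emb_in emb_in])
        then show ?thesis
          using a emb_in[of i j] hilbert_repD(2)[OF rep A.star_closed[OF a] emb_in]
          by (simp add: l2_inner_coord[OF ij] coord_emb[OF ij] inner_cvec app A.star_closed)
      qed
      then have "adj_op (rep_op i j \<pi> (star A a)) = rep_op i j \<pi> a" by (rule adj_op_eqI)
      then show ?thesis using adj_op_adj_op by (metis opV_sel(6))
    qed
    fix b assume b: "b \<in> carrier A"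
    show "rep_op i j \<pi> (a \<oplus>\<^bsub>A\<^esub> b) = rep_op i j \<pi> a \<oplus>\<^bsub>opV\<^esub> rep_op i j \<pi> b"
      using hilbert_rep_ops(1)[OF rep a emb_in b] a b by (intro blinfun_eqI) (simp add: app coord_linear blinfun.add_left)
    show "rep_op i j \<pi> (a \<otimes>\<^bsub>A\<^esub> b) = rep_op i j \<pi> a \<otimes>\<^bsub>opV\<^esub> rep_op i j \<pi> b"
      using hilbert_rep_ops(2)[OF rep a emb_in b] a b hilbert_repD(2)[OF rep b emb_in]
      by (intro blinfun_eqI) (simp add: app emb_coord)
  qed
  show "op_kernel A (rep_op i j \<pi>) = rep_kernel A {i, j} \<pi>"
  proof -
    have "rep_op i j \<pi> a = 0 \<longleftrightarrow> (\<forall>\<xi>\<in>l2 {i, j}. \<pi> a \<xi> = (\<lambda>k. 0))" if a: "a \<in> carrier A" for a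
    proof
      assume "rep_op i j \<pi> a = 0"
      then show "\<forall>\<xi>\<in>l2 {i, j}. \<pi> a \<xi> = (\<lambda>k. 0)" using 2[OF a] by (simp add: emb_linear)
    next
      assume z: "\<forall>\<xi>\<in>l2 {i, j}. \<pi> a \<xi> = (\<lambda>k. 0)"
      have "\<pi> a (emb i j x) = (\<lambda>k. 0)" for x by (rule bspec[OF z emb_in])
      then show "rep_op i j \<pi> a = 0" by (intro blinfun_eqI) (simp add: app a coord_def zero_prod_def)
    qed
    then show ?thesis by (auto simp: op_kernel_def rep_kernel_def)
  qed
qed

text \<open>The line through a nonzero \<open>(p, q)\<close>, written as an equation between
  coordinates because equations pass to coordinatewise limits.\<close>

lemma closed_line:
  assumes ij: "i \<noteq> j"
  shows "closed_l2_subspace {i, j} {\<xi> \<in> l2 {i, j}. \<xi> i * q = \<xi> j * p}"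
  unfolding closed_l2_subspace_def
proof (intro conjI allI impI)
  fix s \<xi> assume s: "(\<forall>n. s n \<in> {\<xi> \<in> l2 {i, j}. \<xi> i * q = \<xi> j * p}) \<and> \<xi> \<in> l2 {i, j}
      \<and> (\<lambda>n. l2_norm (\<lambda>k. s n k - \<xi> k)) \<longlonglongrightarrow> 0"
  have d: "(\<lambda>k. s n k - \<xi> k) \<in> l2 {i, j}" for n using s by (intro l2_diff) auto
  have lim: "(\<lambda>n. s n k) \<longlonglongrightarrow> \<xi> k" if "k = i \<or> k = j" for k
  proof -
    have le: "norm (s n k - \<xi> k) \<le> l2_norm (\<lambda>k. s n k - \<xi> k)" for n
      using l2_norm_component[OF d[of n] ij] that by (elim disjE) simp_all
    have lim0: "(\<lambda>n. l2_norm (\<lambda>k. s n k - \<xi> k)) \<longlonglongrightarrow> 0" using s by (elim conjE)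
    have "(\<lambda>n. s n k - \<xi> k) \<longlonglongrightarrow> 0"
      by (rule Lim_null_comparison[OF always_eventually lim0]) (rule allI, rule le)
    then show ?thesis by (simp add: LIM_zero_iff)
  qed
  have lims: "(\<lambda>n. s n i * q) \<longlonglongrightarrow> \<xi> i * q" "(\<lambda>n. s n j * p) \<longlonglongrightarrow> \<xi> j * p"
    by (rule tendsto_mult[OF lim tendsto_const], simp)+
  have "s n i * q = s n j * p" for n using s by blast
  then have "\<xi> i * q = \<xi> j * p" using LIMSEQ_unique[OF lims(1)] lims(2) by simp
  then show "\<xi> \<in> {\<xi> \<in> l2 {i, j}. \<xi> i * q = \<xi> j * p}" using s by simp
qed (auto simp: l2_zero l2_add l2_scale algebra_simps)

lemma irreducible_repD:
  "irreducible_rep A J \<pi> \<Longrightarrow> closed_l2_subspace J M \<Longrightarrow> (\<And>a \<xi>. a \<in> carrier A \<Longrightarrow> \<xi> \<in> M \<Longrightarrow> \<pi> a \<xi> \<in> M)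
    \<Longrightarrow> M = {\<lambda>i. 0} \<or> M = l2 J"
  by (simp add: irreducible_rep_def)

lemma rep_op_irred:
  assumes irr: "irreducible_rep A {i, j} \<pi>" and ij: "i \<noteq> j" and A: "cstar_algebra A"
  shows "op_irred A (rep_op i j \<pi>)"
  unfolding op_irred_def
proof (intro conjI allI impI)
  have rep: "hilbert_rep A {i, j} \<pi>" using irr by (simp add: irreducible_rep_def)
  note R = rep_op[OF rep ij A]
  show "rep_op i j \<pi> \<in> star_hom A opV" by (rule R)
  fix x :: cvec assume x: "x \<noteq> 0"
  show "\<exists>a\<in>carrier A. \<forall>c. rep_op i j \<pi> a x \<noteq> cscale c x"
  proof (rule ccontr)
    assume "\<not> ?thesis"
    then have ex: "\<exists>c. rep_op i j \<pi> a x = cscale c x" if "a \<in> carrier A" for a using that by blast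
    let ?M = "{\<xi> \<in> l2 {i, j}. \<xi> i * snd x = \<xi> j * fst x}"
    have mult: "\<exists>c. coord i j \<xi> = cscale c x" if "\<xi> \<in> ?M" for \<xi>
      using that x by (intro exI[of _ "if fst x = 0 then \<xi> j / snd x else \<xi> i / fst x"])
        (auto simp: coord_def prod_eq_iff field_simps)
    have in_M: "emb i j (cscale c x) \<in> ?M" for c
      using emb_in[of i j "cscale c x"] ij by (simp add: emb_def)
    have "\<pi> a \<xi> \<in> ?M" if a: "a \<in> carrier A" and \<xi>: "\<xi> \<in> ?M" for a \<xi>
    proof -
      obtain c where c: "coord i j \<xi> = cscale c x" using mult[OF \<xi>] by blast
      obtain d where d: "rep_op i j \<pi> a x = cscale d x" using ex[OF a] by blast
      have "\<pi> a \<xi> = emb i j (cscale (c * d) x)"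
        using R(2)[OF a, of \<xi>] \<xi> opV_apply_cscale[OF star_homD(1)[OF R(3) a], of c x] by (simp add: c d cscale_cscale)
      then show ?thesis using in_M by simp
    qed
    then have dich: "?M = {\<lambda>k. 0} \<or> ?M = l2 {i, j}"
      by (rule irreducible_repD[OF irr closed_line[OF ij]])
    have ne: "?M \<noteq> {\<lambda>k. 0}"
    proof
      assume "?M = {\<lambda>k. 0}"
      then have "emb i j (cscale 1 x) = (\<lambda>k. 0)" using in_M[of 1] by (simp only: singleton_iff)
      then show False using coord_emb[OF ij, of x] x by (simp add: coord_def zero_prod_def)
    qed
    \<comment> \<open>The vector orthogonal to \<open>x\<close> is off the line, so the invariant
      line is not the whole space.\<close>
    have "emb i j (- cnj (snd x), cnj (fst x)) \<notin> ?M"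
    proof
      assume "emb i j (- cnj (snd x), cnj (fst x)) \<in> ?M"
      then have "- (snd x * cnj (snd x)) = fst x * cnj (fst x)" using ij by (simp add: emb_def mult.commute)
      then have "complex_of_real (- (cmod (snd x))\<^sup>2) = complex_of_real ((cmod (fst x))\<^sup>2)"
        by (simp add: complex_mult_cnj cmod_def)
      then have "- (cmod (snd x))\<^sup>2 = (cmod (fst x))\<^sup>2" by (simp only: of_real_eq_iff)
      then have "(cmod (snd x))\<^sup>2 = 0" "(cmod (fst x))\<^sup>2 = 0"
        using zero_le_power2[of "cmod (snd x)"] zero_le_power2[of "cmod (fst x)"] by linarith+
      then show False using x by (simp add: prod_eq_iff)
    qed
    then show False using dich ne emb_in[of i j "(- cnj (snd x), cnj (fst x))"] by (simp only: simp_thms)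
  qed
qed

lemma rep_op_scalar:
  assumes irr: "irreducible_rep A {i} \<pi>" and A: "cstar_algebra A"
  defines "\<delta> \<equiv> (\<lambda>k. if k = i then 1 else 0)"
  shows "op_scalar A (\<lambda>a. cscale_op (\<pi> a \<delta> i))" "op_kernel A (\<lambda>a. cscale_op (\<pi> a \<delta> i)) = rep_kernel A {i} \<pi>"
    "\<And>a \<xi>. a \<in> carrier A \<Longrightarrow> \<xi> \<in> l2 {i} \<Longrightarrow> \<pi> a \<xi> = (\<lambda>k. \<pi> a \<delta> i * \<xi> k)"
proof -
  interpret A: cstar_algebra A by (rule A)
  have rep: "hilbert_rep A {i} \<pi>" using irr by (simp add: irreducible_rep_def)
  have l2: "\<xi> \<in> l2 {i} \<longleftrightarrow> (\<forall>k. k \<noteq> i \<longrightarrow> \<xi> k = 0)" for \<xi> by (simp add: l2_finite)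
  have l2_eq: "\<xi> = (\<lambda>k. \<xi> i * \<delta> k)" if "\<xi> \<in> l2 {i}" for \<xi> using that by (auto simp: l2 \<delta>_def)
  have \<delta>: "\<delta> \<in> l2 {i}" "\<delta> i = 1" by (auto simp: l2 \<delta>_def)
  have app: "\<pi> a \<xi> = (\<lambda>k. \<pi> a \<delta> i * \<xi> k)" if a: "a \<in> carrier A" and \<xi>: "\<xi> \<in> l2 {i}" for a \<xi>
  proof -
    have "\<pi> a \<xi> = (\<lambda>k. \<xi> i * \<pi> a \<delta> k)"
      using hilbert_repD(1)[OF rep a] \<delta>(1) l2_eq[OF \<xi>] unfolding l2_linear_def by metis
    moreover have "\<pi> a \<delta> = (\<lambda>k. \<pi> a \<delta> i * \<delta> k)" by (rule l2_eq[OF hilbert_repD(2)[OF rep a \<delta>(1)]])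
    ultimately have "\<pi> a \<xi> = (\<lambda>k. \<xi> i * (\<pi> a \<delta> i * \<delta> k))" by metis
    also have "\<dots> = (\<lambda>k. \<pi> a \<delta> i * \<xi> k)" by (subst (2) l2_eq[OF \<xi>]) (simp add: mult_ac)
    finally show ?thesis .
  qed
  then show "\<And>a \<xi>. a \<in> carrier A \<Longrightarrow> \<xi> \<in> l2 {i} \<Longrightarrow> \<pi> a \<xi> = (\<lambda>k. \<pi> a \<delta> i * \<xi> k)" .
  have app1: "\<pi> a (\<pi> b \<delta>) i = \<pi> a \<delta> i * \<pi> b \<delta> i" if "a \<in> carrier A" "b \<in> carrier A" for a b
    using app[OF that(1) hilbert_repD(2)[OF rep that(2) \<delta>(1)]] by simp
  have inner: "l2_inner \<xi> \<eta> = cnj (\<xi> i) * \<eta> i" if "\<xi> \<in> l2 {i}" for \<xi> \<eta>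
    using that unfolding l2_inner_def l2 by (subst infsum_finite_support[of "{i}"]) auto
  have hom: "(\<lambda>a. cscale_op (\<pi> a \<delta> i)) \<in> star_hom A opV"
    unfolding star_hom_def
  proof (intro CollectI conjI ballI allI)
    show "(\<lambda>a. cscale_op (\<pi> a \<delta> i)) \<in> carrier A \<rightarrow> carrier opV" by (auto simp: in_opV cscale_cscale mult.commute simp del: split_paired_All)
    fix a assume a: "a \<in> carrier A"
    show "cscale_op (\<pi> (scale A c a) \<delta> i) = scale opV c (cscale_op (\<pi> a \<delta> i))" for c
      using hilbert_rep_ops(3)[OF rep a \<delta>(1)] by (intro blinfun_eqI) (simp add: cscale_cscale)
    have "l2_inner (\<pi> (star A a) \<delta>) \<delta> = l2_inner \<delta> (\<pi> a \<delta>)" by (rule hilbert_rep_ops(4)[OF rep a \<delta>(1) \<delta>(1)])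
    then have "\<pi> (star A a) \<delta> i = cnj (\<pi> a \<delta> i)"
      using inner[OF hilbert_repD(2)[OF rep A.star_closed[OF a] \<delta>(1)]] inner[OF \<delta>(1)] \<delta>(2)
      by (metis complex_cnj_cnj complex_cnj_one mult.right_neutral mult_1)
    moreover have "adj_op (cscale_op c) = cscale_op (cnj c)" for c
      by (rule adj_op_eqI) (simp add: inner_cvec cinner_simps)
    ultimately show "cscale_op (\<pi> (star A a) \<delta> i) = star opV (cscale_op (\<pi> a \<delta> i))" by simp
    fix b assume b: "b \<in> carrier A"
    show "cscale_op (\<pi> (a \<oplus>\<^bsub>A\<^esub> b) \<delta> i) = cscale_op (\<pi> a \<delta> i) \<oplus>\<^bsub>opV\<^esub> cscale_op (\<pi> b \<delta> i)"
      using hilbert_rep_ops(1)[OF rep a \<delta>(1) b] by (intro blinfun_eqI) (simp add: blinfun.add_left cscale_add_left)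
    show "cscale_op (\<pi> (a \<otimes>\<^bsub>A\<^esub> b) \<delta> i) = cscale_op (\<pi> a \<delta> i) \<otimes>\<^bsub>opV\<^esub> cscale_op (\<pi> b \<delta> i)"
    proof -
      have "\<pi> (a \<otimes>\<^bsub>A\<^esub> b) \<delta> i = \<pi> a \<delta> i * \<pi> b \<delta> i"
        using hilbert_rep_ops(2)[OF rep a \<delta>(1) b] app1[OF a b] by simp
      then show ?thesis by (intro blinfun_eqI) (simp add: cscale_cscale)
    qed
  qed
  \<comment> \<open>Irreducibility only provides some nonzero operator; in dimension one this forces
    the unit to act as the identity.\<close>
  obtain a \<xi> where a: "a \<in> carrier A" "\<xi> \<in> l2 {i}" "\<pi> a \<xi> \<noteq> (\<lambda>k. 0)"
    using irr unfolding irreducible_rep_def by (elim conjE bexE)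
  have "\<pi> a \<delta> i \<noteq> 0"
  proof
    assume "\<pi> a \<delta> i = 0"
    then show False using a(3) app[OF a(1,2)] by simp
  qed
  moreover have "\<pi> a (\<pi> \<one>\<^bsub>A\<^esub> \<delta>) i = \<pi> a \<delta> i"
  proof -
    have "\<pi> (a \<otimes>\<^bsub>A\<^esub> \<one>\<^bsub>A\<^esub>) \<delta> = \<pi> a (\<pi> \<one>\<^bsub>A\<^esub> \<delta>)"
      by (rule hilbert_rep_ops(2)[OF rep a(1) \<delta>(1) A.one_closed])
    then show ?thesis using a(1) by simp
  qed
  ultimately have "\<pi> \<one>\<^bsub>A\<^esub> \<delta> i = 1" using app1[OF a(1) A.one_closed] by simp
  then have "cscale_op (\<pi> \<one>\<^bsub>A\<^esub> \<delta> i) = id_blinfun" by (intro blinfun_eqI) simp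
  then show "op_scalar A (\<lambda>a. cscale_op (\<pi> a \<delta> i))" using hom by (auto simp: op_scalar_def)
  have "cscale_op (\<pi> a \<delta> i) = 0 \<longleftrightarrow> (\<forall>\<xi>\<in>l2 {i}. \<pi> a \<xi> = (\<lambda>k. 0))" if a: "a \<in> carrier A" for a
  proof
    assume "cscale_op (\<pi> a \<delta> i) = 0"
    then have "fst (cscale_op (\<pi> a \<delta> i) (1, 0)) = 0" by simp
    then show "\<forall>\<xi>\<in>l2 {i}. \<pi> a \<xi> = (\<lambda>k. 0)" using app[OF a] by simp
  next
    assume z: "\<forall>\<xi>\<in>l2 {i}. \<pi> a \<xi> = (\<lambda>k. 0)"
    have "\<pi> a \<delta> i = 0" using bspec[OF z \<delta>(1)] by simp
    then show "cscale_op (\<pi> a \<delta> i) = 0" by (intro blinfun_eqI) simp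
  qed
  then show "op_kernel A (\<lambda>a. cscale_op (\<pi> a \<delta> i)) = rep_kernel A {i} \<pi>"
    by (auto simp: op_kernel_def rep_kernel_def)
qed

lemma closed_l2_subspaceD:
  "closed_l2_subspace J M \<Longrightarrow> \<xi> \<in> M \<Longrightarrow> \<eta> \<in> M \<Longrightarrow> (\<lambda>i. \<xi> i + \<eta> i) \<in> M"
  "closed_l2_subspace J M \<Longrightarrow> \<xi> \<in> M \<Longrightarrow> (\<lambda>i. c * \<xi> i) \<in> M"
  by (simp_all add: closed_l2_subspace_def)

lemma not_singletonE: assumes "z \<in> M" "M \<noteq> {z}" obtains x where "x \<in> M" "x \<noteq> z"
  using assms by blast

text \<open>An invariant subspace containing a nonzero vector also contains its image under an
  operator that moves it off its line, and these two vectors span the plane.\<close>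

lemma op_irred_rep:
  assumes g: "op_irred A g" and ij: "i \<noteq> j" and A: "cstar_algebra A"
  defines "\<pi> \<equiv> \<lambda>a \<xi>. emb i j (g a (coord i j \<xi>))"
  shows "irreducible_rep A {i, j} \<pi>" "rep_kernel A {i, j} \<pi> = op_kernel A g"
proof -
  interpret A: cstar_algebra A by (rule A)
  have hom: "g \<in> star_hom A opV" using g by (simp add: op_irred_def)
  note H = star_homD[OF hom]
  have rep: "hilbert_rep A {i, j} \<pi>"
    unfolding hilbert_rep_def
  proof (intro conjI ballI allI)
    fix a assume a: "a \<in> carrier A"
    have lin: "l2_linear {i, j} {i, j} (\<pi> a)"
      unfolding l2_linear_def
      by (auto simp: \<pi>_def emb_in coord_linear blinfun.add_right emb_linear opV_apply_cscale[OF H(1)[OF a]])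
    moreover have "l2_norm (\<pi> a \<xi>) \<le> norm (g a) * l2_norm \<xi>" if "\<xi> \<in> l2 {i, j}" for \<xi>
      using norm_blinfun[of "g a" "coord i j \<xi>"] that
      by (simp add: l2_norm_coord[OF ij] emb_in \<pi>_def coord_emb[OF ij])
    ultimately show "l2_bounded {i, j} {i, j} (\<pi> a)" unfolding l2_bounded_def by blast
    show "\<pi> (scale A c a) \<xi> = (\<lambda>k. c * \<pi> a \<xi> k)" for c \<xi>
      using H(4)[OF a] by (simp add: \<pi>_def emb_linear)
    show "l2_inner (\<pi> (star A a) \<xi>) \<eta> = l2_inner \<xi> (\<pi> a \<eta>)" if "\<xi> \<in> l2 {i, j}" "\<eta> \<in> l2 {i, j}" for \<xi> \<eta>
      using that H(5)[OF a] cinner_adj_op[OF H(1)[OF a]]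
      by (simp add: \<pi>_def l2_inner_coord[OF ij] emb_in coord_emb[OF ij])
    fix b assume b: "b \<in> carrier A"
    show "\<pi> (a \<oplus>\<^bsub>A\<^esub> b) \<xi> = (\<lambda>k. \<pi> a \<xi> k + \<pi> b \<xi> k)" for \<xi>
      using H(2)[OF a b] by (simp add: \<pi>_def emb_linear blinfun.add_left)
    show "\<pi> (a \<otimes>\<^bsub>A\<^esub> b) \<xi> = \<pi> a (\<pi> b \<xi>)" for \<xi>
      using H(3)[OF a b] by (simp add: \<pi>_def coord_emb[OF ij])
  qed
  have move: "\<exists>a\<in>carrier A. \<forall>c. g a x \<noteq> cscale c x" if "x \<noteq> 0" for x
    using g that unfolding op_irred_def by blast
  show "irreducible_rep A {i, j} \<pi>"
    unfolding irreducible_rep_def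
  proof (intro conjI allI impI rep)
    obtain a where a: "a \<in> carrier A" "\<And>c. g a (1, 0) \<noteq> cscale c (1, 0)"
      using move[of "(1, 0)"] by (auto simp: zero_prod_def)
    then have "g a (1, 0) \<noteq> 0" by (metis cscale_simps(4))
    then have "\<pi> a (emb i j (1, 0)) \<noteq> (\<lambda>k. 0)"
      unfolding \<pi>_def coord_emb[OF ij] by (simp add: emb_eq_zero[OF ij])
    then show "\<exists>a\<in>carrier A. \<exists>\<xi>\<in>l2 {i, j}. \<pi> a \<xi> \<noteq> (\<lambda>k. 0)"
      by (intro bexI[OF _ a(1)] bexI[OF _ emb_in])
  next
    fix M assume M: "closed_l2_subspace {i, j} M \<and> (\<forall>a\<in>carrier A. \<forall>\<xi>\<in>M. \<pi> a \<xi> \<in> M)"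
    show "M = {\<lambda>k. 0} \<or> M = l2 {i, j}"
    proof (cases "M = {\<lambda>k. 0}")
      case False
      have zero: "(\<lambda>k. 0) \<in> M" and sub: "M \<subseteq> l2 {i, j}" using M by (auto simp: closed_l2_subspace_def)
      obtain \<xi> where \<xi>: "\<xi> \<in> M" "\<xi> \<noteq> (\<lambda>k. 0)" by (rule not_singletonE[OF zero False])
      let ?x = "coord i j \<xi>"
      have e: "emb i j ?x = \<xi>" by (rule emb_coord[OF subsetD[OF sub \<xi>(1)]])
      have "?x \<noteq> 0" using e \<xi>(2) emb_linear(3) by metis
      then obtain a where a: "a \<in> carrier A" "\<And>c. g a ?x \<noteq> cscale c ?x" using move by blast
      have "\<eta> \<in> M" if \<eta>: "\<eta> \<in> l2 {i, j}" for \<eta>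
      proof -
        obtain c d where "coord i j \<eta> = cscale c ?x + cscale d (g a ?x)"
          using cvec_basis[OF a(2) \<open>?x \<noteq> 0\<close>] by blast
        then have "\<eta> = (\<lambda>k. c * \<xi> k + d * \<pi> a \<xi> k)"
          using emb_coord[OF \<eta>] e by (simp add: emb_linear \<pi>_def)
        moreover have "\<pi> a \<xi> \<in> M" by (rule bspec[OF bspec[OF conjunct2[OF M] a(1)] \<xi>(1)])
        ultimately show ?thesis using closed_l2_subspaceD(1)[OF conjunct1[OF M] closed_l2_subspaceD(2)[OF conjunct1[OF M] \<xi>(1)]
              closed_l2_subspaceD(2)[OF conjunct1[OF M]], of "\<pi> a \<xi>" c d] by simp
      qed
      then have "l2 {i, j} \<subseteq> M" by (rule subsetI)
      then show ?thesis using subset_antisym[OF sub] by simp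
    qed simp
  qed
  have "(\<forall>\<xi>\<in>l2 {i, j}. \<pi> a \<xi> = (\<lambda>k. 0)) \<longleftrightarrow> g a = 0" for a
  proof
    assume z: "\<forall>\<xi>\<in>l2 {i, j}. \<pi> a \<xi> = (\<lambda>k. 0)"
    have "emb i j (g a x) = (\<lambda>k. 0)" for x
      using bspec[OF z emb_in[of i j x]] by (simp add: \<pi>_def coord_emb[OF ij])
    then have "g a x = 0" for x by (simp add: emb_eq_zero[OF ij])
    then show "g a = 0" by (intro blinfun_eqI) simp
  qed (simp add: \<pi>_def emb_linear)
  then show "rep_kernel A {i, j} \<pi> = op_kernel A g" by (simp add: rep_kernel_def op_kernel_def)
qed

lemma op_scalar_rep:
  assumes g: "op_scalar A g" and A: "cstar_algebra A"
  defines "\<pi> \<equiv> \<lambda>a \<xi> k. fst (g a (1, 0)) * \<xi> k"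
  shows "irreducible_rep A {i} \<pi>" "rep_kernel A {i} \<pi> = op_kernel A g"
proof -
  interpret A: cstar_algebra A by (rule A)
  have hom: "g \<in> star_hom A opV" and one: "g \<one>\<^bsub>A\<^esub> = id_blinfun" using g by (auto simp: op_scalar_def)
  note H = star_homD[OF hom]
  define ch where "ch a = fst (g a (1, 0))" for a
  have g_eq: "g a = cscale_op (ch a)" if "a \<in> carrier A" for a
    using g that by (auto simp: op_scalar_def ch_def)
  have ch_op: "cscale_op c = cscale_op d \<Longrightarrow> c = d" for c d by (metis cscale_op_apply cscale_simps(1) fst_conv mult.right_neutral)
  have ch: "ch (a \<oplus>\<^bsub>A\<^esub> b) = ch a + ch b" "ch (a \<otimes>\<^bsub>A\<^esub> b) = ch a * ch b" "ch (scale A c a) = c * ch a"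
    "ch (star A a) = cnj (ch a)" "ch \<one>\<^bsub>A\<^esub> = 1"
    if ab: "a \<in> carrier A" "b \<in> carrier A" for a b c
  proof -
    show "ch (a \<oplus>\<^bsub>A\<^esub> b) = ch a + ch b" using H(2)[OF ab] by (simp add: ch_def blinfun.add_left)
    show "ch (a \<otimes>\<^bsub>A\<^esub> b) = ch a * ch b" using H(3)[OF ab] by (simp add: ch_def[of "a \<otimes>\<^bsub>A\<^esub> b"] g_eq[OF ab(1)] g_eq[OF ab(2)])
    show "ch (scale A c a) = c * ch a" using H(4)[OF ab(1)] by (simp add: ch_def)
    show "ch \<one>\<^bsub>A\<^esub> = 1" by (simp add: ch_def one)
    have "adj_op (cscale_op c) = cscale_op (cnj c)" for c
      by (rule adj_op_eqI) (simp add: inner_cvec cinner_simps)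
    then show "ch (star A a) = cnj (ch a)" using H(5)[OF ab(1)] by (simp add: ch_def[of "star A a"] g_eq[OF ab(1)])
  qed
  have \<pi>: "\<pi> a \<xi> = (\<lambda>k. ch a * \<xi> k)" for a \<xi> by (simp add: \<pi>_def ch_def)
  have l2: "\<xi> \<in> l2 {i} \<longleftrightarrow> (\<forall>k. k \<noteq> i \<longrightarrow> \<xi> k = 0)" for \<xi> by (simp add: l2_finite)
  have inner: "l2_inner \<xi> \<eta> = cnj (\<xi> i) * \<eta> i" if "\<xi> \<in> l2 {i}" for \<xi> \<eta>
    using that unfolding l2_inner_def l2 by (subst infsum_finite_support[of "{i}"]) auto
  have norm: "l2_norm \<xi> = cmod (\<xi> i)" if "\<xi> \<in> l2 {i}" for \<xi>
    using that unfolding l2_norm_def l2 by (subst infsum_finite_support[of "{i}"]) auto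
  have rep: "hilbert_rep A {i} \<pi>"
    unfolding hilbert_rep_def l2_bounded_def
  proof (intro conjI ballI allI)
    fix a assume a: "a \<in> carrier A"
    show "l2_linear {i} {i} (\<pi> a)" unfolding l2_linear_def by (auto simp: \<pi> l2_scale distrib_left mult.left_commute)
    show "\<exists>C. \<forall>\<xi>\<in>l2 {i}. l2_norm (\<pi> a \<xi>) \<le> C * l2_norm \<xi>"
      by (intro exI[of _ "cmod (ch a)"]) (simp add: \<pi> norm l2_scale norm_mult)
    show "\<pi> (scale A c a) \<xi> = (\<lambda>k. c * \<pi> a \<xi> k)" for c \<xi> using ch(3)[OF a a] by (simp add: \<pi> mult.assoc)
    show "l2_inner (\<pi> (star A a) \<xi>) \<eta> = l2_inner \<xi> (\<pi> a \<eta>)" if "\<xi> \<in> l2 {i}" "\<eta> \<in> l2 {i}" for \<xi> \<eta>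
      using that ch(4)[OF a a] by (simp add: \<pi> inner l2_scale)
    fix b assume b: "b \<in> carrier A"
    show "\<pi> (a \<oplus>\<^bsub>A\<^esub> b) \<xi> = (\<lambda>k. \<pi> a \<xi> k + \<pi> b \<xi> k)" for \<xi> using ch(1)[OF a b] by (simp add: \<pi> algebra_simps)
    show "\<pi> (a \<otimes>\<^bsub>A\<^esub> b) \<xi> = \<pi> a (\<pi> b \<xi>)" for \<xi> using ch(2)[OF a b] by (simp add: \<pi> mult.assoc)
  qed
  let ?\<delta> = "\<lambda>k. if k = i then 1 else 0 :: complex"
  have \<delta>: "?\<delta> \<in> l2 {i}" by (simp add: l2)
  show "irreducible_rep A {i} \<pi>"
    unfolding irreducible_rep_def
  proof (intro conjI allI impI rep)
    have "\<pi> \<one>\<^bsub>A\<^esub> ?\<delta> \<noteq> (\<lambda>k. 0)" using ch(5)[OF A.one_closed A.one_closed] by (simp add: \<pi> fun_eq_iff)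
    then show "\<exists>a\<in>carrier A. \<exists>\<xi>\<in>l2 {i}. \<pi> a \<xi> \<noteq> (\<lambda>k. 0)" by (intro bexI[OF _ A.one_closed] bexI[OF _ \<delta>])
  next
    fix M assume M: "closed_l2_subspace {i} M \<and> (\<forall>a\<in>carrier A. \<forall>\<xi>\<in>M. \<pi> a \<xi> \<in> M)"
    show "M = {\<lambda>k. 0} \<or> M = l2 {i}"
    proof (cases "M = {\<lambda>k. 0}")
      case False
      have zero: "(\<lambda>k. 0) \<in> M" and sub: "M \<subseteq> l2 {i}" using M by (auto simp: closed_l2_subspace_def)
      obtain \<xi> where \<xi>: "\<xi> \<in> M" "\<xi> \<noteq> (\<lambda>k. 0)" by (rule not_singletonE[OF zero False])
      then have "\<xi> i \<noteq> 0" using subsetD[OF sub \<xi>(1)] by (auto simp: l2 fun_eq_iff)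
      have "\<eta> \<in> M" if \<eta>: "\<eta> \<in> l2 {i}" for \<eta>
      proof -
        have "\<eta> = (\<lambda>k. \<eta> i / \<xi> i * \<xi> k)"
        proof
          fix k
          show "\<eta> k = \<eta> i / \<xi> i * \<xi> k"
            using \<eta> subsetD[OF sub \<xi>(1)] \<open>\<xi> i \<noteq> 0\<close> by (cases "k = i") (simp_all add: l2)
        qed
        then show ?thesis using closed_l2_subspaceD(2)[OF conjunct1[OF M] \<xi>(1), of "\<eta> i / \<xi> i"] by simp
      qed
      then have "l2 {i} \<subseteq> M" by (rule subsetI)
      then show ?thesis using subset_antisym[OF sub] by simp
    qed simp
  qed
  have "(\<forall>\<xi>\<in>l2 {i}. \<pi> a \<xi> = (\<lambda>k. 0)) \<longleftrightarrow> g a = 0" if a: "a \<in> carrier A" for a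
  proof
    assume z: "\<forall>\<xi>\<in>l2 {i}. \<pi> a \<xi> = (\<lambda>k. 0)"
    have "\<pi> a ?\<delta> i = 0" using bspec[OF z \<delta>] by simp
    then have "ch a = 0" by (simp add: \<pi>)
    then show "g a = 0" by (intro blinfun_eqI) (simp add: g_eq[OF a])
  qed (simp add: \<pi>_def)
  then show "rep_kernel A {i} \<pi> = op_kernel A g" by (auto simp: rep_kernel_def op_kernel_def)
qed

text \<open>Index sets of representations consist of elements of the underlying type, so realising a
  two-dimensional representation takes two different elements \<open>i\<close> and
  \<open>j\<close>.\<close>

lemma kern_le2_eq:
  fixes A :: "('a, 'm) star_algebra_scheme"
  assumes A: "cstar_algebra A" and two: "(i :: 'a) \<noteq> j"
  shows "kern_le2 A = {op_kernel A g | g. op_scalar A g \<or> op_irred A g}"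
proof (intro equalityI subsetI)
  fix P assume "P \<in> kern_le2 A"
  then obtain J :: "'a set" and \<pi> where P: "P = rep_kernel A J \<pi>" "irreducible_rep A J \<pi>" "card J = 1 \<or> card J = 2"
    by (auto simp: kern_le2_def)
  from P(3) show "P \<in> {op_kernel A g | g. op_scalar A g \<or> op_irred A g}"
  proof
    assume "card J = 1"
    then obtain k where "J = {k}" by (auto simp: card_1_singleton_iff)
    then show ?thesis using rep_op_scalar(1,2)[of A k \<pi>] P A by blast
  next
    assume "card J = 2"
    then obtain k l where kl: "J = {k, l}" "k \<noteq> l" by (auto simp: card_2_iff)
    then have "hilbert_rep A {k, l} \<pi>" using P(2) by (simp add: irreducible_rep_def)
    then show ?thesis using rep_op_irred[of A k l \<pi>] rep_op(4)[of A k l \<pi>] P A kl by blast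
  qed
next
  fix P assume "P \<in> {op_kernel A g | g. op_scalar A g \<or> op_irred A g}"
  then obtain g where g: "P = op_kernel A g" "op_scalar A g \<or> op_irred A g" by blast
  from g(2) show "P \<in> kern_le2 A"
  proof
    assume s: "op_scalar A g"
    have "card {i} = 1" by simp
    then show ?thesis unfolding kern_le2_def using op_scalar_rep[OF s A, of i] g(1) by blast
  next
    assume s: "op_irred A g"
    have "card {i, j} = 2" using two by simp
    then show ?thesis unfolding kern_le2_def using op_irred_rep[OF s two A] g(1) by blast
  qed
qed

section \<open>Classification of the small representations\<close>

text \<open>\<open>positive_functional_le\<close> is applied to the vector functionals
  \<open>F\<close>, whose value at \<open>star A b \<otimes> b\<close> is the squared norm of
  \<open>g b x\<close>.\<close>

lemma opV_contractive:
  assumes A: "cstar_algebra A" and g: "g \<in> star_hom A opV" and one: "g \<one>\<^bsub>A\<^esub> = id_blinfun"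
  shows "contractive_on A opV g"
  unfolding contractive_on_def
proof
  fix a assume a: "a \<in> carrier A"
  interpret A: cstar_algebra A by (rule A)
  note H = star_homD[OF g]
  have "norm (g a x) \<le> nrm A a * norm x" for x
  proof -
    define F where "F b = Re (cinner x (g b x))" for b
    have F: "F (star A b \<otimes>\<^bsub>A\<^esub> b) = (norm (g b x))\<^sup>2" if b: "b \<in> carrier A" for b
    proof -
      have "g (star A b \<otimes>\<^bsub>A\<^esub> b) x = adj_op (g b) (g b x)"
        using H(3)[OF A.star_closed[OF b] b] H(5)[OF b] by simp
      then have "F (star A b \<otimes>\<^bsub>A\<^esub> b) = x \<bullet> adj_op (g b) (g b x)" by (simp add: F_def inner_cvec)
      then show ?thesis by (simp add: adj_op_inner power2_norm_eq_inner)
    qed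
    have "F (star A a \<otimes>\<^bsub>A\<^esub> a) \<le> (nrm A a)\<^sup>2 * F \<one>\<^bsub>A\<^esub>"
    proof (rule A.positive_functional_le[OF a])
      show "F (b \<oplus>\<^bsub>A\<^esub> c) = F b + F c" if "b \<in> carrier A" "c \<in> carrier A" for b c
        using H(2)[OF that] by (simp add: F_def blinfun.add_left cinner_simps)
      show "F (scale A (complex_of_real r) b) = r * F b" if "b \<in> carrier A" for r b
        using H(4)[OF that] by (simp add: F_def cinner_simps)
      show "0 \<le> F (star A b \<otimes>\<^bsub>A\<^esub> b)" if "b \<in> carrier A" for b using F[OF that] by simp
    qed
    moreover have "F \<one>\<^bsub>A\<^esub> = (norm x)\<^sup>2" by (simp add: F_def one cinner_self)
    ultimately have "(norm (g a x))\<^sup>2 \<le> (nrm A a * norm x)\<^sup>2" using F[OF a] by (simp add: power_mult_distrib)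
    then show ?thesis using A.nrm_nonneg[OF a] by (simp add: power2_le_iff_abs_le)
  qed
  then show "nrm opV (g a) \<le> nrm A a" using A.nrm_nonneg[OF a] by (simp add: norm_blinfun_bound)
qed

lemma opV_limit_apply:
  assumes "opV.limit_of s f" shows "(\<lambda>n. blinfun_apply (s n) x) \<longlonglongrightarrow> f x"
proof -
  have "s n \<ominus>\<^bsub>opV\<^esub> f = s n - f" for n using assms by (intro opV_minus) (auto simp: opV.limit_of_def)
  then have "(\<lambda>n. norm (s n - f)) \<longlonglongrightarrow> 0" using assms by (simp add: opV.limit_of_def)
  then have "s \<longlonglongrightarrow> f" by (simp add: LIM_zero_iff tendsto_norm_zero_iff)
  then show ?thesis by (intro tendsto_intros)
qed

text \<open>Orthogonal to \<open>x\<close> for \<open>cinner\<close> and of the same norm; it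
  completes a unit vector to an orthonormal basis.\<close>

definition perp :: "cvec \<Rightarrow> cvec" where
  "perp x = (- cnj (snd x), cnj (fst x))"

lemma norm_perp [simp]: "norm (perp x) = norm x"
  by (simp add: perp_def norm_prod_def add.commute)

lemma cinner_perp: "cinner x (perp x) = 0" "cinner (perp x) x = 0"
  "cinner (perp x) (perp y) = cnj (cinner x y)" "cinner x (perp y) = - cnj (cinner (perp x) y)"
  by (simp_all add: perp_def cinner_def)

lemma orthonormal_expansion:
  assumes "norm x = 1" shows "z = cscale (cinner x z) x + cscale (cinner (perp x) z) (perp x)"
proof -
  have "cnj (fst x) * fst x + cnj (snd x) * snd x = 1" using cinner_self[of x] assms by (simp add: cinner_def)
  then have "c * (cnj (fst x) * fst x) + c * (cnj (snd x) * snd x) = c" for c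
    by (metis distrib_left mult.right_neutral)
  from this[of "fst z"] this[of "snd z"] show ?thesis
    by (simp add: cinner_def perp_def prod_eq_iff algebra_simps)
qed

lemma cinner_unit: "norm x = 1 \<Longrightarrow> cinner x x = 1" "norm x = 1 \<Longrightarrow> cinner (perp x) (perp x) = 1"
  using cinner_self[of x] by (simp_all add: cinner_perp(3))

lemma sum_blinfun_apply: "blinfun_apply (sum f I) x = (\<Sum>i\<in>I. f i x)"
  by (rule blinfun.sum_left)

text \<open>In dimension two a projection other than 0 and the identity has rank one, and so has its
  complement. The complement is the sum of the other projections, so exactly one of them is
  nonzero.\<close>

lemma rank_one_pair:
  fixes Q :: "'i \<Rightarrow> cvec \<Rightarrow>\<^sub>L cvec"
  assumes fin: "finite I" and Q: "\<And>i. i \<in> I \<Longrightarrow> Q i \<in> carrier opV \<and> adj_op (Q i) = Q i \<and> Q i o\<^sub>L Q i = Q i"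
    and orth: "\<And>i j. i \<in> I \<Longrightarrow> j \<in> I \<Longrightarrow> i \<noteq> j \<Longrightarrow> Q i o\<^sub>L Q j = 0" and sum: "sum Q I = id_blinfun"
    and i: "i \<in> I" "Q i \<noteq> 0" "Q i \<noteq> id_blinfun"
  obtains x j where "norm x = 1" "j \<in> I" "j \<noteq> i" "\<And>z. Q i z = cscale (cinner x z) x"
    "\<And>z. Q j z = cscale (cinner (perp x) z) (perp x)" "\<And>k. k \<in> I \<Longrightarrow> k \<noteq> i \<Longrightarrow> k \<noteq> j \<Longrightarrow> Q k = 0"
proof -
  have sa: "cinner (Q k x) y = cinner x (Q k y)" if "k \<in> I" for k x y
    using cinner_adj_op[of "Q k" x y] Q[OF that] by simp
  have idem: "Q k (Q k x) = Q k x" if "k \<in> I" for k x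
    using Q[OF that] by (metis blinfun_apply_blinfun_compose)
  have orth0: "Q k (Q l x) = 0" if "k \<in> I" "l \<in> I" "k \<noteq> l" for k l x
    using orth[OF that] by (metis blinfun_apply_blinfun_compose blinfun.zero_left)
  have lin: "Q k (cscale c x) = cscale c (Q k x)" if "k \<in> I" for k c x
    using Q[OF that] opV_apply_cscale by blast
  obtain y where y: "Q i y \<noteq> 0" using i(2) by (metis blinfun_eqI blinfun.zero_left)
  define x where "x = cscale (of_real (1 / norm (Q i y))) (Q i y)"
  have x: "norm x = 1" "Q i x = x" using y i(1) by (simp_all add: x_def norm_cscale lin idem norm_divide)
  let ?e = "perp x"
  have e1: "norm ?e = 1" using x by simp
  have along: "Q k ?e = cscale (cinner ?e (Q k ?e)) ?e" if k: "k \<in> I" "cinner (Q k x) ?e = 0" for k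
    using orthonormal_expansion[OF x(1), of "Q k ?e"] sa[OF k(1), of x ?e] k(2) by simp
  have zero_or_one: "Q k ?e = 0 \<or> Q k ?e = ?e" if k: "k \<in> I" "cinner (Q k x) ?e = 0" for k
  proof -
    let ?c = "cinner ?e (Q k ?e)"
    have "cscale ?c (cscale ?c ?e) = cscale ?c ?e"
      using along[OF k] idem[OF k(1), of ?e] lin[OF k(1)] by metis
    then have "cinner ?e (cscale ?c (cscale ?c ?e)) = cinner ?e (cscale ?c ?e)" by simp
    then have "?c * ?c = ?c" using cinner_unit(2)[OF x(1)] by (simp only: cinner_simps mult_1_right)
    then have "?c = 0 \<or> ?c = 1" by auto
    then show ?thesis
    proof
      assume "?c = 0" then show ?thesis using along[OF k] by (metis cscale_simps(4))
    next
      assume "?c = 1" then show ?thesis using along[OF k] by (metis cscale_simps(3))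
    qed
  qed
  have Qi_e: "Q i ?e = 0"
  proof (rule ccontr)
    assume "Q i ?e \<noteq> 0"
    then have e: "Q i ?e = ?e" using zero_or_one[OF i(1)] x by (simp add: cinner_perp)
    have "Q i z = z" for z
    proof -
      have "Q i z = cscale (cinner x z) (Q i x) + cscale (cinner ?e z) (Q i ?e)"
        by (subst orthonormal_expansion[OF x(1), of z]) (simp add: blinfun.add_right lin[OF i(1)])
      also have "\<dots> = z" unfolding x(2) e by (rule orthonormal_expansion[OF x(1), symmetric])
      finally show ?thesis .
    qed
    then have "Q i = id_blinfun" by (intro blinfun_eqI) simp
    then show False using i(3) by simp
  qed
  have Qx: "Q k x = 0" if "k \<in> I" "k \<noteq> i" for k
    using orth0[OF that(1) i(1) that(2), of x] x by simp
  have "\<exists>j\<in>I. Q j ?e \<noteq> 0"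
  proof (rule ccontr)
    assume "\<not> ?thesis"
    then have "sum Q I ?e = 0" unfolding sum_blinfun_apply by (intro sum.neutral) blast
    then show False using e1 by (simp add: sum)
  qed
  then obtain j where j: "j \<in> I" "Q j ?e \<noteq> 0" by blast
  then have ji: "j \<noteq> i" using Qi_e by blast
  have Qj_e: "Q j ?e = ?e" using zero_or_one[OF j(1)] Qx[OF j(1) ji] j(2) by (simp add: cinner_simps)
  have ex: "Q k z = cscale (cinner x z) (Q k x) + cscale (cinner ?e z) (Q k ?e)" if "k \<in> I" for k z
    by (subst orthonormal_expansion[OF x(1), of z]) (simp add: blinfun.add_right lin[OF that])
  show thesis
  proof
    show "norm x = 1" "j \<in> I" "j \<noteq> i" by fact+
    show "Q i z = cscale (cinner x z) x" for z using ex[OF i(1), of z] by (simp add: x(2) Qi_e)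
    show "Q j z = cscale (cinner ?e z) ?e" for z using ex[OF j(1), of z] by (simp add: Qx[OF j(1) ji] Qj_e)
    show "Q k = 0" if k: "k \<in> I" "k \<noteq> i" "k \<noteq> j" for k
    proof (rule blinfun_eqI)
      have "Q k ?e = 0" using orth0[OF k(1) j(1) k(3), of ?e] Qj_e by simp
      then show "Q k z = blinfun_apply 0 z" for z using ex[OF k(1), of z] Qx[OF k(1,2)] by simp
    qed
  qed
qed

context bip_algebra
begin

text \<open>The choice turns the mapping property into a function of the model, so that the
  representations of one 4-cycle form a family in the angle, also at values such as 0 where they are
  reducible.\<close>

definition model_hom :: "('v \<Rightarrow> cvec \<Rightarrow>\<^sub>L cvec) \<Rightarrow> (nat \<Rightarrow> 'v star_poly) set \<Rightarrow> cvec \<Rightarrow>\<^sub>L cvec" where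
  "model_hom e = (SOME f. f \<in> star_hom A opV \<and> contractive_on A opV f \<and> f \<one>\<^bsub>A\<^esub> = id_blinfun \<and>
     (\<forall>x\<in>X. f (gen x) = e x))"

lemma model_hom:
  assumes "bip_projections G opV e"
  shows "model_hom e \<in> star_hom A opV" "contractive_on A opV (model_hom e)" "model_hom e \<one>\<^bsub>A\<^esub> = id_blinfun"
    "x \<in> X \<Longrightarrow> model_hom e (gen x) = e x"
proof -
  obtain f where "f \<in> star_hom A opV" "contractive_on A opV f" "f \<one>\<^bsub>A\<^esub> = \<one>\<^bsub>opV\<^esub>" "\<And>x. x \<in> X \<Longrightarrow> f (gen x) = e x"
    using bip_universal[OF cstar_algebra_opV assms] by metis
  then have "\<exists>f. f \<in> star_hom A opV \<and> contractive_on A opV f \<and> f \<one>\<^bsub>A\<^esub> = id_blinfun \<and> (\<forall>x\<in>X. f (gen x) = e x)"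
    by auto
  from someI_ex[OF this, folded model_hom_def]
  show "model_hom e \<in> star_hom A opV" "contractive_on A opV (model_hom e)" "model_hom e \<one>\<^bsub>A\<^esub> = id_blinfun"
    "x \<in> X \<Longrightarrow> model_hom e (gen x) = e x" by blast+
qed

lemma hom_limit_apply:
  assumes "g \<in> star_hom A opV" "g \<one>\<^bsub>A\<^esub> = id_blinfun" "A.limit_of s a"
  shows "(\<lambda>n. g (s n) x) \<longlonglongrightarrow> g a x"
  using star_hom_limit[OF A.cstar_algebra_axioms cstar_algebra_opV assms(1)
      opV_contractive[OF A.cstar_algebra_axioms assms(1,2)] assms(3)] by (rule opV_limit_apply)

lemma intertwine:
  assumes f: "f \<in> star_hom A opV" "f \<one>\<^bsub>A\<^esub> = id_blinfun" and g: "g \<in> star_hom A opV" "g \<one>\<^bsub>A\<^esub> = id_blinfun"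
    and T: "T \<in> carrier opV" and gens: "\<And>x z. x \<in> X \<Longrightarrow> g (gen x) (T z) = T (f (gen x) z)" and a: "a \<in> carrier A"
  shows "g a (T z) = T (f a z)"
proof -
  have "\<forall>z. g a (T z) = T (f a z)"
    using a
  proof (induction a rule: bip_cstar_induct)
    case (limit s a)
    show ?case
    proof
      fix z
      have "(\<lambda>n. g (s n) (T z)) \<longlonglongrightarrow> g a (T z)" by (rule hom_limit_apply[OF g limit(1)])
      moreover have "(\<lambda>n. T (f (s n) z)) \<longlonglongrightarrow> T (f a z)"
        by (rule bounded_linear.tendsto[OF blinfun.bounded_linear_right hom_limit_apply[OF f limit(1)]])
      ultimately show "g a (T z) = T (f a z)" using limit(2) LIMSEQ_unique by (metis (no_types, lifting) ext)
    qed
  next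
    case (scale a c)
    then show ?case using star_homD(4)[OF f(1)] star_homD(4)[OF g(1)] by (simp add: opV_apply_cscale[OF T])
  qed (use f(2) g(2) gens star_homD[OF f(1)] star_homD[OF g(1)] in \<open>simp_all add: blinfun.add_left blinfun.add_right del: split_paired_All\<close>)
  then show ?thesis ..
qed

lemma invariant_line:
  assumes g: "g \<in> star_hom A opV" "g \<one>\<^bsub>A\<^esub> = id_blinfun" and x: "x \<noteq> 0"
    and gens: "\<And>y. y \<in> X \<Longrightarrow> \<exists>c. g (gen y) x = cscale c x" and a: "a \<in> carrier A"
  shows "\<exists>c. g a x = cscale c x"
proof -
  \<comment> \<open>The line is described by an equation between coordinates, which survives the
    limit step of the induction.\<close>
  have line: "(\<exists>c. z = cscale c x) \<longleftrightarrow> fst z * snd x = snd z * fst x" for z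
  proof
    assume "fst z * snd x = snd z * fst x"
    then show "\<exists>c. z = cscale c x"
      using x by (intro exI[of _ "if fst x = 0 then snd z / snd x else fst z / fst x"])
        (auto simp: prod_eq_iff field_simps)
  qed auto
  note H = star_homD[OF g(1)]
  show ?thesis
    using a
  proof (induction a rule: bip_cstar_induct)
    case one
    show ?case using g(2) by (intro exI[of _ 1]) simp
  next
    case (gen y)
    then show ?case by (rule gens)
  next
    case (add a b)
    then obtain c d where "g a x = cscale c x" "g b x = cscale d x" by blast
    then show ?case using H(2)[OF add(1,2)] by (intro exI[of _ "c + d"]) (simp add: blinfun.add_left cscale_add_left)
  next
    case (mult a b)
    then obtain c d where "g a x = cscale c x" "g b x = cscale d x" by blast
    then show ?case using H(3)[OF mult(1,2)] opV_apply_cscale[OF H(1)[OF mult(1)], of d x]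
      by (intro exI[of _ "d * c"]) (simp add: cscale_cscale)
  next
    case (scale a k)
    then obtain c where "g a x = cscale c x" by blast
    then show ?case using H(4)[OF scale(1)] by (intro exI[of _ "k * c"]) (simp add: cscale_cscale)
  next
    case (limit s a)
    have lim: "(\<lambda>n. g (s n) x) \<longlonglongrightarrow> g a x" by (rule hom_limit_apply[OF g limit(1)])
    have lims: "(\<lambda>n. fst (g (s n) x) * snd x) \<longlonglongrightarrow> fst (g a x) * snd x" "(\<lambda>n. snd (g (s n) x) * fst x) \<longlonglongrightarrow> snd (g a x) * fst x"
      by (rule tendsto_mult[OF tendsto_fst[OF lim] tendsto_const], rule tendsto_mult[OF tendsto_snd[OF lim] tendsto_const])
    have "fst (g (s n) x) * snd x = snd (g (s n) x) * fst x" for n using limit(2)[of n] by (simp only: line)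
    then have "fst (g a x) * snd x = snd (g a x) * fst x" using LIMSEQ_unique[OF lims(1)] lims(2) by simp
    then show ?case by (simp only: line)
  qed
qed

text \<open>A vector moved by the unit leaves a nonzero difference \<open>w\<close>, which every
  operator kills; the line of \<open>w\<close> would be invariant.\<close>

lemma irred_one:
  assumes "op_irred A g" shows "g \<one>\<^bsub>A\<^esub> = id_blinfun"
proof (rule ccontr)
  have g: "g \<in> star_hom A opV" using assms by (simp add: op_irred_def)
  note H = star_homD[OF g]
  assume "g \<one>\<^bsub>A\<^esub> \<noteq> id_blinfun"
  then obtain z where z: "g \<one>\<^bsub>A\<^esub> z \<noteq> z" by (metis blinfun_eqI id_blinfun.rep_eq id_apply)
  define w where "w = z - g \<one>\<^bsub>A\<^esub> z"
  have "g a w = cscale 0 w" if "a \<in> carrier A" for a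
    using H(3)[OF that A.one_closed] that by (simp add: w_def blinfun.diff_right) (metis blinfun_apply_blinfun_compose)
  moreover have "w \<noteq> 0" using z by (simp add: w_def)
  ultimately show False using assms unfolding op_irred_def by blast
qed

lemma hom_projections:
  assumes g: "g \<in> star_hom A opV" "g \<one>\<^bsub>A\<^esub> = id_blinfun" and G: "bipartite_graph G"
  shows "x \<in> X \<Longrightarrow> g (gen x) \<in> carrier opV \<and> adj_op (g (gen x)) = g (gen x) \<and> g (gen x) o\<^sub>L g (gen x) = g (gen x)"
    "x \<in> left G \<and> y \<in> left G \<or> x \<in> right G \<and> y \<in> right G \<Longrightarrow> x \<noteq> y \<Longrightarrow> g (gen x) o\<^sub>L g (gen y) = 0"
    "(\<Sum>x\<in>left G. g (gen x)) = id_blinfun" "(\<Sum>x\<in>right G. g (gen x)) = id_blinfun"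
    "x \<in> left G \<Longrightarrow> y \<in> right G \<Longrightarrow> g (gen x) (g (gen y) z) \<noteq> 0 \<Longrightarrow> {x, y} \<in> edges G"
proof -
  note H = star_homD[OF g(1)]
  have fin: "finite (left G)" "finite (right G)" using G by (auto simp: bipartite_graph_def)
  show p: "g (gen x) \<in> carrier opV \<and> adj_op (g (gen x)) = g (gen x) \<and> g (gen x) o\<^sub>L g (gen x) = g (gen x)" if "x \<in> X" for x
    using H(1,5)[OF gen_closed[OF that]] H(3)[OF gen_closed[OF that] gen_closed[OF that]] star_gen[OF that] gen_idem[OF that]
    by simp
  have s: "(\<Sum>x\<in>W. g (gen x)) = g (\<Oplus>\<^bsub>A\<^esub>x\<in>W. gen x)" if "finite W" "W \<subseteq> X" for W
  proof -
    have "g (\<Oplus>\<^bsub>A\<^esub>x\<in>W. gen x) = (\<Oplus>\<^bsub>opV\<^esub>x\<in>W. g (gen x))"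
      using that gen_closed by (intro star_hom_finsum[OF A.cstar_algebra_axioms cstar_algebra_opV g(1)]) auto
    also have "\<dots> = (\<Sum>x\<in>W. g (gen x))" using that p by (intro opV_finsum) blast
    finally show ?thesis by simp
  qed
  show sums: "(\<Sum>x\<in>left G. g (gen x)) = id_blinfun" "(\<Sum>x\<in>right G. g (gen x)) = id_blinfun"
    using s fin gen_sums g(2) by simp_all
  show "g (gen x) o\<^sub>L g (gen y) = 0" if "x \<in> left G \<and> y \<in> left G \<or> x \<in> right G \<and> y \<in> right G" "x \<noteq> y" for x y
  proof -
    have "(\<Oplus>\<^bsub>opV\<^esub>x\<in>left G. g (gen x)) = \<one>\<^bsub>opV\<^esub>" "(\<Oplus>\<^bsub>opV\<^esub>x\<in>right G. g (gen x)) = \<one>\<^bsub>opV\<^esub>"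
      using sums p by (simp_all add: opV_finsum)
    then have "g (gen x) \<otimes>\<^bsub>opV\<^esub> g (gen y) = \<zero>\<^bsub>opV\<^esub>"
      using that opV.projections_orthogonal[OF fin(1), of "\<lambda>x. g (gen x)" x y]
        opV.projections_orthogonal[OF fin(2), of "\<lambda>x. g (gen x)" x y] p by auto
    then show ?thesis by simp
  qed
  show "{x, y} \<in> edges G" if "x \<in> left G" "y \<in> right G" "g (gen x) (g (gen y) z) \<noteq> 0"
  proof (rule ccontr)
    assume "{x, y} \<notin> edges G"
    then have "g (gen x \<otimes>\<^bsub>A\<^esub> gen y) = 0"
      using gen_nonedge[OF that(1,2)] star_hom_zero_minus(1)[OF A.cstar_algebra_axioms cstar_algebra_opV g(1)] by simp
    then have "g (gen x) o\<^sub>L g (gen y) = 0" using H(3)[of "gen x" "gen y"] that gen_closed by simp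
    then show False using that(3) by (metis blinfun_apply_blinfun_compose blinfun.zero_left)
  qed
qed

lemma no_common_eigenvector:
  assumes g: "op_irred A g" and x: "x \<noteq> 0" shows "\<exists>y\<in>X. \<forall>c. g (gen y) x \<noteq> cscale c x"
proof (rule ccontr)
  have hom: "g \<in> star_hom A opV" using g by (simp add: op_irred_def)
  assume no: "\<not> ?thesis"
  have gens: "\<exists>c. g (gen y) x = cscale c x" if "y \<in> X" for y using no that by blast
  have "\<exists>c. g a x = cscale c x" if "a \<in> carrier A" for a
    by (rule invariant_line[OF hom irred_one[OF g] x gens that])
  then show False using g x unfolding op_irred_def by blast
qed

text \<open>If \<open>gen u\<close> acts as the identity, the other vertices on its side act as 0,
  and any nonzero vector in the range of \<open>gen v\<close> is a common eigenvector of all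
  generators.\<close>

lemma irred_not_id:
  assumes G: "bipartite_graph G" and g: "op_irred A g"
    and W: "W = left G \<and> W' = right G \<or> W = right G \<and> W' = left G"
    and uv: "u \<in> W" "v \<in> W'" "g (gen v) \<noteq> 0"
  shows "g (gen u) \<noteq> id_blinfun"
proof
  assume id: "g (gen u) = id_blinfun"
  have hom: "g \<in> star_hom A opV" using g by (simp add: op_irred_def)
  note P = hom_projections[OF hom irred_one[OF g] G]
  have WX: "W \<subseteq> X" "W' \<subseteq> X" "X = W \<union> W'" using W by auto
  have idem: "g (gen k) (g (gen k) x) = g (gen k) x" if "k \<in> X" for k x
    using P(1)[OF that] by (metis blinfun_apply_blinfun_compose)
  have orth0: "g (gen k) (g (gen l) x) = 0" if "k \<in> W \<and> l \<in> W \<or> k \<in> W' \<and> l \<in> W'" "k \<noteq> l" for k l x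
  proof -
    have "g (gen k) o\<^sub>L g (gen l) = 0" using P(2)[of k l] that W by auto
    then show ?thesis by (metis blinfun_apply_blinfun_compose blinfun.zero_left)
  qed
  obtain y where y: "g (gen v) y \<noteq> 0" using uv(3) by (metis blinfun_eqI blinfun.zero_left)
  have "\<exists>c. g (gen k) (g (gen v) y) = cscale c (g (gen v) y)" if k: "k \<in> X" for k
  proof -
    consider "k = u" | "k \<in> W" "k \<noteq> u" | "k = v" | "k \<in> W'" "k \<noteq> v" using k WX by blast
    then show ?thesis
    proof cases
      case 1 then show ?thesis using id by (intro exI[of _ 1]) simp
    next
      case 2
      then have "g (gen k) (g (gen u) (g (gen v) y)) = 0" using orth0 uv by blast
      then show ?thesis using id by (intro exI[of _ 0]) simp
    next
      case 3 then show ?thesis using idem uv WX by (intro exI[of _ 1]) auto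
    next
      case 4 then show ?thesis using orth0[of k v] uv by (intro exI[of _ 0]) auto
    qed
  qed
  then show False using no_common_eigenvector[OF g y] by blast
qed

text \<open>The generators at \<open>u\<close> and \<open>v\<close> act as projections onto lines,
  spanned by unit vectors \<open>x\<close> and \<open>y\<close>, and on each side only one more
  vertex survives, acting as the complementary projection. Up to a unitary such a configuration is
  described by the angle between the lines.\<close>

theorem irred_classification:
  assumes G: "bipartite_graph G" and g: "op_irred A g"
    and uv: "u \<in> left G" "v \<in> right G" "g (gen u) \<noteq> 0" "g (gen v) \<noteq> 0"
  obtains u' v' t W where "four_cycle G u u' v v'" "0 < t" "t < pi / 2" "W \<in> carrier opV"
    "\<And>x y. cinner (W x) (W y) = cinner x y" "surj (blinfun_apply W)"
    "\<And>a z. a \<in> carrier A \<Longrightarrow> g a (W z) = W (model_hom (cycle_model u u' v v' t) a z)"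
proof -
  have hom: "g \<in> star_hom A opV" using g by (simp add: op_irred_def)
  note one = irred_one[OF g]
  note P = hom_projections[OF hom one G]
  have fin: "finite (left G)" "finite (right G)" and dj: "left G \<inter> right G = {}" using G by (auto simp: bipartite_graph_def)
  have not_id: "g (gen u) \<noteq> id_blinfun" "g (gen v) \<noteq> id_blinfun"
    using irred_not_id[OF G g] uv by blast+
  obtain x u' where x: "norm x = 1" "u' \<in> left G" "u' \<noteq> u" "\<And>z. g (gen u) z = cscale (cinner x z) x"
    "\<And>z. g (gen u') z = cscale (cinner (perp x) z) (perp x)" "\<And>k. k \<in> left G \<Longrightarrow> k \<noteq> u \<Longrightarrow> k \<noteq> u' \<Longrightarrow> g (gen k) = 0"
    by (rule rank_one_pair[OF fin(1) _ _ P(3) uv(1,3) not_id(1)]) (use P(1,2) in blast)+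
  obtain y v' where y: "norm y = 1" "v' \<in> right G" "v' \<noteq> v" "\<And>z. g (gen v) z = cscale (cinner y z) y"
    "\<And>z. g (gen v') z = cscale (cinner (perp y) z) (perp y)" "\<And>k. k \<in> right G \<Longrightarrow> k \<noteq> v \<Longrightarrow> k \<noteq> v' \<Longrightarrow> g (gen k) = 0"
    by (rule rank_one_pair[OF fin(2) _ _ P(4) uv(2,4) not_id(2)]) (use P(1,2) in blast)+
  define a where "a = cinner x y"
  define b where "b = cinner (perp x) y"
  have y_exp: "y = cscale a x + cscale b (perp x)" unfolding a_def b_def by (rule orthonormal_expansion[OF x(1)])
  have x0: "x \<noteq> 0" "perp x \<noteq> 0" and y0: "y \<noteq> 0" "perp y \<noteq> 0"
    using x(1) y(1) norm_perp[of x] norm_perp[of y] by (metis norm_zero zero_neq_one)+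
  \<comment> \<open>If \<open>y\<close> lay on the line of \<open>x\<close> or of
    \<open>perp x\<close>, it would be an eigenvector of every generator; irreducibility makes both
    coordinates of \<open>y\<close> nonzero.\<close>
  have eig: "\<exists>c. g (gen k) y = cscale c y" if z: "a = 0 \<or> b = 0" and k: "k \<in> X" for k
  proof -
    consider "k = u" | "k = u'" | "k = v" | "k = v'" | "g (gen k) = 0" using k x(6) y(6) by blast
    then show ?thesis
    proof cases
      case 1
      then have gy: "g (gen k) y = cscale a x" using x(4)[of y] by (simp add: a_def)
      show ?thesis
      proof (cases "a = 0")
        case True
        then show ?thesis using gy by (intro exI[of _ 0]) simp
      next
        case False
        then have "y = cscale a x" using z y_exp by simp
        then show ?thesis using gy by (intro exI[of _ 1]) simp
      qed
    next
      case 2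
      then have gy: "g (gen k) y = cscale b (perp x)" using x(5)[of y] by (simp add: b_def)
      show ?thesis
      proof (cases "b = 0")
        case True
        then show ?thesis using gy by (intro exI[of _ 0]) simp
      next
        case False
        then have "y = cscale b (perp x)" using z y_exp by simp
        then show ?thesis using gy by (intro exI[of _ 1]) simp
      qed
    next
      case 3
      then have "g (gen k) y = cscale 1 y" using y(4)[of y] cinner_unit(1)[OF y(1)] by simp
      then show ?thesis ..
    next
      case 4
      then have "g (gen k) y = cscale 0 y" using y(5)[of y] by (simp add: cinner_perp)
      then show ?thesis ..
    next
      case 5
      then have "g (gen k) y = cscale 0 y" by simp
      then show ?thesis ..
    qed
  qed
  have ab: "a \<noteq> 0" "b \<noteq> 0" using eig no_common_eigenvector[OF g y0(1)] by blast+
  have sq: "(cmod a)\<^sup>2 + (cmod b)\<^sup>2 = 1"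
  proof -
    have "cinner (cscale a x + cscale b (perp x)) (cscale a x + cscale b (perp x)) = cnj a * a + cnj b * b"
      by (simp add: cinner_simps cinner_perp(1,2) cinner_unit[OF x(1)])
    then have "cinner y y = cnj a * a + cnj b * b" by (simp only: y_exp[symmetric])
    moreover have "complex_of_real ((cmod a)\<^sup>2 + (cmod b)\<^sup>2) = cnj a * a + cnj b * b"
      by (simp only: of_real_add complex_norm_square mult.commute)
    ultimately have "complex_of_real ((cmod a)\<^sup>2 + (cmod b)\<^sup>2) = complex_of_real 1"
      using cinner_unit(1)[OF y(1)] by simp
    then show ?thesis by (simp only: of_real_eq_iff)
  qed
  define t where "t = arccos (cmod a)"
  have a1: "0 < cmod a" "cmod a < 1"
  proof -
    show "0 < cmod a" using ab by simp
    have b0: "0 < (cmod b)\<^sup>2" using ab by simp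
    have "(cmod a)\<^sup>2 < 1\<^sup>2" unfolding power_one using sq b0 by linarith
    then show "cmod a < 1" using power_less_imp_less_base[of "cmod a" 2 1] by simp
  qed
  have t: "0 < t" "t < pi / 2" "cos t = cmod a"
  proof -
    show "0 < t" "t < pi / 2" using arccos_lt_bounded[of "cmod a"] arccos_less_arccos[of 0 "cmod a"] a1
      by (auto simp: t_def)
    show "cos t = cmod a" unfolding t_def using a1 by (intro cos_arccos) linarith+
  qed
  have sin_t: "sin t = cmod b"
  proof -
    have "(sin t)\<^sup>2 = (cmod b)\<^sup>2" using sq sin_cos_squared_add[of t] t(3) by simp
    moreover have "0 \<le> sin t" using t(1,2) by (intro sin_ge_zero) auto
    ultimately show ?thesis by (simp add: power2_eq_iff_nonneg)
  qed
  \<comment> \<open>The phases of the coordinates of \<open>y\<close> are absorbed into the unitary,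
    so that \<open>W\<close> maps the real vector \<open>(cos t, sin t)\<close> of the model to
    \<open>y\<close>.\<close>
  define \<alpha> where "\<alpha> = a / cmod a"
  define \<beta> where "\<beta> = b / cmod b"
  have unimod: "cnj c * c = 1" if "cmod c = 1" for c
    using complex_norm_square[of c] that by (simp add: mult.commute)
  have "cmod \<alpha> = 1" "cmod \<beta> = 1" using ab by (simp_all add: \<alpha>_def \<beta>_def norm_divide)
  then have phase: "cnj \<alpha> * \<alpha> = 1" "cnj \<beta> * \<beta> = 1" using unimod by blast+
  define W where "W = Blinfun (\<lambda>z. cscale (fst z * \<alpha>) x + cscale (snd z * \<beta>) (perp x))"
  have W: "blinfun_apply W = (\<lambda>z. cscale (fst z * \<alpha>) x + cscale (snd z * \<beta>) (perp x))" "W \<in> carrier opV"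
    unfolding W_def by (rule blinfun_Blinfun_complex; simp add: prod_eq_iff algebra_simps)+
  have W_inner: "cinner (W z) (W w) = cinner z w" for z w
  proof -
    have "cinner (W z) (W w) = cnj (fst z) * fst w * (cnj \<alpha> * \<alpha>) + cnj (snd z) * snd w * (cnj \<beta> * \<beta>)"
      by (simp add: W cinner_simps cinner_perp(1,2) cinner_unit[OF x(1)] algebra_simps)
    then show ?thesis by (simp add: phase cinner_def)
  qed
  have \<alpha>a: "cmod a * \<alpha> = a" "cmod b * \<beta> = b" using ab by (simp_all add: \<alpha>_def \<beta>_def)
  have W_y: "W (of_real (cos t), of_real (sin t)) = y"
    using \<alpha>a y_exp by (simp add: W t(3) sin_t)
  have W_surj: "surj (blinfun_apply W)"
  proof (rule surjI)
    fix z
    show "W (cnj \<alpha> * cinner x z, cnj \<beta> * cinner (perp x) z) = z"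
    proof -
      have e1: "cnj \<alpha> * c * \<alpha> = c" for c using phase(1) by (metis mult.assoc mult.commute mult.left_neutral)
      have e2: "cnj \<beta> * c * \<beta> = c" for c using phase(2) by (metis mult.assoc mult.commute mult.left_neutral)
      have "W (cnj \<alpha> * cinner x z, cnj \<beta> * cinner (perp x) z)
          = cscale (cinner x z) x + cscale (cinner (perp x) z) (perp x)" unfolding W fst_conv snd_conv e1 e2 ..
      then show ?thesis unfolding orthonormal_expansion[OF x(1), symmetric] .
    qed
  qed
  have Wu: "g (gen u) (W z) = W (line_proj 1 0 z)" "g (gen u') (W z) = W (line_proj 0 (- 1) z)" for z
    by (simp_all add: W x(4,5) cinner_simps cinner_perp(1,2) cinner_unit[OF x(1)] line_proj_apply)
  have Wv: "g (gen v) (W z) = W (line_proj (cos t) (sin t) z)" for z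
  proof -
    have "cinner y (W z) = cinner (complex_of_real (cos t), complex_of_real (sin t)) z"
      using W_inner[of "(of_real (cos t), of_real (sin t))" z] W_y by simp
    then have "g (gen v) (W z) = cscale (of_real (cos t) * fst z + of_real (sin t) * snd z) (W (of_real (cos t), of_real (sin t)))"
      unfolding W_y y(4) by (simp add: cinner_def)
    then show ?thesis unfolding line_proj_apply opV_apply_cscale[OF W(2)] .
  qed
  have Wv': "g (gen v') (W z) = W (line_proj (sin t) (- cos t) z)" for z
  proof -
    have "g (gen v) (W z) + g (gen v') (W z) = W z"
      using orthonormal_expansion[OF y(1), of "W z"] by (simp add: y(4,5))
    moreover have "line_proj (cos t) (sin t) z + line_proj (sin t) (- cos t) z = z"
      using line_proj_sum[of "cos t" "sin t"] by (metis blinfun.add_left id_blinfun.rep_eq id_apply sin_cos_squared_add2 sin_cos_squared_add)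
    then have "W (line_proj (cos t) (sin t) z) + W (line_proj (sin t) (- cos t) z) = W z"
      by (metis blinfun.add_right)
    ultimately show ?thesis unfolding Wv by (metis add_left_cancel)
  qed
  \<comment> \<open>No line of the left pair is orthogonal to one of the right pair, so the four
    products of projections are nonzero, which forces all four edges.\<close>
  have ne: "cinner x y \<noteq> 0" "cinner x (perp y) \<noteq> 0" "cinner (perp x) y \<noteq> 0" "cinner (perp x) (perp y) \<noteq> 0"
    using ab cinner_perp(3)[of x y] cinner_perp(4)[of x y] by (simp_all add: a_def b_def)
  have cz: "cscale c z \<noteq> 0" if "c \<noteq> 0" "z \<noteq> 0" for c z using that by (auto simp: prod_eq_iff)
  have edges: "{u, v} \<in> edges G" "{u, v'} \<in> edges G" "{u', v} \<in> edges G" "{u', v'} \<in> edges G"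
  proof -
    have "g (gen u) (g (gen v) y) \<noteq> 0" "g (gen u') (g (gen v) y) \<noteq> 0"
      using ne cz x0 cinner_unit[OF y(1)] by (simp_all add: y(4) x(4,5))
    then show "{u, v} \<in> edges G" "{u', v} \<in> edges G" using P(5) uv(1,2) x(2) by blast+
    have "g (gen u) (g (gen v') (perp y)) \<noteq> 0" "g (gen u') (g (gen v') (perp y)) \<noteq> 0"
      using ne cz x0 cinner_unit[OF y(1)] by (simp_all add: y(5) x(4,5))
    then show "{u, v'} \<in> edges G" "{u', v'} \<in> edges G" using P(5) uv(1) y(2) x(2) by blast+
  qed
  have cyc: "four_cycle G u u' v v'" using edges uv x(2,3) y(2,3) by (auto simp: four_cycle_def)
  note M = model_hom[OF cycle_model_projections[OF G cyc, of t]]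
  have "g a (W z) = W (model_hom (cycle_model u u' v v' t) a z)" if "a \<in> carrier A" for a z
  proof (rule intertwine[OF M(1,3) hom one W(2) _ that])
    fix k z assume k: "k \<in> X"
    consider "k = u" | "k = u'" | "k = v" | "k = v'" | "k \<notin> {u, u', v, v'}" "g (gen k) = 0" using k x(6) y(6) by blast
    then show "g (gen k) (W z) = W (model_hom (cycle_model u u' v v' t) (gen k) z)"
      unfolding M(4)[OF k]
      by cases (use uv(1,2) x(2,3) y(2,3) dj Wu Wv Wv' in \<open>auto simp: cycle_model_def blinfun.zero_right\<close>)
  qed
  then show thesis using that[OF cyc t(1,2) W(2) W_inner W_surj] by blast
qed

text \<open>An idempotent scalar is 0 or 1; orthogonality and sum one leave exactly one vertex on
  each side, and the product of their generators is nonzero.\<close>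

theorem scalar_classification:
  assumes G: "bipartite_graph G" and g: "op_scalar A g"
  obtains u v where "u \<in> left G" "v \<in> right G" "{u, v} \<in> edges G"
    "\<And>a. a \<in> carrier A \<Longrightarrow> g a = model_hom (edge_model u v) a"
proof -
  have hom: "g \<in> star_hom A opV" and one: "g \<one>\<^bsub>A\<^esub> = id_blinfun" using g by (auto simp: op_scalar_def)
  note P = hom_projections[OF hom one G]
  have dj: "left G \<inter> right G = {}" using G by (auto simp: bipartite_graph_def)
  have id0: "id_blinfun \<noteq> (0 :: cvec \<Rightarrow>\<^sub>L cvec)"
  proof
    assume "id_blinfun = (0 :: cvec \<Rightarrow>\<^sub>L cvec)"
    then have "blinfun_apply id_blinfun ((1, 0) :: cvec) = blinfun_apply 0 (1, 0)" by simp
    then show False by (simp add: zero_prod_def)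
  qed
  have zi: "g (gen k) = 0 \<or> g (gen k) = id_blinfun" if k: "k \<in> X" for k
  proof -
    obtain c where c: "g (gen k) = cscale_op c" using g gen_closed[OF k] unfolding op_scalar_def by blast
    have "cscale_op c (cscale_op c (1, 0)) = cscale_op c (1, 0)" using P(1)[OF k] c by (metis blinfun_apply_blinfun_compose)
    then have "c * c = c" by (simp add: cscale_def)
    then have "c = 0 \<or> c = 1" by auto
    then show ?thesis unfolding c by (auto intro!: blinfun_eqI)
  qed
  have pick: "\<exists>u\<in>W. g (gen u) = id_blinfun \<and> (\<forall>k\<in>W. k \<noteq> u \<longrightarrow> g (gen k) = 0)" if W: "W = left G \<or> W = right G" for W
  proof -
    have "(\<Sum>k\<in>W. g (gen k)) \<noteq> 0" using W P(3,4) id0 by auto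
    then obtain u where u: "u \<in> W" "g (gen u) \<noteq> 0" by (metis sum.neutral)
    then have id: "g (gen u) = id_blinfun" using zi W by blast
    have "g (gen k) = 0" if "k \<in> W" "k \<noteq> u" for k
    proof -
      have "g (gen k) o\<^sub>L g (gen u) = 0" using P(2)[of k u] W u(1) that by auto
      moreover have "g (gen k) o\<^sub>L id_blinfun = g (gen k)" by (rule blinfun_eqI) simp
      ultimately show ?thesis unfolding id by simp
    qed
    then show ?thesis using u(1) id by blast
  qed
  obtain u where u: "u \<in> left G" "g (gen u) = id_blinfun" "\<And>k. k \<in> left G \<Longrightarrow> k \<noteq> u \<Longrightarrow> g (gen k) = 0"
    using pick[of "left G"] by blast
  obtain v where v: "v \<in> right G" "g (gen v) = id_blinfun" "\<And>k. k \<in> right G \<Longrightarrow> k \<noteq> v \<Longrightarrow> g (gen k) = 0"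
    using pick[of "right G"] by blast
  have e: "{u, v} \<in> edges G" using P(5)[OF u(1) v(1), of "(1, 0)"] u(2) v(2) by (simp add: zero_prod_def)
  note M = model_hom[OF edge_model_projections[OF G u(1) v(1) e]]
  have "g a = model_hom (edge_model u v) a" if "a \<in> carrier A" for a
  proof (rule star_hom_eqI[OF cstar_algebra_opV hom _ _ M(1,2) _ _ that])
    show "contractive_on A opV g" by (rule opV_contractive[OF A.cstar_algebra_axioms hom one])
    show "g (gen k) = model_hom (edge_model u v) (gen k)" if "k \<in> X" for k
      unfolding M(4)[OF that] using that u v dj by (auto simp: edge_model_def)
  qed (simp_all add: one M(3))
  then show thesis using that[OF u(1) v(1) e] by blast
qed

end

section \<open>The small spectrum as a space of kernels\<close>

definition kern_topology :: "('a, 'm) star_algebra_scheme \<Rightarrow> 'a set topology" where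
  "kern_topology A = subtopology (Prim_topology A) (kern_le2 A)"

lemma kern_le2_subset_Prim: "kern_le2 A \<subseteq> Prim A"
  unfolding kern_le2_def Prim_def irreps_def by auto

lemma openin_kern_topology:
  assumes "cstar_algebra A"
  shows "openin (kern_topology A) W \<longleftrightarrow> (\<exists>I \<subseteq> carrier A. W = {P \<in> kern_le2 A. \<not> I \<subseteq> P})"
proof -
  have "(Prim A - prim_hull A I) \<inter> kern_le2 A = {P \<in> kern_le2 A. \<not> I \<subseteq> P}" for I
    using kern_le2_subset_Prim[of A] by (auto simp: prim_hull_def)
  then show ?thesis
    unfolding kern_topology_def openin_subtopology openin_Prim_topology[OF assms] by metis
qed

lemma topspace_kern_topology: "cstar_algebra A \<Longrightarrow> topspace (kern_topology A) = kern_le2 A"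
  using kern_le2_subset_Prim[of A] by (auto simp: kern_topology_def topspace_Prim_topology)

lemma Spec_member:
  assumes "c \<in> Spec A" "(J, \<pi>) \<in> c"
  shows "(J, \<pi>) \<in> irreps A" "c = unitarily_equivalent A `` {(J, \<pi>)}" "spec_kernel A c = rep_kernel A J \<pi>"
proof -
  obtain y where y: "y \<in> irreps A" "c = unitarily_equivalent A `` {y}" using assms(1) unfolding Spec_def by (rule quotientE)
  then have R: "(y, (J, \<pi>)) \<in> unitarily_equivalent A" using assms(2) by simp
  then show 1: "(J, \<pi>) \<in> irreps A" by (auto simp: unitarily_equivalent_def)
  show 2: "c = unitarily_equivalent A `` {(J, \<pi>)}"
    unfolding y(2) by (rule equiv_class_eq[OF unitarily_equivalent_equiv R])
  show "spec_kernel A c = rep_kernel A J \<pi>" unfolding 2 by (rule spec_kernel_class[OF 1])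
qed

lemma spec_kernel_image:
  fixes A :: "('a, 'm) star_algebra_scheme"
  shows "spec_kernel A ` Spec_le2 A = kern_le2 A"
proof (intro equalityI subsetI)
  fix P assume "P \<in> spec_kernel A ` Spec_le2 A"
  then obtain c J \<pi> where c: "P = spec_kernel A c" "c \<in> Spec A" "(J, \<pi>) \<in> c" "card J = 1 \<or> card J = 2"
    unfolding Spec_le2_def by blast
  then show "P \<in> kern_le2 A"
    using Spec_member[OF c(2,3)] unfolding kern_le2_def irreps_def by auto
next
  fix P assume "P \<in> kern_le2 A"
  then obtain J :: "'a set" and \<pi> where P: "P = rep_kernel A J \<pi>" "(J, \<pi>) \<in> irreps A" "card J = 1 \<or> card J = 2"
    unfolding kern_le2_def irreps_def by auto
  let ?c = "unitarily_equivalent A `` {(J, \<pi>)}"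
  have "?c \<in> Spec A" unfolding Spec_def by (rule quotientI[OF P(2)])
  moreover have "(J, \<pi>) \<in> ?c" by (rule equiv_class_self[OF unitarily_equivalent_equiv P(2)])
  ultimately have "?c \<in> Spec_le2 A" using P(3) unfolding Spec_le2_def by blast
  moreover have "P = spec_kernel A ?c" using spec_kernel_class[OF P(2)] P(1) by simp
  ultimately show "P \<in> spec_kernel A ` Spec_le2 A" by blast
qed

lemma openin_Spec_le2_topology:
  assumes "cstar_algebra A"
  shows "openin (Spec_le2_topology A) W \<longleftrightarrow> (\<exists>I \<subseteq> carrier A. W = {c \<in> Spec_le2 A. \<not> I \<subseteq> spec_kernel A c})"
proof -
  have eq: "{c \<in> Spec A. \<not> I \<subseteq> spec_kernel A c} \<inter> Spec_le2 A = {c \<in> Spec_le2 A. \<not> I \<subseteq> spec_kernel A c}" for I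
    by (auto simp: Spec_le2_def)
  show ?thesis
    unfolding Spec_le2_topology_def openin_subtopology openin_Spec_topology[OF assms]
  proof (intro iffI)
    assume "\<exists>T. (\<exists>I\<subseteq>carrier A. T = {c \<in> Spec A. \<not> I \<subseteq> spec_kernel A c}) \<and> W = T \<inter> Spec_le2 A"
    then obtain I where I: "I \<subseteq> carrier A" "W = {c \<in> Spec A. \<not> I \<subseteq> spec_kernel A c} \<inter> Spec_le2 A" by (elim exE conjE) simp
    show "\<exists>I\<subseteq>carrier A. W = {c \<in> Spec_le2 A. \<not> I \<subseteq> spec_kernel A c}"
      by (rule exI[of _ I], rule conjI[OF I(1) trans[OF I(2) eq]])
  next
    assume "\<exists>I\<subseteq>carrier A. W = {c \<in> Spec_le2 A. \<not> I \<subseteq> spec_kernel A c}"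
    then obtain I where I: "I \<subseteq> carrier A" "W = {c \<in> Spec_le2 A. \<not> I \<subseteq> spec_kernel A c}" by (elim exE conjE)
    show "\<exists>T. (\<exists>I\<subseteq>carrier A. T = {c \<in> Spec A. \<not> I \<subseteq> spec_kernel A c}) \<and> W = T \<inter> Spec_le2 A"
    proof (intro exI conjI)
      show "W = {c \<in> Spec A. \<not> I \<subseteq> spec_kernel A c} \<inter> Spec_le2 A" by (rule trans[OF I(2) eq[symmetric]])
      show "I \<subseteq> carrier A" by (rule I(1))
    qed (rule refl)
  qed
qed

lemma topspace_Spec_le2_topology:
  assumes A: "cstar_algebra A" shows "topspace (Spec_le2_topology A) = Spec_le2 A"
proof -
  have "\<not> carrier A \<subseteq> spec_kernel A c" if c: "c \<in> Spec_le2 A" for c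
  proof -
    have "spec_kernel A c \<in> kern_le2 A" using c spec_kernel_image[of A] by blast
    then show ?thesis
      unfolding kern_le2_def irreducible_rep_def rep_kernel_def by fastforce
  qed
  then have "openin (Spec_le2_topology A) (Spec_le2 A)"
    unfolding openin_Spec_le2_topology[OF A] by (intro exI[of _ "carrier A"]) auto
  moreover have "topspace (Spec_le2_topology A) \<subseteq> Spec_le2 A" by (simp add: Spec_le2_topology_def)
  ultimately show ?thesis using openin_subset by blast
qed

text \<open>Open sets on both sides are given by the same subsets \<open>I\<close> of the algebra,
  so a kernel map that is injective is a homeomorphism onto the space of kernels.\<close>

lemma Spec_le2_homeomorphic_kern:
  assumes A: "cstar_algebra A" and inj: "inj_on (spec_kernel A) (Spec_le2 A)"
  shows "Spec_le2_topology A homeomorphic_space kern_topology A"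
proof -
  have "homeomorphic_map (Spec_le2_topology A) (kern_topology A) (spec_kernel A)"
  proof (rule bijective_open_imp_homeomorphic_map)
    have mem: "spec_kernel A c \<in> kern_le2 A" if "c \<in> Spec_le2 A" for c
      unfolding spec_kernel_image[symmetric] by (rule imageI[OF that])
    have ex: "\<exists>c\<in>Spec_le2 A. P = spec_kernel A c" if "P \<in> kern_le2 A" for P
      using that unfolding spec_kernel_image[symmetric] by (elim imageE) (intro bexI)
    have pre: "{c \<in> Spec_le2 A. spec_kernel A c \<in> {P \<in> kern_le2 A. \<not> I \<subseteq> P}} = {c \<in> Spec_le2 A. \<not> I \<subseteq> spec_kernel A c}" for I
      by (intro Collect_cong) (simp add: mem cong: conj_cong)
    have img: "spec_kernel A ` {c \<in> Spec_le2 A. \<not> I \<subseteq> spec_kernel A c} = {P \<in> kern_le2 A. \<not> I \<subseteq> P}" for I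
    proof (intro equalityI subsetI)
      fix P assume "P \<in> {P \<in> kern_le2 A. \<not> I \<subseteq> P}"
      then obtain c where "c \<in> Spec_le2 A" "P = spec_kernel A c" "\<not> I \<subseteq> P" using ex[of P] by blast
      then show "P \<in> spec_kernel A ` {c \<in> Spec_le2 A. \<not> I \<subseteq> spec_kernel A c}" by (intro image_eqI[of _ _ c]) simp_all
    qed (auto simp: mem)
    show "continuous_map (Spec_le2_topology A) (kern_topology A) (spec_kernel A)"
      unfolding continuous_map_def topspace_Spec_le2_topology[OF A] topspace_kern_topology[OF A]
    proof (intro conjI allI impI)
      fix W assume "openin (kern_topology A) W"
      then obtain I where I: "I \<subseteq> carrier A" "W = {P \<in> kern_le2 A. \<not> I \<subseteq> P}"
        unfolding openin_kern_topology[OF A] by (elim exE conjE)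
      show "openin (Spec_le2_topology A) {c \<in> Spec_le2 A. spec_kernel A c \<in> W}"
        unfolding I(2) pre openin_Spec_le2_topology[OF A] by (intro exI conjI) (rule I(1), rule refl)
    qed (simp add: Pi_def mem)
    show "open_map (Spec_le2_topology A) (kern_topology A) (spec_kernel A)"
      unfolding open_map_def
    proof (intro allI impI)
      fix W assume "openin (Spec_le2_topology A) W"
      then obtain I where I: "I \<subseteq> carrier A" "W = {c \<in> Spec_le2 A. \<not> I \<subseteq> spec_kernel A c}"
        unfolding openin_Spec_le2_topology[OF A] by (elim exE conjE)
      show "openin (kern_topology A) (spec_kernel A ` W)"
        unfolding I(2) img openin_kern_topology[OF A] by (intro exI conjI) (rule I(1), rule refl)
    qed
    show "spec_kernel A ` topspace (Spec_le2_topology A) = topspace (kern_topology A)"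
      unfolding topspace_Spec_le2_topology[OF A] topspace_kern_topology[OF A] by (rule spec_kernel_image)
    show "inj_on (spec_kernel A) (topspace (Spec_le2_topology A))"
      unfolding topspace_Spec_le2_topology[OF A] by (rule inj)
  qed
  then show ?thesis by (rule homeomorphic_map_imp_homeomorphic_space)
qed

lemma opV_hom_minus:
  assumes A: "cstar_algebra A" and f: "f \<in> star_hom A opV" and a: "a \<in> carrier A" "b \<in> carrier A"
  shows "f (a \<ominus>\<^bsub>A\<^esub> b) = f a - f b"
  using star_hom_zero_minus(2)[OF A cstar_algebra_opV f a] opV_minus[OF star_homD(1)[OF f a(1)] star_homD(1)[OF f a(2)]]
  by simp

text \<open>If \<open>g a\<close> is the scalar \<open>c\<close>, then \<open>a\<close> minus
  \<open>c\<close> times the unit is in the kernel of \<open>g\<close> and hence killed by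
  \<open>h\<close>, which is unital.\<close>

lemma scalar_kernel_le:
  assumes A: "cstar_algebra A" and g: "op_scalar A g" and h: "h \<in> star_hom A opV" "h \<one>\<^bsub>A\<^esub> = id_blinfun"
    and sub: "op_kernel A g \<subseteq> op_kernel A h" and a: "a \<in> carrier A"
  shows "h a = g a"
proof -
  interpret A: cstar_algebra A by (rule A)
  have hom: "g \<in> star_hom A opV" and one: "g \<one>\<^bsub>A\<^esub> = id_blinfun" using g by (auto simp: op_scalar_def)
  obtain c where c: "g a = cscale_op c" using g a unfolding op_scalar_def by blast
  have ci: "cscale_op c o\<^sub>L id_blinfun = cscale_op c" by (rule blinfun_eqI) simp
  have "g (a \<ominus>\<^bsub>A\<^esub> scale A c \<one>\<^bsub>A\<^esub>) = g a \<ominus>\<^bsub>opV\<^esub> g (scale A c \<one>\<^bsub>A\<^esub>)"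
    "h (a \<ominus>\<^bsub>A\<^esub> scale A c \<one>\<^bsub>A\<^esub>) = h a \<ominus>\<^bsub>opV\<^esub> h (scale A c \<one>\<^bsub>A\<^esub>)"
    using star_hom_zero_minus(2)[OF A cstar_algebra_opV] hom h(1) a A.scale_closed by blast+
  moreover have "g (scale A c \<one>\<^bsub>A\<^esub>) = cscale_op c" "h (scale A c \<one>\<^bsub>A\<^esub>) = cscale_op c"
    using star_homD(4)[OF hom A.one_closed] star_homD(4)[OF h(1) A.one_closed] one h(2) ci by simp_all
  moreover have "g a \<in> carrier opV" "h a \<in> carrier opV" using star_homD(1)[OF hom a] star_homD(1)[OF h(1) a] .
  ultimately have *: "g (a \<ominus>\<^bsub>A\<^esub> scale A c \<one>\<^bsub>A\<^esub>) = 0" "h (a \<ominus>\<^bsub>A\<^esub> scale A c \<one>\<^bsub>A\<^esub>) = h a - g a"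
    using c opV_minus[of "g a" "g a"] opV_minus[of "h a" "g a"] by simp_all
  then have "a \<ominus>\<^bsub>A\<^esub> scale A c \<one>\<^bsub>A\<^esub> \<in> op_kernel A g" using a A.scale_closed by (simp add: op_kernel_def)
  then have "h (a \<ominus>\<^bsub>A\<^esub> scale A c \<one>\<^bsub>A\<^esub>) = 0" using sub by (auto simp: op_kernel_def)
  then show ?thesis using * by simp
qed

lemma unitarily_equivalent_one:
  assumes A: "cstar_algebra A" and \<pi>: "irreducible_rep A {i} \<pi>" and \<rho>: "irreducible_rep A {j} \<rho>"
    and ker: "rep_kernel A {i} \<pi> = rep_kernel A {j} \<rho>"
  shows "(({i}, \<pi>), ({j}, \<rho>)) \<in> unitarily_equivalent A"
proof -
  let ?\<delta> = "\<lambda>i k. if k = i then 1 else 0 :: complex"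
  let ?g = "\<lambda>a. cscale_op (\<pi> a (?\<delta> i) i)" and ?h = "\<lambda>a. cscale_op (\<rho> a (?\<delta> j) j)"
  note P = rep_op_scalar[OF \<pi> A] and R = rep_op_scalar[OF \<rho> A]
  have eq: "\<rho> a (?\<delta> j) j = \<pi> a (?\<delta> i) i" if "a \<in> carrier A" for a
  proof -
    have h: "?h \<in> star_hom A opV" "?h \<one>\<^bsub>A\<^esub> = id_blinfun" using R(1) unfolding op_scalar_def by simp_all
    have "op_kernel A ?g \<subseteq> op_kernel A ?h" using P(2) R(2) ker by simp
    then have "?h a = ?g a" by (rule scalar_kernel_le[OF A P(1) h _ that])
    then have "fst (?h a (1, 0)) = fst (?g a (1, 0))" by simp
    then show ?thesis by simp
  qed
  have l2: "\<xi> \<in> l2 {i} \<longleftrightarrow> (\<forall>k. k \<noteq> i \<longrightarrow> \<xi> k = 0)" for \<xi> i by (simp add: l2_finite)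
  have inner: "l2_inner \<xi> \<eta> = cnj (\<xi> i) * \<eta> i" if "\<xi> \<in> l2 {i}" for \<xi> \<eta> i
    using that unfolding l2_inner_def l2 by (subst infsum_finite_support[of "{i}"]) auto
  define T where "T \<xi> = (\<lambda>k. if k = j then \<xi> i else 0)" for \<xi> :: "'a \<Rightarrow> complex"
  define S where "S \<xi> = (\<lambda>k. if k = i then \<xi> j else 0)" for \<xi> :: "'a \<Rightarrow> complex"
  have T_in: "T \<xi> \<in> l2 {j}" and S_in: "S \<xi> \<in> l2 {i}" for \<xi> by (simp_all add: l2 T_def S_def)
  have ST: "S (T \<xi>) = \<xi>" if "\<xi> \<in> l2 {i}" for \<xi> using that by (auto simp: l2 S_def T_def)
  have TS: "T (S \<xi>) = \<xi>" if "\<xi> \<in> l2 {j}" for \<xi> using that by (auto simp: l2 S_def T_def)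
  have lin: "l2_linear {i} {j} T"
    unfolding l2_linear_def using T_in by (auto simp: T_def)
  have "bij_betw T (l2 {i}) (l2 {j})"
    using T_in S_in ST TS by (intro bij_betw_byWitness[of _ S]) auto
  moreover have "l2_inner (T \<xi>) (T \<eta>) = l2_inner \<xi> \<eta>" if "\<xi> \<in> l2 {i}" for \<xi> \<eta>
    using inner[OF T_in, of \<xi> "T \<eta>"] inner[OF that, of \<eta>] by (simp add: T_def)
  ultimately have U: "l2_unitary {i} {j} T" using lin by (simp add: l2_unitary_def)
  have "T (\<pi> a \<xi>) = \<rho> a (T \<xi>)" if "a \<in> carrier A" "\<xi> \<in> l2 {i}" for a \<xi>
    unfolding P(3)[OF that] R(3)[OF that(1) T_in] eq[OF that(1)] by (auto simp: T_def)
  then show ?thesis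
    using U \<pi> \<rho> unfolding unitarily_equivalent_def irreps_def by blast
qed

lemma unitarily_equivalent_two:
  assumes A: "cstar_algebra A" and \<pi>: "irreducible_rep A {i, j} \<pi>" "i \<noteq> j" and \<rho>: "irreducible_rep A {k, l} \<rho>" "k \<noteq> l"
    and W: "W \<in> carrier opV" "\<And>x y. cinner (W x) (W y) = cinner x y" "surj (blinfun_apply W)"
    and int: "\<And>a z. a \<in> carrier A \<Longrightarrow> rep_op k l \<rho> a (W z) = W (rep_op i j \<pi> a z)"
  shows "(({i, j}, \<pi>), ({k, l}, \<rho>)) \<in> unitarily_equivalent A"
proof -
  have rep: "hilbert_rep A {i, j} \<pi>" "hilbert_rep A {k, l} \<rho>" using \<pi> \<rho> by (auto simp: irreducible_rep_def)
  define T where "T \<xi> = emb k l (W (coord i j \<xi>))" for \<xi>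
  have lin: "l2_linear {i, j} {k, l} T"
    unfolding l2_linear_def by (auto simp: T_def emb_in coord_linear emb_linear blinfun.add_right opV_apply_cscale[OF W(1)])
  have inner: "l2_inner (T \<xi>) (T \<eta>) = l2_inner \<xi> \<eta>" if "\<xi> \<in> l2 {i, j}" for \<xi> \<eta>
    using that unfolding T_def
    by (simp add: l2_inner_coord[OF \<pi>(2)] l2_inner_coord[OF \<rho>(2) emb_in] coord_emb[OF \<rho>(2)] W(2))
  have inj: "W x = W y \<Longrightarrow> x = y" for x y
  proof -
    assume "W x = W y"
    then have "W (x - y) = 0" by (simp add: blinfun.diff_right)
    then have "cinner (x - y) (x - y) = 0" using W(2)[of "x - y" "x - y"] by (simp add: cinner_simps)
    then show "x = y" by (simp add: cinner_self)
  qed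
  have "bij_betw T (l2 {i, j}) (l2 {k, l})"
  proof (rule bij_betwI')
    show "T \<xi> = T \<eta> \<longleftrightarrow> \<xi> = \<eta>" if "\<xi> \<in> l2 {i, j}" "\<eta> \<in> l2 {i, j}" for \<xi> \<eta>
    proof
      assume "T \<xi> = T \<eta>"
      then have "coord k l (T \<xi>) = coord k l (T \<eta>)" by simp
      then have "coord i j \<xi> = coord i j \<eta>" unfolding T_def coord_emb[OF \<rho>(2)] by (rule inj)
      then have "emb i j (coord i j \<xi>) = emb i j (coord i j \<eta>)" by (simp only:)
      then show "\<xi> = \<eta>" by (simp only: emb_coord[OF that(1)] emb_coord[OF that(2)])
    qed simp
    show "T \<xi> \<in> l2 {k, l}" for \<xi> unfolding T_def by (rule emb_in)
    show "\<exists>\<xi>\<in>l2 {i, j}. \<eta> = T \<xi>" if "\<eta> \<in> l2 {k, l}" for \<eta>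
    proof -
      obtain x where "W x = coord k l \<eta>" using W(3) by (metis surjD)
      then have "\<eta> = T (emb i j x)" using emb_coord[OF that] by (simp add: T_def coord_emb[OF \<pi>(2)])
      then show ?thesis using emb_in by (rule bexI)
    qed
  qed
  then have U: "l2_unitary {i, j} {k, l} T" using lin inner by (simp add: l2_unitary_def)
  have "T (\<pi> a \<xi>) = \<rho> a (T \<xi>)" if a: "a \<in> carrier A" "\<xi> \<in> l2 {i, j}" for a \<xi>
  proof -
    have "T (\<pi> a \<xi>) = emb k l (W (rep_op i j \<pi> a (coord i j \<xi>)))"
      unfolding rep_op(2)[OF rep(1) \<pi>(2) A a] T_def coord_emb[OF \<pi>(2)] ..
    also have "\<dots> = emb k l (rep_op k l \<rho> a (W (coord i j \<xi>)))" by (simp add: int[OF a(1)])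
    also have "\<dots> = \<rho> a (T \<xi>)"
      unfolding T_def using rep_op(1)[OF rep(2) \<rho>(2) A a(1)] by simp
    finally show ?thesis .
  qed
  then show ?thesis
    using U \<pi> \<rho> unfolding unitarily_equivalent_def irreps_def by blast
qed

lemma cscale_eq_iff: "x \<noteq> 0 \<Longrightarrow> cscale c x = cscale d x \<longleftrightarrow> c = d"
  by (auto simp: prod_eq_iff)

section \<open>The model representations and their kernels\<close>

locale bip_graph_algebra = bip_algebra G for G :: "'v bip_graph" +
  assumes G: "bipartite_graph G"
begin

lemma G_fin: "finite (left G)" "finite (right G)" "left G \<inter> right G = {}"
  using G by (auto simp: bipartite_graph_def)

abbreviation "cycle_hom u u' v v' t \<equiv> model_hom (cycle_model u u' v v' t)"
abbreviation "edge_hom u v \<equiv> model_hom (edge_model u v)"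

lemma cycle_hom:
  assumes c: "four_cycle G u u' v v'"
  shows "cycle_hom u u' v v' t \<in> star_hom A opV" "cycle_hom u u' v v' t \<one>\<^bsub>A\<^esub> = id_blinfun"
    "cycle_hom u u' v v' t (gen u) = line_proj 1 0" "cycle_hom u u' v v' t (gen u') = line_proj 0 (- 1)"
    "cycle_hom u u' v v' t (gen v) = line_proj (cos t) (sin t)" "cycle_hom u u' v v' t (gen v') = line_proj (sin t) (- cos t)"
    "x \<in> X \<Longrightarrow> x \<notin> {u, u', v, v'} \<Longrightarrow> cycle_hom u u' v v' t (gen x) = 0"
proof -
  have d: "u \<in> X" "u' \<in> X" "v \<in> X" "v' \<in> X" "u \<noteq> u'" "v \<noteq> v'" "u \<noteq> v" "u \<noteq> v'" "u' \<noteq> v" "u' \<noteq> v'"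
    using c G_fin(3) by (auto simp: four_cycle_def)
  note M = model_hom[OF cycle_model_projections[OF G c, of t]]
  show "cycle_hom u u' v v' t \<in> star_hom A opV" "cycle_hom u u' v v' t \<one>\<^bsub>A\<^esub> = id_blinfun" by (rule M(1), rule M(3))
  show "cycle_hom u u' v v' t (gen u) = line_proj 1 0" "cycle_hom u u' v v' t (gen u') = line_proj 0 (- 1)"
    "cycle_hom u u' v v' t (gen v) = line_proj (cos t) (sin t)" "cycle_hom u u' v v' t (gen v') = line_proj (sin t) (- cos t)"
    "x \<in> X \<Longrightarrow> x \<notin> {u, u', v, v'} \<Longrightarrow> cycle_hom u u' v v' t (gen x) = 0"
    using M(4) d by (auto simp: cycle_model_def)
qed

lemma edge_hom:
  assumes e: "u \<in> left G" "v \<in> right G" "{u, v} \<in> edges G"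
  shows "edge_hom u v \<in> star_hom A opV" "edge_hom u v \<one>\<^bsub>A\<^esub> = id_blinfun"
    "x \<in> X \<Longrightarrow> edge_hom u v (gen x) = (if x = u \<or> x = v then id_blinfun else 0)"
proof -
  note M = model_hom[OF edge_model_projections[OF G e]]
  show "edge_hom u v \<in> star_hom A opV" "edge_hom u v \<one>\<^bsub>A\<^esub> = id_blinfun" by (rule M(1), rule M(3))
  show "x \<in> X \<Longrightarrow> edge_hom u v (gen x) = (if x = u \<or> x = v then id_blinfun else 0)"
    using M(4) by (auto simp: edge_model_def)
qed

text \<open>Every vector is an eigenvector of every generator, hence of every element. Comparing the
  eigenvalues at \<open>(1, 0)\<close>, \<open>(0, 1)\<close> and their sum shows that such an
  operator is scalar.\<close>

lemma edge_hom_scalar: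
  assumes e: "u \<in> left G" "v \<in> right G" "{u, v} \<in> edges G" shows "op_scalar A (edge_hom u v)"
  unfolding op_scalar_def
proof (intro conjI ballI)
  note E = edge_hom[OF e]
  note H = star_homD[OF E(1)]
  show "edge_hom u v \<in> star_hom A opV" "edge_hom u v \<one>\<^bsub>A\<^esub> = id_blinfun" by (rule E(1), rule E(2))
  fix a assume a: "a \<in> carrier A"
  have line: "\<exists>c. edge_hom u v a x = cscale c x" if "x \<noteq> 0" for x
  proof (rule invariant_line[OF E(1,2) that _ a])
    fix y assume "y \<in> X"
    then have "edge_hom u v (gen y) = id_blinfun \<or> edge_hom u v (gen y) = 0" using E(3) by auto
    then show "\<exists>c. edge_hom u v (gen y) x = cscale c x"
      by (elim disjE) (simp_all add: exI[of _ "1::complex"] exI[of _ "0::complex"])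
  qed
  obtain c where c: "edge_hom u v a (1, 0) = cscale c (1, 0)" using line[of "(1, 0)"] by (auto simp: zero_prod_def)
  obtain d where d: "edge_hom u v a (0, 1) = cscale d (0, 1)" using line[of "(0, 1)"] by (auto simp: zero_prod_def)
  obtain k where k: "edge_hom u v a (1, 1) = cscale k (1, 1)" using line[of "(1, 1)"] by (auto simp: zero_prod_def)
  have "edge_hom u v a ((1, 0) + (0, 1)) = cscale c (1, 0) + cscale d (0, 1)" unfolding blinfun.add_right c d ..
  then have "k = c \<and> k = d" using k by (auto simp: cscale_def)
  then have cd: "c = k" "d = k" by blast+
  have "edge_hom u v a = cscale_op k"
  proof (rule blinfun_eqI)
    fix z :: cvec
    have z: "z = cscale (fst z) (1, 0) + cscale (snd z) (0, 1)" by (simp add: prod_eq_iff)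
    have "edge_hom u v a z = cscale (fst z) (edge_hom u v a (1, 0)) + cscale (snd z) (edge_hom u v a (0, 1))"
      by (subst z) (simp only: blinfun.add_right opV_apply_cscale[OF H(1)[OF a]])
    then show "edge_hom u v a z = cscale_op k z" by (simp add: c d cd prod_eq_iff)
  qed
  then show "\<exists>c. edge_hom u v a = cscale_op c" ..
qed

text \<open>\<open>gen u\<close> has eigenvectors on the two axes only, and \<open>gen v\<close>
  projects onto a line that is neither equal nor orthogonal to an axis.\<close>

lemma cycle_hom_irred:
  assumes c: "four_cycle G u u' v v'" and t: "0 < t" "t < pi / 2" shows "op_irred A (cycle_hom u u' v v' t)"
  unfolding op_irred_def
proof (intro conjI allI impI)
  note M = cycle_hom[OF c]
  show "cycle_hom u u' v v' t \<in> star_hom A opV" by (rule M(1))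
  have sc: "cos t \<noteq> 0" "sin t \<noteq> 0" using t cos_gt_zero[of t] sin_gt_zero[of t] by auto
  have in_A: "gen u \<in> carrier A" "gen v \<in> carrier A" using c gen_closed by (auto simp: four_cycle_def)
  fix x :: cvec assume x: "x \<noteq> 0"
  show "\<exists>a\<in>carrier A. \<forall>k. cycle_hom u u' v v' t a x \<noteq> cscale k x"
  proof (cases "fst x = 0 \<or> snd x = 0")
    case True
    have "cycle_hom u u' v v' t (gen v) x \<noteq> cscale k x" for k
      using True x sc by (auto simp: M(5) line_proj_apply prod_eq_iff)
    then show ?thesis using in_A by blast
  next
    case False
    have "cycle_hom u u' v v' t (gen u) x \<noteq> cscale k x" for k
      using False by (auto simp: M(3) line_proj_apply prod_eq_iff)
    then show ?thesis using in_A by blast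
  qed
qed

lemma line_proj_nonzero: assumes "a\<^sup>2 + b\<^sup>2 = 1" shows "line_proj a b \<noteq> 0"
proof
  assume "line_proj a b = 0"
  moreover have "line_proj a b (of_real a, of_real b) = cscale (of_real (a\<^sup>2 + b\<^sup>2)) (of_real a, of_real b)"
    by (simp add: line_proj_apply power2_eq_square)
  ultimately have "(complex_of_real a, complex_of_real b) = 0" using assms by simp
  then show False using assms by (simp add: zero_prod_def)
qed

lemma cycle_kernel_gen:
  assumes c: "four_cycle G u u' v v'" and x: "x \<in> X"
  shows "gen x \<in> op_kernel A (cycle_hom u u' v v' t) \<longleftrightarrow> x \<notin> {u, u', v, v'}"
proof -
  note M = cycle_hom[OF c, where t = t]
  have "cycle_hom u u' v v' t (gen x) = 0 \<longleftrightarrow> x \<notin> {u, u', v, v'}"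
    using M(3-6) M(7)[OF x] line_proj_nonzero[of 1 0] line_proj_nonzero[of 0 "- 1"]
      line_proj_nonzero[of "cos t" "sin t"] line_proj_nonzero[of "sin t" "- cos t"] by auto
  then show ?thesis using gen_closed[OF x] by (simp add: op_kernel_def)
qed

lemma edge_kernel_gen:
  assumes e: "u \<in> left G" "v \<in> right G" "{u, v} \<in> edges G" and x: "x \<in> X"
  shows "gen x \<in> op_kernel A (edge_hom u v) \<longleftrightarrow> x \<notin> {u, v}"
proof -
  have "(id_blinfun :: cvec \<Rightarrow>\<^sub>L cvec) \<noteq> 0"
  proof
    assume "id_blinfun = (0 :: cvec \<Rightarrow>\<^sub>L cvec)"
    then have "blinfun_apply id_blinfun ((1, 0) :: cvec) = blinfun_apply 0 (1, 0)" by simp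
    then show False by (simp add: zero_prod_def)
  qed
  then show ?thesis using edge_hom(3)[OF e x] gen_closed[OF x] by (simp add: op_kernel_def)
qed

lemma cycle_kernel_angle:
  assumes c: "four_cycle G u u' v v'" and t: "0 < t" "t < pi / 2" and s: "0 < s" "s < pi / 2"
    and eq: "op_kernel A (cycle_hom u u' v v' t) = op_kernel A (cycle_hom u u' v v' s)"
  shows "t = s"
proof -
  have in_A: "gen u \<in> carrier A" "gen v \<in> carrier A" using c gen_closed by (auto simp: four_cycle_def)
  let ?k = "complex_of_real ((cos t)\<^sup>2)"
  \<comment> \<open>At angle \<open>r\<close> the compression of \<open>gen v\<close> by
    \<open>gen u\<close> is the squared cosine of \<open>r\<close> times \<open>gen u\<close>.
    Subtracting the multiple belonging to \<open>t\<close> leaves an element that vanishes at angle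
    \<open>r\<close> exactly if the squared cosines agree.\<close>
  define a where "a = gen u \<otimes>\<^bsub>A\<^esub> (gen v \<otimes>\<^bsub>A\<^esub> gen u) \<ominus>\<^bsub>A\<^esub> scale A ?k (gen u)"
  have a: "a \<in> carrier A" using in_A by (simp add: a_def A.scale_closed)
  have val: "cycle_hom u u' v v' r a (1, 0) = cscale (of_real ((cos r)\<^sup>2) - ?k) (1, 0)" "cycle_hom u u' v v' r a (0, 1) = 0" for r
  proof -
    note M = cycle_hom[OF c, where t = r]
    note H = star_homD[OF M(1)]
    have cl: "cycle_hom u u' v v' r (gen u) \<in> carrier opV" "cycle_hom u u' v v' r (gen v) \<in> carrier opV"
      using H(1) in_A by blast+
    have in_A': "gen u \<otimes>\<^bsub>A\<^esub> (gen v \<otimes>\<^bsub>A\<^esub> gen u) \<in> carrier A" "scale A ?k (gen u) \<in> carrier A" using in_A by (simp_all add: A.scale_closed)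
    have "cycle_hom u u' v v' r a = (line_proj 1 0 o\<^sub>L (line_proj (cos r) (sin r) o\<^sub>L line_proj 1 0)) - (cscale_op ?k o\<^sub>L line_proj 1 0)"
      unfolding a_def opV_hom_minus[OF A.cstar_algebra_axioms M(1) in_A'] using in_A by (simp add: H M(3,5))
    then show "cycle_hom u u' v v' r a (1, 0) = cscale (of_real ((cos r)\<^sup>2) - ?k) (1, 0)"
      "cycle_hom u u' v v' r a (0, 1) = 0"
      by (simp_all add: blinfun.diff_left line_proj_apply cscale_def power2_eq_square zero_prod_def)
  qed
  have kern: "a \<in> op_kernel A (cycle_hom u u' v v' t)"
  proof -
    have "cycle_hom u u' v v' t a = 0"
    proof (rule blinfun_eqI)
      fix z :: cvec
      have z: "z = cscale (fst z) (1, 0) + cscale (snd z) (0, 1)" by (simp add: prod_eq_iff)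
      have "cycle_hom u u' v v' t a z = cscale (fst z) (cycle_hom u u' v v' t a (1, 0)) + cscale (snd z) (cycle_hom u u' v v' t a (0, 1))"
        by (subst z) (simp only: blinfun.add_right opV_apply_cscale[OF star_homD(1)[OF cycle_hom(1)[OF c] a]])
      then show "cycle_hom u u' v v' t a z = blinfun_apply 0 z" by (simp add: val)
    qed
    then show ?thesis using a by (simp add: op_kernel_def)
  qed
  then have "cycle_hom u u' v v' s a = 0" unfolding eq by (simp add: op_kernel_def)
  then have "cscale (of_real ((cos s)\<^sup>2) - ?k) ((1, 0) :: cvec) = 0" using val[of s] by simp
  then have "complex_of_real ((cos s)\<^sup>2) = ?k" by (simp add: cscale_def zero_prod_def)
  then have "(cos s)\<^sup>2 = (cos t)\<^sup>2" by (simp only: of_real_eq_iff)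
  then have "cos s = cos t" using s t cos_gt_zero[of s] cos_gt_zero[of t] by (simp add: power2_eq_iff_nonneg)
  then show ?thesis using cos_inj_pi[of s t] s t by simp
qed

lemma unitary_kernel:
  assumes "\<And>x y. cinner (blinfun_apply W x) (W y) = cinner x y" "surj (blinfun_apply W)"
    "\<And>a z. a \<in> carrier A \<Longrightarrow> blinfun_apply (g a) (W z) = W (blinfun_apply (f a) z)"
  shows "op_kernel A g = op_kernel A f"
proof -
  have W0: "W z = 0 \<longleftrightarrow> z = 0" for z
    using assms(1)[of z z] by (metis blinfun.zero_right cinner_self cinner_simps(7) norm_eq_zero of_real_eq_0_iff power_eq_0_iff)
  have "g a = 0 \<longleftrightarrow> f a = 0" if a: "a \<in> carrier A" for a
  proof
    assume "g a = 0"
    then show "f a = 0" using assms(3)[OF a] W0 by (intro blinfun_eqI) (metis blinfun.zero_left)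
  next
    assume f: "f a = 0"
    show "g a = 0"
    proof (rule blinfun_eqI)
      fix z
      obtain w where "z = W w" using assms(2) by (metis surjD)
      then show "g a z = blinfun_apply 0 z" using assms(3)[OF a, of w] f by simp
    qed
  qed
  then show ?thesis by (auto simp: op_kernel_def)
qed

lemma irred_supports:
  assumes "op_irred A g" obtains u v where "u \<in> left G" "v \<in> right G" "g (gen u) \<noteq> 0" "g (gen v) \<noteq> 0"
proof -
  have hom: "g \<in> star_hom A opV" using assms by (simp add: op_irred_def)
  have one: "g \<one>\<^bsub>A\<^esub> = id_blinfun" by (rule irred_one[OF assms])
  have "\<exists>x. x \<noteq> (0::cvec)" by (intro exI[of _ "(1, 0)"]) (simp add: zero_prod_def)
  then have "id_blinfun \<noteq> (0 :: cvec \<Rightarrow>\<^sub>L cvec)" by (metis blinfun.zero_left id_blinfun.rep_eq id_apply)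
  then have "\<exists>u\<in>left G. g (gen u) \<noteq> 0" "\<exists>v\<in>right G. g (gen v) \<noteq> 0"
    using hom_projections(3,4)[OF hom one G] sum.neutral by metis+
  then show thesis using that by blast
qed

text \<open>Both representations are classified from the same pair \<open>u\<close>,
  \<open>v\<close>. The generators outside the kernel determine the 4-cycle, and
  \<open>cycle_kernel_angle\<close> the angle; so both are equivalent to one model, and
  \<open>W\<close> is the composite of the two equivalences.\<close>

lemma irred_kernel_eq:
  assumes g: "op_irred A g" and h: "op_irred A h" and ker: "op_kernel A g = op_kernel A h"
  obtains W where "W \<in> carrier opV" "\<And>x y. cinner (blinfun_apply W x) (W y) = cinner x y" "surj (blinfun_apply W)"
    "\<And>a z. a \<in> carrier A \<Longrightarrow> blinfun_apply (h a) (W z) = W (g a z)"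
proof -
  obtain u v where uv: "u \<in> left G" "v \<in> right G" "g (gen u) \<noteq> 0" "g (gen v) \<noteq> 0" using irred_supports[OF g] by metis
  then have h0: "h (gen u) \<noteq> 0" "h (gen v) \<noteq> 0"
    using ker gen_closed unfolding op_kernel_def by blast+
  obtain u1 v1 t1 W1 where 1: "four_cycle G u u1 v v1" "0 < t1" "t1 < pi / 2" "W1 \<in> carrier opV"
    "\<And>x y. cinner (W1 x) (W1 y) = cinner x y" "surj (blinfun_apply W1)"
    "\<And>a z. a \<in> carrier A \<Longrightarrow> g a (W1 z) = W1 (cycle_hom u u1 v v1 t1 a z)"
    by (rule irred_classification[OF G g uv]) blast
  obtain u2 v2 t2 W2 where 2: "four_cycle G u u2 v v2" "0 < t2" "t2 < pi / 2" "W2 \<in> carrier opV"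
    "\<And>x y. cinner (W2 x) (W2 y) = cinner x y" "surj (blinfun_apply W2)"
    "\<And>a z. a \<in> carrier A \<Longrightarrow> h a (W2 z) = W2 (cycle_hom u u2 v v2 t2 a z)"
    by (rule irred_classification[OF G h uv(1,2) h0]) blast
  have k: "op_kernel A (cycle_hom u u1 v v1 t1) = op_kernel A (cycle_hom u u2 v v2 t2)"
    using unitary_kernel[OF 1(5-7)] unitary_kernel[OF 2(5-7)] ker by simp
  have s: "u1 \<in> left G" "v1 \<in> right G" "u2 \<in> left G" "v2 \<in> right G" "u1 \<noteq> u" "v1 \<noteq> v" "u2 \<noteq> u" "v2 \<noteq> v"
    using 1(1) 2(1) by (auto simp: four_cycle_def)
  have "u1 \<in> {u, u2, v, v2}" "v1 \<in> {u, u2, v, v2}"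
    using cycle_kernel_gen[OF 1(1), of u1 t1] cycle_kernel_gen[OF 2(1), of u1 t2]
      cycle_kernel_gen[OF 1(1), of v1 t1] cycle_kernel_gen[OF 2(1), of v1 t2] s k by auto
  then have eq: "u1 = u2" "v1 = v2" using s uv(1,2) G_fin(3) by auto
  then have t: "t1 = t2" using cycle_kernel_angle[OF 1(1-3) 2(2,3)] k by simp
  define W where "W = W2 o\<^sub>L adj_op W1"
  have inv: "adj_op W1 (W1 z) = z" for z
  proof -
    have "cinner (adj_op W1 (W1 z) - z) w = 0" for w
      using cinner_adj_op[OF 1(4), of "W1 z" w] 1(5)[of z w] by (simp add: cinner_simps)
    then show ?thesis using cinner_self[of "adj_op W1 (W1 z) - z"] by simp
  qed
  have W: "W (W1 z) = W2 z" for z by (simp add: W_def inv)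
  have ex: "\<exists>w. z = W1 w" for z using 1(6) by (metis surjD)
  show thesis
  proof
    show "W \<in> carrier opV" unfolding W_def using opV.m_closed[OF 2(4) adj_op_closed[OF 1(4)]] by simp
    show "cinner (W x) (W y) = cinner x y" for x y
      using ex[of x] ex[of y] W 1(5) 2(5) by auto
    show "surj (blinfun_apply W)" using W 2(6) by (metis surj_def)
    show "h a (W z) = W (g a z)" if "a \<in> carrier A" for a z
    proof -
      obtain w where w: "z = W1 w" using ex[of z] by blast
      show ?thesis unfolding w W 1(7)[OF that] 2(7)[OF that] by (simp only: eq t)
    qed
  qed
qed

text \<open>A character is recovered from its kernel by its values, a two-dimensional representation
  by \<open>irred_kernel_eq\<close>. The two kinds cannot share a kernel, since modulo the kernel of
  a character every element is a multiple of the unit.\<close>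

theorem inj_spec_kernel: "inj_on (spec_kernel A) (Spec_le2 A)"
proof (rule inj_onI)
  fix c d assume cd: "c \<in> Spec_le2 A" "d \<in> Spec_le2 A" "spec_kernel A c = spec_kernel A d"
  obtain J \<pi> where J: "(J, \<pi>) \<in> c" "card J = 1 \<or> card J = 2" "c \<in> Spec A" using cd(1) unfolding Spec_le2_def by blast
  obtain K \<rho> where K: "(K, \<rho>) \<in> d" "card K = 1 \<or> card K = 2" "d \<in> Spec A" using cd(2) unfolding Spec_le2_def by blast
  note c = Spec_member[OF J(3,1)] and d = Spec_member[OF K(3,1)]
  have \<pi>: "irreducible_rep A J \<pi>" and \<rho>: "irreducible_rep A K \<rho>" using c(1) d(1) by (auto simp: irreps_def)
  have ker: "rep_kernel A J \<pi> = rep_kernel A K \<rho>" using cd(3) c(3) d(3) by simp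
  note A = A.cstar_algebra_axioms
  have mixed: False if g: "op_scalar A g" and h: "op_irred A h" and k: "op_kernel A g = op_kernel A h" for g h
  proof -
    have hom: "h \<in> star_hom A opV" using h by (simp add: op_irred_def)
    have "\<exists>c. h a = cscale_op c" if "a \<in> carrier A" for a
      using scalar_kernel_le[OF A g hom irred_one[OF h] _ that] k g that unfolding op_scalar_def by auto
    then have "\<forall>a\<in>carrier A. \<exists>c. h a (1, 0) = cscale c (1, 0)" by (metis cscale_op_apply)
    moreover have "(1, 0) \<noteq> (0 :: cvec)" by (simp add: zero_prod_def)
    ultimately show False using h unfolding op_irred_def by blast
  qed
  have "((J, \<pi>), (K, \<rho>)) \<in> unitarily_equivalent A"
  proof (cases "card J = 1")
    case True
    then obtain i where i: "J = {i}" by (auto simp: card_1_singleton_iff)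
    note P = rep_op_scalar[OF \<pi>[unfolded i] A]
    show ?thesis
    proof (cases "card K = 1")
      case True
      then obtain j where j: "K = {j}" by (auto simp: card_1_singleton_iff)
      show ?thesis using unitarily_equivalent_one[OF A \<pi>[unfolded i] \<rho>[unfolded j]] ker by (simp add: i j)
    next
      case False
      then obtain k l where kl: "K = {k, l}" "k \<noteq> l" using K(2) by (auto simp: card_2_iff)
      have rep: "hilbert_rep A {k, l} \<rho>" using \<rho> kl by (simp add: irreducible_rep_def)
      show ?thesis
        using mixed[OF P(1) rep_op_irred[OF \<rho>[unfolded kl(1)] kl(2) A]] P(2) rep_op(4)[OF rep kl(2) A] ker
        by (simp add: i kl)
    qed
  next
    case False
    then obtain i j where ij: "J = {i, j}" "i \<noteq> j" using J(2) by (auto simp: card_2_iff)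
    have rp: "hilbert_rep A {i, j} \<pi>" using \<pi> ij by (simp add: irreducible_rep_def)
    note P = rep_op_irred[OF \<pi>[unfolded ij(1)] ij(2) A] rep_op(4)[OF rp ij(2) A]
    show ?thesis
    proof (cases "card K = 1")
      case True
      then obtain k where k: "K = {k}" by (auto simp: card_1_singleton_iff)
      note R = rep_op_scalar[OF \<rho>[unfolded k] A]
      show ?thesis using mixed[OF R(1) P(1)] R(2) P(2) ker by (simp add: k ij)
    next
      case False
      then obtain k l where kl: "K = {k, l}" "k \<noteq> l" using K(2) by (auto simp: card_2_iff)
      have rr: "hilbert_rep A {k, l} \<rho>" using \<rho> kl by (simp add: irreducible_rep_def)
      note R = rep_op_irred[OF \<rho>[unfolded kl(1)] kl(2) A] rep_op(4)[OF rr kl(2) A]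
      have "op_kernel A (rep_op i j \<pi>) = op_kernel A (rep_op k l \<rho>)" using P(2) R(2) ker by (simp add: ij kl)
      then obtain W where "W \<in> carrier opV" "\<And>x y. cinner (blinfun_apply W x) (W y) = cinner x y" "surj (blinfun_apply W)"
        "\<And>a z. a \<in> carrier A \<Longrightarrow> rep_op k l \<rho> a (W z) = W (rep_op i j \<pi> a z)"
        using irred_kernel_eq[OF P(1) R(1)] by blast
      then show ?thesis unfolding ij(1) kl(1)
        by (rule unitarily_equivalent_two[OF A \<pi>[unfolded ij(1)] ij(2) \<rho>[unfolded kl(1)] kl(2)])
    qed
  qed
  then show "c = d" unfolding c(2) d(2) by (rule equiv_class_eq[OF unitarily_equivalent_equiv])
qed

end

section \<open>Angles\<close>

context cstar_algebra
begin

text \<open>The unitary \<open>W\<close> is a certificate for the norm bound: it gives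
  \<open>nrm A h \<le> 1\<close>, and its square certifies the doubled cosine, so the bound survives
  all doublings.\<close>

definition is_cosine :: "'a \<Rightarrow> bool" where
  "is_cosine h \<longleftrightarrow> h \<in> carrier A \<and> (\<exists>W\<in>carrier A. star A W \<otimes> W = \<one> \<and> W \<otimes> star A W = \<one> \<and> h \<oplus> h = W \<oplus> star A W)"

lemma nrm_one_le: "nrm A \<one> \<le> 1"
  by (rule projection_nrm_le) (simp_all add: star_one)

lemma nrm_double: assumes "h \<in> carrier A" shows "nrm A (h \<oplus> h) = 2 * nrm A h"
proof -
  have "h \<oplus> h = scale A 2 h" using scale_add_left[OF assms, of 1 1] by (simp add: scale_one[OF assms])
  then show ?thesis by (simp add: nrm_scale[OF assms])
qed

lemma cosineD:
  assumes "is_cosine h" shows "h \<in> carrier A" "star A h = h" "nrm A h \<le> 1"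
proof -
  obtain W where W: "W \<in> carrier A" "star A W \<otimes> W = \<one>" "h \<oplus> h = W \<oplus> star A W" using assms by (auto simp: is_cosine_def)
  show h: "h \<in> carrier A" using assms by (simp add: is_cosine_def)
  have "star A h \<oplus> star A h = star A (h \<oplus> h)" using h by (simp add: star_add)
  also have "\<dots> = h \<oplus> h" unfolding W(3) using W(1) by (simp add: star_add star_star star_closed a_comm)
  finally have "scale A (1/2) (star A h \<oplus> star A h) = scale A (1/2) (h \<oplus> h)" by simp
  then show "star A h = h" using half_double[OF h] half_double[OF star_closed[OF h]] by simp
  have "(nrm A W)\<^sup>2 \<le> 1" using cstar_identity[OF W(1)] W(2) nrm_one_le by simp
  then have W1: "nrm A W \<le> 1" using power2_le_imp_le[of "nrm A W" 1] by simp
  have "nrm A (star A W) \<le> 1" using W1 W(1) by (simp add: nrm_star)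
  then have "nrm A (h \<oplus> h) \<le> 2" unfolding W(3) using nrm_triangle[OF W(1) star_closed[OF W(1)]] W1 by linarith
  then show "nrm A h \<le> 1" by (simp add: nrm_double[OF h])
qed

lemma cosine_double:
  assumes "is_cosine h" shows "is_cosine (h \<otimes> h \<oplus> h \<otimes> h \<ominus> \<one>)"
proof -
  obtain W where W: "W \<in> carrier A" "star A W \<otimes> W = \<one>" "W \<otimes> star A W = \<one>" "h \<oplus> h = W \<oplus> star A W"
    using assms by (auto simp: is_cosine_def)
  have h: "h \<in> carrier A" by (rule cosineD(1)[OF assms])
  define V where "V = star A W"
  have V: "V \<in> carrier A" "V \<otimes> W = \<one>" "W \<otimes> V = \<one>" "star A V = W" using W by (simp_all add: V_def star_closed star_star)
  have "(V \<otimes> V) \<otimes> (W \<otimes> W) = V \<otimes> (V \<otimes> W) \<otimes> W" "(W \<otimes> W) \<otimes> (V \<otimes> V) = W \<otimes> (W \<otimes> V) \<otimes> V"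
    using V(1) W(1) by (simp_all only: m_assoc m_closed)
  then have u: "(V \<otimes> V) \<otimes> (W \<otimes> W) = \<one>" "(W \<otimes> W) \<otimes> (V \<otimes> V) = \<one>"
    using V W(1) by simp_all
  have "(h \<oplus> h) \<otimes> (h \<oplus> h) = (W \<oplus> V) \<otimes> (W \<oplus> V)" unfolding W(4) V_def ..
  then have "(h \<otimes> h \<oplus> h \<otimes> h) \<oplus> (h \<otimes> h \<oplus> h \<otimes> h) = (W \<otimes> W \<oplus> V \<otimes> V) \<oplus> (\<one> \<oplus> \<one>)"
    using h V W(1) by (simp add: l_distr r_distr a_ac)
  then have "(h \<otimes> h \<oplus> h \<otimes> h \<ominus> \<one>) \<oplus> (h \<otimes> h \<oplus> h \<otimes> h \<ominus> \<one>) = (W \<otimes> W \<oplus> V \<otimes> V) \<oplus> (\<one> \<oplus> \<one>) \<ominus> (\<one> \<oplus> \<one>)"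
  proof -
    have "(s \<ominus> \<one>) \<oplus> (s \<ominus> \<one>) = (s \<oplus> s) \<ominus> (\<one> \<oplus> \<one>)" if "s \<in> carrier A" for s
      using that by (simp add: a_minus_def minus_add a_ac)
    from this[of "h \<otimes> h \<oplus> h \<otimes> h"] show ?thesis unfolding \<open>_ = (W \<otimes> W \<oplus> V \<otimes> V) \<oplus> (\<one> \<oplus> \<one>)\<close> using h by simp
  qed
  also have "\<dots> = W \<otimes> W \<oplus> V \<otimes> V"
    using V(1) W(1) by (simp add: a_minus_def a_assoc r_neg)
  finally have "(h \<otimes> h \<oplus> h \<otimes> h \<ominus> \<one>) \<oplus> (h \<otimes> h \<oplus> h \<otimes> h \<ominus> \<one>) = W \<otimes> W \<oplus> V \<otimes> V" .
  then show ?thesis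
    unfolding is_cosine_def using h W(1) u by (intro conjI bexI[of _ "W \<otimes> W"]) (simp_all add: star_mult V_def)
qed

text \<open>One minus the square of \<open>h\<close> has norm at most 1, since its double is one
  minus the doubled cosine. Visser's iteration then gives a square root \<open>y\<close> of the
  square of \<open>h\<close>, and applied once more a square root \<open>z\<close> of
  \<open>y\<close>; the latter certifies that \<open>y\<close> is positive, so that it is the
  absolute value of \<open>h\<close>.\<close>

lemma cosine_abs:
  assumes "is_cosine h"
  obtains y z where "y \<in> carrier A" "z \<in> carrier A" "star A z = z" "z \<otimes> z = y" "y \<otimes> y = h \<otimes> h"
proof -
  note H = cosineD[OF assms] and K = cosineD[OF cosine_double[OF assms]]
  define b where "b = \<one> \<ominus> h \<otimes> h"
  have b: "b \<in> carrier A" "star A b = b" using H by (simp_all add: b_def star_minus star_one star_mult)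
  have "b \<oplus> b = \<one> \<oplus> \<ominus> (h \<otimes> h \<oplus> h \<otimes> h \<ominus> \<one>)"
    using H(1) by (simp add: b_def a_minus_def minus_add a_ac)
  then have "nrm A (b \<oplus> b) \<le> nrm A \<one> + nrm A (h \<otimes> h \<oplus> h \<otimes> h \<ominus> \<one>)"
    using nrm_triangle[OF one_closed a_inv_closed[OF K(1)]] nrm_uminus[OF K(1)] by simp
  then have nb: "nrm A b \<le> 1" using K(3) nrm_one_le nrm_double[OF b(1)] by simp
  obtain d where d: "d \<in> carrier A" "star A d = d" "nrm A d \<le> 1" "b \<oplus> d \<otimes> d = d \<oplus> d"
    using visser_limit[OF b(1) nb b(2)] by metis
  obtain f where f: "f \<in> carrier A" "star A f = f" "d \<oplus> f \<otimes> f = f \<oplus> f"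
    using visser_limit[OF d(1,3,2)] by metis
  have sq: "(\<one> \<ominus> x) \<otimes> (\<one> \<ominus> x) = \<one> \<ominus> c" if "x \<in> carrier A" "c \<in> carrier A" "c \<oplus> x \<otimes> x = x \<oplus> x" for x c
  proof -
    have "(\<one> \<ominus> x) \<otimes> (\<one> \<ominus> x) = \<one> \<oplus> x \<otimes> x \<ominus> (x \<oplus> x)"
      using that(1) by (simp add: a_minus_def l_distr r_distr l_minus r_minus minus_add a_ac)
    also have "\<dots> = \<one> \<oplus> x \<otimes> x \<ominus> (c \<oplus> x \<otimes> x)" by (simp only: that(3))
    also have "\<dots> = \<one> \<ominus> c" using that(1,2) by (simp add: a_minus_def minus_add) (simp add: a_ac r_neg r_neg1 r_neg2)
    finally show ?thesis .
  qed
  have "\<one> \<ominus> b = h \<otimes> h" using H(1) by (simp add: b_def a_minus_def minus_add minus_minus) (simp add: a_assoc[symmetric] r_neg)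
  then have "(\<one> \<ominus> d) \<otimes> (\<one> \<ominus> d) = h \<otimes> h" using sq[OF d(1) b(1) d(4)] by simp
  moreover have "(\<one> \<ominus> f) \<otimes> (\<one> \<ominus> f) = \<one> \<ominus> d" by (rule sq[OF f(1) d(1) f(3)])
  moreover have "star A (\<one> \<ominus> f) = \<one> \<ominus> f" using f by (simp add: star_minus star_one)
  ultimately show thesis using that[of "\<one> \<ominus> d" "\<one> \<ominus> f"] d(1) f(1) by simp
qed

end

text \<open>\<open>Y\<close> is positive, being the square of the self-adjoint \<open>Z\<close>. The
  defect \<open>w\<close> of the eigenvalue equation satisfies
  \<open>Y w = - \<bar>c\<bar> w\<close>, which positivity forbids unless \<open>w = 0\<close>. For
  \<open>c = 0\<close> the same positivity descends from the fourth power of \<open>Z\<close> to its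
  square.\<close>

lemma op_abs_eigen:
  assumes Z: "adj_op Z = Z" and Y: "\<And>x. blinfun_apply Y x = Z (Z x)" and x: "Y (Y x) = (c * c) *\<^sub>R x"
  shows "Y x = \<bar>c\<bar> *\<^sub>R x"
proof -
  have sa: "Z x \<bullet> y = x \<bullet> Z y" for x y using Z by (metis adj_op_inner)
  show ?thesis
  proof (cases "c = 0")
    case True
    have "Z (Z (Z x)) \<bullet> Z (Z (Z x)) = Z (Z x) \<bullet> Y (Y x)" by (simp add: sa Y)
    then have 3: "Z (Z (Z x)) = 0" using x True by simp
    have "Z (Z x) \<bullet> Z (Z x) = Z x \<bullet> Z (Z (Z x))" by (simp add: sa)
    then show ?thesis using 3 True by (simp add: Y)
  next
    case False
    define w where "w = Y x - \<bar>c\<bar> *\<^sub>R x"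
    have "Y w + \<bar>c\<bar> *\<^sub>R w = 0"
      using x by (simp add: w_def blinfun.diff_right blinfun.scaleR_right scaleR_diff_right)
    then have "w \<bullet> Y w + \<bar>c\<bar> * (w \<bullet> w) = 0" by (metis inner_add_right inner_scaleR_right inner_zero_right)
    moreover have "w \<bullet> Y w = Z w \<bullet> Z w" by (simp add: Y sa)
    ultimately have "Z w \<bullet> Z w + \<bar>c\<bar> * (w \<bullet> w) = 0" by simp
    moreover have "0 \<le> Z w \<bullet> Z w" "0 \<le> \<bar>c\<bar> * (w \<bullet> w)" by simp_all
    ultimately have "\<bar>c\<bar> * (w \<bullet> w) = 0" by linarith
    then have "w = 0" using False by simp
    then show ?thesis by (simp add: w_def)
  qed
qed

text \<open>\<open>T\<close> is the tent map on \<open>[0, pi]\<close>, and the cosines of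
  \<open>T z\<close> are those of \<open>z\<close> one doubling later. While both points are on the
  same side of \<open>pi / 2\<close>, \<open>T\<close> doubles their distance; \<open>n\<close>
  counts the doublings that are still possible, and for \<open>n = 0\<close> the distance would
  exceed \<open>pi\<close>.\<close>

lemma tent_separation_aux:
  assumes "0 \<le> x" "x \<le> pi" "0 \<le> y" "y \<le> pi" "pi < 2 ^ n * \<bar>x - y\<bar>"
  shows "\<exists>k. cos (2 ^ k * x) * cos (2 ^ k * y) < 0"
  using assms
proof (induction n arbitrary: x y)
  case (Suc n)
  define T where "T z = (if z \<le> pi / 2 then 2 * z else 2 * pi - 2 * z)" for z
  have cosT: "cos (2 ^ k * T z) = cos (2 ^ Suc k * z)" for k z
  proof -
    have "2 ^ k * (2 * pi - 2 * z) = 2 * real (2 ^ k) * pi - 2 ^ Suc k * z" by (simp add: algebra_simps)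
    then have "cos (2 ^ k * (2 * pi - 2 * z)) = cos (2 ^ Suc k * z)"
      by (simp only: cos_diff cos_2npi sin_2npi)
    then show ?thesis by (simp add: T_def mult_ac)
  qed
  consider "x \<le> pi / 2 \<and> y \<le> pi / 2 \<or> x \<ge> pi / 2 \<and> y \<ge> pi / 2" | "x < pi / 2" "y > pi / 2" | "x > pi / 2" "y < pi / 2" by linarith
  then show ?case
  proof cases
    case 1
    have T1: "T z = 2 * z" if "z \<le> pi / 2" for z using that by (simp add: T_def)
    have T2: "T z = 2 * pi - 2 * z" if "z \<ge> pi / 2" for z using that by (cases "z = pi / 2") (simp_all add: T_def)
    have d: "\<bar>T x - T y\<bar> = 2 * \<bar>x - y\<bar>"
      using 1
    proof
      assume "x \<le> pi / 2 \<and> y \<le> pi / 2"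
      then have "T x - T y = 2 * (x - y)" using T1 by simp
      then show ?thesis by (simp only: abs_mult abs_numeral)
    next
      assume "x \<ge> pi / 2 \<and> y \<ge> pi / 2"
      then have "T x - T y = 2 * (y - x)" using T2 by simp
      then show ?thesis by (simp only: abs_mult abs_numeral abs_minus_commute)
    qed
    have T: "0 \<le> T z" "T z \<le> pi" if "0 \<le> z" "z \<le> pi" for z using that by (auto simp: T_def)
    have "\<exists>k. cos (2 ^ k * T x) * cos (2 ^ k * T y) < 0"
      using Suc.prems by (intro Suc.IH T) (simp_all add: d mult_ac)
    then show ?thesis unfolding cosT by blast
  next
    case 2
    then have "0 < cos x" "cos y < 0" using Suc.prems cos_gt_zero_pi[of x] cos_gt_zero_pi[of "pi - y"] by simp_all
    then show ?thesis by (intro exI[of _ 0]) (simp add: mult_pos_neg)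
  next
    case 3
    then have "0 < cos y" "cos x < 0" using Suc.prems cos_gt_zero_pi[of y] cos_gt_zero_pi[of "pi - x"] by simp_all
    then show ?thesis by (intro exI[of _ 0]) (simp add: mult_neg_pos)
  qed
qed simp

lemma tent_separation:
  assumes "0 \<le> x" "x \<le> pi" "0 \<le> y" "y \<le> pi" "x \<noteq> y"
  shows "\<exists>k. cos (2 ^ k * x) * cos (2 ^ k * y) < 0"
proof -
  obtain n where "pi / \<bar>x - y\<bar> < 2 ^ n" using real_arch_pow[of 2 "pi / \<bar>x - y\<bar>"] by auto
  then show ?thesis using assms by (intro tent_separation_aux[of _ _ n]) (simp_all add: field_simps)
qed

section \<open>Elements that measure the angle, and continuity in the angle\<close>

context bip_graph_algebra
begin

text \<open>The reflection in the range of \<open>gen x\<close>. A product of two reflections in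
  lines of the plane is a rotation by twice the angle between them, and it is the unitary whose real
  part is \<open>cheb u v 0\<close>.\<close>

definition refl_elt :: "'v \<Rightarrow> (nat \<Rightarrow> 'v star_poly) set" where
  "refl_elt x = gen x \<oplus>\<^bsub>A\<^esub> gen x \<ominus>\<^bsub>A\<^esub> \<one>\<^bsub>A\<^esub>"

text \<open>
  In a representation in which the ranges of \<open>gen u\<close> and \<open>gen v\<close> are lines meeting at an angle
  \<open>t\<close>, the element \<open>cheb u v k\<close> acts as the scalar \<open>cos (2 ^ k * (2 * t))\<close>.
\<close>

primrec cheb :: "'v \<Rightarrow> 'v \<Rightarrow> nat \<Rightarrow> (nat \<Rightarrow> 'v star_poly) set" where
  "cheb u v 0 = scale A (1/2) (refl_elt u \<otimes>\<^bsub>A\<^esub> refl_elt v \<oplus>\<^bsub>A\<^esub> refl_elt v \<otimes>\<^bsub>A\<^esub> refl_elt u)"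
| "cheb u v (Suc k) = cheb u v k \<otimes>\<^bsub>A\<^esub> cheb u v k \<oplus>\<^bsub>A\<^esub> cheb u v k \<otimes>\<^bsub>A\<^esub> cheb u v k \<ominus>\<^bsub>A\<^esub> \<one>\<^bsub>A\<^esub>"

lemma refl_elt:
  assumes "x \<in> X" shows "refl_elt x \<in> carrier A" "star A (refl_elt x) = refl_elt x" "refl_elt x \<otimes>\<^bsub>A\<^esub> refl_elt x = \<one>\<^bsub>A\<^esub>"
proof -
  note g = gen_closed[OF assms] star_gen[OF assms] gen_idem[OF assms]
  show "refl_elt x \<in> carrier A" "star A (refl_elt x) = refl_elt x"
    using g by (simp_all add: refl_elt_def A.star_minus A.star_add A.star_one)
  define s where "s = gen x \<oplus>\<^bsub>A\<^esub> gen x"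
  have s: "s \<in> carrier A" "s \<otimes>\<^bsub>A\<^esub> s = s \<oplus>\<^bsub>A\<^esub> s" using g(1,3) by (simp_all add: s_def A.l_distr A.r_distr A.a_ac)
  have "refl_elt x \<otimes>\<^bsub>A\<^esub> refl_elt x = \<one>\<^bsub>A\<^esub> \<oplus>\<^bsub>A\<^esub> s \<otimes>\<^bsub>A\<^esub> s \<ominus>\<^bsub>A\<^esub> (s \<oplus>\<^bsub>A\<^esub> s)"
    unfolding refl_elt_def s_def[symmetric] using s(1)
    by (simp add: a_minus_def A.l_distr A.r_distr A.l_minus A.r_minus A.minus_add A.a_ac)
  also have "\<dots> = \<one>\<^bsub>A\<^esub>" unfolding s(2) using s(1) by (simp only: a_minus_def A.a_assoc A.r_neg A.r_zero A.one_closed A.a_closed A.a_inv_closed)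
  finally show "refl_elt x \<otimes>\<^bsub>A\<^esub> refl_elt x = \<one>\<^bsub>A\<^esub>" .
qed

lemma cheb_cosine: assumes "u \<in> X" "v \<in> X" shows "A.is_cosine (cheb u v k)"
proof (induction k)
  case 0
  note u = refl_elt[OF assms(1)] and v = refl_elt[OF assms(2)]
  define W where "W = refl_elt u \<otimes>\<^bsub>A\<^esub> refl_elt v"
  have cl: "W \<in> carrier A" "refl_elt v \<otimes>\<^bsub>A\<^esub> refl_elt u \<in> carrier A" using u v by (simp_all add: W_def)
  have st: "star A W = refl_elt v \<otimes>\<^bsub>A\<^esub> refl_elt u" using u v by (simp add: W_def A.star_mult)
  have "star A W \<otimes>\<^bsub>A\<^esub> W = refl_elt v \<otimes>\<^bsub>A\<^esub> (refl_elt u \<otimes>\<^bsub>A\<^esub> refl_elt u) \<otimes>\<^bsub>A\<^esub> refl_elt v"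
    "W \<otimes>\<^bsub>A\<^esub> star A W = refl_elt u \<otimes>\<^bsub>A\<^esub> (refl_elt v \<otimes>\<^bsub>A\<^esub> refl_elt v) \<otimes>\<^bsub>A\<^esub> refl_elt u"
    unfolding st using u(1) v(1) by (simp_all only: W_def A.m_assoc A.m_closed)
  then have "star A W \<otimes>\<^bsub>A\<^esub> W = \<one>\<^bsub>A\<^esub>" "W \<otimes>\<^bsub>A\<^esub> star A W = \<one>\<^bsub>A\<^esub>" using u v by simp_all
  moreover have "cheb u v 0 \<oplus>\<^bsub>A\<^esub> cheb u v 0 = W \<oplus>\<^bsub>A\<^esub> star A W" "cheb u v 0 \<in> carrier A"
    using cl A.double_half[of "W \<oplus>\<^bsub>A\<^esub> star A W"] A.scale_closed st by (simp_all add: W_def)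
  ultimately show ?case using cl(1) unfolding A.is_cosine_def by blast
next
  case (Suc k)
  then show ?case using A.cosine_double by simp
qed

definition unital_rep :: "((nat \<Rightarrow> 'v star_poly) set \<Rightarrow> cvec \<Rightarrow>\<^sub>L cvec) \<Rightarrow> bool" where
  "unital_rep f \<longleftrightarrow> f \<in> star_hom A opV \<and> f \<one>\<^bsub>A\<^esub> = id_blinfun"

lemma unital_repD:
  assumes "unital_rep f" and a: "a \<in> carrier A"
  shows "f \<one>\<^bsub>A\<^esub> = id_blinfun" "f a \<in> carrier opV" "f (star A a) = adj_op (f a)" "f (scale A c a) x = cscale c (f a x)"
    "b \<in> carrier A \<Longrightarrow> f (a \<oplus>\<^bsub>A\<^esub> b) x = f a x + f b x" "b \<in> carrier A \<Longrightarrow> f (a \<otimes>\<^bsub>A\<^esub> b) x = f a (f b x)"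
    "b \<in> carrier A \<Longrightarrow> f (a \<ominus>\<^bsub>A\<^esub> b) x = f a x - f b x"
  using assms star_homD[of f A opV a] opV_hom_minus[OF A.cstar_algebra_axioms, of f a b]
  by (simp_all add: unital_rep_def blinfun.add_left blinfun.diff_left)

lemma rep_refl_elt: assumes "unital_rep f" "x \<in> X" shows "f (refl_elt x) z = f (gen x) z + f (gen x) z - z"
  unfolding refl_elt_def using gen_closed[OF assms(2)] by (simp add: unital_repD[OF assms(1)])

lemma rep_cheb_0:
  assumes "unital_rep f" "u \<in> X" "v \<in> X"
  shows "f (cheb u v 0) z = (1/2) *\<^sub>R (f (refl_elt u) (f (refl_elt v) z) + f (refl_elt v) (f (refl_elt u) z))"
proof -
  have "f (cheb u v 0) z = cscale (of_real (1/2)) (f (refl_elt u) (f (refl_elt v) z) + f (refl_elt v) (f (refl_elt u) z))"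
    using refl_elt(1)[OF assms(2)] refl_elt(1)[OF assms(3)] by (simp add: unital_repD[OF assms(1)])
  then show ?thesis by (simp only: cscale_of_real)
qed

text \<open>\<open>\<theta>\<close> is twice the angle between the ranges.\<close>

definition has_angle :: "((nat \<Rightarrow> 'v star_poly) set \<Rightarrow> cvec \<Rightarrow>\<^sub>L cvec) \<Rightarrow> 'v \<Rightarrow> 'v \<Rightarrow> 'v \<Rightarrow> real \<Rightarrow> bool" where
  "has_angle f u v x \<theta> \<longleftrightarrow> unital_rep f \<and> (\<forall>z. f (cheb u v 0) (f (gen x) z) = cos \<theta> *\<^sub>R f (gen x) z)"

lemma has_angle_cheb:
  assumes f: "has_angle f u v x \<theta>" and uv: "u \<in> X" "v \<in> X"
  shows "f (cheb u v k) (f (gen x) z) = cos (2 ^ k * \<theta>) *\<^sub>R f (gen x) z"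
proof (induction k arbitrary: z)
  case 0
  show ?case using f by (simp add: has_angle_def del: split_paired_All)
next
  case (Suc k)
  note h = A.cosineD(1)[OF cheb_cosine[OF uv]]
  have rep: "unital_rep f" using f by (simp add: has_angle_def)
  have sq: "f (cheb u v k) (f (cheb u v k) (f (gen x) z)) = (cos (2 ^ k * \<theta>) * cos (2 ^ k * \<theta>)) *\<^sub>R f (gen x) z"
    by (simp add: Suc blinfun.scaleR_right)
  let ?c = "cos (2 ^ k * \<theta>)"
  have "f (cheb u v (Suc k)) (f (gen x) z) = (?c * ?c) *\<^sub>R f (gen x) z + (?c * ?c) *\<^sub>R f (gen x) z - f (gen x) z"
    using h rep by (simp add: unital_repD(5-7)[OF rep] sq) (simp add: unital_rep_def)
  also have "\<dots> = (2 * ?c\<^sup>2 - 1) *\<^sub>R f (gen x) z"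
  proof -
    have e: "2 * ?c\<^sup>2 - 1 = ?c * ?c + ?c * ?c - 1" by (simp add: power2_eq_square)
    show ?thesis unfolding e by (simp only: scaleR_left_diff_distrib scaleR_left_distrib scaleR_one)
  qed
  also have "\<dots> = cos (2 ^ Suc k * \<theta>) *\<^sub>R f (gen x) z" using cos_double_cos[of "2 ^ k * \<theta>"] by (simp add: mult_ac)
  finally show ?case .
qed

text \<open>With \<open>y\<close> the absolute value of \<open>h\<close>, the elements
  \<open>y \<oplus> h\<close> and \<open>y \<ominus> h\<close> are twice its positive and negative
  part. The factor \<open>gen x\<close> restricts them to the range on which the angle is known, and
  makes \<open>a\<close> vanish where \<open>x\<close> is missing from the support.\<close>

lemma sign_elements:
  assumes uv: "u \<in> X" "v \<in> X" and x: "x \<in> X"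
  obtains a b where "a \<in> carrier A" "b \<in> carrier A"
    "\<And>f \<theta>. has_angle f u v x \<theta> \<Longrightarrow> f (gen x) \<noteq> 0 \<Longrightarrow> f a = 0 \<longleftrightarrow> cos (2 ^ k * \<theta>) \<le> 0"
    "\<And>f \<theta>. has_angle f u v x \<theta> \<Longrightarrow> f (gen x) \<noteq> 0 \<Longrightarrow> f b = 0 \<longleftrightarrow> 0 \<le> cos (2 ^ k * \<theta>)"
    "\<And>f. unital_rep f \<Longrightarrow> f (gen x) = 0 \<Longrightarrow> f a = 0"
proof -
  define h where "h = cheb u v k"
  have hc: "A.is_cosine h" unfolding h_def by (rule cheb_cosine[OF uv])
  note h = A.cosineD(1)[OF hc] and g = gen_closed[OF x]
  obtain y z where yz: "y \<in> carrier A" "z \<in> carrier A" "star A z = z" "z \<otimes>\<^bsub>A\<^esub> z = y" "y \<otimes>\<^bsub>A\<^esub> y = h \<otimes>\<^bsub>A\<^esub> h"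
    using A.cosine_abs[OF hc] by metis
  define a where "a = (y \<oplus>\<^bsub>A\<^esub> h) \<otimes>\<^bsub>A\<^esub> gen x"
  define b where "b = (y \<ominus>\<^bsub>A\<^esub> h) \<otimes>\<^bsub>A\<^esub> gen x"
  have val: "f a w = (\<bar>c\<bar> + c) *\<^sub>R f (gen x) w" "f b w = (\<bar>c\<bar> - c) *\<^sub>R f (gen x) w"
    if f: "has_angle f u v x \<theta>" and c: "c = cos (2 ^ k * \<theta>)" for f \<theta> c w
  proof -
    have rep: "unital_rep f" using f by (simp add: has_angle_def)
    note R = unital_repD[OF rep]
    have hx: "f h (f (gen x) w) = c *\<^sub>R f (gen x) w" unfolding h_def c by (rule has_angle_cheb[OF f uv])
    have "f y (f (gen x) w) = \<bar>c\<bar> *\<^sub>R f (gen x) w"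
    proof (rule op_abs_eigen)
      show "adj_op (f z) = f z" using R(3)[OF yz(2)] yz(3) by simp
      show "f y v = f z (f z v)" for v using R(6)[OF yz(2) yz(2)] yz(4) by simp
      have "f y (f y (f (gen x) w)) = f h (f h (f (gen x) w))"
        using R(6)[OF yz(1) yz(1)] R(6)[OF h h] yz(5) by metis
      then show "f y (f y (f (gen x) w)) = (c * c) *\<^sub>R f (gen x) w" by (simp add: hx blinfun.scaleR_right)
    qed
    then show "f a w = (\<bar>c\<bar> + c) *\<^sub>R f (gen x) w" "f b w = (\<bar>c\<bar> - c) *\<^sub>R f (gen x) w"
      using h g yz(1) by (simp_all add: a_def b_def R hx scaleR_add_left scaleR_diff_left)
  qed
  have zero: "f d = 0 \<longleftrightarrow> r = 0" if dw: "\<And>w. f d w = r *\<^sub>R f (gen x) w" and nz: "f (gen x) \<noteq> 0" for f :: "(nat \<Rightarrow> 'v star_poly) set \<Rightarrow> cvec \<Rightarrow>\<^sub>L cvec" and d and r :: real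
  proof
    assume "f d = 0"
    then have 0: "r *\<^sub>R f (gen x) w = 0" for w using dw[of w] by simp
    obtain w where "f (gen x) w \<noteq> 0" using nz by (metis blinfun_eqI blinfun.zero_left)
    then show "r = 0" using 0[of w] by simp
  qed (use dw in \<open>auto intro!: blinfun_eqI\<close>)
  show thesis
  proof
    show "a \<in> carrier A" "b \<in> carrier A" using h g yz(1) by (simp_all add: a_def b_def)
    show "f a = 0 \<longleftrightarrow> cos (2 ^ k * \<theta>) \<le> 0" if "has_angle f u v x \<theta>" "f (gen x) \<noteq> 0" for f \<theta>
      using zero[OF val(1)[OF that(1) refl] that(2)] by auto
    show "f b = 0 \<longleftrightarrow> 0 \<le> cos (2 ^ k * \<theta>)" if "has_angle f u v x \<theta>" "f (gen x) \<noteq> 0" for f \<theta>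
      using zero[OF val(2)[OF that(1) refl] that(2)] by auto
    show "f a = 0" if "unital_rep f" "f (gen x) = 0" for f
      using h g yz(1) that(2) by (intro blinfun_eqI) (simp add: a_def unital_repD[OF that(1)])
  qed
qed

lemma rep_cycle_hom: "four_cycle G u u' v v' \<Longrightarrow> unital_rep (cycle_hom u u' v v' t)"
  using cycle_hom(1,2) by (simp add: unital_rep_def)

lemma rep_edge_hom: "u \<in> left G \<Longrightarrow> v \<in> right G \<Longrightarrow> {u, v} \<in> edges G \<Longrightarrow> unital_rep (edge_hom u v)"
  using edge_hom(1,2) by (simp add: unital_rep_def)

lemma cycle_hom_angle:
  assumes c: "four_cycle G u u' v v'" shows "has_angle (cycle_hom u u' v v' t) u v x (2 * t)"
proof -
  let ?f = "cycle_hom u u' v v' t"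
  have X: "u \<in> X" "v \<in> X" using c by (auto simp: four_cycle_def)
  note rep = rep_cycle_hom[OF c, of t]
  note M = cycle_hom[OF c, where t = t]
  have cs: "complex_of_real (cos (2 * t)) = 2 * complex_of_real (cos t) * complex_of_real (cos t) - 1"
    using cos_double_cos[of t] by (simp add: power2_eq_square)
  have "sin t * sin t = 1 - cos t * cos t" using sin_squared_eq[of t] by (simp add: power2_eq_square)
  from arg_cong[OF this, of complex_of_real]
  have ss: "complex_of_real (sin t) * of_real (sin t) = 1 - of_real (cos t) * of_real (cos t)" by simp
  have s2: "complex_of_real (sin t) * (of_real (sin t) * k) = k - of_real (cos t) * (of_real (cos t) * k)" for k
    by (simp add: mult.assoc[symmetric] ss left_diff_distrib)
  have "?f (cheb u v 0) z = cos (2 * t) *\<^sub>R z" for z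
    unfolding rep_cheb_0[OF rep X] rep_refl_elt[OF rep X(1)] rep_refl_elt[OF rep X(2)] M(3) M(5) cscale_of_real[symmetric] cs
    by (cases z) (simp add: line_proj_apply prod_eq_iff field_simps s2)
  then show ?thesis using rep by (simp add: has_angle_def)
qed

lemma edge_hom_angle:
  assumes e: "u \<in> left G" "v \<in> right G" "{u, v} \<in> edges G" shows "has_angle (edge_hom u v) u v x 0"
proof -
  have X: "u \<in> X" "v \<in> X" using e by auto
  note rep = rep_edge_hom[OF e]
  have "edge_hom u v (cheb u v 0) z = z" for z
    unfolding rep_cheb_0[OF rep X] rep_refl_elt[OF rep X(1)] rep_refl_elt[OF rep X(2)]
    using edge_hom(3)[OF e X(1)] edge_hom(3)[OF e X(2)] by simp
  then show ?thesis using rep by (simp add: has_angle_def)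
qed

text \<open>The reflection of a vertex acting as 0 is minus the identity, while that of
  \<open>x\<close> fixes its range; the cosine is -1.\<close>

lemma missing_angle:
  assumes rep: "unital_rep f" and x: "x \<in> X" "y \<in> X" "f (gen y) = 0" and uv: "{u, v} = {x, y}"
  shows "has_angle f u v x pi"
proof -
  have g: "f (gen x) (f (gen x) z) = f (gen x) z" for z
    using unital_repD(6)[OF rep gen_closed[OF x(1)] gen_closed[OF x(1)], of z] gen_idem[OF x(1)] by simp
  have r: "f (refl_elt x) (f (gen x) z) = f (gen x) z" "f (refl_elt y) z = - z" for z
    unfolding rep_refl_elt[OF rep x(1)] rep_refl_elt[OF rep x(2)] by (simp_all add: g x(3))
  have "f (cheb u v 0) (f (gen x) z) = - f (gen x) z" for z
  proof -
    have X: "u \<in> X" "v \<in> X" using uv x by (auto simp: doubleton_eq_iff)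
    have "u = x \<and> v = y \<or> u = y \<and> v = x" using uv by (simp add: doubleton_eq_iff)
    then have "f (refl_elt u) (f (refl_elt v) (f (gen x) z)) + f (refl_elt v) (f (refl_elt u) (f (gen x) z)) = (- 2) *\<^sub>R f (gen x) z"
      by (elim disjE) (simp_all add: r blinfun.minus_right scaleR_2)
    then show ?thesis unfolding rep_cheb_0[OF rep X] by simp
  qed
  then show ?thesis using rep by (simp add: has_angle_def)
qed

text \<open>Continuity in the operator norm, extended from the generators by the algebra operations
  and uniform limits.\<close>

lemma cycle_hom_continuous:
  assumes c: "four_cycle G u u' v v'" and a: "a \<in> carrier A"
  shows "continuous_on UNIV (\<lambda>t. cycle_hom u u' v v' t a)"
  using a
proof (induction a rule: bip_cstar_induct)
  case one
  then show ?case using cycle_hom(2)[OF c] by (simp add: continuous_on_const)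
next
  case (gen x)
  \<comment> \<open>\<open>line_proj r s\<close> is a quadratic form in \<open>(r, s)\<close> with
    mixed coefficient \<open>E\<close>; so the generators depend polynomially on sine and
    cosine.\<close>
  define E where "E = line_proj 1 1 - line_proj 1 0 - line_proj 0 1"
  have lp: "line_proj r s = (r * r) *\<^sub>R line_proj 1 0 + (r * s) *\<^sub>R E + (s * s) *\<^sub>R line_proj 0 1" for r s
    unfolding E_def
    by (rule blinfun_eqI) (simp add: line_proj_apply blinfun.add_left blinfun.diff_left blinfun.scaleR_left prod_eq_iff scaleR_conv_of_real algebra_simps)
  have "continuous_on UNIV (\<lambda>t. line_proj (cos t) (sin t))" "continuous_on UNIV (\<lambda>t. line_proj (sin t) (- cos t))"
    unfolding lp[of "cos _"] lp[of "sin _"] by (intro continuous_intros)+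
  then show ?case
    using cycle_hom(3-6)[OF c] cycle_hom(7)[OF c gen] by (cases "x \<in> {u, u', v, v'}") (auto simp: continuous_on_const)
next
  case (add a b)
  have "cycle_hom u u' v v' t (a \<oplus>\<^bsub>A\<^esub> b) = cycle_hom u u' v v' t a + cycle_hom u u' v v' t b" for t
    using star_homD(2)[OF cycle_hom(1)[OF c] add(1,2)] by simp
  then show ?case using add(3,4) by (simp add: continuous_on_add)
next
  case (mult a b)
  have "cycle_hom u u' v v' t (a \<otimes>\<^bsub>A\<^esub> b) = cycle_hom u u' v v' t a o\<^sub>L cycle_hom u u' v v' t b" for t
    using star_homD(3)[OF cycle_hom(1)[OF c] mult(1,2)] by simp
  then show ?case using bounded_bilinear.continuous_on[OF bounded_bilinear_blinfun_compose mult(3,4)] by simp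
next
  case (scale a k)
  have "cycle_hom u u' v v' t (scale A k a) = cscale_op k o\<^sub>L cycle_hom u u' v v' t a" for t
    using star_homD(4)[OF cycle_hom(1)[OF c] scale(1)] by simp
  then show ?case
    using bounded_bilinear.continuous_on[OF bounded_bilinear_blinfun_compose continuous_on_const scale(2)] by simp
next
  case (limit s a)
  have in_A: "s n \<in> carrier A" "a \<in> carrier A" "(\<lambda>n. nrm A (s n \<ominus>\<^bsub>A\<^esub> a)) \<longlonglongrightarrow> 0" for n
    using limit(1) by (auto simp: A.limit_of_def)
  \<comment> \<open>Contractivity makes the approximation uniform in \<open>t\<close>.\<close>
  have le: "norm (cycle_hom u u' v v' t (s n) - cycle_hom u u' v v' t a) \<le> nrm A (s n \<ominus>\<^bsub>A\<^esub> a)" for t n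
  proof -
    have "nrm opV (cycle_hom u u' v v' t (s n \<ominus>\<^bsub>A\<^esub> a)) \<le> nrm A (s n \<ominus>\<^bsub>A\<^esub> a)"
      using opV_contractive[OF A.cstar_algebra_axioms cycle_hom(1,2)[OF c]] in_A by (simp add: contractive_on_def)
    then show ?thesis using opV_hom_minus[OF A.cstar_algebra_axioms cycle_hom(1)[OF c] in_A(1,2)] by simp
  qed
  have "uniform_limit UNIV (\<lambda>n t. cycle_hom u u' v v' t (s n)) (\<lambda>t. cycle_hom u u' v v' t a) sequentially"
  proof (rule uniform_limitI)
    fix e :: real assume "0 < e"
    then have "\<forall>\<^sub>F n in sequentially. nrm A (s n \<ominus>\<^bsub>A\<^esub> a) < e" by (rule order_tendstoD(2)[OF in_A(3)])
    then show "\<forall>\<^sub>F n in sequentially. \<forall>t\<in>UNIV. dist (cycle_hom u u' v v' t (s n)) (cycle_hom u u' v v' t a) < e"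
      by (rule eventually_mono) (use le in \<open>auto simp: dist_norm intro: le_less_trans\<close>)
  qed
  then show ?case by (rule uniform_limit_theorem[rotated]) (use limit(2) in simp_all)
qed

text \<open>At \<open>t = 0\<close> the lines of \<open>u\<close> and \<open>v\<close> coincide, and
  so do those of \<open>u'\<close> and \<open>v'\<close>: the representation is the direct sum of
  two characters, and the projection onto an axis intertwines it with one of them.\<close>

lemma cycle_hom_zero:
  assumes c: "four_cycle G u u' v v'" and a: "a \<in> carrier A"
  shows "edge_hom u v a \<noteq> 0 \<Longrightarrow> cycle_hom u u' v v' 0 a \<noteq> 0" "edge_hom u' v' a \<noteq> 0 \<Longrightarrow> cycle_hom u u' v v' 0 a \<noteq> 0"
proof -
  have e: "u \<in> left G" "v \<in> right G" "{u, v} \<in> edges G" "u' \<in> left G" "v' \<in> right G" "{u', v'} \<in> edges G"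
    and ne: "u \<noteq> u'" "v \<noteq> v'" using c by (auto simp: four_cycle_def)
  then have d: "u \<noteq> v" "u \<noteq> v'" "u' \<noteq> v" "u' \<noteq> v'" using G_fin(3) by auto
  have key: "cycle_hom u u' v v' 0 a \<noteq> 0"
    if w: "w \<in> left G" "y \<in> right G" "{w, y} \<in> edges G" and T: "T \<in> carrier opV" "T z \<noteq> 0"
      and gens: "\<And>x z. x \<in> X \<Longrightarrow> cycle_hom u u' v v' 0 (gen x) (T z) = T (edge_hom w y (gen x) z)"
      and nz: "edge_hom w y a \<noteq> 0" for w y T z
  proof
    assume 0: "cycle_hom u u' v v' 0 a = 0"
    obtain k where k: "edge_hom w y a = cscale_op k" using edge_hom_scalar[OF w] a unfolding op_scalar_def by blast
    have "cycle_hom u u' v v' 0 a (T z) = T (edge_hom w y a z)"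
      by (rule intertwine[OF edge_hom(1,2)[OF w] cycle_hom(1,2)[OF c] T(1) gens a])
    then have "cscale k (T z) = 0" using 0 k opV_apply_cscale[OF T(1)] by simp
    then have "k = 0" using cscale_eq_iff[OF T(2), of k 0] by simp
    then show False using nz k by (auto intro: blinfun_eqI)
  qed
  note M = cycle_hom[OF c, where t = 0]
  have z: "line_proj 1 0 (1, 0) \<noteq> 0" "line_proj 0 (- 1) (0, 1) \<noteq> 0" by (simp_all add: line_proj_apply cscale_def zero_prod_def)
  show "cycle_hom u u' v v' 0 a \<noteq> 0" if nz: "edge_hom u v a \<noteq> 0"
  proof (rule key[OF e(1-3) line_proj_closed z(1) _ nz])
    fix x z assume x: "x \<in> X"
    show "cycle_hom u u' v v' 0 (gen x) (line_proj 1 0 z) = line_proj 1 0 (edge_hom u v (gen x) z)"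
      using M(3-6) M(7)[OF x] edge_hom(3)[OF e(1-3) x] ne d
      by (cases "x \<in> {u, u', v, v'}") (auto simp: line_proj_apply)
  qed
  show "cycle_hom u u' v v' 0 a \<noteq> 0" if nz: "edge_hom u' v' a \<noteq> 0"
  proof (rule key[OF e(4-6) line_proj_closed z(2) _ nz])
    fix x z assume x: "x \<in> X"
    show "cycle_hom u u' v v' 0 (gen x) (line_proj 0 (- 1) z) = line_proj 0 (- 1) (edge_hom u' v' (gen x) z)"
      using M(3-6) M(7)[OF x] edge_hom(3)[OF e(4-6) x] ne d
      by (cases "x \<in> {u, u', v, v'}") (auto simp: line_proj_apply)
  qed
qed

lemma cycle_hom_nonzero_nearby:
  assumes c: "four_cycle G u u' v v'" and a: "a \<in> carrier A" and t: "cycle_hom u u' v v' t a \<noteq> 0"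
  obtains \<delta> where "0 < \<delta>" "\<And>s. \<bar>s - t\<bar> < \<delta> \<Longrightarrow> cycle_hom u u' v v' s a \<noteq> 0"
proof -
  have "open {s. cycle_hom u u' v v' s a \<noteq> 0}"
    by (rule open_Collect_neq[OF cycle_hom_continuous[OF c a] continuous_on_const])
  then obtain \<delta> where "0 < \<delta>" "\<And>s. dist s t < \<delta> \<Longrightarrow> cycle_hom u u' v v' s a \<noteq> 0"
    using t unfolding open_dist by blast
  then show thesis using that by (simp add: dist_real_def)
qed

end

section \<open>The topology of the small spectrum\<close>

definition inseparable :: "'a topology \<Rightarrow> 'a \<Rightarrow> 'a \<Rightarrow> bool" where
  "inseparable Y x y \<longleftrightarrow> (\<forall>U V. openin Y U \<longrightarrow> openin Y V \<longrightarrow> x \<in> U \<longrightarrow> y \<in> V \<longrightarrow> U \<inter> V \<noteq> {})"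

definition special_points :: "'a topology \<Rightarrow> 'a set" where
  "special_points Y = {x \<in> topspace Y. openin Y {x} \<or> (\<exists>y\<in>topspace Y. y \<noteq> x \<and> inseparable Y x y)}"

definition linked :: "'a topology \<Rightarrow> 'a \<Rightarrow> 'a \<Rightarrow> bool" where
  "linked Y x y \<longleftrightarrow> (\<exists>S. connectedin Y S \<and> S \<subseteq> topspace Y - special_points Y \<and> x \<in> Y closure_of S \<and> y \<in> Y closure_of S)"

lemma inseparable_sym: "inseparable Y x y \<Longrightarrow> inseparable Y y x"
  unfolding inseparable_def by (metis Int_commute)

lemma inseparable_map:
  assumes f: "continuous_map X Y f" and xy: "x \<in> topspace X" "y \<in> topspace X" and ins: "inseparable X x y"
  shows "inseparable Y (f x) (f y)"
  unfolding inseparable_def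
proof (intro allI impI)
  fix U V assume UV: "openin Y U" "openin Y V" "f x \<in> U" "f y \<in> V"
  note pre = openin_continuous_map_preimage[OF f UV(1)] openin_continuous_map_preimage[OF f UV(2)]
  have "{z \<in> topspace X. f z \<in> U} \<inter> {z \<in> topspace X. f z \<in> V} \<noteq> {}"
    using ins pre UV(3,4) xy unfolding inseparable_def by simp
  then show "U \<inter> V \<noteq> {}" by blast
qed

lemma special_points_map:
  assumes fg: "homeomorphic_maps X Y f g" and x: "x \<in> special_points X" shows "f x \<in> special_points Y"
proof -
  have f: "continuous_map X Y f" and g: "continuous_map Y X g"
    and gf: "\<And>z. z \<in> topspace X \<Longrightarrow> g (f z) = z" and fg': "\<And>z. z \<in> topspace Y \<Longrightarrow> f (g z) = z"
    using fg by (auto simp: homeomorphic_maps_def)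
  have xX: "x \<in> topspace X" using x by (simp add: special_points_def)
  have fx: "f z \<in> topspace Y" if "z \<in> topspace X" for z using that f by (auto simp: continuous_map_def)
  have "openin X {x} \<or> (\<exists>y\<in>topspace X. y \<noteq> x \<and> inseparable X x y)" using x by (simp add: special_points_def)
  then show ?thesis
  proof
    assume "openin X {x}"
    then have "openin Y {z \<in> topspace Y. g z \<in> {x}}" by (rule openin_continuous_map_preimage[OF g])
    moreover have "{z \<in> topspace Y. g z \<in> {x}} = {f x}"
    proof (intro equalityI subsetI)
      fix z assume "z \<in> {z \<in> topspace Y. g z \<in> {x}}"
      then have "z \<in> topspace Y" "g z = x" by simp_all
      then show "z \<in> {f x}" using fg'[of z] by simp
    qed (use fx[OF xX] gf[OF xX] in simp)
    ultimately show ?thesis using fx[OF xX] by (simp add: special_points_def)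
  next
    assume "\<exists>y\<in>topspace X. y \<noteq> x \<and> inseparable X x y"
    then obtain y where y: "y \<in> topspace X" "y \<noteq> x" "inseparable X x y" by blast
    have "inseparable Y (f x) (f y)" by (rule inseparable_map[OF f xX y(1,3)])
    moreover have "f y \<noteq> f x" using gf[OF xX] gf[OF y(1)] y(2) by metis
    ultimately show ?thesis using fx[OF xX] fx[OF y(1)] unfolding special_points_def by blast
  qed
qed

lemma linked_map:
  assumes fg: "homeomorphic_maps X Y f g" and l: "linked X x y" shows "linked Y (f x) (f y)"
proof -
  have f: "continuous_map X Y f" and gf: "\<And>z. z \<in> topspace X \<Longrightarrow> g (f z) = z"
    using fg by (auto simp: homeomorphic_maps_def)
  obtain S where S: "connectedin X S" "S \<subseteq> topspace X - special_points X" "x \<in> X closure_of S" "y \<in> X closure_of S"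
    using l unfolding linked_def by blast
  have "f ` S \<subseteq> topspace Y - special_points Y"
  proof
    fix z assume "z \<in> f ` S"
    then obtain s where s: "s \<in> S" "z = f s" by blast
    then have sX: "s \<in> topspace X" "s \<notin> special_points X" using S(2) by blast+
    have "f s \<notin> special_points Y"
      using special_points_map[OF fg[unfolded homeomorphic_maps_sym[of X]], of "f s"] gf[OF sX(1)] sX(2) by metis
    moreover have "f s \<in> topspace Y" using f sX(1) by (auto simp: continuous_map_def)
    ultimately show "z \<in> topspace Y - special_points Y" using s(2) by simp
  qed
  moreover have "f x \<in> Y closure_of f ` S" "f y \<in> Y closure_of f ` S"
    using continuous_map_image_closure_subset[OF f, of S] S(3,4) by blast+
  ultimately show ?thesis
    unfolding linked_def using connectedin_continuous_map_image[OF f S(1)] by (intro exI[of _ "f ` S"] conjI)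
qed

section \<open>Points, supports and neighbourhoods in the small spectrum\<close>

context bip_graph_algebra
begin

abbreviation "Y \<equiv> kern_topology A"
abbreviation "cycle_point u u' v v' t \<equiv> op_kernel A (cycle_hom u u' v v' t)"

text \<open>Takes the edge as a set, to match \<open>edge_iso\<close>; \<open>edge_point_eq\<close>
  is the version with named ends.\<close>

definition edge_point :: "'v set \<Rightarrow> (nat \<Rightarrow> 'v star_poly) set set" where
  "edge_point e = op_kernel A (model_hom (\<lambda>x. if x \<in> e then id_blinfun else 0))"

text \<open>For a character this is its edge, for a two-dimensional point the vertex set of its
  4-cycle. Having a given vertex in the support is an open condition.\<close>

definition supp :: "(nat \<Rightarrow> 'v star_poly) set set \<Rightarrow> 'v set" where
  "supp P = {x \<in> X. gen x \<notin> P}"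

lemma edge_point_eq: "edge_point {u, v} = op_kernel A (edge_hom u v)"
proof -
  have "edge_model u v = (\<lambda>x. if x \<in> {u, v} then id_blinfun else 0)" by (auto simp: edge_model_def)
  then show ?thesis by (simp add: edge_point_def)
qed

lemma supp_edge_point: assumes "e \<in> edges G" shows "supp (edge_point e) = e"
proof -
  obtain u v where e: "u \<in> left G" "v \<in> right G" "e = {u, v}" using edgeE[OF G assms] by metis
  show ?thesis using edge_kernel_gen[OF e(1,2)] assms e by (auto simp: supp_def edge_point_eq)
qed

lemma supp_cycle_point: assumes "four_cycle G u u' v v'" shows "supp (cycle_point u u' v v' t) = {u, u', v, v'}"
  using cycle_kernel_gen[OF assms] assms by (auto simp: supp_def four_cycle_def)

lemma kern_points: "kern_le2 A = {op_kernel A g | g. op_scalar A g \<or> op_irred A g}"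
  by (rule kern_le2_eq[OF A.cstar_algebra_axioms, of "{}" UNIV]) simp

lemma point_rep: assumes "P \<in> kern_le2 A" obtains g where "unital_rep g" "op_kernel A g = P" "op_scalar A g \<or> op_irred A g"
proof -
  obtain g where g: "P = op_kernel A g" "op_scalar A g \<or> op_irred A g" using assms unfolding kern_points by blast
  have "unital_rep g"
    using g(2) irred_one by (auto simp: unital_rep_def op_scalar_def op_irred_def)
  then show thesis using that g by blast
qed

lemma edge_point_in: assumes "e \<in> edges G" shows "edge_point e \<in> kern_le2 A"
proof -
  obtain u v where e: "u \<in> left G" "v \<in> right G" "e = {u, v}" using edgeE[OF G assms] by metis
  show ?thesis unfolding kern_points using edge_hom_scalar[OF e(1,2)] assms e by (auto simp: edge_point_eq)
qed

lemma cycle_point_in: "four_cycle G u u' v v' \<Longrightarrow> 0 < t \<Longrightarrow> t < pi / 2 \<Longrightarrow> cycle_point u u' v v' t \<in> kern_le2 A"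
  unfolding kern_points using cycle_hom_irred by blast

text \<open>A 4-cycle can be labelled from any of its edges. Fixing a left and a right vertex of the
  support in advance gives the parametrisation in which \<open>t\<close> is the angle between these
  two.\<close>

lemma point_cases_at [consumes 5, case_names edge cycle]:
  assumes P: "P \<in> kern_le2 A" and u: "u \<in> left G" "u \<in> supp P" and v: "v \<in> right G" "v \<in> supp P"
  obtains (edge) "{u, v} \<in> edges G" "P = edge_point {u, v}"
    | (cycle) u' v' t where "four_cycle G u u' v v'" "0 < t" "t < pi / 2" "P = cycle_point u u' v v' t"
proof -
  obtain g where g: "op_kernel A g = P" "op_scalar A g \<or> op_irred A g" using point_rep[OF P] by metis
  have gz: "g (gen u) \<noteq> 0" "g (gen v) \<noteq> 0"
    using u v gen_closed unfolding g(1)[symmetric] by (auto simp: supp_def op_kernel_def)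
  from g(2) show thesis
  proof
    assume s: "op_scalar A g"
    obtain u2 v2 where e: "u2 \<in> left G" "v2 \<in> right G" "{u2, v2} \<in> edges G"
      and eq: "\<And>a. a \<in> carrier A \<Longrightarrow> g a = edge_hom u2 v2 a" by (rule scalar_classification[OF G s]) blast
    have PE: "P = edge_point {u2, v2}" unfolding edge_point_eq g(1)[symmetric] using eq by (auto simp: op_kernel_def)
    then have "u \<in> {u2, v2}" "v \<in> {u2, v2}" using u v supp_edge_point[OF e(3)] by simp_all
    then have "u = u2" "v = v2" using e u v G_fin(3) by auto
    then show thesis using edge e PE by simp
  next
    assume i: "op_irred A g"
    obtain u' v' t W where c: "four_cycle G u u' v v'" "0 < t" "t < pi / 2" "W \<in> carrier opV"
      "\<And>x y. cinner (W x) (W y) = cinner x y" "surj (blinfun_apply W)"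
      "\<And>a z. a \<in> carrier A \<Longrightarrow> g a (W z) = W (cycle_hom u u' v v' t a z)"
      by (rule irred_classification[OF G i u(1) v(1) gz]) blast
    have "P = cycle_point u u' v v' t" using unitary_kernel[OF c(5-7)] g(1) by simp
    then show thesis using cycle c(1-3) by blast
  qed
qed

lemma point_support: assumes P: "P \<in> kern_le2 A" obtains u v where "u \<in> left G" "u \<in> supp P" "v \<in> right G" "v \<in> supp P"
proof -
  obtain g where g: "op_kernel A g = P" "op_scalar A g \<or> op_irred A g" using point_rep[OF P] by metis
  from g(2) show thesis
  proof
    assume s: "op_scalar A g"
    obtain u v where e: "u \<in> left G" "v \<in> right G" "{u, v} \<in> edges G"
      and eq: "\<And>a. a \<in> carrier A \<Longrightarrow> g a = edge_hom u v a" by (rule scalar_classification[OF G s]) blast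
    have "P = edge_point {u, v}" unfolding edge_point_eq g(1)[symmetric] using eq by (auto simp: op_kernel_def)
    then show thesis using that[OF e(1) _ e(2)] supp_edge_point[OF e(3)] by simp
  next
    assume "op_irred A g"
    then obtain u v where uv: "u \<in> left G" "v \<in> right G" "g (gen u) \<noteq> 0" "g (gen v) \<noteq> 0" using irred_supports by metis
    then have "u \<in> supp P" "v \<in> supp P" unfolding g(1)[symmetric] by (auto simp: supp_def op_kernel_def)
    then show thesis using that uv(1,2) by blast
  qed
qed

lemma point_cases:
  assumes P: "P \<in> kern_le2 A"
  obtains (edge) e where "e \<in> edges G" "P = edge_point e"
    | (cycle) u u' v v' t where "four_cycle G u u' v v'" "0 < t" "t < pi / 2" "P = cycle_point u u' v v' t"
proof -
  obtain u v where uv: "u \<in> left G" "u \<in> supp P" "v \<in> right G" "v \<in> supp P" using point_support[OF P] by metis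
  from point_cases_at[OF P uv] show thesis
    by cases (use edge cycle in blast)+
qed

lemma topspace_Y: "topspace Y = kern_le2 A"
  by (rule topspace_kern_topology[OF A.cstar_algebra_axioms])

lemma openin_avoid: assumes "a \<in> carrier A" shows "openin Y {P \<in> kern_le2 A. a \<notin> P}"
  unfolding openin_kern_topology[OF A.cstar_algebra_axioms] using assms by (intro exI[of _ "{a}"]) simp

lemma openin_supp: assumes "x \<in> X" shows "openin Y {P \<in> kern_le2 A. x \<in> supp P}"
  using openin_avoid[OF gen_closed[OF assms]] assms by (simp add: supp_def)

lemma open_basis:
  assumes "openin Y W" "P \<in> W"
  obtains a where "a \<in> carrier A" "a \<notin> P" "\<And>Q. Q \<in> kern_le2 A \<Longrightarrow> a \<notin> Q \<Longrightarrow> Q \<in> W"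
proof -
  obtain I where I: "I \<subseteq> carrier A" "W = {P \<in> kern_le2 A. \<not> I \<subseteq> P}"
    using assms(1) unfolding openin_kern_topology[OF A.cstar_algebra_axioms] by (elim exE conjE)
  obtain a where a: "a \<in> I" "a \<notin> P" using assms(2) unfolding I(2) by blast
  show thesis
  proof
    show "a \<in> carrier A" "a \<notin> P" using a I(1) by blast+
    show "Q \<in> W" if "Q \<in> kern_le2 A" "a \<notin> Q" for Q using a(1) that unfolding I(2) by blast
  qed
qed

text \<open>An element that does not vanish at one of the two characters does not vanish at
  \<open>t = 0\<close>, where both are contained in the representation, and by continuity not for
  small \<open>t\<close> either.\<close>

lemma cycle_near_edge:
  assumes c: "four_cycle G u u' v v'" and W: "openin Y W" "edge_point {u, v} \<in> W \<or> edge_point {u', v'} \<in> W"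
  obtains \<delta> where "0 < \<delta>" "\<And>t. 0 < t \<Longrightarrow> t < \<delta> \<Longrightarrow> t < pi / 2 \<Longrightarrow> cycle_point u u' v v' t \<in> W"
proof -
  have "\<exists>a\<in>carrier A. cycle_hom u u' v v' 0 a \<noteq> 0 \<and> (\<forall>Q. Q \<in> kern_le2 A \<longrightarrow> a \<notin> Q \<longrightarrow> Q \<in> W)"
    using W(2)
  proof
    assume "edge_point {u, v} \<in> W"
    then obtain a where a: "a \<in> carrier A" "a \<notin> edge_point {u, v}" "\<And>Q. Q \<in> kern_le2 A \<Longrightarrow> a \<notin> Q \<Longrightarrow> Q \<in> W"
      using open_basis[OF W(1)] by metis
    then have "edge_hom u v a \<noteq> 0" by (auto simp: edge_point_eq op_kernel_def)
    then show ?thesis using cycle_hom_zero(1)[OF c a(1)] a by blast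
  next
    assume "edge_point {u', v'} \<in> W"
    then obtain a where a: "a \<in> carrier A" "a \<notin> edge_point {u', v'}" "\<And>Q. Q \<in> kern_le2 A \<Longrightarrow> a \<notin> Q \<Longrightarrow> Q \<in> W"
      using open_basis[OF W(1)] by metis
    then have "edge_hom u' v' a \<noteq> 0" by (auto simp: edge_point_eq op_kernel_def)
    then show ?thesis using cycle_hom_zero(2)[OF c a(1)] a by blast
  qed
  then obtain a where a: "a \<in> carrier A" "cycle_hom u u' v v' 0 a \<noteq> 0" "\<And>Q. Q \<in> kern_le2 A \<Longrightarrow> a \<notin> Q \<Longrightarrow> Q \<in> W" by blast
  obtain \<delta> where d: "0 < \<delta>" "\<And>s. \<bar>s - 0\<bar> < \<delta> \<Longrightarrow> cycle_hom u u' v v' s a \<noteq> 0"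
    using cycle_hom_nonzero_nearby[OF c a(1,2)] by metis
  show thesis
  proof
    fix t assume t: "0 < t" "t < \<delta>" "t < pi / 2"
    have "a \<notin> cycle_point u u' v v' t" using d(2)[of t] t by (simp add: op_kernel_def)
    then show "cycle_point u u' v v' t \<in> W" by (rule a(3)[OF cycle_point_in[OF c t(1,3)]])
  qed (rule d(1))
qed

lemma cycle_near_cycle:
  assumes c: "four_cycle G u u' v v'" and W: "openin Y W" "cycle_point u u' v v' t \<in> W"
  obtains \<delta> where "0 < \<delta>" "\<And>s. \<bar>s - t\<bar> < \<delta> \<Longrightarrow> 0 < s \<Longrightarrow> s < pi / 2 \<Longrightarrow> cycle_point u u' v v' s \<in> W"
proof -
  obtain a where a: "a \<in> carrier A" "a \<notin> cycle_point u u' v v' t" "\<And>Q. Q \<in> kern_le2 A \<Longrightarrow> a \<notin> Q \<Longrightarrow> Q \<in> W"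
    using open_basis[OF W] by metis
  have "cycle_hom u u' v v' t a \<noteq> 0" using a(1,2) by (simp add: op_kernel_def)
  then obtain \<delta> where d: "0 < \<delta>" "\<And>s. \<bar>s - t\<bar> < \<delta> \<Longrightarrow> cycle_hom u u' v v' s a \<noteq> 0"
    using cycle_hom_nonzero_nearby[OF c a(1)] by metis
  show thesis
  proof
    fix s assume s: "\<bar>s - t\<bar> < \<delta>" "0 < s" "s < pi / 2"
    have "a \<notin> cycle_point u u' v v' s" using d(2)[OF s(1)] by (simp add: op_kernel_def)
    then show "cycle_point u u' v v' s \<in> W" by (rule a(3)[OF cycle_point_in[OF c s(2,3)]])
  qed (rule d(1))
qed

text \<open>Off the 4-cycles, the character is the only point whose support contains both ends of
  the edge.\<close>

lemma isolated_edge_point: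
  assumes e: "e \<in> edges G" and nc: "\<not> cocyclic G e e" shows "openin Y {edge_point e}"
proof -
  obtain u v where uv: "u \<in> left G" "v \<in> right G" "e = {u, v}" using edgeE[OF G e] by metis
  have "{P \<in> kern_le2 A. u \<in> supp P} \<inter> {P \<in> kern_le2 A. v \<in> supp P} = {edge_point e}"
  proof (intro equalityI subsetI)
    fix P assume "P \<in> {P \<in> kern_le2 A. u \<in> supp P} \<inter> {P \<in> kern_le2 A. v \<in> supp P}"
    then have P: "P \<in> kern_le2 A" "u \<in> supp P" "v \<in> supp P" by simp_all
    show "P \<in> {edge_point e}"
      using P(1) uv(1) P(2) uv(2) P(3)
    proof (cases rule: point_cases_at)
      case edge
      then show ?thesis using uv by simp
    next
      case (cycle u' v' t)
      then have "cocyclic G e e" unfolding cocyclic_def uv(3) by (intro exI conjI) auto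
      then show ?thesis using nc by simp
    qed
  qed (use edge_point_in[OF e] supp_edge_point[OF e] uv in simp)
  then show ?thesis using openin_Int[OF openin_supp[of u] openin_supp[of v]] uv by simp
qed

lemma opposite_inseparable:
  assumes "opposite G e f" shows "inseparable Y (edge_point e) (edge_point f)"
  unfolding inseparable_def
proof (intro allI impI)
  fix U V assume UV: "openin Y U" "openin Y V" "edge_point e \<in> U" "edge_point f \<in> V"
  obtain u u' v v' where c: "four_cycle G u u' v v'" "e = {u, v}" "f = {u', v'}" using assms by (auto simp: opposite_def)
  obtain d where d: "0 < d" "\<And>t. 0 < t \<Longrightarrow> t < d \<Longrightarrow> t < pi / 2 \<Longrightarrow> cycle_point u u' v v' t \<in> U"
    using cycle_near_edge[OF c(1) UV(1)] UV(3) c(2) by metis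
  obtain b where b: "0 < b" "\<And>t. 0 < t \<Longrightarrow> t < b \<Longrightarrow> t < pi / 2 \<Longrightarrow> cycle_point u u' v v' t \<in> V"
    using cycle_near_edge[OF c(1) UV(2)] UV(4) c(3) by metis
  obtain t where t: "0 < t" "t < min (min d b) (pi / 2)" using dense[of 0 "min (min d b) (pi / 2)"] d(1) b(1) by auto
  then have "cycle_point u u' v v' t \<in> U" "cycle_point u u' v v' t \<in> V" using d(2)[of t] b(2)[of t] by simp_all
  then show "U \<inter> V \<noteq> {}" by blast
qed

text \<open>The angle is 0 at the character of \<open>{u, v}\<close>, \<open>2 * t\<close> on a
  4-cycle through both vertices, and \<open>pi\<close> if the other vertex is missing from the
  support.\<close>

lemma point_angle:
  assumes P: "P \<in> kern_le2 A" and uv: "u \<in> left G" "v \<in> right G" and x: "x = u \<or> x = v" "x \<in> supp P"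
  obtains f \<theta> where "has_angle f u v x \<theta>" "op_kernel A f = P"
proof (cases "u \<in> supp P \<and> v \<in> supp P")
  case True
  then have s: "u \<in> supp P" "v \<in> supp P" by simp_all
  show thesis
    using P uv(1) s(1) uv(2) s(2)
  proof (cases rule: point_cases_at)
    case edge
    then show thesis using that[OF edge_hom_angle[OF uv]] by (simp add: edge_point_eq)
  next
    case (cycle u' v' t)
    then show thesis using that[OF cycle_hom_angle] by blast
  qed
next
  case False
  obtain y where y: "{u, v} = {x, y}" "y \<in> X" "y \<notin> supp P" using False x uv by blast
  obtain g where g: "unital_rep g" "op_kernel A g = P" using point_rep[OF P] by metis
  have "g (gen y) = 0" using y(2,3) gen_closed[OF y(2)] unfolding g(2)[symmetric] by (simp add: supp_def op_kernel_def)
  moreover have "x \<in> X" using x uv by auto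
  ultimately show thesis using that[OF missing_angle[OF g(1) _ y(2) _ y(1)] g(2)] by blast
qed

lemma supp_rep: "op_kernel A f = P \<Longrightarrow> x \<in> X \<Longrightarrow> x \<in> supp P \<longleftrightarrow> f (gen x) \<noteq> 0"
  using gen_closed by (auto simp: supp_def op_kernel_def)

text \<open>The open sets are those where the elements \<open>a\<close> and \<open>b\<close> of
  \<open>sign_elements\<close> do not vanish. A common point would have \<open>x\<close> in its
  support, as \<open>a\<close> vanishes otherwise, and then a cosine that is both positive and
  negative.\<close>

lemma angle_separation_pos:
  assumes uv: "u \<in> left G" "v \<in> right G" and x: "x = u \<or> x = v"
    and P: "P \<in> kern_le2 A" "x \<in> supp P" "has_angle f u v x \<theta>" "op_kernel A f = P"
    and Q: "Q \<in> kern_le2 A" "x \<in> supp Q" "has_angle g u v x \<eta>" "op_kernel A g = Q"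
    and pos: "0 < cos (2 ^ k * \<theta>)" "cos (2 ^ k * \<eta>) < 0"
  shows "\<not> inseparable Y P Q"
proof -
  have X: "u \<in> X" "v \<in> X" "x \<in> X" using uv x by auto
  obtain a b where ab: "a \<in> carrier A" "b \<in> carrier A"
    "\<And>f \<theta>. has_angle f u v x \<theta> \<Longrightarrow> f (gen x) \<noteq> 0 \<Longrightarrow> f a = 0 \<longleftrightarrow> cos (2 ^ k * \<theta>) \<le> 0"
    "\<And>f \<theta>. has_angle f u v x \<theta> \<Longrightarrow> f (gen x) \<noteq> 0 \<Longrightarrow> f b = 0 \<longleftrightarrow> 0 \<le> cos (2 ^ k * \<theta>)"
    "\<And>f. unital_rep f \<Longrightarrow> f (gen x) = 0 \<Longrightarrow> f a = 0"
    by (rule sign_elements[OF X, of k]) blast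
  define U where "U = {R \<in> kern_le2 A. a \<notin> R}"
  define V where "V = {R \<in> kern_le2 A. b \<notin> R}"
  have "openin Y U" "openin Y V" unfolding U_def V_def by (rule openin_avoid, rule ab)+
  moreover have "P \<in> U"
  proof -
    have "f a \<noteq> 0" using ab(3)[OF P(3)] supp_rep[OF P(4) X(3)] P(2) pos(1) by simp
    then show ?thesis using P(1) unfolding U_def P(4)[symmetric] by (simp add: op_kernel_def)
  qed
  moreover have "Q \<in> V"
  proof -
    have "g b \<noteq> 0" using ab(4)[OF Q(3)] supp_rep[OF Q(4) X(3)] Q(2) pos(2) by simp
    then show ?thesis using Q(1) unfolding V_def Q(4)[symmetric] by (simp add: op_kernel_def)
  qed
  moreover have "U \<inter> V = {}"
  proof (rule ccontr)
    assume "U \<inter> V \<noteq> {}"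
    then obtain R where R: "R \<in> kern_le2 A" "a \<notin> R" "b \<notin> R" unfolding U_def V_def by blast
    have "x \<in> supp R"
    proof (rule ccontr)
      assume n: "x \<notin> supp R"
      obtain h where h: "unital_rep h" "op_kernel A h = R" using point_rep[OF R(1)] by metis
      then have "h a = 0" using ab(5)[OF h(1)] supp_rep[OF h(2) X(3)] n by simp
      then show False using R(2) ab(1) unfolding h(2)[symmetric] by (simp add: op_kernel_def)
    qed
    then obtain h \<phi> where h: "has_angle h u v x \<phi>" "op_kernel A h = R" using point_angle[OF R(1) uv x] by metis
    have "h (gen x) \<noteq> 0" using supp_rep[OF h(2) X(3)] \<open>x \<in> supp R\<close> by simp
    moreover have "h a \<noteq> 0" "h b \<noteq> 0" using R(2,3) ab(1,2) unfolding h(2)[symmetric] by (simp_all add: op_kernel_def)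
    ultimately show False using ab(3)[OF h(1)] ab(4)[OF h(1)] by simp
  qed
  ultimately show ?thesis unfolding inseparable_def by blast
qed

text \<open>Tent separation supplies a number of doublings after which the cosines have opposite
  signs.\<close>

lemma angle_separation:
  assumes uv: "u \<in> left G" "v \<in> right G" and x: "x = u \<or> x = v"
    and P: "P \<in> kern_le2 A" "x \<in> supp P" "has_angle f u v x \<theta>" "op_kernel A f = P"
    and Q: "Q \<in> kern_le2 A" "x \<in> supp Q" "has_angle g u v x \<eta>" "op_kernel A g = Q"
    and range: "0 \<le> \<theta>" "\<theta> \<le> pi" "0 \<le> \<eta>" "\<eta> \<le> pi" "\<theta> \<noteq> \<eta>"
  shows "\<not> inseparable Y P Q"
proof -
  obtain k where "cos (2 ^ k * \<theta>) * cos (2 ^ k * \<eta>) < 0" using tent_separation[OF range] by blast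
  then consider "0 < cos (2 ^ k * \<theta>)" "cos (2 ^ k * \<eta>) < 0" | "0 < cos (2 ^ k * \<eta>)" "cos (2 ^ k * \<theta>) < 0"
    by (auto simp: mult_less_0_iff)
  then show ?thesis
  proof cases
    case 1
    then show ?thesis by (rule angle_separation_pos[OF uv x P Q])
  next
    case 2
    then have "\<not> inseparable Y Q P" by (rule angle_separation_pos[OF uv x Q P])
    then show ?thesis by (rule contrapos_nn[OF _ inseparable_sym])
  qed
qed

text \<open>If the edges share a vertex, the angles at \<open>(u, v)\<close> are 0 and
  \<open>pi\<close>, and the points can be separated. If not, the supports give neighbourhoods in
  which a common point contains all four vertices; it can only lie on a 4-cycle with these edges
  opposite.\<close>

lemma non_opposite_separable:
  assumes e: "e \<in> edges G" and f: "f \<in> edges G" and ne: "e \<noteq> f" and ins: "inseparable Y (edge_point e) (edge_point f)"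
  shows "opposite G e f"
proof -
  obtain u v where uv: "u \<in> left G" "v \<in> right G" "e = {u, v}" using edgeE[OF G e] by metis
  obtain u' v' where uv': "u' \<in> left G" "v' \<in> right G" "f = {u', v'}" using edgeE[OF G f] by metis
  have d: "u \<noteq> v" "u \<noteq> v'" "u' \<noteq> v" "u' \<noteq> v'" using uv uv' G_fin(3) by auto
  note s = supp_edge_point[OF e] supp_edge_point[OF f]
  have common: False if x: "x = u \<or> x = v" "x \<in> f" and y: "y = u \<or> y = v" "y \<notin> f" for x y
  proof -
    have xy: "{u, v} = {x, y}" and X: "x \<in> X" "y \<in> X" using x y uv by auto
    obtain g where g: "unital_rep g" "op_kernel A g = edge_point f" using point_rep[OF edge_point_in[OF f]] by metis
    have "g (gen y) = 0" using supp_rep[OF g(2) X(2)] y(2) s(2) by simp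
    then have ga: "has_angle g u v x pi" by (rule missing_angle[OF g(1) X _ xy])
    have "{u, v} \<in> edges G" using e uv by simp
    then have ea: "has_angle (edge_hom u v) u v x 0" by (rule edge_hom_angle[OF uv(1,2)])
    have "\<not> inseparable Y (edge_point e) (edge_point f)"
      by (rule angle_separation[OF uv(1,2) x(1) edge_point_in[OF e] _ ea _ edge_point_in[OF f] _ ga g(2)])
        (use s x uv in \<open>auto simp: edge_point_eq\<close>)
    then show False using ins by simp
  qed
  have uu: "u \<noteq> u'"
  proof
    assume "u = u'"
    then have "v \<noteq> v'" using ne uv uv' by auto
    then show False using common[of u v] \<open>u = u'\<close> uv' d by simp
  qed
  have vv: "v \<noteq> v'"
  proof
    assume "v = v'"
    then show False using common[of v u] uv' d uu by simp
  qed
  define U where "U = {P \<in> kern_le2 A. u \<in> supp P} \<inter> {P \<in> kern_le2 A. v \<in> supp P}"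
  define V where "V = {P \<in> kern_le2 A. u' \<in> supp P} \<inter> {P \<in> kern_le2 A. v' \<in> supp P}"
  have "openin Y U" "openin Y V" unfolding U_def V_def using uv uv' by (intro openin_Int openin_supp; simp)+
  moreover have "edge_point e \<in> U" "edge_point f \<in> V"
    using s uv uv' edge_point_in[OF e] edge_point_in[OF f] by (simp_all add: U_def V_def)
  ultimately have "U \<inter> V \<noteq> {}" using ins unfolding inseparable_def by blast
  then obtain P where P: "P \<in> kern_le2 A" "u \<in> supp P" "v \<in> supp P" "u' \<in> supp P" "v' \<in> supp P"
    unfolding U_def V_def by blast
  show ?thesis
    using P(1) uv(1) P(2) uv(2) P(3)
  proof (cases rule: point_cases_at)
    case edge
    then have "u' \<in> {u, v}" using P(4) supp_edge_point[of "{u, v}"] by simp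
    then show ?thesis using uu d by simp
  next
    case (cycle u2 v2 t)
    then have "u' \<in> {u, u2, v, v2}" "v' \<in> {u, u2, v, v2}" using P(4,5) supp_cycle_point by simp_all
    moreover have "u2 \<in> left G" "v2 \<in> right G" using cycle(1) by (auto simp: four_cycle_def)
    moreover from this have "u' \<noteq> v2" "v' \<noteq> u2" using uv'(1,2) G_fin(3) by blast+
    ultimately have "u' = u2" "v' = v2" using uu vv d(2,3) by simp_all
    then show ?thesis
      unfolding opposite_def uv(3) uv'(3) using cycle(1) by (intro exI[of _ u] exI[of _ u'] exI[of _ v] exI[of _ v']) simp
  qed
qed

definition cell :: "'v set \<Rightarrow> (nat \<Rightarrow> 'v star_poly) set set set" where
  "cell D = {P \<in> kern_le2 A. D \<subseteq> supp P}"

lemma openin_cell: assumes "finite D" "D \<subseteq> X" shows "openin Y (cell D)"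
  using assms
proof (induction D rule: finite_induct)
  case empty
  show ?case using openin_topspace[of Y] by (simp add: cell_def topspace_Y)
next
  case (insert x D)
  have "cell (insert x D) = {P \<in> kern_le2 A. x \<in> supp P} \<inter> cell D" by (auto simp: cell_def)
  then show ?case using insert openin_supp[of x] by auto
qed

lemma cell_cycle:
  assumes c: "four_cycle G u u' v v'" shows "cell {u, u', v, v'} = (\<lambda>t. cycle_point u u' v v' t) ` {0<..<pi / 2}"
proof (intro equalityI subsetI)
  fix P assume "P \<in> cell {u, u', v, v'}"
  then have P: "P \<in> kern_le2 A" "u \<in> supp P" "v \<in> supp P" "u' \<in> supp P" "v' \<in> supp P" by (auto simp: cell_def)
  have uv: "u \<in> left G" "v \<in> right G" "u' \<in> left G" "v' \<in> right G" "u \<noteq> u'" "v \<noteq> v'" using c by (auto simp: four_cycle_def)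
  show "P \<in> (\<lambda>t. cycle_point u u' v v' t) ` {0<..<pi / 2}"
    using P(1) uv(1) P(2) uv(2) P(3)
  proof (cases rule: point_cases_at)
    case edge
    then have "u' \<in> {u, v}" using P(4) supp_edge_point[of "{u, v}"] by simp
    then show ?thesis using uv G_fin(3) by auto
  next
    case (cycle u2 v2 t)
    then have "u' \<in> {u, u2, v, v2}" "v' \<in> {u, u2, v, v2}" using P(4,5) supp_cycle_point by simp_all
    moreover have "u2 \<in> left G" "v2 \<in> right G" using cycle(1) by (auto simp: four_cycle_def)
    moreover from this have "u' \<noteq> v2" "v' \<noteq> u2" "u' \<noteq> v" "v' \<noteq> u" using uv G_fin(3) by blast+
    ultimately have "u' = u2" "v' = v2" using uv(5,6) by simp_all
    then show ?thesis using cycle by (intro image_eqI[of _ _ t]) simp_all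
  qed
next
  fix P assume "P \<in> (\<lambda>t. cycle_point u u' v v' t) ` {0<..<pi / 2}"
  then obtain t where t: "P = cycle_point u u' v v' t" "0 < t" "t < pi / 2" by auto
  then show "P \<in> cell {u, u', v, v'}" using cycle_point_in[OF c t(2,3)] supp_cycle_point[OF c, of t] by (simp add: cell_def)
qed

lemma cell_supp: assumes "four_cycle G u u' v v'" "P \<in> cell {u, u', v, v'}" shows "supp P = {u, u', v, v'}"
proof -
  obtain t where "P = cycle_point u u' v v' t" using assms(2) unfolding cell_cycle[OF assms(1)] by blast
  then show ?thesis using supp_cycle_point[OF assms(1)] by simp
qed

text \<open>Nearby angles exclude isolation. Another point either has a vertex outside the 4-cycle
  in its support, and is separated by supports, or its angle at a common pair of vertices is
  different.\<close>

lemma cycle_point_not_special: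
  assumes c: "four_cycle G u u' v v'" and t: "0 < t" "t < pi / 2" shows "cycle_point u u' v v' t \<notin> special_points Y"
proof
  let ?P = "cycle_point u u' v v' t"
  have P: "?P \<in> kern_le2 A" by (rule cycle_point_in[OF c t])
  have sP: "supp ?P = {u, u', v, v'}" by (rule supp_cycle_point[OF c])
  have cX: "{u, u', v, v'} \<subseteq> X" using c by (auto simp: four_cycle_def)
  assume "?P \<in> special_points Y"
  then have "openin Y {?P} \<or> (\<exists>Q\<in>kern_le2 A. Q \<noteq> ?P \<and> inseparable Y ?P Q)" by (simp add: special_points_def topspace_Y)
  then show False
  proof
    assume "openin Y {?P}"
    then obtain d where d: "0 < d" "\<And>s. \<bar>s - t\<bar> < d \<Longrightarrow> 0 < s \<Longrightarrow> s < pi / 2 \<Longrightarrow> cycle_point u u' v v' s \<in> {?P}"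
      using cycle_near_cycle[OF c, of "{?P}" t] by blast
    obtain s where s: "t < s" "s < min (t + d) (pi / 2)" using dense[of t "min (t + d) (pi / 2)"] t d(1) by auto
    then have "cycle_point u u' v v' s = ?P" using d(2)[of s] t by simp
    then have "s = t" using cycle_kernel_angle[OF c _ _ t, of s] s t by simp
    then show False using s by simp
  next
    assume "\<exists>Q\<in>kern_le2 A. Q \<noteq> ?P \<and> inseparable Y ?P Q"
    then obtain Q where Q: "Q \<in> kern_le2 A" "Q \<noteq> ?P" and ins: "inseparable Y ?P Q" by blast
    show False
    proof (cases "supp Q \<subseteq> {u, u', v, v'}")
      case False
      then obtain x where x: "x \<in> supp Q" "x \<notin> {u, u', v, v'}" by blast
      then have "x \<in> X" by (simp add: supp_def)
      then have "openin Y {R \<in> kern_le2 A. x \<in> supp R}" by (rule openin_supp)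
      moreover have "openin Y (cell {u, u', v, v'})" using cX by (intro openin_cell) simp_all
      moreover have "?P \<in> cell {u, u', v, v'}" using P sP by (simp add: cell_def)
      moreover have "Q \<in> {R \<in> kern_le2 A. x \<in> supp R}" using Q x by simp
      ultimately have "cell {u, u', v, v'} \<inter> {R \<in> kern_le2 A. x \<in> supp R} \<noteq> {}" using ins unfolding inseparable_def by blast
      then obtain R where "R \<in> cell {u, u', v, v'}" "x \<in> supp R" by blast
      then show False using cell_supp[OF c] x(2) by blast
    next
      case True
      \<comment> \<open>The reference pair is taken from the support of \<open>Q\<close>, which is
        contained in that of \<open>?P\<close>; so both points have an angle at
        \<open>(a, b)\<close>, and the 4-cycle of \<open>?P\<close> is relabelled from
        there.\<close>
      obtain a b where ab: "a \<in> left G" "a \<in> supp Q" "b \<in> right G" "b \<in> supp Q" using point_support[OF Q(1)] by metis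
      have abP: "a \<in> supp ?P" "b \<in> supp ?P" using ab True sP by blast+
      have four: "u \<in> left G" "u' \<in> left G" "u \<noteq> u'" "v \<in> right G" "v' \<in> right G" "v \<noteq> v'" using c by (auto simp: four_cycle_def)
      show False
        using P ab(1) abP(1) ab(3) abP(2)
      proof (cases rule: point_cases_at)
        case edge
        then have "supp ?P = {a, b}" using supp_edge_point by metis
        then have "u \<in> {a, b}" "u' \<in> {a, b}" unfolding sP by blast+
        then show False using four ab(1,3) G_fin(3) by auto
      next
        case (cycle a' b' s)
        have sP': "{u, u', v, v'} = {a, a', b, b'}" using sP cycle(4) supp_cycle_point[OF cycle(1)] by simp
        have sa: "has_angle (cycle_hom a a' b b' s) a b a (2 * s)" by (rule cycle_hom_angle[OF cycle(1)])
        show False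
          using Q(1) ab
        proof (cases rule: point_cases_at)
          case edge
          have qa: "has_angle (edge_hom a b) a b a 0" by (rule edge_hom_angle[OF ab(1,3) edge(1)])
          have "\<not> inseparable Y ?P Q"
            by (rule angle_separation[OF ab(1,3) disjI1[OF refl] P abP(1) sa cycle(4)[symmetric] Q(1) ab(2) qa])
              (use cycle edge in \<open>simp_all add: edge_point_eq\<close>)
          then show False using ins by simp
        next
          case q: (cycle a2 b2 r)
          have "a2 \<in> {a, a', b, b'}" "b2 \<in> {a, a', b, b'}"
            using True unfolding q(4) supp_cycle_point[OF q(1)] sP' by simp_all
          moreover have "a2 \<in> left G" "b2 \<in> right G" "a2 \<noteq> a" "b2 \<noteq> b" "a' \<in> left G" "b' \<in> right G"
            using q(1) cycle(1) by (auto simp: four_cycle_def)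
          moreover from this have "a2 \<noteq> b" "a2 \<noteq> b'" "b2 \<noteq> a" "b2 \<noteq> a'" using ab(1,3) G_fin(3) by blast+
          ultimately have eq: "a2 = a'" "b2 = b'" by simp_all
          have qa: "has_angle (cycle_hom a a2 b b2 r) a b a (2 * r)" by (rule cycle_hom_angle[OF q(1)])
          have "s \<noteq> r" using Q(2) cycle(4) q(4) eq by metis
          then have "\<not> inseparable Y ?P Q"
            by (intro angle_separation[OF ab(1,3) disjI1[OF refl] P abP(1) sa cycle(4)[symmetric] Q(1) ab(2) qa q(4)[symmetric]])
              (use cycle q in simp_all)
          then show False using ins by simp
        qed
      qed
    qed
  qed
qed

lemma edge_in_cycle:
  assumes "cocyclic G e e"
  obtains u u' v v' where "four_cycle G u u' v v'" "e = {u, v}"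
proof -
  obtain u u' v v' where c: "four_cycle G u u' v v'" "e \<in> {{u, v}, {u, v'}, {u', v}, {u', v'}}"
    using assms by (auto simp: cocyclic_def)
  have "four_cycle G u' u v v'" "four_cycle G u u' v' v" "four_cycle G u' u v' v" using c(1) by (auto simp: four_cycle_def)
  then show thesis using c that by blast
qed

lemma edge_point_special: assumes e: "e \<in> edges G" shows "edge_point e \<in> special_points Y"
proof (cases "cocyclic G e e")
  case False
  then show ?thesis using isolated_edge_point[OF e] edge_point_in[OF e] by (simp add: special_points_def topspace_Y)
next
  case True
  obtain u u' v v' where c: "four_cycle G u u' v v'" "e = {u, v}" using edge_in_cycle[OF True] by metis
  have op: "opposite G e {u', v'}" using c by (auto simp: opposite_def)
  have f: "{u', v'} \<in> edges G" using c by (auto simp: four_cycle_def)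
  have "e \<noteq> {u', v'}" using opposite_disjoint[OF G op] c(2) by auto
  then have "edge_point {u', v'} \<noteq> edge_point e" using supp_edge_point[OF e] supp_edge_point[OF f] by metis
  then show ?thesis
    using opposite_inseparable[OF op] edge_point_in[OF e] edge_point_in[OF f] unfolding special_points_def topspace_Y by blast
qed

lemma special_points_eq: "special_points Y = edge_point ` edges G"
proof (intro equalityI subsetI)
  fix P assume s: "P \<in> special_points Y"
  then have P: "P \<in> kern_le2 A" by (simp add: special_points_def topspace_Y)
  from P show "P \<in> edge_point ` edges G"
  proof (cases rule: point_cases)
    case edge
    then show ?thesis by blast
  next
    case (cycle u u' v v' t)
    then show ?thesis using cycle_point_not_special[OF cycle(1-3)] s by simp
  qed
qed (use edge_point_special in blast)

text \<open>A continuous image of an open interval; continuity is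
  \<open>cycle_near_cycle\<close>.\<close>

lemma connectedin_cell:
  assumes c: "four_cycle G u u' v v'" shows "connectedin Y (cell {u, u', v, v'})"
proof -
  let ?S = "{0<..<pi / 2}"
  have "continuous_map (top_of_set ?S) Y (\<lambda>t. cycle_point u u' v v' t)"
    unfolding continuous_map_def
  proof (intro conjI allI impI)
    fix W assume W: "openin Y W"
    have "open {t \<in> ?S. cycle_point u u' v v' t \<in> W}"
      unfolding open_dist
    proof
      fix t assume "t \<in> {t \<in> ?S. cycle_point u u' v v' t \<in> W}"
      then have t: "0 < t" "t < pi / 2" "cycle_point u u' v v' t \<in> W" by simp_all
      obtain d where d: "0 < d" "\<And>s. \<bar>s - t\<bar> < d \<Longrightarrow> 0 < s \<Longrightarrow> s < pi / 2 \<Longrightarrow> cycle_point u u' v v' s \<in> W"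
        using cycle_near_cycle[OF c W t(3)] by metis
      show "\<exists>e>0. \<forall>s. dist s t < e \<longrightarrow> s \<in> {t \<in> ?S. cycle_point u u' v v' t \<in> W}"
      proof (intro exI[of _ "min d (min t (pi / 2 - t))"] conjI allI impI)
        fix s assume "dist s t < min d (min t (pi / 2 - t))"
        then have "\<bar>s - t\<bar> < d" "0 < s" "s < pi / 2" by (auto simp: dist_real_def)
        then show "s \<in> {t \<in> ?S. cycle_point u u' v v' t \<in> W}" using d(2)[of s] by simp
      qed (use d(1) t in simp)
    qed
    then show "openin (top_of_set ?S) {t \<in> topspace (top_of_set ?S). cycle_point u u' v v' t \<in> W}"
      by (intro open_subset) auto
  qed (use cycle_point_in[OF c] in \<open>simp add: topspace_Y Pi_def\<close>)
  moreover have "connectedin (top_of_set ?S) ?S" by (simp add: connectedin_subtopology convex_connected)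
  ultimately show ?thesis unfolding cell_cycle[OF c] by (rule connectedin_continuous_map_image)
qed

lemma edge_point_closure:
  assumes c: "four_cycle G u u' v v'" shows "edge_point {u, v} \<in> Y closure_of (cell {u, u', v, v'})"
  unfolding in_closure_of
proof (intro conjI allI impI)
  have "{u, v} \<in> edges G" using c by (simp add: four_cycle_def)
  then show "edge_point {u, v} \<in> topspace Y" unfolding topspace_Y by (rule edge_point_in)
  fix W assume W: "edge_point {u, v} \<in> W \<and> openin Y W"
  obtain d where d: "0 < d" "\<And>t. 0 < t \<Longrightarrow> t < d \<Longrightarrow> t < pi / 2 \<Longrightarrow> cycle_point u u' v v' t \<in> W"
    using cycle_near_edge[OF c, of W] W by metis
  obtain t where t: "0 < t" "t < min d (pi / 2)" using dense[of 0 "min d (pi / 2)"] d(1) by auto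
  then have "cycle_point u u' v v' t \<in> W" "cycle_point u u' v v' t \<in> cell {u, u', v, v'}"
    using d(2)[of t] unfolding cell_cycle[OF c] by auto
  then show "\<exists>y. y \<in> cell {u, u', v, v'} \<and> y \<in> W" by blast
qed

text \<open>For the converse: the two-dimensional points with a given vertex set form an open
  family, and so do all points with some vertex outside it, so a connected set of non-special points
  stays in one family. An edge in its closure keeps to the four vertices, because having a vertex in
  the support is open.\<close>

lemma cocyclic_iff_linked:
  assumes e: "e \<in> edges G" and f: "f \<in> edges G"
  shows "cocyclic G e f \<longleftrightarrow> linked Y (edge_point e) (edge_point f)"
proof
  assume "cocyclic G e f"
  then obtain u u' v v' where c: "four_cycle G u u' v v'"
    "e \<in> {{u, v}, {u, v'}, {u', v}, {u', v'}}" "f \<in> {{u, v}, {u, v'}, {u', v}, {u', v'}}" by (auto simp: cocyclic_def)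
  have cs: "four_cycle G u' u v v'" "four_cycle G u u' v' v" "four_cycle G u' u v' v" using c(1) by (auto simp: four_cycle_def)
  have eq: "{u', u, v, v'} = {u, u', v, v'}" "{u, u', v', v} = {u, u', v, v'}" "{u', u, v', v} = {u, u', v, v'}" by auto
  have cl: "edge_point g \<in> Y closure_of (cell {u, u', v, v'})" if "g \<in> {{u, v}, {u, v'}, {u', v}, {u', v'}}" for g
    using that edge_point_closure[OF c(1)] edge_point_closure[OF cs(1)] edge_point_closure[OF cs(2)] edge_point_closure[OF cs(3)]
    unfolding eq by (elim insertE emptyE) simp_all
  have "cell {u, u', v, v'} \<subseteq> topspace Y - special_points Y"
  proof
    fix P assume P: "P \<in> cell {u, u', v, v'}"
    then obtain t where "0 < t" "t < pi / 2" "P = cycle_point u u' v v' t" unfolding cell_cycle[OF c(1)] by auto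
    then have "P \<notin> special_points Y" using cycle_point_not_special[OF c(1)] by simp
    then show "P \<in> topspace Y - special_points Y" using P by (simp add: topspace_Y cell_def)
  qed
  then show "linked Y (edge_point e) (edge_point f)"
    unfolding linked_def using connectedin_cell[OF c(1)] cl[OF c(2)] cl[OF c(3)] by (intro exI conjI)
next
  assume "linked Y (edge_point e) (edge_point f)"
  then obtain S where S: "connectedin Y S" "S \<subseteq> topspace Y - special_points Y" "edge_point e \<in> Y closure_of S" "edge_point f \<in> Y closure_of S"
    unfolding linked_def by blast
  have pt: "\<exists>u u' v v' t. four_cycle G u u' v v' \<and> P = cycle_point u u' v v' t" if P: "P \<in> S" for P
  proof -
    have "P \<in> kern_le2 A" "P \<notin> special_points Y" using P S(2) topspace_Y by blast+
    then show ?thesis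
      by (cases rule: point_cases) (use edge_point_special in blast)+
  qed
  have "S \<noteq> {}" using S(3) by auto
  then obtain P where P: "P \<in> S" by blast
  obtain u u' v v' t where c: "four_cycle G u u' v v'" "P = cycle_point u u' v v' t" using pt[OF P] by blast
  let ?C = "{u, u', v, v'}"
  have CX: "?C \<subseteq> X" using c(1) by (auto simp: four_cycle_def)
  define V where "V = (\<Union>x\<in>X - ?C. {R \<in> kern_le2 A. x \<in> supp R})"
  have op: "openin Y (cell ?C)" "openin Y V"
    unfolding V_def using CX by (simp add: openin_cell, intro openin_Union) (auto intro: openin_supp)
  have dj: "cell ?C \<inter> V = {}" using cell_supp[OF c(1)] by (auto simp: V_def)
  have SK: "S \<subseteq> kern_le2 A" using S(2) topspace_Y by blast
  have cover: "S \<subseteq> cell ?C \<union> V"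
  proof
    fix Q assume Q: "Q \<in> S"
    obtain a a' b b' s where q: "four_cycle G a a' b b'" "Q = cycle_point a a' b b' s" using pt[OF Q] by blast
    have sQ: "supp Q = {a, a', b, b'}" using supp_cycle_point[OF q(1)] q(2) by simp
    show "Q \<in> cell ?C \<union> V"
    proof (cases "supp Q \<subseteq> ?C")
      case True
      \<comment> \<open>Both 4-cycles have two vertices on each side, so inclusion of their vertex
        sets is equality.\<close>
      have "a \<noteq> a'" "b \<noteq> b'" "a \<in> left G" "a' \<in> left G" "b \<in> right G" "b' \<in> right G"
        "u \<in> left G" "u' \<in> left G" "v \<in> right G" "v' \<in> right G" using q(1) c(1) by (auto simp: four_cycle_def)
      then have "?C \<subseteq> supp Q" using True G_fin(3) unfolding sQ by auto
      then show ?thesis using Q SK by (auto simp: cell_def)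
    next
      case False
      then obtain x where "x \<in> supp Q" "x \<notin> ?C" by blast
      then show ?thesis using Q SK by (auto simp: V_def supp_def)
    qed
  qed
  have "P \<in> cell ?C" using P SK supp_cycle_point[OF c(1)] c(2) by (auto simp: cell_def)
  then have SV: "S \<inter> V = {}" using S(1) op dj cover P unfolding connectedin by blast
  have sub: "g \<subseteq> ?C" if g: "g \<in> edges G" "edge_point g \<in> Y closure_of S" for g
  proof
    fix x assume x: "x \<in> g"
    then have xs: "x \<in> supp (edge_point g)" using supp_edge_point[OF g(1)] by simp
    then have X: "x \<in> X" by (simp add: supp_def)
    have "edge_point g \<in> {R \<in> kern_le2 A. x \<in> supp R} \<and> openin Y {R \<in> kern_le2 A. x \<in> supp R}"
      using edge_point_in[OF g(1)] xs openin_supp[OF X] by simp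
    from mp[OF spec[OF conjunct2[OF g(2)[unfolded in_closure_of]]] this]
    obtain R where R: "R \<in> S" "R \<in> kern_le2 A" "x \<in> supp R" by (elim exE conjE CollectE)
    then have "R \<notin> V" using SV by blast
    then show "x \<in> ?C" using R(2,3) X by (auto simp: V_def)
  qed
  have mem: "g \<in> {{u, v}, {u, v'}, {u', v}, {u', v'}}" if g: "g \<in> edges G" "edge_point g \<in> Y closure_of S" for g
  proof -
    obtain a b where ab: "a \<in> left G" "b \<in> right G" "g = {a, b}" using edgeE[OF G g(1)] by metis
    then have "a \<in> ?C" "b \<in> ?C" using sub[OF g] by blast+
    then have "a = u \<or> a = u'" "b = v \<or> b = v'" using ab c(1) G_fin(3) by (auto simp: four_cycle_def)
    then show ?thesis using ab(3) by auto
  qed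
  show "cocyclic G e f" unfolding cocyclic_def using c(1) mem[OF e S(3)] mem[OF f S(4)] by blast
qed

lemma opposite_iff_inseparable:
  assumes e: "e \<in> edges G" and f: "f \<in> edges G"
  shows "opposite G e f \<longleftrightarrow> edge_point e \<noteq> edge_point f \<and> inseparable Y (edge_point e) (edge_point f)"
proof
  assume op: "opposite G e f"
  obtain u v where "e = {u, v}" using edgeE[OF G e] by metis
  then have "e \<noteq> f" using opposite_disjoint[OF G op] by auto
  then show "edge_point e \<noteq> edge_point f \<and> inseparable Y (edge_point e) (edge_point f)"
    using opposite_inseparable[OF op] supp_edge_point[OF e] supp_edge_point[OF f] by metis
next
  assume ne: "edge_point e \<noteq> edge_point f \<and> inseparable Y (edge_point e) (edge_point f)"
  then have "e \<noteq> f" by auto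
  then show "opposite G e f" using non_opposite_separable[OF e f] ne by simp
qed

lemma bij_edge_point: "bij_betw edge_point (edges G) (special_points Y)"
  unfolding special_points_eq bij_betw_def by (intro conjI inj_onI refl) (metis supp_edge_point)

end

section \<open>Transport along isomorphisms and homeomorphisms\<close>

lemma star_hom_one:
  assumes A: "cstar_algebra A" and B: "cstar_algebra B" and f: "f \<in> star_hom A B" and surj: "f ` carrier A = carrier B"
  shows "f \<one>\<^bsub>A\<^esub> = \<one>\<^bsub>B\<^esub>"
proof -
  interpret A: cstar_algebra A by (rule A)
  interpret B: cstar_algebra B by (rule B)
  obtain a where a: "a \<in> carrier A" "\<one>\<^bsub>B\<^esub> = f a" using B.one_closed unfolding surj[symmetric] by (elim imageE)
  have "f \<one>\<^bsub>A\<^esub> = f \<one>\<^bsub>A\<^esub> \<otimes>\<^bsub>B\<^esub> f a" using star_homD(1)[OF f A.one_closed] a(2)[symmetric] by simp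
  also have "\<dots> = f a" using star_homD(3)[OF f A.one_closed a(1)] a(1) by simp
  finally show ?thesis using a(2) by simp
qed

lemma star_hom_inv:
  assumes A: "cstar_algebra A" and f: "f \<in> star_hom A B" and bij: "bij_betw f (carrier A) (carrier B)"
  shows "inv_into (carrier A) f \<in> star_hom B A"
proof -
  interpret A: cstar_algebra A by (rule A)
  let ?g = "inv_into (carrier A) f"
  have g: "?g b \<in> carrier A" "f (?g b) = b" if "b \<in> carrier B" for b
    using that bij bij_betw_apply[OF bij_betw_inv_into[OF bij]] by (simp_all add: bij_betw_inv_into_right)
  have eq: "?g b = a" if "a \<in> carrier A" "f a = b" for a b
    using that bij_betw_inv_into_left[OF bij] by blast
  note H = star_homD[OF f]
  show ?thesis
    unfolding star_hom_def
  proof (intro CollectI conjI ballI allI)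
    show "?g \<in> carrier B \<rightarrow> carrier A" using g(1) by blast
    fix b assume b: "b \<in> carrier B"
    show "?g (scale B c b) = scale A c (?g b)" for c
      by (rule eq) (simp_all add: H(4) g b A.scale_closed)
    show "?g (star B b) = star A (?g b)"
      by (rule eq) (simp_all add: H(5) g b A.star_closed)
    fix d assume d: "d \<in> carrier B"
    show "?g (b \<oplus>\<^bsub>B\<^esub> d) = ?g b \<oplus>\<^bsub>A\<^esub> ?g d" "?g (b \<otimes>\<^bsub>B\<^esub> d) = ?g b \<otimes>\<^bsub>A\<^esub> ?g d"
      by (rule eq; simp add: H(2,3) g b d)+
  qed
qed

text \<open>Composition with a surjection changes neither the set of operators nor the action of the
  unit, hence neither scalarity nor irreducibility.\<close>

lemma kern_le2_pullback:
  fixes A :: "('a, 'm) star_algebra_scheme" and B :: "('b, 'n) star_algebra_scheme"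
  assumes A: "cstar_algebra A" and B: "cstar_algebra B" and two: "(i :: 'a) \<noteq> j" "(k :: 'b) \<noteq> l"
    and f: "f \<in> star_hom A B" and surj: "f ` carrier A = carrier B" and P: "P \<in> kern_le2 B"
  shows "{a \<in> carrier A. f a \<in> P} \<in> kern_le2 A"
proof -
  obtain g where g: "P = op_kernel B g" "op_scalar B g \<or> op_irred B g" using P unfolding kern_le2_eq[OF B two(2)] by blast
  note H = star_homD[OF f]
  have eq: "{a \<in> carrier A. f a \<in> P} = op_kernel A (\<lambda>a. g (f a))" using H(1) by (auto simp: g(1) op_kernel_def)
  have "op_scalar A (\<lambda>a. g (f a)) \<or> op_irred A (\<lambda>a. g (f a))"
    using g(2)
  proof
    assume s: "op_scalar B g"
    then have "(\<lambda>a. g (f a)) \<in> star_hom A opV" by (intro star_hom_comp[OF f]) (simp add: op_scalar_def)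
    moreover have "g (f \<one>\<^bsub>A\<^esub>) = id_blinfun" using s star_hom_one[OF A B f surj] by (simp add: op_scalar_def)
    moreover have "\<forall>a\<in>carrier A. \<exists>c. g (f a) = cscale_op c" using s H(1) unfolding op_scalar_def by blast
    ultimately show ?thesis unfolding op_scalar_def by blast
  next
    assume s: "op_irred B g"
    then have hom: "(\<lambda>a. g (f a)) \<in> star_hom A opV" by (intro star_hom_comp[OF f]) (simp add: op_irred_def)
    have "\<exists>a\<in>carrier A. \<forall>c. g (f a) x \<noteq> cscale c x" if x: "x \<noteq> 0" for x
    proof -
      obtain b where b: "b \<in> carrier B" "\<forall>c. g b x \<noteq> cscale c x" using s x unfolding op_irred_def by blast
      obtain a where "a \<in> carrier A" "b = f a" using b(1) unfolding surj[symmetric] by (elim imageE)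
      then show ?thesis using b(2) by blast
    qed
    then have "op_irred A (\<lambda>a. g (f a))" using hom unfolding op_irred_def by (intro conjI allI impI)
    then show ?thesis ..
  qed
  then show ?thesis unfolding eq kern_le2_eq[OF A two(1)] by (intro CollectI exI[of _ "\<lambda>a. g (f a)"] conjI refl)
qed

lemma continuous_kern_pullback:
  fixes A :: "('a, 'm) star_algebra_scheme" and B :: "('b, 'n) star_algebra_scheme"
  assumes A: "cstar_algebra A" and B: "cstar_algebra B" and two: "(i :: 'a) \<noteq> j" "(k :: 'b) \<noteq> l"
    and f: "f \<in> star_hom A B" and surj: "f ` carrier A = carrier B"
  shows "continuous_map (kern_topology B) (kern_topology A) (\<lambda>P. {a \<in> carrier A. f a \<in> P})"
  unfolding continuous_map_def topspace_kern_topology[OF A] topspace_kern_topology[OF B]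
proof (intro conjI allI impI)
  note pull = kern_le2_pullback[OF A B two f surj]
  show "(\<lambda>P. {a \<in> carrier A. f a \<in> P}) \<in> kern_le2 B \<rightarrow> kern_le2 A" using pull by (rule Pi_I)
  fix W assume "openin (kern_topology A) W"
  then obtain I where I: "I \<subseteq> carrier A" "W = {P \<in> kern_le2 A. \<not> I \<subseteq> P}"
    unfolding openin_kern_topology[OF A] by (elim exE conjE)
  have sub: "I \<subseteq> {a \<in> carrier A. f a \<in> P} \<longleftrightarrow> f ` I \<subseteq> P" for P using I(1) by auto
  have "{P \<in> kern_le2 B. {a \<in> carrier A. f a \<in> P} \<in> W} = {P \<in> kern_le2 B. \<not> f ` I \<subseteq> P}"
    unfolding I(2) by (rule Collect_cong) (simp add: pull sub cong: conj_cong)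
  moreover have "f ` I \<subseteq> carrier B" using I(1) surj by blast
  ultimately show "openin (kern_topology B) {P \<in> kern_le2 B. {a \<in> carrier A. f a \<in> P} \<in> W}"
    unfolding openin_kern_topology[OF B] by (intro exI[of _ "f ` I"] conjI)
qed

lemma isomorphic_imp_kern_homeomorphic:
  fixes A :: "('a, 'm) star_algebra_scheme" and B :: "('b, 'n) star_algebra_scheme"
  assumes A: "cstar_algebra A" and B: "cstar_algebra B" and two: "(i :: 'a) \<noteq> j" "(k :: 'b) \<noteq> l"
    and iso: "cstar_isomorphic A B"
  shows "kern_topology A homeomorphic_space kern_topology B"
proof -
  obtain f where f: "f \<in> star_hom A B" "bij_betw f (carrier A) (carrier B)" using iso unfolding cstar_isomorphic_def by blast
  define g where "g = inv_into (carrier A) f"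
  have g: "g \<in> star_hom B A" unfolding g_def by (rule star_hom_inv[OF A f])
  have gf: "g (f a) = a" if "a \<in> carrier A" for a using bij_betw_inv_into_left[OF f(2) that] by (simp add: g_def)
  have fg: "f (g b) = b" if "b \<in> carrier B" for b using bij_betw_inv_into_right[OF f(2) that] by (simp add: g_def)
  note fc = star_homD(1)[OF f(1)] and gc = star_homD(1)[OF g]
  have sf: "f ` carrier A = carrier B" using f(2) by (simp add: bij_betw_def)
  have sg: "g ` carrier B = carrier A" using bij_betw_inv_into[OF f(2)] by (simp add: g_def bij_betw_def)
  have sub: "P \<subseteq> carrier A" if "P \<in> kern_le2 A" for P using that unfolding kern_le2_def rep_kernel_def by blast
  have sub': "P \<subseteq> carrier B" if "P \<in> kern_le2 B" for P using that unfolding kern_le2_def rep_kernel_def by blast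
  have "homeomorphic_maps (kern_topology A) (kern_topology B)
      (\<lambda>P. {b \<in> carrier B. g b \<in> P}) (\<lambda>P. {a \<in> carrier A. f a \<in> P})"
    unfolding homeomorphic_maps_def topspace_kern_topology[OF A] topspace_kern_topology[OF B]
  proof (intro conjI ballI)
    show "continuous_map (kern_topology A) (kern_topology B) (\<lambda>P. {b \<in> carrier B. g b \<in> P})"
      by (rule continuous_kern_pullback[OF B A two(2,1) g sg])
    show "continuous_map (kern_topology B) (kern_topology A) (\<lambda>P. {a \<in> carrier A. f a \<in> P})"
      by (rule continuous_kern_pullback[OF A B two f(1) sf])
    show "{a \<in> carrier A. f a \<in> {b \<in> carrier B. g b \<in> P}} = P" if "P \<in> kern_le2 A" for P
      using sub[OF that] fc gf by (auto simp: subset_iff)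
    show "{b \<in> carrier B. g b \<in> {a \<in> carrier A. f a \<in> P}} = P" if "P \<in> kern_le2 B" for P
      using sub'[OF that] gc fg by (auto simp: subset_iff)
  qed
  then show ?thesis unfolding homeomorphic_space_def by (intro exI)
qed

text \<open>Special points, inseparability and linking are topological; read on edges through
  \<open>edge_point\<close>, they are the data of \<open>edge_iso\<close>.\<close>

lemma kern_homeomorphic_imp_edge_iso:
  assumes G: "bipartite_graph G" and G': "bipartite_graph G'"
    and hs: "kern_topology (bip_cstar G) homeomorphic_space kern_topology (bip_cstar G')"
  shows "\<exists>\<phi>. edge_iso G G' \<phi>"
proof -
  interpret L: bip_graph_algebra G by unfold_locales (rule G)
  interpret R: bip_graph_algebra G' by unfold_locales (rule G')
  obtain h k where hk: "homeomorphic_maps L.Y R.Y h k" using hs unfolding homeomorphic_space_def by (elim exE)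
  have kh: "homeomorphic_maps R.Y L.Y k h" by (rule iffD1[OF homeomorphic_maps_sym hk])
  have k: "k (h x) = x" if "x \<in> topspace L.Y" for x using hk that by (simp add: homeomorphic_maps_def)
  have h: "h (k x) = x" if "x \<in> topspace R.Y" for x using hk that by (simp add: homeomorphic_maps_def)
  have cont: "continuous_map L.Y R.Y h" "continuous_map R.Y L.Y k" using hk by (simp_all add: homeomorphic_maps_def)
  have spL: "x \<in> topspace L.Y" if "x \<in> special_points L.Y" for x using that by (simp add: special_points_def)
  have spR: "x \<in> topspace R.Y" if "x \<in> special_points R.Y" for x using that by (simp add: special_points_def)
  have bh: "bij_betw h (special_points L.Y) (special_points R.Y)"
    by (rule bij_betw_byWitness[of _ k])
      (simp_all add: k h spL spR special_points_map[OF hk] special_points_map[OF kh] image_subset_iff)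
  define \<phi> where "\<phi> = inv_into (edges G') R.edge_point \<circ> (h \<circ> L.edge_point)"
  have bij: "bij_betw \<phi> (edges G) (edges G')"
    unfolding \<phi>_def
    by (rule bij_betw_trans[OF bij_betw_trans[OF L.bij_edge_point bh] bij_betw_inv_into[OF R.bij_edge_point]])
  have \<phi>: "\<phi> e \<in> edges G'" "R.edge_point (\<phi> e) = h (L.edge_point e)" "L.edge_point e \<in> topspace L.Y"
    if e: "e \<in> edges G" for e
  proof -
    have s: "L.edge_point e \<in> special_points L.Y" by (rule L.edge_point_special[OF e])
    then have "h (L.edge_point e) \<in> special_points R.Y" by (rule special_points_map[OF hk])
    then show "R.edge_point (\<phi> e) = h (L.edge_point e)"
      unfolding \<phi>_def by (simp add: bij_betw_inv_into_right[OF R.bij_edge_point])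
    show "\<phi> e \<in> edges G'" by (rule bij_betw_apply[OF bij e])
    show "L.edge_point e \<in> topspace L.Y" by (rule spL[OF s])
  qed
  have ins: "inseparable L.Y x y \<longleftrightarrow> inseparable R.Y (h x) (h y)" if xy: "x \<in> topspace L.Y" "y \<in> topspace L.Y" for x y
  proof
    assume "inseparable L.Y x y" then show "inseparable R.Y (h x) (h y)" by (rule inseparable_map[OF cont(1) xy])
  next
    have hxy: "h x \<in> topspace R.Y" "h y \<in> topspace R.Y" using cont(1) xy by (auto simp: continuous_map_def)
    assume "inseparable R.Y (h x) (h y)"
    from inseparable_map[OF cont(2) hxy this] show "inseparable L.Y x y" by (simp add: k xy)
  qed
  have lnk: "linked L.Y x y \<longleftrightarrow> linked R.Y (h x) (h y)" if xy: "x \<in> topspace L.Y" "y \<in> topspace L.Y" for x y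
  proof
    assume "linked L.Y x y" then show "linked R.Y (h x) (h y)" by (rule linked_map[OF hk])
  next
    assume "linked R.Y (h x) (h y)"
    from linked_map[OF kh this] show "linked L.Y x y" by (simp add: k xy)
  qed
  have "opposite G e f \<longleftrightarrow> opposite G' (\<phi> e) (\<phi> f)" if e: "e \<in> edges G" and f: "f \<in> edges G" for e f
  proof -
    have "h (L.edge_point e) = h (L.edge_point f) \<longleftrightarrow> L.edge_point e = L.edge_point f"
      using k[OF \<phi>(3)[OF e]] k[OF \<phi>(3)[OF f]] by metis
    then show ?thesis
      unfolding L.opposite_iff_inseparable[OF e f] R.opposite_iff_inseparable[OF \<phi>(1)[OF e] \<phi>(1)[OF f]]
        \<phi>(2)[OF e] \<phi>(2)[OF f] ins[OF \<phi>(3)[OF e] \<phi>(3)[OF f]] by simp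
  qed
  moreover have "cocyclic G e f \<longleftrightarrow> cocyclic G' (\<phi> e) (\<phi> f)" if e: "e \<in> edges G" and f: "f \<in> edges G" for e f
    unfolding L.cocyclic_iff_linked[OF e f] R.cocyclic_iff_linked[OF \<phi>(1)[OF e] \<phi>(1)[OF f]]
      \<phi>(2)[OF e] \<phi>(2)[OF f] by (rule lnk[OF \<phi>(3)[OF e] \<phi>(3)[OF f]])
  ultimately have "edge_iso G G' \<phi>" using bij unfolding edge_iso_def by blast
  then show ?thesis by blast
qed

theorem theorem3:
  fixes G :: "'v bip_graph" and G' :: "'w bip_graph"
  assumes "bipartite_graph G" and "bipartite_graph G'"
  shows "cstar_isomorphic (bip_cstar G) (bip_cstar G') \<longleftrightarrow>
    Spec_le2_topology (bip_cstar G) homeomorphic_space Spec_le2_topology (bip_cstar G')"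
proof -
  interpret L: bip_graph_algebra G by unfold_locales (rule assms)
  interpret R: bip_graph_algebra G' by unfold_locales (rule assms)
  note AL = L.A.cstar_algebra_axioms and AR = R.A.cstar_algebra_axioms
  have kL: "Spec_le2_topology (bip_cstar G) homeomorphic_space kern_topology (bip_cstar G)"
    by (rule Spec_le2_homeomorphic_kern[OF AL L.inj_spec_kernel])
  have kR: "Spec_le2_topology (bip_cstar G') homeomorphic_space kern_topology (bip_cstar G')"
    by (rule Spec_le2_homeomorphic_kern[OF AR R.inj_spec_kernel])
  note kL' = iffD1[OF homeomorphic_space_sym kL] and kR' = iffD1[OF homeomorphic_space_sym kR]
  show ?thesis
  proof
    assume "cstar_isomorphic (bip_cstar G) (bip_cstar G')"
    \<comment> \<open>The elements of both algebras are sets, so \<open>{}\<close> and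
      \<open>UNIV\<close> are the two different indices on which a two-dimensional representation
      can be realised.\<close>
    from isomorphic_imp_kern_homeomorphic[OF AL AR empty_not_UNIV empty_not_UNIV this]
    show "Spec_le2_topology (bip_cstar G) homeomorphic_space Spec_le2_topology (bip_cstar G')"
      by (rule homeomorphic_space_trans[OF homeomorphic_space_trans[OF kL] kR'])
  next
    assume "Spec_le2_topology (bip_cstar G) homeomorphic_space Spec_le2_topology (bip_cstar G')"
    then have "kern_topology (bip_cstar G) homeomorphic_space kern_topology (bip_cstar G')"
      by (rule homeomorphic_space_trans[OF homeomorphic_space_trans[OF kL'] kR])
    then obtain \<phi> where "edge_iso G G' \<phi>" using kern_homeomorphic_imp_edge_iso[OF assms] by blast
    then show "cstar_isomorphic (bip_cstar G) (bip_cstar G')" by (rule edge_iso_imp_isomorphic[OF assms])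
  qed
qed

end
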